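(* Let $j+k=n-1$. Then every function $f\in L_{\log}(G(n,j))$ can be reconstructed from $\varphi=\mathcal R_{j,k}f$ by the formula (for almost all $\xi\in G_{n,j}$, $u\in\xi^\perp$) $$f(\xi,u)=(R^{-1}_{k,\xi^\perp}[\tilde f_\xi])(u),$$ where $$\tilde f_\xi(\eta,v)\equiv\tilde f_\eta(\xi,v)=(R^*_{\eta^\perp})^{-1}[\varphi(\eta,\cdot)](\xi,v),\qquad \eta\in G_k(\xi^\perp),\ v\in\xi^\perp\cap\eta^\perp.$$ Here $R^{-1}_{k,\xi^\perp}$ is the inverse hyperplane Radon transform in the $(k+1)$-dimensional space $\xi^\perp$, and $(R^*_{\eta^\perp})^{-1}$ is the inverse dual hyperplane Radon transform in the $(j+1)$-dimensional space $\eta^\perp$, given by the explicit formulas $R^{-1}=B^{-1}F^{-1}A^{-1}$ and $(R^* )^{-1}=B_*^{-1}F^{-1}A_*^{-1}$ stated in the context.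
   Context: $n,j,k$ are integers with $j>0$, $k>0$. $G_{n,j}$ is the Grassmannian of $j$-dimensional linear subspaces of $\mathbb R^n$; $G(n,j)$ is the manifold of $j$-dimensional unoriented affine planes. Every $\tau\in G(n,j)$ is written uniquely as $\tau=\xi+u$, $\xi\in G_{n,j}$, $u\in\xi^\perp$; $f(\tau)=f(\xi,u)$, $|\tau|=|u|$, $d\tau=d\xi\,du$ with $d\xi$ the invariant probability measure and $du$ Lebesgue measure on $\xi^\perp$. Similarly $\zeta=\eta+v\in G(n,k)$, $\varphi(\zeta)=\varphi(\eta,v)$. $G_k(X)$ is the set of $k$-dimensional linear subspaces of a space $X$. $$(\mathcal R_{j,k}f)(\eta,v)=\int_{G_j(\eta^\perp)}d\xi\int_\eta f(\xi+u+v)\,du,$$ with the invariant probability measure on $G_j(\eta^\perp)$ and Lebesgue measure $du$ on $\eta$. $L_{\log}(G(n,j))$ is the class of functions $f$ on $G(n,j)$ with $$\int_{G(n,j)}\frac{|f(\tau)|}{1+|\tau|}\log(2+|\tau|)\,d\tau<\infty.$$ Hyperplane transforms and inverses in a $d$-dimensional Euclidean space $X$, $d\ge2$, identified with $\mathbb R^d$ by an orthonormal basis. A hyperplane is $\tau(\omega_0,t)=\{x\in\mathbb R^d: x\cdot\omega_0=t\}$, $\omega_0\in S^{d-1}$, $t\in\mathbb R$, with $\tau(-\omega_0,-t)=\tau(\omega_0,t)$, $|\tau|=|t|$. $(Rg)(\tau)=\int_\tau g$ is the integral of $g$ over $\tau$, and $(R^*h)(x)=\frac1{\sigma_{d-1}}\int_{S^{d-1}}h(\omega_0,x\cdot\omega_0)\,d\omega_0$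 is the average of $h$ over hyperplanes through $x$; $\sigma_{d-1}=2\pi^{d/2}/\Gamma(d/2)$. For $X=\xi^\perp$ ($d=k+1$) hyperplanes are $\eta+v$ with $\eta\in G_k(\xi^\perp)$, $v\in\xi^\perp\cap\eta^\perp$; for $X=\eta^\perp$ ($d=j+1$) they are $\xi+v$ with $\xi\in G_j(\eta^\perp)$, $v\in\xi^\perp\cap\eta^\perp$. Let $S^d\subset\mathbb R^{d+1}=\mathbb R^d\oplus\mathbb Re_{d+1}$, and write $\theta=(\theta',\theta_{d+1})\in S^d$. Put $\mu(x)=\frac{x+e_{d+1}}{|x+e_{d+1}|}$ for $x\in\mathbb R^d$, and for a hyperplane $\tau=\tau(\omega_0,t)$ with $t\ge0$, $\tilde\mu(\tau)=-\omega_0\cos\alpha+e_{d+1}\sin\alpha$, $\tan\alpha=t$ (a unit normal vector to the linear span of $\tau+e_{d+1}$, with values in $\{\omega\in S^d:0\le\omega_{d+1}<1\}$; functions on the sphere below are even, or extended as even functions). Also $-\tau=\{x:-x\in\tau\}$. The operators are $$(A^{-1}h)(\omega)=\frac{2}{\sigma_{d-1}|\omega'|}\,h(\tilde\mu^{-1}(\omega)),\ |\omega'|\ne0,\qquad (B^{-1}f)(x)=(1+|x|^2)^{-d/2}f(\mu(x)),$$ $$(A_*^{-1}g)(\theta)=\frac{1}{|\theta_{d+1}|}\,g\Bigl(-\frac{\theta'}{\theta_{d+1}}\Bigr),\ \theta_{d+1}\neq0,\qquad (B_*^{-1}f)(\tau)=(1+|\tau|^2)^{-d/2}f(\tilde\mu(-\tau)).$$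 $F^{-1}$ is the inverse of the Funk transform $(Ff)(\theta)=\int_{S^d\cap\theta^\perp}f(\sigma)\,d_\theta\sigma$ (probability measure on $S^d\cap\theta^\perp$) on even functions in $L^1(S^d)$: for $\psi=Ff$, $$f(\theta)=\lim_{t\to1}\Bigl(\frac{\partial}{\partial t}\Bigr)^{d-1}\Bigl[\frac1{(d-2)!}\int_0^t(t^2-s^2)^{(d-3)/2}\,\Psi_\theta(s)\,s\,ds\Bigr],\quad \Psi_\theta(s)=\frac1{\sigma_{d-1}}\int_{S^d\cap\theta^\perp}\psi\bigl(s\sigma+\sqrt{1-s^2}\,\theta\bigr)\,d\sigma,$$ the limit being in the $L^1$-norm. *)

theory Defs
  imports "HOL-Probability.Probability"
begin

section \<open>Linear and affine Grassmannians inside a subspace\<close>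

text \<open>Throughout, $X$ is a linear subspace of a Euclidean space, and planes are represented as
  point sets, so that the plane $\xi + u$ is the set \<^term>\<open>(+) u ` \<xi>\<close>.\<close>

definition grassmannian :: "'a::euclidean_space set \<Rightarrow> nat \<Rightarrow> 'a set set" where
  "grassmannian X j = {\<xi>. subspace \<xi> \<and> \<xi> \<subseteq> X \<and> dim \<xi> = j}"

definition affine_grassmannian :: "'a::euclidean_space set \<Rightarrow> nat \<Rightarrow> 'a set set" where
  "affine_grassmannian X j = {\<tau>. affine \<tau> \<and> \<tau> \<subseteq> X \<and> aff_dim \<tau> = int j}"

text \<open>Writing $\tau = \xi + u$ with $u \in \xi^\perp$, the next three are $u$, $|u|$ and $\xi$.\<close>

definition foot :: "'a::euclidean_space set \<Rightarrow> 'a" where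
  "foot \<tau> = closest_point \<tau> 0"

definition plane_norm :: "'a::euclidean_space set \<Rightarrow> real" where
  "plane_norm \<tau> = norm (foot \<tau>)"

definition direction :: "'a::euclidean_space set \<Rightarrow> 'a set" where
  "direction \<tau> = (\<lambda>x. x - foot \<tau>) ` \<tau>"

text \<open>Borel structure on a set \<open>P\<close> of planes.  The nearest point of $\xi + u$ to $x$ is
  $\mathrm{Pr}_\xi x + u$; hence the maps \<open>\<tau> \<mapsto> closest_point \<tau> x\<close> embed the manifold of planes
  by $(\mathrm{Pr}_\xi, u)$, and they generate the Borel sets of its usual topology.\<close>

definition plane_borel :: "'a::euclidean_space set set \<Rightarrow> 'a set measure" where
  "plane_borel P = vimage_algebra P (\<lambda>\<tau> x. closest_point \<tau> x) (\<Pi>\<^sub>M x\<in>UNIV. borel)"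

definition is_invariant_prob ::
    "'a::euclidean_space set \<Rightarrow> nat \<Rightarrow> 'a set measure \<Rightarrow> bool" where
  "is_invariant_prob X j M \<longleftrightarrow>
     prob_space M \<and> space M = grassmannian X j \<and> sets M = sets (plane_borel (grassmannian X j)) \<and>
     (\<forall>T. orthogonal_transformation T \<and> T ` X = X \<longrightarrow> distr M M (image T) = M)"

text \<open>The orthogonal group of \<open>X\<close> is compact and acts transitively on the Grassmannian, so there is
  exactly one such measure when $j \le \dim X$.\<close>

definition grass_measure :: "'a::euclidean_space set \<Rightarrow> nat \<Rightarrow> 'a set measure" where
  "grass_measure X j = completion (THE M. is_invariant_prob X j M)"


section \<open>Lebesgue measure on a subspace and related measures\<close>

definition orthonormal_basis :: "'a::euclidean_space set \<Rightarrow> 'a set" where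
  "orthonormal_basis X =
     (SOME B. B \<subseteq> X \<and> pairwise orthogonal B \<and> (\<forall>b\<in>B. norm b = 1) \<and> span B = X)"

text \<open>A measure on the whole ambient space concentrated on \<open>X\<close>, built like \<^const>\<open>lborel\<close>;
  it does not depend on the chosen orthonormal basis.\<close>

definition subspace_lborel :: "'a::euclidean_space set \<Rightarrow> 'a measure" where
  "subspace_lborel X =
     distr (\<Pi>\<^sub>M b\<in>orthonormal_basis X. lborel) borel
       (\<lambda>c. \<Sum>b\<in>orthonormal_basis X. c b *\<^sub>R b)"

definition subspace_lebesgue :: "'a::euclidean_space set \<Rightarrow> 'a measure" where
  "subspace_lebesgue X = completion (subspace_lborel X)"

text \<open>Normalised surface measure on the unit sphere of \<open>X\<close>, as the radial projection of
  the uniform distribution on the unit ball of \<open>X\<close>.\<close>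

definition sphere_measure :: "'a::euclidean_space set \<Rightarrow> 'a measure" where
  "sphere_measure X = completion (distr (uniform_measure (subspace_lborel X) (ball 0 1)) borel sgn)"

text \<open>The measure $d\tau = d\xi\,du$ on the $j$-planes contained in \<open>X\<close>.\<close>

definition affine_grass_measure :: "'a::euclidean_space set \<Rightarrow> nat \<Rightarrow> 'a set measure" where
  "affine_grass_measure X j = completion
     (measure_of (affine_grassmannian X j) (sets (plane_borel (affine_grassmannian X j)))
       (\<lambda>A. \<integral>\<^sup>+ \<xi>. (\<integral>\<^sup>+ u. indicator A ((+) u ` \<xi>) \<partial>subspace_lebesgue (X \<inter> \<xi>\<^sup>\<bottom>)) \<partial>grass_measure X j))"


section \<open>The class \<open>L_log\<close> and the transform \<open>R_{j,k}\<close>\<close>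

definition L_log :: "nat \<Rightarrow> ('a::euclidean_space set \<Rightarrow> 'b::euclidean_space) set" where
  "L_log j = {f \<in> borel_measurable (affine_grass_measure UNIV j).
     (\<integral>\<^sup>+ \<tau>. ennreal (norm (f \<tau>) / (1 + plane_norm \<tau>) * ln (2 + plane_norm \<tau>))
        \<partial>affine_grass_measure UNIV j) < \<infinity>}"

definition radon_jk ::
    "nat \<Rightarrow> ('a::euclidean_space set \<Rightarrow> 'b::euclidean_space) \<Rightarrow> 'a set \<Rightarrow> 'a \<Rightarrow> 'b" where
  "radon_jk j f \<eta> v =
     (LINT \<xi>|grass_measure (\<eta>\<^sup>\<bottom>) j. (LINT u|subspace_lebesgue \<eta>. f ((+) (u + v) ` \<xi>)))"


section \<open>The Funk transform and its inverse\<close>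

text \<open>Here $Y$ is a linear subspace of dimension $d + 1$ and $S^d$ is its unit sphere.\<close>

definition funk :: "'c::euclidean_space set \<Rightarrow> ('c \<Rightarrow> 'b::euclidean_space) \<Rightarrow> 'c \<Rightarrow> 'b" where
  "funk Y f \<theta> = (LINT \<sigma>|sphere_measure (Y \<inter> {\<theta>}\<^sup>\<bottom>). f \<sigma>)"

text \<open>The even functions in $L^1(S^d)$.\<close>

definition even_L1 :: "'c::euclidean_space set \<Rightarrow> ('c \<Rightarrow> 'b::euclidean_space) set" where
  "even_L1 Y = {f. integrable (sphere_measure Y) f \<and> (\<forall>\<theta>\<in>Y \<inter> sphere 0 1. f (- \<theta>) = f \<theta>)}"

definition funk_mean ::
    "'c::euclidean_space set \<Rightarrow> ('c \<Rightarrow> 'b::euclidean_space) \<Rightarrow> 'c \<Rightarrow> real \<Rightarrow> 'b" where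
  "funk_mean Y \<psi> \<theta> s =
     (LINT \<sigma>|sphere_measure (Y \<inter> {\<theta>}\<^sup>\<bottom>). \<psi> (s *\<^sub>R \<sigma> + sqrt (1 - s\<^sup>2) *\<^sub>R \<theta>))"

definition funk_primitive ::
    "'c::euclidean_space set \<Rightarrow> ('c \<Rightarrow> 'b::euclidean_space) \<Rightarrow> real \<Rightarrow> 'c \<Rightarrow> 'b" where
  "funk_primitive Y \<psi> t \<theta> = (let d = dim Y - 1 in
     (1 / fact (d - 2)) *\<^sub>R
       (LINT s:{0..t}|lebesgue. ((t\<^sup>2 - s\<^sup>2) powr ((real d - 3) / 2) * s) *\<^sub>R funk_mean Y \<psi> \<theta> s))"

definition L1_tendsto ::
    "'c measure \<Rightarrow> (real \<Rightarrow> 'c \<Rightarrow> 'b::euclidean_space) \<Rightarrow> ('c \<Rightarrow> 'b) \<Rightarrow> real filter \<Rightarrow> bool" where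
  "L1_tendsto M G g F \<longleftrightarrow>
     integrable M g \<and> (\<forall>\<^sub>F t in F. integrable M (G t)) \<and>
     ((\<lambda>t. LINT \<theta>|M. norm (G t \<theta> - g \<theta>)) \<longlongrightarrow> 0) F"

text \<open>For a merely integrable function the $t$-derivative need not exist pointwise at each $t$;
  like the final limit $t \to 1$, it is a limit (of difference quotients) in the $L^1$-norm.\<close>

definition L1_has_derivative_01 ::
    "'c measure \<Rightarrow> (real \<Rightarrow> 'c \<Rightarrow> 'b::euclidean_space) \<Rightarrow> (real \<Rightarrow> 'c \<Rightarrow> 'b) \<Rightarrow> bool" where
  "L1_has_derivative_01 M G G' \<longleftrightarrow>
     (\<forall>t\<in>{0<..<1}. L1_tendsto M (\<lambda>s \<theta>. (1 / (s - t)) *\<^sub>R (G s \<theta> - G t \<theta>)) (G' t) (at t))"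

text \<open>\<open>is_funk_inverse Y \<psi> g\<close>: the function \<open>\<psi>\<close> is the Funk transform of an even integrable
  function, and \<open>g\<close> is a version of $F^{-1}\psi$ computed by the inversion formula, in which
  \<open>D m\<close> is the $m$-th $t$-derivative.\<close>

definition is_funk_inverse ::
    "'c::euclidean_space set \<Rightarrow> ('c \<Rightarrow> 'b::euclidean_space) \<Rightarrow> ('c \<Rightarrow> 'b) \<Rightarrow> bool" where
  "is_funk_inverse Y \<psi> g \<longleftrightarrow>
     (\<exists>f\<in>even_L1 Y. AE \<theta> in sphere_measure Y. \<psi> \<theta> = funk Y f \<theta>) \<and>
     g \<in> even_L1 Y \<and>
     (\<exists>D. D 0 = funk_primitive Y \<psi> \<and>
          (\<forall>m < dim Y - 2. L1_has_derivative_01 (sphere_measure Y) (D m) (D (Suc m))) \<and>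
          L1_tendsto (sphere_measure Y) (D (dim Y - 2)) g (at_left 1))"


section \<open>Inverse hyperplane Radon transform and its dual\<close>

text \<open>Now $X$ has dimension $d$, and $X \oplus \mathbb{R} e_{d+1}$ is \<^term>\<open>X \<times> (UNIV :: real set)\<close>,
  whose unit sphere is $S^d$.\<close>

text \<open>The surface area $\sigma_m$ of $S^m$.\<close>

definition sphere_area :: "nat \<Rightarrow> real" where
  "sphere_area m = 2 * pi powr ((real m + 1) / 2) / Gamma ((real m + 1) / 2)"

definition hyperplane :: "'a::euclidean_space set \<Rightarrow> 'a \<Rightarrow> real \<Rightarrow> 'a set" where
  "hyperplane X \<omega>\<^sub>0 t = {x \<in> X. x \<bullet> \<omega>\<^sub>0 = t}"

definition mu :: "'a::euclidean_space \<Rightarrow> 'a \<times> real" where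
  "mu x = (1 / norm (x, 1::real)) *\<^sub>R (x, 1)"

text \<open>If \<open>\<tau>\<close> contains the origin, \<open>\<omega>\<^sub>0\<close> is determined up to sign only;
  \<^term>\<open>mu_tilde\<close> is only composed with even functions, so the choice is immaterial.\<close>

definition mu_tilde :: "'a::euclidean_space set \<Rightarrow> 'a set \<Rightarrow> 'a \<times> real" where
  "mu_tilde X \<tau> = (SOME \<omega>. \<exists>\<omega>\<^sub>0 t. \<omega>\<^sub>0 \<in> X \<and> norm \<omega>\<^sub>0 = 1 \<and> 0 \<le> t \<and> \<tau> = hyperplane X \<omega>\<^sub>0 t \<and>
      \<omega> = (- cos (arctan t) *\<^sub>R \<omega>\<^sub>0, sin (arctan t)))"

text \<open>The hyperplane \<open>\<tau>\<close> such that \<open>\<omega>\<close> is normal to the linear span of $\tau + e_{d+1}$.  This makes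
  sense on the whole sphere minus the poles, where it is the even extension of the inverse map.\<close>

definition mu_tilde_inv :: "'a::euclidean_space set \<Rightarrow> 'a \<times> real \<Rightarrow> 'a set" where
  "mu_tilde_inv X \<omega> = {x \<in> X. (x, 1) \<bullet> \<omega> = 0}"

lemma mu_tilde_inv_mu_tilde:
  assumes "\<omega>\<^sub>0 \<in> X" "norm \<omega>\<^sub>0 = 1" "0 \<le> t" "\<tau> = hyperplane X \<omega>\<^sub>0 t"
  shows "mu_tilde_inv X (mu_tilde X \<tau>) = \<tau>" "mu_tilde_inv X (- mu_tilde X \<tau>) = \<tau>"
proof -
  have "\<exists>\<omega> \<omega>\<^sub>0 t. \<omega>\<^sub>0 \<in> X \<and> norm \<omega>\<^sub>0 = 1 \<and> 0 \<le> t \<and> \<tau> = hyperplane X \<omega>\<^sub>0 t \<and>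
      \<omega> = (- cos (arctan t) *\<^sub>R \<omega>\<^sub>0, sin (arctan t))"
    using assms by blast
  from someI_ex[OF this] obtain w s where
    w: "\<tau> = hyperplane X w s" "mu_tilde X \<tau> = (- cos (arctan s) *\<^sub>R w, sin (arctan s))"
    unfolding mu_tilde_def by blast
  have c: "cos (arctan s) > 0" by (simp add: cos_arctan add_pos_nonneg)
  have "sin (arctan s) = s * cos (arctan s)"
    using tan_arctan[of s] c by (simp add: tan_def field_simps)
  then have "(x, 1) \<bullet> mu_tilde X \<tau> = cos (arctan s) * (s - x \<bullet> w)" for x
    unfolding w(2) by (simp add: algebra_simps)
  then have "(x, 1) \<bullet> mu_tilde X \<tau> = 0 \<longleftrightarrow> x \<bullet> w = s" for x
    using c by auto
  then show "mu_tilde_inv X (mu_tilde X \<tau>) = \<tau>" "mu_tilde_inv X (- mu_tilde X \<tau>) = \<tau>"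
    unfolding mu_tilde_inv_def by (simp_all only: w(1) hyperplane_def inner_minus_right neg_equal_0_iff_equal)
qed

definition A_inv ::
    "'a::euclidean_space set \<Rightarrow> ('a set \<Rightarrow> 'b::euclidean_space) \<Rightarrow> 'a \<times> real \<Rightarrow> 'b" where
  "A_inv X h \<omega> = (2 / (sphere_area (dim X - 1) * norm (fst \<omega>))) *\<^sub>R h (mu_tilde_inv X \<omega>)"

definition B_inv ::
    "'a::euclidean_space set \<Rightarrow> ('a \<times> real \<Rightarrow> 'b::euclidean_space) \<Rightarrow> 'a \<Rightarrow> 'b" where
  "B_inv X f x = ((1 + (norm x)\<^sup>2) powr (- (real (dim X) / 2))) *\<^sub>R f (mu x)"

definition A_star_inv :: "('a::euclidean_space \<Rightarrow> 'b::euclidean_space) \<Rightarrow> 'a \<times> real \<Rightarrow> 'b" where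
  "A_star_inv g \<theta> = (1 / \<bar>snd \<theta>\<bar>) *\<^sub>R g (- (1 / snd \<theta>) *\<^sub>R fst \<theta>)"

definition B_star_inv ::
    "'a::euclidean_space set \<Rightarrow> ('a \<times> real \<Rightarrow> 'b::euclidean_space) \<Rightarrow> 'a set \<Rightarrow> 'b" where
  "B_star_inv X f \<tau> =
     ((1 + (plane_norm \<tau>)\<^sup>2) powr (- (real (dim X) / 2))) *\<^sub>R f (mu_tilde X (uminus ` \<tau>))"

text \<open>\<open>is_radon_inverse X h f\<close> says $f = B^{-1}F^{-1}A^{-1}h$ almost everywhere on \<open>X\<close>, and
  \<open>is_dual_radon_inverse X g h\<close> says $h = B_*^{-1}F^{-1}A_*^{-1}g$ for almost all
  hyperplanes of \<open>X\<close>.  These are relations because $F^{-1}$ is an $L^1$-limit, hence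
  defined up to null sets.\<close>

definition is_radon_inverse ::
    "'a::euclidean_space set \<Rightarrow> ('a set \<Rightarrow> 'b::euclidean_space) \<Rightarrow> ('a \<Rightarrow> 'b) \<Rightarrow> bool" where
  "is_radon_inverse X h f \<longleftrightarrow>
     (\<exists>p. is_funk_inverse (X \<times> UNIV) (A_inv X h) p \<and>
          (AE x in subspace_lebesgue X. f x = B_inv X p x))"

definition is_dual_radon_inverse ::
    "'a::euclidean_space set \<Rightarrow> ('a \<Rightarrow> 'b::euclidean_space) \<Rightarrow> ('a set \<Rightarrow> 'b) \<Rightarrow> bool" where
  "is_dual_radon_inverse X g h \<longleftrightarrow>
     (\<exists>p. is_funk_inverse (X \<times> UNIV) (A_star_inv g) p \<and>
          (AE \<tau> in affine_grass_measure X (dim X - 1). h \<tau> = B_star_inv X p \<tau>))"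


section \<open>The intermediate function\<close>

text \<open>Triples $(\xi,\eta,v)$ with $\xi \perp \eta$ and $v \in \xi^\perp \cap \eta^\perp$.\<close>

definition flags :: "nat \<Rightarrow> nat \<Rightarrow> ('a::euclidean_space set \<times> 'a set \<times> 'a) set" where
  "flags j k = {(\<xi>, \<eta>, v). \<eta> \<in> grassmannian UNIV k \<and> \<xi> \<in> grassmannian (\<eta>\<^sup>\<bottom>) j \<and> v \<in> \<xi>\<^sup>\<bottom> \<inter> \<eta>\<^sup>\<bottom>}"

text \<open>\<open>is_tilde j k \<phi> F\<close>: the value \<open>F \<xi> \<eta> v\<close> is a version of
  $\tilde f_\xi(\eta,v) \equiv \tilde f_\eta(\xi,v) = (R^*_{\eta^\perp})^{-1}[\varphi(\eta,\cdot)](\xi,v)$.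
  For each \<open>\<eta>\<close> the right-hand side is defined only up to a null set of hyperplanes $\xi + v$ of
  $\eta^\perp$, whereas \<open>F\<close> is going to be used with \<open>\<xi>\<close> fixed; joint measurability
  is what makes the change of the fixed variable meaningful.\<close>

definition is_tilde ::
    "nat \<Rightarrow> nat \<Rightarrow> ('a::euclidean_space set \<Rightarrow> 'a \<Rightarrow> 'b::euclidean_space) \<Rightarrow>
     ('a set \<Rightarrow> 'a set \<Rightarrow> 'a \<Rightarrow> 'b) \<Rightarrow> bool" where
  "is_tilde j k \<phi> F \<longleftrightarrow>
     (\<lambda>(\<xi>, \<eta>, v). F \<xi> \<eta> v) \<in> borel_measurable (restrict_space
        (plane_borel (grassmannian UNIV j) \<Otimes>\<^sub>M plane_borel (grassmannian UNIV k) \<Otimes>\<^sub>M borel)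
        (flags j k)) \<and>
     (AE \<eta> in grass_measure UNIV k.
        is_dual_radon_inverse (\<eta>\<^sup>\<bottom>) (\<phi> \<eta>) (\<lambda>\<tau>. F (direction \<tau>) \<eta> (foot \<tau>)))"

end

theory Submission
 imports Defs
begin

text \<open>Put $F(\xi,\eta,v) = \int_\eta f(\xi+u+v)\,du$.  For fixed $\eta$, $\varphi(\eta,\cdot)$ is the
 dual hyperplane transform of $F(\cdot,\eta,\cdot)$ in $\eta^\perp$; for fixed $\xi$, $F(\xi,\cdot,\cdot)$
 is the hyperplane transform of $f(\xi,\cdot)$ in $\xi^\perp$.  The gnomonic projection turns both into
 Funk transforms of even functions, so both can be inverted on every slice where the even function lies in
 $L^1(S^d)$.  By Tonelli's theorem over the flags $\xi\perp\eta$ almost all slices qualify, because the mean of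
 $1/(1+|x\cdot\omega|)$ over the unit sphere is $O(\log(2+|x|)/(1+|x|))$; this is where $L_{\log}$ enters.
 The same theorem turns the almost everywhere uniqueness of $F$ for almost every $\eta$ into the one for almost
 every $\xi$.  It rests on the uniqueness of a measure on pairs $(\xi,\omega)$, $\omega\perp\xi$,
 invariant under the orthogonal group.

 The Funk transform is inverted without approximation by continuous functions: the means of $Ff$ over
 sections of the sphere are a fractional integral of the means of $f$, the outer fractional integral turns this
 into a repeated integral, and the means of $f$ depend continuously on the section in $L^1$.\<close>

text \<open>The measures of the statement come from choices: \<open>orthonormal_basis\<close> is a
  \<open>SOME\<close>, the invariant measure on a Grassmannian a \<open>THE\<close>. So each is
  first characterised through the masses of balls centred on its support, and then written as an
  image of one fixed measure: Lebesgue measure on a subspace through \<open>nni_leb_eq\<close>,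
  spheres through \<open>sph UNIV\<close>, hyperplane directions through \<open>cut_plane\<close>.
  Only in this form are integrals measurable in the subspace, as Tonelli over the flags demands.
  Formulas are proved for nonnegative integrands, where integrability is no issue; integrals with
  values in 'b are reached by comparing image measures or components. The weight 1 / (1 + |t|) has a
  simple origin: the even function behind the dual transform in d dimensions carries the factor sqrt
  (1 + t^2)^d, and the surface measure in the coordinates (\<omega>, t) carries sqrt (1 + t^2)^-(d +
  1). Averaging this weight over \<omega> at t = x . \<omega> produces the logarithm.\<close>

abbreviation (input) "leb == subspace_lborel"
abbreviation (input) "bmeas == borel_measurable"
abbreviation (input) "proj == closest_point"
abbreviation (input) "enn == ennreal"
abbreviation (input) "sfin == sigma_finite_measure"
abbreviation (input) "em == emeasure"
abbreviation (input) "Gr == grassmannian"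
abbreviation (input) "aGr == affine_grassmannian"
abbreviation (input) "plb == plane_borel"
abbreviation (input) "orth == orthogonal_transformation"
notation (input) iff (infixr "<->" 25)
notation (input) LIMSEQ (infixr "--->" 60)
abbreviation (input) "ind == indicator"
notation scaleR (infixr "*R" 75)
notation inner (infix "*." 70)
notation pair_measure (infixr "xx" 80)
notation orthogonal_comp ("_^o" [80] 80)
notation power2 ("(_^2)" [1000] 999)
syntax "_II" :: "pttrn => ennreal => 'a measure => ennreal" ("(2II _./ _ dd _)" [60,61] 110)
translations "II x. f dd M" == "CONST nn_integral M (%x. f)"

text \<open>By symmetry of \<open>B n\<close> and Tonelli, the \<open>M\<close>-integral over
  \<open>U\<close> of the \<open>N\<close>-mass that the neighbourhood of x has in \<open>U\<close>
  is at most \<open>c n\<close> times the \<open>N\<close>-mass of \<open>U\<close>. Divided by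
  \<open>d n\<close>, these averages tend to the indicator of \<open>U\<close>. The ratio
  \<open>c n / d n\<close> is not under control, so the same is done for \<open>V\<close> with
  \<open>M\<close> and \<open>N\<close> exchanged, and the two bounds are multiplied.\<close>

lemma uniform_measures_le:
 fixes M N :: "'a measure" and B :: "nat => 'a => 'a => bool" and c d :: "nat => ennreal"
 assumes sf: "sfin M" "sfin N" and sets: "sets N = sets M"
  and B: "!!n. Measurable.pred (M xx M) (%(x, y). B n x y)"
  and sym: "!!n x y. B n x y ==> B n y x"
  and AE_S: "AE x in M. x : S" "AE x in N. x : S"
  and c: "!!n x. x : S ==> em M {y:space M. B n x y} = c n"
  and d: "!!n x. x : S ==> em N {y:space M. B n x y} = d n"
  and c0: "!!n. 0 < c n" "!!n. c n < \<infinity>" and d0: "!!n. 0 < d n" "!!n. d n < \<infinity>"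
  and U: "U : sets M" "!!x. x : U Int S ==> \<forall>\<^sub>F n in sequentially. ALL y:space M. B n x y --> y : U"
  and V: "V : sets M" "!!x. x : V Int S ==> \<forall>\<^sub>F n in sequentially. ALL y:space M. B n x y --> y : V"
 shows "em M U * em N V <= em N U * em M V"
proof -
 interpret M: sigma_finite_measure M by fact
 interpret N: sigma_finite_measure N by fact
 have [measurable_cong]: "sets N = sets M" by fact
 have spN: "space N = space M" using sets by (rule sets_eq_imp_space_eq)
 note [measurable] = U(1) V(1)
 have Bm[measurable]: "Measurable.pred (P xx Q) (%(x, y). B n x y)"
  if "sets P = sets M" "sets Q = sets M" for n and P Q :: "'a measure" using B[of n] measurable_cong_sets[OF sets_pair_measure_cong[OF that] refl] by blast
 have key: "(II x. ind W x * (II y. ind W y * ind {y. B n x y} y dd Q) dd P)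
   <= e n * em Q W"
  if PQ: "sfin P" "sfin Q" "sets P = sets M" "sets Q = sets M"
   and W[measurable]: "W : sets M" and e: "!!n x. x : S ==> em P {y:space M. B n x y} = e n"
   and AE_Q: "AE x in Q. x : S" for P Q :: "'a measure" and W n and e :: "nat => ennreal"
 proof -
  interpret P: sigma_finite_measure P by fact
  interpret Q: sigma_finite_measure Q by fact
  interpret PQ: pair_sigma_finite P Q ..
  have [measurable_cong]: "sets P = sets M" "sets Q = sets M" by fact+
  have spP: "space P = space M" using PQ(3) by (rule sets_eq_imp_space_eq)
  have [measurable]: "Measurable.pred (P xx Q) (%(x, y). B n x y)" by (rule Bm) fact+
  have [measurable]: "Measurable.pred (Q xx P) (%(x, y). B n x y)" by (rule Bm) fact+
  have m: "(%(x,y). ind W x * (ind W y * ind {y. B n x y} y) :: ennreal) : bmeas (P xx Q)" unfolding indicator_def by measurable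
  have "(II x. ind W x * (II y. ind W y * ind {y. B n x y} y dd Q) dd P)
   = (II x. (II y. ind W x * (ind W y * ind {y. B n x y} y) dd Q) dd P)"
  proof (intro nn_integral_cong, subst nn_integral_cmult[symmetric])
   fix x assume "x : space P"
   then show "(%y. ind W y * ind {y. B n x y} y :: ennreal) : bmeas Q" unfolding indicator_def by measurable
  qed simp
  also have "... = (II y. (II x. ind W x * (ind W y * ind {y. B n x y} y) dd P) dd Q)" using PQ.Fubini'[OF m] by simp
  also have "... <= (II y. e n * ind W y dd Q)"
  proof (rule nn_integral_mono_AE, use AE_Q in eventually_elim)
   fix y assume y: "y : S"
   show "(II x. ind W x * (ind W y * ind {y. B n x y} y) dd P) <= e n * ind W y"
   proof (cases "y : W")
    case True
    then have "y : space M" using sets.sets_into_space[OF W] by auto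
    then have "Measurable.pred P (%x. B n y x)" using spP PQ(3,4) sets_eq_imp_space_eq[OF PQ(4)] by measurable
    then have *: "{x:space P. B n y x} : sets P" by measurable
    have "(II x. ind W x * (ind W y * ind {y. B n x y} y) dd P)
     <= (II x. ind {x:space P. B n y x} x dd P)" by (intro nn_integral_mono) (auto split: split_indicator intro: sym)
    also have "... = e n" using e[OF y] * by (simp add: spP)
    finally show ?thesis using True by simp
   qed simp
  qed
  also have "... = e n * em Q W" by (subst nn_integral_cmult) auto
  finally show ?thesis .
 qed
 \<comment> \<open>Normalised by \<open>d n\<close> and by \<open>c n\<close> respectively: the
   bounds for the two integrals then carry the reciprocal factors \<open>c n / d n\<close> and
   \<open>d n / c n\<close>.\<close>
 define a where "a = (%n x. ind U x * (II y. ind U y * ind {y. B n x y} y dd N) / d n)"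
 define b where "b = (%n x. ind V x * (II y. ind V y * ind {y. B n x y} y dd M) / c n)"
 have [measurable]: "Measurable.pred (M xx N) (%(x, y). B n x y)" 
  "Measurable.pred (N xx M) (%(x, y). B n x y)" "Measurable.pred (M xx M) (%(x, y). B n x y)" for n using sets by (auto intro: Bm)
 have am[measurable]: "a n : bmeas M" for n unfolding a_def indicator_def by measurable
 have bm[measurable]: "b n : bmeas N" for n unfolding b_def indicator_def by measurable
 \<comment> \<open>As soon as the neighbourhood of \<open>x\<close> lies inside \<open>W\<close>,
   the normalised average equals 1 exactly.\<close>
 have lim: "\<forall>\<^sub>F n in sequentially. ind W x * (II y. ind W y * ind {y. B n x y} y dd Q) / e n = 1"
  if Q: "sets Q = sets M" and W: "W : sets M" "\<forall>\<^sub>F n in sequentially. ALL y:space M. B n x y --> y : W"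
   and x: "x : S" "x : W" and e: "!!n x. x : S ==> em Q {y:space M. B n x y} = e n"
   "!!n. 0 < e n" "!!n. e n < \<infinity>" for Q W x and e :: "nat => ennreal" using W(2)
 proof eventually_elim
  fix n assume n: "ALL y:space M. B n x y --> y : W"
  have spQ: "space Q = space M" using Q by (rule sets_eq_imp_space_eq)
  have xM: "x : space M" using x(2) sets.sets_into_space[OF W(1)] by auto
  have [measurable]: "Measurable.pred (M xx Q) (%(x, y). B n x y)" using Q by (auto intro: Bm)
  have "Measurable.pred Q (%y. B n x y)" using xM by measurable
  then have *: "{y:space Q. B n x y} : sets Q" by measurable
  have "(II y. ind W y * ind {y. B n x y} y dd Q) = (II y. ind {y:space Q. B n x y} y dd Q)" using n spQ by (intro nn_integral_cong) (auto split: split_indicator)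
  also have "... = e n" using * e(1)[OF x(1)] spQ by simp
  finally show "ind W x * (II y. ind W y * ind {y. B n x y} y dd Q) / e n = 1" using x e(2)[of n] e(3)[of n] by (simp add: ennreal_divide_self)
 qed
 have a1: "AE x in M. ind U x <= liminf (%n. a n x)" using AE_S(1)
 proof eventually_elim
  fix x assume x: "x : S"
  show "ind U x <= liminf (%n. a n x)"
  proof (cases "x : U")
   case True
   have "\<forall>\<^sub>F n in sequentially. a n x = 1" unfolding a_def using True x U d d0 sets by (intro lim) auto
   then have "(%n. a n x) ---> 1" by (rule tendsto_eventually)
   then have "liminf (%n. a n x) = 1" by (intro lim_imp_Liminf) auto
   then show ?thesis using True by simp
  qed simp
 qed
 have "em M U * em N V = (II x. (II y. ind U x * ind V y dd N) dd M)" by (simp add: nn_integral_cmult nn_integral_multc)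
 also have "... <= (II x. liminf (%n. II y. a n x * b n y dd N) dd M)"
 proof (rule nn_integral_mono_AE, use AE_S(1) in eventually_elim)
  fix x assume x: "x : S"
  show "(II y. ind U x * ind V y dd N) <= liminf (%n. II y. a n x * b n y dd N)"
  proof (cases "x : U")
   case True
   have "(II y. ind U x * ind V y dd N) <= (II y. liminf (%n. a n x * b n y) dd N)"
   proof (rule nn_integral_mono_AE, use AE_S(2) in eventually_elim)
    fix y assume y: "y : S"
    show "ind U x * ind V y <= liminf (%n. a n x * b n y)"
    proof (cases "y : V")
     case yV: True
     have "\<forall>\<^sub>F n in sequentially. a n x = 1" unfolding a_def using True x U d d0 sets by (intro lim) auto
     moreover have "\<forall>\<^sub>F n in sequentially. b n y = 1" unfolding b_def using yV y V c c0 by (intro lim) auto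
     ultimately have "\<forall>\<^sub>F n in sequentially. a n x * b n y = 1" by eventually_elim simp
     then have "(%n. a n x * b n y) ---> 1" by (rule tendsto_eventually)
     then have "liminf (%n. a n x * b n y) = 1" by (intro lim_imp_Liminf) auto
     then show ?thesis by (auto split: split_indicator)
    qed simp
   qed
   also have "... <= liminf (%n. II y. a n x * b n y dd N)" by (intro nn_integral_liminf) measurable
   finally show ?thesis .
  qed simp
 qed
 also have "... <= liminf (%n. II x. (II y. a n x * b n y dd N) dd M)" by (intro nn_integral_liminf) measurable
 also have "... <= liminf (%n. em N U * em M V)"
 proof (intro Liminf_mono always_eventually allI)
  fix n
  have 1: "(II x. a n x dd M) <= c n * em N U / d n"
  proof -
   have "(II x. a n x dd M) = (II x. ind U x * (II y. ind U y * ind {y. B n x y} y dd N) dd M) / d n" unfolding a_def by (rule nn_integral_divide) (unfold indicator_def, measurable)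
   also have "... <= c n * em N U / d n" by (intro divide_right_mono_ennreal key) (use assms in auto)
   finally show ?thesis .
  qed
  have 2: "(II x. b n x dd N) <= d n * em M V / c n"
  proof -
   have "(II x. b n x dd N) = (II x. ind V x * (II y. ind V y * ind {y. B n x y} y dd M) dd N) / c n" unfolding b_def by (rule nn_integral_divide) (unfold indicator_def, measurable)
   also have "... <= d n * em M V / c n" by (intro divide_right_mono_ennreal key) (use assms in auto)
   finally show ?thesis .
  qed
  have "(II x. (II y. a n x * b n y dd N) dd M) = (II x. a n x dd M) * (II y. b n y dd N)" by (simp add: nn_integral_cmult nn_integral_multc)
  also have "... <= (c n * em N U / d n) * (d n * em M V / c n)" by (intro mult_mono 1 2) auto
  also have "... = (c n / c n) * (d n / d n) * (em N U * em M V)" by (simp add: divide_ennreal_def mult_ac)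
  also have "... = em N U * em M V" using c0[of n] d0[of n] by (simp add: ennreal_divide_self)
  finally show "(II x. (II y. a n x * b n y dd N) dd M) <= em N U * em M V" .
 qed
 also have "... = em N U * em M V" by (simp add: Liminf_const)
 finally show ?thesis .
qed

text \<open>Christensen's uniqueness argument for uniformly distributed measures, with an abstract
 sequence of neighbourhood relations \<open>B n\<close> in place of the balls of a metric.\<close>

theorem uniform_measures_proportional:
 fixes M N :: "'a measure" and B :: "nat => 'a => 'a => bool" and c d :: "nat => ennreal"
 assumes "sfin M" "sfin N" "sets N = sets M"
  and "!!n. Measurable.pred (M xx M) (%(x, y). B n x y)"
  and "!!n x y. B n x y ==> B n y x"
  and "AE x in M. x : S" "AE x in N. x : S"
  and "!!n x. x : S ==> em M {y:space M. B n x y} = c n"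
  and "!!n x. x : S ==> em N {y:space M. B n x y} = d n"
  and "!!n. 0 < c n" "!!n. c n < \<infinity>" "!!n. 0 < d n" "!!n. d n < \<infinity>"
  and "U : sets M" "!!x. x : U Int S ==> \<forall>\<^sub>F n in sequentially. ALL y:space M. B n x y --> y : U"
  and "V : sets M" "!!x. x : V Int S ==> \<forall>\<^sub>F n in sequentially. ALL y:space M. B n x y --> y : V"
 shows "em M U * em N V = em N U * em M V"
proof (rule antisym)
 show "em M U * em N V <= em N U * em M V" by (rule uniform_measures_le[where B=B and S=S and c=c and d=d]) (use assms in auto)
 have "em M V * em N U <= em N V * em M U" by (rule uniform_measures_le[where B=B and S=S and c=c and d=d]) (use assms in auto)
 then show "em N U * em M V <= em M U * em N V" by (simp add: mult.commute)
qed

section \<open>Lebesgue measures on subspaces\<close>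

lemma comp_iff: "x : W^o <-> (ALL y:W. x *. y = 0)" by (auto simp: orthogonal_comp_def orthogonal_def inner_commute)

lemma subspace_Int_comp: "subspace X ==> subspace (X Int W^o)" by (intro subspace_inter subspace_orthogonal_comp)

lemma proj_subspaceI:
 fixes V :: "'a::euclidean_space set"
 assumes "subspace V" "y : V" "x - y : V^o"
 shows "proj V x = y"
proof -
 have "dist x y <= dist x z" if "z : V" for z
 proof -
  have "y - z : V" using assms that by (simp add: subspace_diff)
  then have "(x - y) *. (y - z) = 0" using assms(3) by (simp add: comp_iff)
  then have "(norm (x - z))^2 = (norm (x - y))^2 + (norm (y - z))^2" using norm_add_Pythagorean[of "x - y" "y - z"] by (simp add: orthogonal_def)
  then have "(norm (x - y))^2 <= (norm (x - z))^2" by simp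
  then have "norm (x - y) <= norm (x - z)" by (rule power2_le_imp_le) simp
  then show ?thesis by (simp only: dist_norm)
 qed
 then have "y = proj V x" using assms(2) by (intro closest_point_unique) (auto simp: subspace_imp_convex closed_subspace assms(1))
 then show ?thesis by simp
qed

lemma proj_subspace:
 fixes V :: "'a::euclidean_space set"
 assumes "subspace V"
 shows closest_point_in_subspace: "proj V x : V"
  and closest_point_orthogonal: "x - proj V x : V^o"
proof -
 obtain y z where "y : span V" "!!w. w : span V ==> orthogonal z w" "x = y + z" using orthogonal_subspace_decomp_exists[of V x] by blast
 then have *: "y : V" "x - y : V^o" using assms by (auto simp: comp_iff orthogonal_def span_eq_iff[THEN iffD2])
 then have "proj V x = y" by (intro proj_subspaceI assms)
 with * show "proj V x : V" "x - proj V x : V^o" by simp_all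
qed

lemma proj_dot_subspace:
 fixes V :: "'a::euclidean_space set"
 assumes "subspace V" "v : V"
 shows "proj V x *. v = x *. v" using closest_point_orthogonal[OF assms(1), of x] assms(2) by (simp add: comp_iff inner_diff_left)

lemma linear_proj:
 fixes V :: "'a::euclidean_space set"
 assumes "subspace V" shows "linear (proj V)"
proof (rule linearI)
 note * = proj_subspace[OF assms]
 fix x y :: 'a and c :: real
 have "(x - proj V x) + (y - proj V y) : V^o" using *(2) by (intro subspace_add subspace_orthogonal_comp)
 then have "x + y - (proj V x + proj V y) : V^o" by (simp add: add_diff_add)
 then show "proj V (x + y) = proj V x + proj V y" using *(1) by (intro proj_subspaceI assms subspace_add)
 have "c *R (x - proj V x) : V^o" using *(2) by (intro subspace_scale subspace_orthogonal_comp)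
 then have "c *R x - c *R proj V x : V^o" by (simp add: scaleR_diff_right)
 then show "proj V (c *R x) = c *R proj V x" using *(1) by (intro proj_subspaceI assms subspace_scale)
qed

lemma proj_subspace_eq: "subspace V ==> v : V ==> proj V v = v" for V :: "'a::euclidean_space set" by (rule closest_point_self)

lemma proj_subspace_eq_0: "subspace V ==> v : V^o ==> proj V v = 0" for V :: "'a::euclidean_space set" by (rule proj_subspaceI) (auto simp: subspace_0)

lemma bm_proj[measurable]:
 "subspace V ==> proj V : bmeas borel" for V :: "'a::euclidean_space set" by (intro borel_measurable_continuous_onI continuous_on_closest_point subspace_imp_convex
   closed_subspace) (auto simp: subspace_0 dest: subspace_0)

lemma proj_comp:
 fixes V :: "'a::euclidean_space set"
 assumes "subspace V" shows "proj (V^o) x = x - proj V x" using proj_subspace[OF assms, of x] by (intro proj_subspaceI subspace_orthogonal_comp) (auto simp: comp_iff inner_commute)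

lemma proj_Int_comp:
 fixes X V :: "'a::euclidean_space set"
 assumes "subspace X" "subspace V" "V \<subseteq> X"
 shows "proj (X Int V^o) x = proj X x - proj V x"
proof (rule proj_subspaceI)
 note * = proj_subspace[OF assms(1), of x] proj_subspace[OF assms(2), of x]
 show "subspace (X Int V^o)" using assms(1) by (rule subspace_Int_comp)
 have 1: "proj X x *. w = x *. w" if "w : X" for w using assms(1) that by (rule proj_dot_subspace)
 have 2: "proj V x *. w = x *. w" if "w : V" for w using assms(2) that by (rule proj_dot_subspace)
 have "proj X x - proj V x : X" using * assms by (auto intro!: subspace_diff)
 then show "proj X x - proj V x : X Int V^o" using assms(3) by (auto simp: comp_iff inner_diff_left 1 2 subset_iff)
 show "x - (proj X x - proj V x) : (X Int V^o)^o" unfolding comp_iff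
 proof
  fix y assume y: "y : X Int V^o"
  then have "y *. proj V x = 0" using *(3) by (auto simp: comp_iff)
  then show "(x - (proj X x - proj V x)) *. y = 0" using y 1[of y] by (simp add: inner_diff_right inner_commute[of _ y])
 qed
qed

lemma dim_Int_comp:
 fixes X :: "'a::euclidean_space set"
 assumes "subspace X" "subspace V" "V \<subseteq> X"
 shows "dim (X Int V^o) + dim V = dim X"
proof -
 have "{y : X. ALL x:V. orthogonal x y} = X Int V^o" by (auto simp: orthogonal_comp_def)
 then show ?thesis using dim_subspace_orthogonal_to_vectors[OF assms(2,1,3)] by simp
qed

lemma orthonormal_basis_props:
 fixes X :: "'a::euclidean_space set"
 assumes "subspace X"
 shows "orthonormal_basis X \<subseteq> X" "pairwise orthogonal (orthonormal_basis X)"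
  "!!b. b : orthonormal_basis X ==> norm b = 1" "span (orthonormal_basis X) = X"
proof -
 have "EX B. B \<subseteq> X & pairwise orthogonal B & (ALL b:B. norm b = 1) & span B = X" using orthonormal_basis_subspace[OF assms] by metis
 from someI_ex[OF this, folded orthonormal_basis_def]
 show "orthonormal_basis X \<subseteq> X" "pairwise orthogonal (orthonormal_basis X)"
  "!!b. b : orthonormal_basis X ==> norm b = 1" "span (orthonormal_basis X) = X" by auto
qed

lemma orthonormal_set_props:
 fixes B :: "'a::euclidean_space set"
 assumes "pairwise orthogonal B" "!!b. b : B ==> norm b = 1"
 shows orthonormal_finite: "finite B" and orthonormal_independent: "independent B"
  and orthonormal_card: "card B = dim (span B)"
proof -
 show "independent B" using assms pairwise_orthogonal_independent by force
 then show "finite B" "card B = dim (span B)" by (auto simp: independent_imp_finite dim_eq_card_independent)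
qed

text \<open>The construction of \<open>subspace_lborel\<close> for an explicit basis. It allows
  independence of the chosen basis to be stated, and bases to be joined in
  \<open>leb_decomp\<close>.\<close>

definition onb_lborel :: "'a::euclidean_space set => 'a measure" where
 "onb_lborel B = distr (\<Pi>\<^sub>M b\<in>B. lborel) borel (%c. \<Sum>b\<in>B. c b *R b)"

lemma PiM_lborel_translate:
 fixes B :: "'i set" and v :: "'i => real"
 assumes "finite B"
 shows "distr (\<Pi>\<^sub>M b\<in>B. lborel) (\<Pi>\<^sub>M b\<in>B. lborel) (%c. \<lambda>b\<in>B. v b + c b) = (\<Pi>\<^sub>M b\<in>B. lborel)"
proof -
 interpret product_sigma_finite "%_::'i. lborel :: real measure" by standard
 show ?thesis
 proof (rule PiM_eqI)
  fix A :: "'i => real set" assume A: "!!i. i : B ==> A i : sets lborel"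
  have m: "(+) (v i) -` A i : sets borel" if "i : B" for i using measurable_sets[of "(+) (v i)" borel borel "A i"] A[OF that] by simp
  have 1: "(%c. \<lambda>b\<in>B. v b + c b) -` Pi\<^sub>E B A Int space (\<Pi>\<^sub>M b\<in>B. lborel) = Pi\<^sub>E B (%b. (+) (v b) -` A b)" by (auto simp: space_PiM PiE_iff restrict_def)
  have 2: "em lborel ((+) (v i) -` A i) = em lborel (A i)" if "i : B" for i
  proof -
   have "em lborel (A i) = em (distr lborel borel ((+) (v i))) (A i)" by (simp add: lborel_distr_plus)
   also have "... = em lborel ((+) (v i) -` A i)" using A[OF that] by (subst emeasure_distr) auto
   finally show ?thesis by simp
  qed
  have "em (distr (\<Pi>\<^sub>M b\<in>B. lborel) (\<Pi>\<^sub>M b\<in>B. lborel) (%c. \<lambda>b\<in>B. v b + c b)) (Pi\<^sub>E B A)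
   = em (\<Pi>\<^sub>M b\<in>B. lborel) (Pi\<^sub>E B (%b. (+) (v b) -` A b))" unfolding 1[symmetric] using A assms by (intro emeasure_distr) (auto intro!: sets_PiM_I_finite)
  also have "... = (\<Prod>i\<in>B. em lborel (A i))" using assms by (subst emeasure_PiM) (auto simp: 2 m)
  finally show "em (distr (\<Pi>\<^sub>M b\<in>B. lborel) (\<Pi>\<^sub>M b\<in>B. lborel) (%c. \<lambda>b\<in>B. v b + c b)) (Pi\<^sub>E B A)
   = (\<Prod>i\<in>B. em lborel (A i))" .
 qed (use assms in auto)
qed

lemma norm_orthonormal_sum:
 fixes B :: "'a::euclidean_space set"
 assumes "pairwise orthogonal B" "!!b. b : B ==> norm b = 1"
 shows "norm (\<Sum>b\<in>B. c b *R b) = sqrt (\<Sum>b\<in>B. (c b)^2)"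
proof -
 have "(norm (\<Sum>b\<in>B. c b *R b))^2 = (\<Sum>b\<in>B. (norm (c b *R b))^2)" using assms orthonormal_finite[OF assms] by (intro norm_sum_Pythagorean) (auto simp: pairwise_def orthogonal_def)
 also have "... = (\<Sum>b\<in>B. (c b)^2)" using assms by (intro sum.cong) auto
 finally show ?thesis by (metis norm_ge_zero real_sqrt_unique)
qed

lemma sets_onb_lborel[simp, measurable_cong]: "sets (onb_lborel B) = sets borel"
 and space_onb_lborel[simp]: "space (onb_lborel B) = UNIV" by (auto simp: onb_lborel_def)

lemma meas_onb_map[measurable]:
 "finite B ==> (%c. \<Sum>b\<in>B. c b *R b) : bmeas (\<Pi>\<^sub>M b\<in>B. lborel)" for B :: "'a::euclidean_space set" by (intro borel_measurable_sum borel_measurable_scaleR) auto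

text \<open>In coordinates with respect to \<open>B\<close> the ball is a translate of a Euclidean
  ball about the origin, and the product measure is translation invariant.\<close>

lemma em_onb_lborel_cball:
 fixes B :: "'a::euclidean_space set"
 assumes B: "pairwise orthogonal B" "!!b. b : B ==> norm b = 1" and v: "v : span B" and r: "0 < r"
 shows "em (onb_lborel B) (cball v r) = enn (unit_ball_vol (real (card B)) * r ^ card B)"
proof -
 have fin: "finite B" using B by (rule orthonormal_finite)
 obtain w where w: "v = (\<Sum>b\<in>B. w b *R b)" using v fin by (auto simp: span_finite)
 let ?S = "%c::'a => real. \<Sum>b\<in>B. c b *R b" and ?P = "\<Pi>\<^sub>M b\<in>B. (lborel :: real measure)"
 let ?T = "%c. \<lambda>b\<in>B. w b + c b"
 have T[measurable]: "?T : ?P \<rightarrow>\<^sub>M ?P" by measurable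
 have "em (onb_lborel B) (cball v r) = em ?P (?S -` cball v r Int space ?P)" unfolding onb_lborel_def using fin by (intro emeasure_distr) auto
 also have "... = em (distr ?P ?P ?T) (?S -` cball v r Int space ?P)" using fin by (simp add: PiM_lborel_translate)
 also have "... = em ?P (?T -` (?S -` cball v r Int space ?P) Int space ?P)" using fin by (intro emeasure_distr T measurable_sets[OF meas_onb_map]) auto
 also have "?T -` (?S -` cball v r Int space ?P) Int space ?P = {f. sqrt (\<Sum>i\<in>B. (f i)^2) <= r} Int space ?P"
 proof -
  have "?S (?T f) = v + ?S f" for f unfolding w sum.distrib[symmetric] by (intro sum.cong) (auto simp: scaleR_add_left)
  then have "dist v (?S (?T f)) = sqrt (\<Sum>i\<in>B. (f i)^2)" for f using norm_orthonormal_sum[OF B] by (simp add: dist_norm)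
  moreover have "?T f : space ?P" if "f : space ?P" for f using measurable_space[OF T that] .
  ultimately show ?thesis by auto
 qed
 also have "em ?P ... = enn (unit_ball_vol (real (card B)) * r ^ card B)" using fin r by (rule emeasure_cball_aux)
 finally show ?thesis .
qed

lemma AE_onb_lborel: 
 fixes B :: "'a::euclidean_space set"
 assumes "finite B" shows "AE x in onb_lborel B. x : span B"
proof -
 have "{x : space borel. x : span B} : sets borel" using closed_subspace[OF subspace_span, of B] by simp
 then show ?thesis unfolding onb_lborel_def using assms by (subst AE_distr_iff[OF meas_onb_map]) (auto intro!: AE_I2 span_sum span_scale intro: span_base)
qed

lemma sf_cball:
 fixes M :: "'a::euclidean_space measure"
 assumes "sets M = sets borel" "!!r. 0 < r ==> em M (cball 0 r) < \<infinity>"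
 shows "sfin M"
proof
 have "x : \<Union>(range (%n::nat. cball (0::'a) (real n + 1)))" for x :: 'a
 proof -
  obtain n where "norm x < real n" using reals_Archimedean2 by blast
  then have "x : cball 0 (real n + 1)" by simp
  then show ?thesis by blast
 qed
 then have U: "\<Union>(range (%n::nat. cball (0::'a) (real n + 1))) = UNIV" by blast
 have sp: "space M = UNIV" using sets_eq_imp_space_eq[OF assms(1)] by simp
 show "EX A. countable A & A \<subseteq> sets M & \<Union>A = space M & (ALL a:A. em M a ~= \<infinity>)"
 proof (intro exI[of _ "range (%n::nat. cball (0::'a) (real n + 1))"] conjI ballI)
  fix a assume "a : range (%n::nat. cball (0::'a) (real n + 1))"
  then obtain n where "a = cball (0::'a) (real n + 1)" by blast
  then show "em M a ~= \<infinity>" using assms(2)[of "real n + 1"] by simp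
 qed (use U sp assms(1) in auto)
qed

text \<open>Ball masses that do not depend on the centre make both measures uniformly distributed on
  \<open>V\<close>, hence proportional on open sets; the open unit ball then fixes the
  factor.\<close>

lemma measure_eqI_cball:
 fixes M N :: "'a::euclidean_space measure" and c :: "real => ennreal"
 assumes sets: "sets M = sets borel" "sets N = sets borel"
  and AE: "AE x in M. x : V" "AE x in N. x : V" and V: "subspace V"
  and M: "!!v r. v : V ==> 0 < r ==> em M (cball v r) = c r"
  and N: "!!v r. v : V ==> 0 < r ==> em N (cball v r) = c r"
  and c: "!!r. 0 < r ==> 0 < c r" "!!r. 0 < r ==> c r < \<infinity>"
 shows "M = N"
proof -
 have [measurable_cong]: "sets M = sets borel" "sets N = sets borel" by fact+
 have sp: "space M = UNIV" "space N = UNIV" using sets[THEN sets_eq_imp_space_eq] by auto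
 have 0: "0 : V" using V by (rule subspace_0)
 have prp: "em M U * em N W = em N U * em M W" if "open U" "open W" for U W
 proof (rule uniform_measures_proportional[where B="%n x y. dist x y <= inverse (real (Suc n))" and S=V
    and c="%n. c (inverse (real (Suc n)))" and d="%n. c (inverse (real (Suc n)))"])
  show "sfin M" "sfin N" using M N 0 c by (auto intro!: sf_cball sets)
  have "Measurable.pred (borel xx borel) (%(x::'a, y). dist x y <= inverse (real (Suc n)))" for n by measurable
  then show "Measurable.pred (M xx M) (%(x, y). dist x y <= inverse (real (Suc n)))" for n using measurable_cong_sets[OF sets_pair_measure_cong[OF sets(1) sets(1)] refl] by blast
  have *: "\<forall>\<^sub>F n in sequentially. ALL y. dist x y <= inverse (real (Suc n)) --> y : U" if "open U" "x : U" for U and x :: 'a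
  proof -
   obtain e where e: "e > 0" "cball x e \<subseteq> U" using \<open>open U\<close> \<open>x : U\<close> open_contains_cball by blast
   have "\<forall>\<^sub>F n in sequentially. inverse (real (Suc n)) < e" using LIMSEQ_inverse_real_of_nat e(1) by (rule order_tendstoD)
   then show ?thesis by eventually_elim (use e(2) in auto)
  qed
  show "\<forall>\<^sub>F n in sequentially. ALL y:space M. dist x y <= inverse (real (Suc n)) --> y : U" if "x : U Int V" for x using *[OF \<open>open U\<close>, of x] that unfolding sp by simp
  show "\<forall>\<^sub>F n in sequentially. ALL y:space M. dist x y <= inverse (real (Suc n)) --> y : W" if "x : W Int V" for x using *[OF \<open>open W\<close>, of x] that unfolding sp by simp
  show "em M {y : space M. dist x y <= inverse (real (Suc n))} = c (inverse (real (Suc n)))"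
    "em N {y : space M. dist x y <= inverse (real (Suc n))} = c (inverse (real (Suc n)))" if "x : V" for n x using M[OF that, of "inverse (real (Suc n))"] N[OF that, of "inverse (real (Suc n))"] by (auto simp: sp cball_def)
 qed (use AE c that sets in \<open>auto simp: dist_commute\<close>)
 \<comment> \<open>Equal masses are known for closed balls only; those of radius 1 - 1/(n+2), which
   is positive for every n, exhaust the open unit ball.\<close>
 have inc: "incseq (%n. cball (0::'a) (1 - inverse (real (Suc (Suc n)))))" by (intro incseq_SucI subset_cball diff_left_mono) (simp add: field_simps)
 have "em M (cball 0 (1 - inverse (real (Suc (Suc n))))) = em N (cball 0 (1 - inverse (real (Suc (Suc n)))))" for n using M[OF 0, of "1 - inverse (real (Suc (Suc n)))"] N[OF 0, of "1 - inverse (real (Suc (Suc n)))"] by (simp add: field_simps)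
 moreover have "(\<Union>n. cball 0 (1 - inverse (real (Suc (Suc n))))) : sets borel" by auto
 ultimately have "em M (\<Union>n. cball 0 (1 - inverse (real (Suc (Suc n))))) = em N (\<Union>n. cball 0 (1 - inverse (real (Suc (Suc n)))))" using SUP_emeasure_incseq[OF _ inc, of M] SUP_emeasure_incseq[OF _ inc, of N] by (simp add: sets image_subset_iff)
 moreover have "(\<Union>n. cball (0::'a) (1 - inverse (real (Suc (Suc n))))) = ball 0 1"
 proof safe
  fix x :: 'a assume "x : ball 0 1"
  then have "0 < 1 - norm x" by simp
  then obtain n where "inverse (real (Suc n)) < 1 - norm x" using reals_Archimedean by blast
  moreover have "inverse (real (Suc (Suc n))) <= inverse (real (Suc n))" by (simp add: field_simps)
  ultimately have "x : cball 0 (1 - inverse (real (Suc (Suc n))))" unfolding mem_cball_0 by linarith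
  then show "x : (\<Union>n. cball 0 (1 - inverse (real (Suc (Suc n)))))" by blast
 next
  fix x :: 'a and n assume "x : cball 0 (1 - inverse (real (Suc (Suc n))))"
  moreover have "0 < inverse (real (Suc (Suc n)))" by simp
  ultimately show "x : ball 0 1" unfolding mem_cball_0 mem_ball_0 by linarith
 qed
 ultimately have ball: "em M (ball 0 1) = em N (ball 0 1)" by simp
 have b0: "em M (ball 0 1) ~= 0"
 proof -
  have "c (1/2) <= em M (ball 0 1)" using emeasure_mono[of "cball 0 (1/2)" "ball 0 1" M] M[OF 0, of "1/2"] by (auto simp: sets cball_subset_ball_iff)
  then show ?thesis using c(1)[of "1/2"] by auto
 qed
 have b1: "em M (ball 0 1) ~= \<infinity>"
 proof -
  have "em M (ball 0 1) <= em M (cball 0 1)" by (intro emeasure_mono) (auto simp: sets)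
  then show ?thesis using M[OF 0, of 1] c(2)[of 1] by (auto simp: top_unique)
 qed
 have sb: "sets borel = sigma_sets UNIV {U :: 'a set. open U}" unfolding borel_def by (rule sets_measure_of) simp
 show "M = N"
 proof (rule measure_eqI_generator_eq[where E="{U. open U}" and \<Omega>=UNIV and A="%n. ball 0 (real n)"])
  show "em M U = em N U" if "U : {U. open U}" for U
  proof -
   have "open U" using that by simp
   then have "em M U * em N (ball 0 1) = em N U * em N (ball 0 1)" using prp[of U "ball 0 1"] ball by (simp only: open_ball)
   then have "em N (ball 0 1) * em M U = em N (ball 0 1) * em N U" by (simp only: mult.commute)
   moreover have "em N (ball 0 1) ~= 0" "em N (ball 0 1) ~= \<top>" using b0 b1 ball by auto
   ultimately show ?thesis by (meson ennreal_mult_cancel_left)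
  qed
  show "(\<Union>i. ball (0::'a) (real i)) = UNIV" by (simp add: set_eq_iff reals_Archimedean2)
  fix i
  have "em M (ball 0 (real i)) <= em M (cball 0 (real i + 1))" by (intro emeasure_mono) (auto simp: sets)
  also have "... < \<infinity>" using M[OF 0, of "real i + 1"] c(2)[of "real i + 1"] by simp
  finally show "em M (ball 0 (real i)) ~= \<infinity>" by simp
 qed (simp_all only: sets sb, simp_all add: Int_stable_def open_Int image_subset_iff)
qed

lemma leb_onb: "leb X = onb_lborel (orthonormal_basis X)" by (simp add: subspace_lborel_def onb_lborel_def)

lemma sets_leb[simp, measurable_cong]: "sets (leb X) = sets borel"
 and space_subspace_lborel[simp]: "space (leb X) = UNIV" by (auto simp: leb_onb)

lemma em_leb_cball:
 fixes V :: "'a::euclidean_space set"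
 assumes "subspace V" "v : V" "0 < r"
 shows "em (leb V) (cball v r) = enn (unit_ball_vol (real (dim V)) * r ^ dim V)"
proof -
 note B = orthonormal_basis_props[OF assms(1)]
 have "card (orthonormal_basis V) = dim V" using orthonormal_card[OF B(2,3)] B(4) by simp
 then show ?thesis unfolding leb_onb using em_onb_lborel_cball[OF B(2,3), of v r] assms B(4) by simp
qed

lemma AE_leb:
 fixes V :: "'a::euclidean_space set"
 assumes "subspace V" shows "AE x in leb V. x : V" using AE_onb_lborel[OF orthonormal_finite[OF orthonormal_basis_props(2,3)[OF assms]]] unfolding leb_onb[symmetric] orthonormal_basis_props(4)[OF assms] .

lemma sf_leb:
 fixes V :: "'a::euclidean_space set"
 assumes "subspace V" shows "sfin (leb V)" using em_leb_cball[OF assms subspace_0[OF assms]] by (intro sf_cball) auto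

text \<open>The working tool for subspaces: isometries, scaling and independence of the basis all
  reduce to the volumes of balls centred in \<open>V\<close>.\<close>

lemma leb_eqI:
 fixes V :: "'a::euclidean_space set"
 assumes "subspace V" "sets M = sets borel" "AE x in M. x : V"
  and "!!v r. v : V ==> 0 < r ==> em M (cball v r) = enn (unit_ball_vol (real (dim V)) * r ^ dim V)"
 shows "M = leb V" using assms AE_leb[OF assms(1)] em_leb_cball[OF assms(1)] by (intro measure_eqI_cball[where V=V and c="%r. enn (unit_ball_vol (real (dim V)) * r ^ dim V)"]) auto

lemma onb_lborel_eq:
 fixes B :: "'a::euclidean_space set"
 assumes "pairwise orthogonal B" "!!b. b : B ==> norm b = 1"
 shows "onb_lborel B = leb (span B)" using AE_onb_lborel[OF orthonormal_finite[OF assms]] em_onb_lborel_cball[OF assms]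
  orthonormal_card[OF assms] by (intro leb_eqI) auto

lemma leb_UNIV: "leb UNIV = (lborel :: 'a::euclidean_space measure)"
proof (rule leb_eqI[symmetric])
 show "em lborel (cball v r) = enn (unit_ball_vol (real (dim (UNIV :: 'a set))) * r ^ dim (UNIV :: 'a set))"
  if "0 < r" for v :: 'a and r using emeasure_cball[of r v] that by simp
qed auto

lemma leb_isometry:
 fixes V :: "'a::euclidean_space set" and T :: "'a => 'c::euclidean_space"
 assumes V: "subspace V" and T: "linear T" "!!x. x : V ==> norm (T x) = norm x"
 shows "leb (T ` V) = distr (leb V) borel T"
proof (rule leb_eqI[symmetric])
 have [measurable]: "T : bmeas borel" using T(1) by (intro borel_measurable_continuous_onI linear_continuous_on linear_conv_bounded_linear[THEN iffD1])
 have dist: "dist (T x) (T y) = dist x y" if "x : V" "y : V" for x y using T(2)[of "x - y"] that V T(1) by (simp add: dist_norm linear_diff subspace_diff)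
 have inj: "inj_on T V" using dist by (intro inj_onI) (metis dist_eq_0_iff)
 then have dim: "dim (T ` V) = dim V" using V T(1) by (intro dim_image_eq) (auto simp: span_eq_iff[THEN iffD2])
 show sub: "subspace (T ` V)" using V T(1) by (rule linear_subspace_image[rotated])
 then have "T ` V : sets borel" by (simp add: closed_subspace)
 then have "{x : space borel. x : T ` V} : sets borel" by simp
 then show "AE x in distr (leb V) borel T. x : T ` V" using AE_leb[OF V] by (subst AE_distr_iff) auto
 show "em (distr (leb V) borel T) (cball v r)
   = enn (unit_ball_vol (real (dim (T ` V))) * r ^ dim (T ` V))" if v: "v : T ` V" and "0 < r" for v r
 proof -
  obtain w where w: "w : V" "v = T w" using v by blast
  have "em (distr (leb V) borel T) (cball v r) = em (leb V) (T -` cball v r)" by (subst emeasure_distr) auto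
  also have "... = em (leb V) (cball w r)"
  proof (rule emeasure_eq_AE)
   show "AE x in leb V. (x : T -` cball v r) = (x : cball w r)" using AE_leb[OF V] by eventually_elim (simp add: w dist)
   show "T -` cball v r : sets (leb V)" using measurable_sets[of T borel borel "cball v r"] by simp
  qed auto
  finally show ?thesis using em_leb_cball[OF V w(1) \<open>0 < r\<close>] dim by simp
 qed
qed auto

lemma AE_scale_measure:
 assumes "AE x in M. P x" shows "AE x in scale_measure r M. P x"
proof -
 obtain N where "N : null_sets M" "{x : space M. ~ P x} \<subseteq> N" using assms by (auto simp: eventually_ae_filter)
 then have "N : null_sets (scale_measure r M)" "{x : space (scale_measure r M). ~ P x} \<subseteq> N" by (auto simp: null_sets_def space_scale_measure)
 then show ?thesis by (auto simp: eventually_ae_filter)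
qed

text \<open>Scaling maps balls centred in \<open>V\<close> to such balls, so \<open>leb_eqI\<close>
  applies. The factor \<open>s\<close> may be negative; \<open>s = -1\<close> later supplies the
  symmetry of Lebesgue measure on a subspace.\<close>

lemma nni_leb_scale:
 fixes V :: "'a::euclidean_space set"
 assumes V: "subspace V" and s: "s ~= 0" and [measurable]: "g : bmeas borel"
 shows "(II x. g x dd leb V) = enn (\<bar>s\<bar> ^ dim V) * (II x. g (s *R x) dd leb V)"
proof -
 have "leb V = scale_measure (enn (\<bar>s\<bar> ^ dim V)) (distr (leb V) borel (scaleR s))"
 proof (rule leb_eqI[OF V, symmetric])
  have "AE x in leb V. s *R x : V" using AE_leb[OF V] by eventually_elim (rule subspace_scale[OF V])
  then have "AE x in distr (leb V) borel (scaleR s). x : V" by (subst AE_distr_iff) (auto simp: closed_subspace[OF V])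
  then show "AE x in scale_measure (enn (\<bar>s\<bar> ^ dim V)) (distr (leb V) borel (scaleR s)). x : V" by (rule AE_scale_measure)
  fix w and r :: real assume w: "w : V" "0 < r"
  have "scaleR s -` cball w r = cball (w /\<^sub>R s) (r / \<bar>s\<bar>)"
  proof -
   have "dist w (s *R x) = \<bar>s\<bar> * dist (w /\<^sub>R s) x" for x
   proof -
    have "w - s *R x = s *R (w /\<^sub>R s - x)" using s by (simp add: scaleR_diff_right)
    then show ?thesis by (metis dist_norm norm_scaleR)
   qed
   then show ?thesis using s by (auto simp: field_simps)
  qed
  then have "em (distr (leb V) borel (scaleR s)) (cball w r)
    = em (leb V) (cball (w /\<^sub>R s) (r / \<bar>s\<bar>))" by (subst emeasure_distr) auto
  also have "... = enn (unit_ball_vol (real (dim V)) * (r / \<bar>s\<bar>) ^ dim V)" using w s by (intro em_leb_cball V subspace_scale) auto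
  finally show "em (scale_measure (enn (\<bar>s\<bar> ^ dim V)) (distr (leb V) borel (scaleR s))) (cball w r)
   = enn (unit_ball_vol (real (dim V)) * r ^ dim V)" using s w by (simp add: ennreal_mult'[symmetric] power_divide field_simps)
 qed auto
 then have "(II x. g x dd leb V) = (II x. g x dd (scale_measure (enn (\<bar>s\<bar> ^ dim V)) (distr (leb V) borel (scaleR s))))" by simp
 also have "... = enn (\<bar>s\<bar> ^ dim V) * (II x. g (s *R x) dd leb V)" by (subst nn_integral_scale_measure) (auto simp: nn_integral_distr)
 finally show ?thesis .
qed

text \<open>Orthonormal bases of \<open>V\<close> and of its complement in \<open>X\<close> together
  form one of \<open>X\<close>, and by \<open>onb_lborel_eq\<close> this basis is as good as the
  chosen one. A product over a disjoint union of index sets is a product of two.\<close>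

lemma leb_decomp:
 fixes X V :: "'a::euclidean_space set"
 assumes X: "subspace X" and V: "subspace V" "V \<subseteq> X"
 shows "leb X = distr (leb V xx leb (X Int V^o)) borel (%(x, y). x + y)"
proof -
 define W where "W = X Int V^o"
 have W: "subspace W" unfolding W_def using X by (rule subspace_Int_comp)
 define B where "B = orthonormal_basis V"
 define C where "C = orthonormal_basis W"
 note B = orthonormal_basis_props[OF V(1), folded B_def]
 note C = orthonormal_basis_props[OF W, folded C_def]
 have BC: "orthogonal b c" if "b : B" "c : C" for b c using that B(1) C(1) by (auto simp: W_def orthogonal_comp_def)
 have po: "pairwise orthogonal (B \<union> C)" unfolding pairwise_def
 proof (intro ballI impI)
  fix x y assume "x : B \<union> C" "y : B \<union> C" "x ~= y"
  then show "orthogonal x y" using B(2) C(2) BC[of x y] BC[of y x] by (auto simp: pairwise_def orthogonal_commute[of x y])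
 qed
 have n1: "norm b = 1" if "b : B \<union> C" for b using that B(3) C(3) by auto
 have fin: "finite B" "finite C" using orthonormal_finite B C by auto
 have disj: "B Int C = {}"
 proof -
  have False if "b : B" "b : C" for b using BC[OF that] B(3)[OF that(1)] by (auto simp: orthogonal_self)
  then show ?thesis by blast
 qed
 have sp: "span (B \<union> C) = X"
 proof
  show "span (B \<union> C) \<subseteq> X" using B(1) C(1) V(2) X by (intro span_minimal) (auto simp: W_def)
  show "X \<subseteq> span (B \<union> C)"
  proof
   fix x assume x: "x : X"
   have 1: "proj V x : V" using V(1) by (rule closest_point_in_subspace)
   have "x - proj V x : W" using x 1 V X closest_point_orthogonal[OF V(1), of x] by (auto simp: W_def intro: subspace_diff)
   then have "proj V x : span (B \<union> C)" "x - proj V x : span (B \<union> C)" using 1 B(4) C(4) span_mono[of B "B \<union> C"] span_mono[of C "B \<union> C"] by auto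
   then show "x : span (B \<union> C)" using span_add[of "proj V x" "B \<union> C" "x - proj V x"] by simp
  qed
 qed
 interpret product_sigma_finite "%_::'a. lborel :: real measure" by standard
 interpret sB: finite_product_sigma_finite "%_::'a. lborel :: real measure" B by standard (rule fin)
 interpret sC: finite_product_sigma_finite "%_::'a. lborel :: real measure" C by standard (rule fin)
 have sB: "sfin (\<Pi>\<^sub>M b\<in>B. lborel :: real measure)" by (rule sigma_finite) (rule fin)
 have sC: "sfin (\<Pi>\<^sub>M b\<in>C. lborel :: real measure)" by (rule sigma_finite) (rule fin)
 let ?S = "%D (c::'a => real). \<Sum>b\<in>D. c b *R b"
 have [measurable]: "?S B : bmeas (\<Pi>\<^sub>M b\<in>B. lborel)" "?S C : bmeas (\<Pi>\<^sub>M b\<in>C. lborel)"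
  "?S (B \<union> C) : bmeas (\<Pi>\<^sub>M b\<in>B \<union> C. lborel)" using fin by auto
 have "leb X = onb_lborel (B \<union> C)" using onb_lborel_eq[OF po n1] sp by simp
 also have "... = distr (distr ((\<Pi>\<^sub>M b\<in>B. lborel) xx (\<Pi>\<^sub>M b\<in>C. lborel)) (\<Pi>\<^sub>M b\<in>B \<union> C. lborel) (merge B C)) borel (?S (B \<union> C))" unfolding onb_lborel_def distr_merge[OF disj fin] ..
 also have "... = distr ((\<Pi>\<^sub>M b\<in>B. lborel) xx (\<Pi>\<^sub>M b\<in>C. lborel)) borel (?S (B \<union> C) \<circ> merge B C)" by (intro distr_distr) auto
 also have "... = distr ((\<Pi>\<^sub>M b\<in>B. lborel) xx (\<Pi>\<^sub>M b\<in>C. lborel)) borel ((%(x, y). x + y) \<circ> (%(c, d). (?S B c, ?S C d)))"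
 proof (rule distr_cong)
  fix z :: "('a => real) \<times> ('a => real)"
  have "?S B (merge B C (c, d)) = ?S B c" "?S C (merge B C (c, d)) = ?S C d" for c d using disj by (auto intro!: sum.cong simp: merge_def)
  then show "(?S (B \<union> C) \<circ> merge B C) z = ((%(x, y). x + y) \<circ> (%(c, d). (?S B c, ?S C d))) z" using disj fin by (cases z) (simp add: sum.union_disjoint)
 qed auto
 also have "... = distr (distr ((\<Pi>\<^sub>M b\<in>B. lborel) xx (\<Pi>\<^sub>M b\<in>C. lborel)) (borel xx borel) (%(c, d). (?S B c, ?S C d))) borel (%(x, y). x + y)" by (intro distr_distr[symmetric]) measurable
 also have "distr ((\<Pi>\<^sub>M b\<in>B. lborel) xx (\<Pi>\<^sub>M b\<in>C. lborel)) (borel xx borel) (%(c, d). (?S B c, ?S C d))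
  = distr (\<Pi>\<^sub>M b\<in>B. lborel) borel (?S B) xx distr (\<Pi>\<^sub>M b\<in>C. lborel) borel (?S C)"
 proof (rule pair_measure_distr[symmetric])
  show "sfin (distr (\<Pi>\<^sub>M b\<in>C. lborel) borel (?S C))" using sf_leb[OF W] by (simp add: subspace_lborel_def C_def)
 qed auto
 finally show ?thesis by (simp add: subspace_lborel_def B_def C_def W_def)
qed

lemma nni_leb_decomp:
 fixes X V :: "'a::euclidean_space set"
 assumes X: "subspace X" and V: "subspace V" "V \<subseteq> X" and [measurable]: "g : bmeas borel"
 shows "(II x. g x dd leb X)
  = (II x. II y. g (x + y) dd leb (X Int V^o) dd leb V)"
proof -
 interpret sigma_finite_measure "leb (X Int V^o)" by (intro sf_leb subspace_Int_comp X)
 show ?thesis unfolding leb_decomp[OF X V] by (subst nn_integral_distr) (auto simp: nn_integral_fst[symmetric] case_prod_beta)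
qed

text \<open>The next formula presents the Lebesgue measures of all subspaces of a given dimension through
 the single measure \<^term>\<open>lborel\<close>; this is what makes them depend measurably on the subspace.\<close>

definition complement_weight :: "nat => 'a::euclidean_space => ennreal" where
 "complement_weight m z = ind (cball 0 1) z / enn (unit_ball_vol (real m))"

lemma bm_complement_weight[measurable]: "complement_weight m : bmeas borel" unfolding complement_weight_def by (intro borel_measurable_divide_ennreal borel_measurable_indicator) auto

lemma nni_complement_weight:
 fixes V :: "'a::euclidean_space set"
 assumes "subspace V" "dim V = m"
 shows "(II z. complement_weight m z dd leb V) = 1"
proof -
 have "(II z. complement_weight m z dd leb V)
  = enn (unit_ball_vol (real m)) / enn (unit_ball_vol (real m))" unfolding complement_weight_def using em_leb_cball[OF assms(1) subspace_0[OF assms(1)], of 1] assms by (subst nn_integral_divide) (auto intro!: borel_measurable_indicator)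
 moreover have "unit_ball_vol (real m) > 0" by simp
 ultimately show ?thesis by (simp add: ennreal_divide_self ennreal_eq_0_iff not_le)
qed

text \<open>The weight has total mass 1 on the complement of \<open>V\<close> in \<open>X\<close>,
  so the added directions integrate out. On the right \<open>V\<close> enters only through
  \<open>proj V\<close> and its dimension.\<close>

lemma nni_leb_eq:
 fixes X V :: "'a::euclidean_space set"
 assumes X: "subspace X" and V: "subspace V" "V \<subseteq> X" and [measurable]: "g : bmeas borel"
 shows "(II x. g x dd leb V)
  = (II x. g (proj V x) * complement_weight (dim X - dim V) (x - proj V x) dd leb X)"
proof -
 let ?W = "X Int V^o"
 have W: "subspace ?W" using X by (rule subspace_Int_comp)
 have dW: "dim ?W = dim X - dim V" using dim_Int_comp[OF X V] by simp
 note [measurable] = bm_proj[OF V(1)]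
 have "(II x. g (proj V x) * complement_weight (dim X - dim V) (x - proj V x) dd leb X)
  = (II x. II y. g (proj V (x + y)) * complement_weight (dim X - dim V) (x + y - proj V (x + y)) dd leb ?W dd leb V)" by (rule nni_leb_decomp[OF X V]) measurable
 also have "... = (II x. II y. g x * complement_weight (dim X - dim V) y dd leb ?W dd leb V)"
 proof (rule nn_integral_cong_AE, use AE_leb[OF V(1)] in eventually_elim)
  fix x assume x: "x : V"
  show "(II y. g (proj V (x + y)) * complement_weight (dim X - dim V) (x + y - proj V (x + y)) dd leb ?W)
   = (II y. g x * complement_weight (dim X - dim V) y dd leb ?W)"
  proof (rule nn_integral_cong_AE, use AE_leb[OF W] in eventually_elim)
   fix y assume y: "y : ?W"
   have "proj V (x + y) = x" using x y by (intro proj_subspaceI V) auto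
   then show "g (proj V (x + y)) * complement_weight (dim X - dim V) (x + y - proj V (x + y))
    = g x * complement_weight (dim X - dim V) y" by simp
  qed
 qed
 also have "... = (II x. g x dd leb V)" by (subst nn_integral_cmult) (auto simp: nni_complement_weight[OF W dW])
 finally show ?thesis by simp
qed

section \<open>Sphere measures\<close>

text \<open>If these balls were null, the countably many open balls that cover \<open>S\<close> by
  Lindelof's theorem would form a null set of full measure.\<close>

lemma em_homogeneous_pos:
 fixes M :: "'c::{second_countable_topology, metric_space} measure"
 assumes "sets M = sets borel" "AE x in M. x : S" "em M (space M) ~= 0" "0 < r"
  and "!!x. x : S ==> em M (cball x r) = c"
 shows "0 < c"
proof (rule ccontr)
 assume "~ 0 < c"
 then have c: "c = 0" by simp
 obtain F where F: "F \<subseteq> (%x. ball x r) ` S" "countable F" "\<Union>F = \<Union>((%x. ball x r) ` S)" using Lindelof[of "(%x. ball x r) ` S"] by auto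
 have "U : null_sets M" if U: "U : F" for U
 proof -
  obtain x where x: "x : S" "U = ball x r" using F(1) U by auto
  have "em M U <= em M (cball x r)" unfolding x by (intro emeasure_mono) (auto simp: assms(1))
  then show ?thesis using assms(5)[OF x(1)] c x by (auto simp: null_sets_def assms(1))
 qed
 then have "\<Union>F \<in> null_sets M" using null_sets_UN'[OF F(2), of "%x. x" M] by simp
 then have "AE x in M. x ~: \<Union>F" by (rule AE_not_in)
 then have "AE x in M. False" using assms(2)
 proof eventually_elim
  fix x assume "x ~: \<Union>F" "x : S"
  then show False using F(3) \<open>0 < r\<close> by auto
 qed
 then show False using assms(3) by (simp add: AE_iff_null null_sets_def)
qed

text \<open>The whole space serves as the reference set in the proportionality theorem, so the ball
  masses may stay uncomputed as long as they agree along one sequence of radii.\<close>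

lemma prob_eqI_homogeneous:
 fixes M N :: "'c::{second_countable_topology, metric_space} measure"
 assumes prob: "prob_space M" "prob_space N" and sets: "sets M = sets borel" "sets N = sets borel"
  and AE: "AE x in M. x : S" "AE x in N. x : S"
  and M: "!!x y n. x : S ==> y : S ==> em M (cball x (inverse (real (Suc n)))) = em M (cball y (inverse (real (Suc n))))"
  and N: "!!x y n. x : S ==> y : S ==> em N (cball x (inverse (real (Suc n)))) = em N (cball y (inverse (real (Suc n))))"
 shows "M = N"
proof -
 interpret M: prob_space M by fact
 interpret N: prob_space N by fact
 have sp: "space M = UNIV" "space N = UNIV" using sets[THEN sets_eq_imp_space_eq] by auto
 obtain a where a: "a : S"
 proof (rule ccontr)
  assume *: "~ thesis"
  from that * have "S = {}" by blast
  then have "AE x in M. False" using AE(1) by simp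
  then show False by simp
 qed
 define e where "e n = inverse (real (Suc n))" for n
 have e0: "0 < e n" for n by (simp add: e_def)
 have 1: "em M U = em N U" if "open U" for U
 proof -
  have "em M U * em N UNIV = em N U * em M UNIV"
  proof (rule uniform_measures_proportional[where B="%n x y. dist x y <= e n" and S=S
    and c="%n. em M (cball a (e n))" and d="%n. em N (cball a (e n))"])
   have "Measurable.pred (borel xx borel) (%(x::'c, y). dist x y <= e n)" for n by measurable
   then show "Measurable.pred (M xx M) (%(x, y). dist x y <= e n)" for n using measurable_cong_sets[OF sets_pair_measure_cong[OF sets(1) sets(1)] refl] by blast
   show "\<forall>\<^sub>F n in sequentially. ALL y:space M. dist x y <= e n --> y : U" if "x : U Int S" for x
   proof -
    have "x : U" using that by simp
    then obtain s where s: "s > 0" "cball x s \<subseteq> U" using \<open>open U\<close> open_contains_cball[of U] by blast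
    have "\<forall>\<^sub>F n in sequentially. e n < s" unfolding e_def using LIMSEQ_inverse_real_of_nat s(1) by (rule order_tendstoD)
    then show ?thesis by eventually_elim (use s(2) in auto)
   qed
   show "em M {y : space M. dist x y <= e n} = em M (cball a (e n))" if "x : S" for n x using M[OF that a, of n, folded e_def] by (simp add: sp cball_def)
   show "em N {y : space M. dist x y <= e n} = em N (cball a (e n))" if "x : S" for n x using N[OF that a, of n, folded e_def] by (simp add: sp cball_def)
   show "0 < em M (cball a (e n))" for n by (rule em_homogeneous_pos[where M=M and S=S and r="e n", OF sets(1) AE(1) _ e0])
     (simp add: M.emeasure_space_1, rule M[OF _ a, folded e_def])
   show "0 < em N (cball a (e n))" for n by (rule em_homogeneous_pos[where M=N and S=S and r="e n", OF sets(2) AE(2) _ e0])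
     (simp add: N.emeasure_space_1, rule N[OF _ a, folded e_def])
  qed (use AE sets that in \<open>auto simp: dist_commute M.emeasure_eq_measure N.emeasure_eq_measure
     M.sigma_finite_measure_axioms N.sigma_finite_measure_axioms\<close>)
  then show ?thesis using M.emeasure_space_1 N.emeasure_space_1 by (simp add: sp)
 qed
 have sb: "sets borel = sigma_sets UNIV {U :: 'c set. open U}" unfolding borel_def by (rule sets_measure_of) simp
 show "M = N" by (rule measure_eqI_generator_eq[where E="{U. open U}" and \<Omega>=UNIV and A="%n. UNIV"])
   (use 1 in \<open>auto simp: sets[unfolded sb] Int_stable_def open_Int M.emeasure_eq_measure\<close>)
qed

lemma ball_in_borel[measurable]: "ball x r : sets borel" "cball x r : sets borel" for x :: "'c::metric_space" by auto

text \<open>Left uncompleted, so that images, products and Tonelli stay within Borel measures; the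
  completion returns where the definitions of the statement are met.\<close>

definition sph :: "'a::euclidean_space set => 'a measure" where
 "sph X = distr (uniform_measure (leb X) (ball 0 1)) borel sgn"

lemma sphere_measure_eq: "sphere_measure X = completion (sph X)" by (simp add: sphere_measure_def sph_def)

lemma sets_sph[simp, measurable_cong]: "sets (sph X) = sets borel"
 and space_sphere_borel[simp]: "space (sph X) = UNIV" by (auto simp: sph_def)

lemma bm_sgn_euclidean[measurable]: "(sgn :: 'a::euclidean_space => 'a) : bmeas borel" unfolding sgn_div_norm[abs_def] by measurable

text \<open>Volumes are known for closed balls, while \<open>sph\<close> is built on the open ball;
  closed balls of radius tending to 1 bridge the two.\<close>

lemma em_leb_ball:
 fixes V :: "'a::euclidean_space set"
 assumes V: "subspace V"
 shows "em (leb V) (ball 0 1) = enn (unit_ball_vol (real (dim V)))"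
proof (rule antisym)
 have "em (leb V) (ball 0 1) <= em (leb V) (cball 0 1)" by (intro emeasure_mono) auto
 then show "em (leb V) (ball 0 1) <= enn (unit_ball_vol (real (dim V)))" using em_leb_cball[OF V subspace_0[OF V], of 1] by simp
 define r where "r n = 1 - inverse (real (Suc (Suc n)))" for n
 have r: "0 < r n" "r n < 1" for n by (auto simp: r_def field_simps)
 have "(%n. inverse (real (Suc (Suc n)))) ---> 0" using LIMSEQ_inverse_real_of_nat by (rule LIMSEQ_Suc)
 then have "r ---> 1 - 0" unfolding r_def by (intro tendsto_diff tendsto_const)
 then have "(%n. enn (unit_ball_vol (real (dim V)) * r n ^ dim V)) ---> enn (unit_ball_vol (real (dim V)) * (1 - 0) ^ dim V)" by (intro tendsto_ennrealI tendsto_mult tendsto_const tendsto_power)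
 then have lim: "(%n. enn (unit_ball_vol (real (dim V)) * r n ^ dim V)) ---> enn (unit_ball_vol (real (dim V)))" by simp
 have le: "enn (unit_ball_vol (real (dim V)) * r n ^ dim V) <= em (leb V) (ball 0 1)" for n unfolding em_leb_cball[OF V subspace_0[OF V] r(1), symmetric] using r(2)[of n] by (intro emeasure_mono) auto
 show "enn (unit_ball_vol (real (dim V))) <= em (leb V) (ball 0 1)" by (rule tendsto_upperbound[OF lim]) (use le in auto)
qed

lemma nni_sph:
 fixes V :: "'a::euclidean_space set"
 assumes V: "subspace V" and [measurable]: "g : bmeas borel"
 shows "(II x. g x dd sph V)
  = (II x. g (sgn x) * ind (ball 0 1) x dd leb V) / enn (unit_ball_vol (real (dim V)))"
proof -
 have "(II x. g x dd sph V) = (II x. g (sgn x) dd uniform_measure (leb V) (ball 0 1))" unfolding sph_def by (subst nn_integral_distr) auto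
 also have "... = (II x. g (sgn x) * ind (ball 0 1) x dd leb V) / em (leb V) (ball 0 1)" by (rule nn_integral_uniform_measure) auto
 finally show ?thesis by (simp add: em_leb_ball[OF V])
qed

lemma prob_sph:
 fixes V :: "'a::euclidean_space set"
 assumes V: "subspace V" shows "prob_space (sph V)"
proof -
 have "unit_ball_vol (real (dim V)) > 0" by simp
 then have "prob_space (uniform_measure (leb V) (ball 0 1))" by (intro prob_space_uniform_measure) (auto simp: em_leb_ball[OF V] ennreal_eq_0_iff not_le)
 then show ?thesis unfolding sph_def by (rule prob_space.prob_space_distr) auto
qed

lemma em_leb_0:
 fixes V :: "'a::euclidean_space set"
 assumes V: "subspace V" "0 < dim V"
 shows "em (leb V) {0} = 0"
proof -
 have lim: "(%n. enn (unit_ball_vol (real (dim V)) * inverse (real (Suc n)) ^ dim V)) ---> enn (unit_ball_vol (real (dim V)) * 0 ^ dim V)" by (intro tendsto_ennrealI tendsto_mult tendsto_const tendsto_power LIMSEQ_inverse_real_of_nat)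
 have le: "em (leb V) {0} <= enn (unit_ball_vol (real (dim V)) * inverse (real (Suc n)) ^ dim V)" for n using emeasure_mono[of "{0}" "cball 0 (inverse (real (Suc n)))" "leb V"]
   em_leb_cball[OF V(1) subspace_0[OF V(1)], of "inverse (real (Suc n))"] by simp
 have "em (leb V) {0} <= enn (unit_ball_vol (real (dim V)) * 0 ^ dim V)" by (rule tendsto_lowerbound[OF lim]) (use le in auto)
 moreover have "(0::real) ^ dim V = 0" using V(2) by (rule zero_power)
 ultimately show ?thesis by simp
qed

lemma AE_leb_nonzero:
 fixes V :: "'a::euclidean_space set"
 assumes "subspace V" "0 < dim V" shows "AE x in leb V. x ~= 0" using em_leb_0[OF assms] by (intro AE_I[of _ _ "{0}"]) auto

lemma AE_sph:
 fixes V :: "'a::euclidean_space set"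
 assumes V: "subspace V" "0 < dim V"
 shows "AE x in sph V. x : V Int sphere 0 1"
proof -
 have m: "{x : space borel. x : V Int sphere 0 1} : sets borel"
 proof -
  have "{x : space borel. x : V Int sphere 0 1} = V Int sphere 0 1" by auto
  moreover have "closed (V Int sphere 0 1)" using closed_subspace[OF V(1)] by (intro closed_Int) auto
  ultimately show ?thesis by (simp only: borel_closed)
 qed
 have "AE x in leb V. x : ball 0 1 --> sgn x : V Int sphere 0 1" using AE_leb[OF V(1)] AE_leb_nonzero[OF V] by eventually_elim (simp add: norm_sgn sgn_div_norm subspace_scale[OF V(1)])
 then have "AE x in uniform_measure (leb V) (ball 0 1). sgn x : V Int sphere 0 1" by (intro AE_uniform_measureI) auto
 then show ?thesis unfolding sph_def by (subst AE_distr_iff[OF _ m]) auto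
qed

lemma bm_linear:
 fixes T :: "'a::euclidean_space => 'c::euclidean_space"
 assumes "linear T" shows "T : bmeas borel" using assms by (intro borel_measurable_continuous_onI linear_continuous_on linear_conv_bounded_linear[THEN iffD1])

lemma linear_sgn: "linear T ==> norm (T x) = norm x ==> T (sgn x) = sgn (T x)" by (simp add: sgn_div_norm linear_scale)

lemma sph_isometry:
 fixes V :: "'a::euclidean_space set" and T :: "'a => 'c::euclidean_space"
 assumes V: "subspace V" and T: "linear T" "!!x. x : V ==> norm (T x) = norm x"
 shows "sph (T ` V) = distr (sph V) borel T"
proof (rule measure_eqI)
 note [measurable] = bm_linear[OF T(1)]
 have TV: "subspace (T ` V)" using V T(1) by (rule linear_subspace_image[rotated])
 have inj: "inj_on T V"
 proof (rule inj_onI)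
  fix x y assume "x : V" "y : V" "T x = T y"
  then show "x = y" using T(2)[of "x - y"] V T(1) by (simp add: linear_diff subspace_diff)
 qed
 then have dim: "dim (T ` V) = dim V" using V T(1) by (intro dim_image_eq) (auto simp: span_eq_iff[THEN iffD2])
 fix A assume "A : sets (sph (T ` V))"
 then have A[measurable]: "A : sets borel" by simp
 have "em (sph (T ` V)) A = (II x. ind A x dd sph (T ` V))" by simp
 also have "... = (II x. ind A (sgn x) * ind (ball 0 1) x dd leb (T ` V)) / enn (unit_ball_vol (real (dim V)))" unfolding nni_sph[OF TV borel_measurable_indicator[OF A]] dim ..
 also have "(II x. ind A (sgn x) * ind (ball 0 1) x dd leb (T ` V))
  = (II x. ind A (sgn (T x)) * ind (ball 0 1) (T x) dd leb V)" by (subst leb_isometry[OF V T], assumption, subst nn_integral_distr) auto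
 also have "(II x. ind A (sgn (T x)) * ind (ball 0 1) (T x) dd leb V)
  = (II x. ind A (T (sgn x)) * ind (ball 0 1) x dd leb V)"
 proof (rule nn_integral_cong_AE, use AE_leb[OF V] in eventually_elim)
  fix x assume "x : V"
  then show "ind A (sgn (T x)) * ind (ball 0 1) (T x) = (ind A (T (sgn x)) * ind (ball 0 1) x :: ennreal)" using T(2)[of x] linear_sgn[OF T(1), of x] by (simp add: indicator_def)
 qed
 also have "... / enn (unit_ball_vol (real (dim V))) = (II x. ind A (T x) dd sph V)" by (rule nni_sph[OF V, symmetric]) measurable
 also have "... = (II x. ind A x dd distr (sph V) borel T)" by (subst nn_integral_distr) auto
 finally show "em (sph (T ` V)) A = em (distr (sph V) borel T) A" by simp
qed auto

text \<open>Two vectors of \<open>X\<close> of equal norm are exchanged by the reflection along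
  their difference, which preserves \<open>X\<close>. Invariance under reflections can therefore
  stand in for the full orthogonal group of \<open>X\<close> on its sphere.\<close>

definition reflection :: "'a::euclidean_space => 'a => 'a" where
 "reflection u x = x - (2 * (x *. u)) *R u"

lemma orth_reflection:
 assumes "norm u = 1" shows "orth (reflection u)"
proof -
 have u: "u *. u = 1" using assms by (simp add: dot_square_norm)
 have "linear (reflection u)" unfolding reflection_def by (rule linearI) (simp_all add: algebra_simps inner_add_left scaleR_add_left)
 moreover have "reflection u v *. reflection u w = v *. w" for v w unfolding reflection_def using u by (simp add: inner_diff_left inner_diff_right inner_commute)
 ultimately show ?thesis by (simp add: orthogonal_transformation_def)
qed

lemma reflection_reflection: "norm u = 1 ==> reflection u (reflection u x) = x" by (simp add: reflection_def inner_diff_left dot_square_norm)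

lemma reflection_image:
 assumes "subspace X" "u : X" "norm u = 1" shows "reflection u ` X = X"
proof -
 have "reflection u x : X" if "x : X" for x unfolding reflection_def using assms that by (intro subspace_diff subspace_scale)
 moreover have "x : reflection u ` X" if "x : X" for x using imageI[OF calculation[OF that], of "reflection u"] reflection_reflection[OF assms(3)] by simp
 ultimately show ?thesis by blast
qed

lemma reflection_swap:
 assumes "norm x = norm y" "x ~= y"
 shows "reflection (sgn (x - y)) x = y"
proof -
 have "(norm (x - y))^2 = x *. x - 2 * (x *. y) + y *. y" by (simp add: power2_norm_eq_inner inner_diff_left inner_diff_right inner_commute)
 moreover have "y *. y = x *. x" using assms(1) by (simp add: dot_square_norm)
 ultimately have *: "2 * (x *. (x - y)) = (norm (x - y))^2" by (simp add: inner_diff_right)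
 have "2 * (inverse (norm (x - y)) * (x *. (x - y))) * inverse (norm (x - y)) = 2 * (x *. (x - y)) / (norm (x - y))^2" by (simp add: power2_eq_square divide_inverse)
 then have "reflection (sgn (x - y)) x = x - (2 * (x *. (x - y)) / (norm (x - y))^2) *R (x - y)" unfolding reflection_def sgn_div_norm inner_scaleR_right scaleR_scaleR by simp
 also have "... = y" unfolding * using assms(2) by simp
 finally show ?thesis .
qed

lemma em_cball_invariant:
 fixes M :: "'a::euclidean_space measure"
 assumes "distr M borel T = M" "orth T" "sets M = sets borel"
 shows "em M (cball (T x) r) = em M (cball x r)"
proof -
 have T: "linear T" using assms(2) by (simp add: orthogonal_transformation_def)
 have "T -` cball (T x) r = cball x r"
 proof -
  have "dist (T x) (T y) = dist x y" for y using assms(2) T by (metis dist_norm linear_diff orthogonal_transformation_norm)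
  then show ?thesis by auto
 qed
 moreover have "T : measurable M borel" using bm_linear[OF T] measurable_cong_sets[OF assms(3) refl] by blast
 moreover have "space M = UNIV" using assms(3) by (metis sets_eq_imp_space_eq space_borel)
 ultimately have "em (distr M borel T) (cball (T x) r) = em M (cball x r)" by (subst emeasure_distr) auto
 then show ?thesis using assms(1) by simp
qed

lemma sph_eqI:
 fixes X :: "'a::euclidean_space set"
 assumes X: "subspace X" "0 < dim X" and M: "prob_space M" "sets M = sets borel" "AE x in M. x : X Int sphere 0 1"
  and inv: "!!u. u : X ==> norm u = 1 ==> distr M borel (reflection u) = M"
 shows "M = sph X"
proof (rule prob_eqI_homogeneous[where S="X Int sphere 0 1"])
 have *: "em N (cball x r) = em N (cball y r)"
  if "x : X Int sphere 0 1" "y : X Int sphere 0 1" "sets N = sets borel"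
  "!!u. u : X ==> norm u = 1 ==> distr N borel (reflection u) = N" for N :: "'a measure" and x y r
 proof (cases "x = y")
  case False
  have "sgn (x - y) : X" using that X by (simp add: sgn_div_norm subspace_scale subspace_diff)
  moreover have n: "norm (sgn (x - y)) = 1" using False by (simp add: norm_sgn)
  ultimately have "distr N borel (reflection (sgn (x - y))) = N" using that(4) by blast
  then have "em N (cball (reflection (sgn (x - y)) x) r) = em N (cball x r)" by (rule em_cball_invariant[OF _ orth_reflection[OF n] that(3)])
  then show ?thesis using reflection_swap[of x y] False that by simp
 qed simp
 show "em M (cball x r) = em M (cball y r)" if "x : X Int sphere 0 1" "y : X Int sphere 0 1" for x y r by (rule *[OF that M(2)]) (rule inv)
 have **: "distr (sph X) borel (reflection u) = sph X" if "u : X" "norm u = 1" for u using sph_isometry[OF X(1), of "reflection u"] orth_reflection[OF that(2)]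
   reflection_image[OF X(1) that] by (simp add: orthogonal_transformation)
 show "em (sph X) (cball x r) = em (sph X) (cball y r)" if "x : X Int sphere 0 1" "y : X Int sphere 0 1" for x y r by (rule *[OF that sets_sph]) (rule **)
qed (use M AE_sph[OF X] prob_sph[OF X(1)] in auto)

text \<open>Reflections along vectors of \<open>X\<close> commute with \<open>proj X\<close>, so the
  image measure is invariant. All spheres thereby become images of the single measure
  \<open>sph UNIV\<close>, and the subspace moves into the integrand, where its dependence is
  measurable.\<close>

lemma sph_eq_distr:
 fixes X :: "'a::euclidean_space set"
 assumes X: "subspace X" "0 < dim X"
 shows "sph X = distr (sph UNIV) borel (%x. sgn (proj X x))"
proof (rule sph_eqI[symmetric, OF X])
 interpret prob_space "sph (UNIV :: 'a set)" by (rule prob_sph) simp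
 note [measurable] = bm_proj[OF X(1)]
 show "prob_space (distr (sph UNIV) borel (%x. sgn (proj X x)))" by (rule prob_space_distr) measurable
 have m: "{x : space borel. x : X Int sphere 0 1} : sets borel"
 proof -
  have "{x : space borel. x : X Int sphere 0 1} = X Int sphere 0 1" by auto
  moreover have "closed (X Int sphere 0 1)" using closed_subspace[OF X(1)] by (intro closed_Int) auto
  ultimately show ?thesis by (simp only: borel_closed)
 qed
 \<comment> \<open>The orthogonal complement of \<open>X\<close> is a proper subspace and hence
   Lebesgue null, so \<open>sgn\<close> is not applied to 0 outside a null set.\<close>
 have "AE x in lborel. x : ball 0 1 --> proj X x ~= 0"
 proof -
  have "dim (X^o) ~= DIM('a)" using dim_Int_comp[of UNIV X] X by simp
  then have "X^o ~= UNIV" by auto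
  then have "negligible (X^o)" using dim_eq_full[of "X^o"] \<open>dim (X^o) ~= DIM('a)\<close> dim_subset_UNIV[of "X^o"] by (intro negligible_lowdim) auto
  moreover have "X^o : sets borel" by (simp add: closed_subspace subspace_orthogonal_comp)
  ultimately have "em lborel (X^o) = 0" by (simp add: negligible_iff_null_sets null_sets_def)
  then have "AE x in lborel. x ~: X^o" using \<open>X^o : sets borel\<close> by (intro AE_not_in) (auto simp: null_sets_def)
  then show ?thesis by eventually_elim (metis closest_point_orthogonal[OF X(1)] diff_zero)
 qed
 then have "AE x in uniform_measure lborel (ball 0 1). proj X x ~= 0" by (intro AE_uniform_measureI) auto
 then have "AE x in uniform_measure lborel (ball 0 1). proj X (sgn x) ~= 0" by eventually_elim (auto simp: sgn_div_norm linear_scale[OF linear_proj[OF X(1)]]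
    linear_0[OF linear_proj[OF X(1)]])
 then have nz: "AE x in sph UNIV. proj X x ~= 0" unfolding sph_def leb_UNIV by (subst AE_distr_iff) auto
 show "AE x in distr (sph UNIV) borel (%x. sgn (proj X x)). x : X Int sphere 0 1"
 proof (subst AE_distr_iff[OF _ m])
  show "AE x in sph UNIV. sgn (proj X x) : X Int sphere 0 1" using nz by eventually_elim
    (simp add: norm_sgn sgn_div_norm subspace_scale[OF X(1)] closest_point_in_subspace[OF X(1)])
 qed measurable
 fix u :: 'a assume u: "u : X" "norm u = 1"
 note R = orth_reflection[OF u(2)]
 have lin: "linear (reflection u)" and nrm: "norm (reflection u x) = norm x" for x using R by (auto simp: orthogonal_transformation)
 note [measurable] = bm_linear[OF lin]
 have comm: "reflection u (proj X x) = proj X (reflection u x)" for x by (simp add: reflection_def linear_diff[OF linear_proj[OF X(1)]] linear_scale[OF linear_proj[OF X(1)]]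
    proj_subspace_eq[OF X(1) u(1)] proj_dot_subspace[OF X(1) u(1)])
 have "distr (distr (sph UNIV) borel (%x. sgn (proj X x))) borel (reflection u)
  = distr (sph UNIV) borel (%x. reflection u (sgn (proj X x)))" by (subst distr_distr) (auto simp: comp_def)
 also have "... = distr (sph UNIV) borel (%x. sgn (proj X (reflection u x)))" by (simp add: linear_sgn[OF lin nrm] comm)
 also have "... = distr (distr (sph UNIV) borel (reflection u)) borel (%x. sgn (proj X x))" by (subst distr_distr) (auto simp: comp_def)
 also have "distr (sph UNIV) borel (reflection u) = sph UNIV" using sph_isometry[OF subspace_UNIV lin nrm] reflection_image[OF subspace_UNIV UNIV_I u(2)] by simp
 finally show "distr (distr (sph UNIV) borel (%x. sgn (proj X x))) borel (reflection u)
  = distr (sph UNIV) borel (%x. sgn (proj X x))" .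
qed auto

section \<open>Polar coordinates, parallel slices and gnomonic charts of spheres\<close>

declare of_nat_Suc [simp del] power_Suc [simp del]

lemma ennreal_times_divide_cancel: "0 < v ==> ennreal v * (a / enn v) = a" by (subst mult.commute) (simp add: ennreal_divide_times ennreal_mult_divide_eq)

lemma nni_swap:
 assumes "sfin M" "sfin N"
  and "(%(x, y). f x y) : bmeas (M xx N)"
 shows "(II x. II y. f x y dd N dd M) = (II y. II x. f x y dd M dd N)"
proof -
 interpret M: sigma_finite_measure M by fact
 interpret N: sigma_finite_measure N by fact
 interpret pair_sigma_finite M N ..
 show ?thesis using Fubini'[OF assms(3)] by simp
qed

lemma sf_sph: "subspace V ==> sigma_finite_measure (sph V)"
 for V :: "'a::euclidean_space set" by (intro prob_space_imp_sigma_finite prob_sph)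

lemma nni_power_upto:
 assumes "0 <= b"
 shows "(II r. enn (r ^ m) * ind {0<..<b} r dd lborel) = enn (b ^ Suc m / real (Suc m))"
proof -
 have "(II r. enn (r ^ m) * ind {0<..<b} r dd lborel) = (II r. enn (r ^ m) * ind {0..b} r dd lborel)" by (rule nn_integral_cong_AE, use AE_lborel_singleton[of 0] AE_lborel_singleton[of b] in eventually_elim)
   (auto simp: indicator_def)
 also have "... = enn (b ^ Suc m / real (Suc m) - 0 ^ Suc m / real (Suc m))"
 proof (rule nn_integral_FTC_Icc)
  have "((%x. x ^ Suc m / real (Suc m)) has_real_derivative (real (Suc m) * x ^ (Suc m - Suc 0)) / real (Suc m)) (at x)" for x :: real by (intro DERIV_cdivide DERIV_pow)
  then show "((%x. x ^ Suc m / real (Suc m)) has_real_derivative x ^ m) (at x)" for x :: real by simp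
 qed (use assms in auto)
 finally show ?thesis by simp
qed

text \<open>Polar coordinates: the density $\sigma_{d-1} r^{d-1}$ is written with
 $\sigma_{d-1} = d\,v_d$, where $v_d$ is the volume of the unit ball.\<close>

lemma polar_measure:
 fixes V :: "'a::euclidean_space set"
 assumes V: "subspace V" and d: "dim V = Suc m"
 shows "density lborel (%r. enn (real (Suc m) * unit_ball_vol (real (Suc m)) * r ^ m) * ind {0<..} r) xx sph V
  = distr (leb V) (borel xx borel) (%x. (norm x, sgn x))" (is "?D xx _ = ?R")
proof (rule pair_measure_eqI)
 let ?v = "unit_ball_vol (real (Suc m))"
 let ?f = "%r. enn (real (Suc m) * ?v * r ^ m) * ind {0<..} r"
 have v: "0 < ?v" by simp
 have Dlt: "em ?D {..<r} = enn (?v * (max 0 r) ^ Suc m)" for r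
 proof -
  have "em ?D {..<r} = (II x. ?f x * ind {..<r} x dd lborel)" by (rule emeasure_density) auto
  also have "... = (II x. enn (real (Suc m) * ?v) * (enn (x ^ m) * ind {0<..<max 0 r} x) dd lborel)" by (intro nn_integral_cong) (use v in \<open>auto simp: indicator_def ennreal_mult''[symmetric] ennreal_mult'[symmetric]\<close>)
  also have "... = enn (real (Suc m) * ?v) * enn (max 0 r ^ Suc m / real (Suc m))" by (subst nn_integral_cmult) (auto simp: nni_power_upto simp del: power_Suc of_nat_Suc)
  also have "... = enn (?v * (max 0 r) ^ Suc m)" using v by (subst ennreal_mult'[symmetric]) (auto simp del: power_Suc of_nat_Suc)
  finally show ?thesis .
 qed
 have Dfin: "em ?D {..<r} < \<infinity>" for r unfolding Dlt by simp
 show "sfin (sph V)" using V by (rule sf_sph)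
 show "sfin ?D"
 proof
  have "(\<Union>n. {..<real n}) = (UNIV :: real set)" by (auto simp: reals_Archimedean2)
  then show "EX A. countable A & A \<subseteq> sets ?D & \<Union>A = space ?D & (ALL a:A. em ?D a ~= \<infinity>)" by (intro exI[of _ "range (%n. {..<real n})"]) (use Dfin in \<open>auto simp: less_top\<close>)
 qed
 show "sets (?D xx sph V) = sets ?R" by (simp add: sets_pair_measure_cong[of ?D borel "sph V" borel])
 fix A B assume A: "A : sets ?D" and "B : sets (sph V)"
 then have A[measurable]: "A : sets borel" and B[measurable]: "B : sets borel" by auto
 define N where "N = distr (density (leb V) (%x. ind B (sgn x))) borel norm"
 have N: "em N C = (II x. ind B (sgn x) * ind C (norm x) dd leb V)"
  if [measurable]: "C : sets borel" for C unfolding N_def using that using measurable_sets[of norm "borel :: 'a measure" borel C] by (subst emeasure_distr, simp, simp, subst emeasure_density) (auto intro!: nn_integral_cong simp: indicator_def)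
 \<comment> \<open>With the direction confined to \<open>B\<close>, both sides are measures of the
   radius. They are compared on half lines, where scaling by \<open>r\<close> reduces to the unit
   ball in the definition of \<open>sph\<close>.\<close>
 have "scale_measure (em (sph V) B) ?D = N"
 proof (rule measure_eqI_generator_eq[where E="range lessThan" and \<Omega>=UNIV and A="%n. {..<real n}"])
  show "Int_stable (range (lessThan :: real => _))"
  proof -
   have "{..<a} Int {..<b} = {..<min a b}" for a b :: real by auto
   then show ?thesis by (auto simp: Int_stable_def)
  qed
  have sb: "sets (borel :: real measure) = sigma_sets UNIV (range lessThan)" unfolding borel_Iio by (rule sets_measure_of) simp
  show "sets (scale_measure (em (sph V) B) ?D) = sigma_sets UNIV (range lessThan)"
    "sets N = sigma_sets UNIV (range lessThan)" by (simp_all add: N_def sb)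
  show "(\<Union>n. {..<real n}) = (UNIV :: real set)" by (auto simp: reals_Archimedean2)
  have fin: "em (sph V) B <= 1" using prob_space.emeasure_le_1[OF prob_sph[OF V]] .
  show "em (scale_measure (em (sph V) B) ?D) {..<real n} ~= \<infinity>" for n using le_less_trans[OF fin ennreal_one_less_top] Dfin[of "real n"] by (auto simp: ennreal_mult_eq_top_iff top_unique less_top)
  fix X :: "real set" assume "X : range lessThan"
  then obtain r where r: "X = {..<r}" by auto
  show "em (scale_measure (em (sph V) B) ?D) X = em N X"
  proof (cases "0 < r")
   case True
   have "em N X = (II x. ind B (sgn x) * ind {..<r} (norm x) dd leb V)" unfolding r by (rule N) simp
   also have "... = enn (\<bar>r\<bar> ^ dim V) * (II x. ind B (sgn (r *R x)) * ind {..<r} (norm (r *R x)) dd leb V)" using True by (intro nni_leb_scale V) auto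
   also have "(II x. ind B (sgn (r *R x)) * ind {..<r} (norm (r *R x)) dd leb V)
    = (II x. ind B (sgn x) * ind (ball 0 1) x dd leb V)" using True by (intro nn_integral_cong) (auto simp: sgn_scaleR indicator_def)
   also have "... = enn ?v * em (sph V) B"
   proof -
    have "em (sph V) B = (II x. ind B (sgn x) * ind (ball 0 1) x dd leb V) / enn ?v" using nni_sph[OF V, of "ind B"] d by simp
    then show ?thesis using ennreal_times_divide_cancel[OF v] by simp
   qed
   finally show ?thesis using True v unfolding r d emeasure_scale_measure Dlt by (simp add: ennreal_mult mult.commute mult.left_commute)
  next
   case False
   then have "(II x. ind B (sgn x) * ind {..<r} (norm x) dd leb V) = (II x. 0 dd leb V)" using order_trans[OF _ norm_ge_zero, of r] by (intro nn_integral_cong) (auto simp: indicator_def not_less)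
   then have "em N X = 0" unfolding r by (subst N) auto
   then show ?thesis using False unfolding r by (simp add: Dlt)
  qed
 qed auto
 then have "em (scale_measure (em (sph V) B) ?D) A = em N A" by (rule arg_cong)
 then have "em ?D A * em (sph V) B = em N A" unfolding emeasure_scale_measure by (subst mult.commute)
 also have "... = em (leb V) {x. norm x : A & sgn x : B}"
 proof -
  have "(II x. ind B (sgn x) * ind A (norm x) dd leb V)
   = (II x. ind {x. norm x : A & sgn x : B} x dd leb V)" by (intro nn_integral_cong) (auto simp: indicator_def)
  also have "... = em (leb V) {x. norm x : A & sgn x : B}"
  proof (rule nn_integral_indicator)
   have "{x : space borel. norm (x::'a) : A & sgn x : B} : sets borel" by measurable
   then show "{x. norm x : A & sgn x : B} : sets (leb V)" by simp
  qed
  finally show ?thesis by (simp add: N[OF A])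
 qed
 also have "... = em ?R (A \<times> B)"
 proof -
  have "(%x. (norm x, sgn x)) -` (A \<times> B) = {x. norm x : A & sgn x : B}" by auto
  then show ?thesis by (subst emeasure_distr) auto
 qed
 finally show "em ?D A * em (sph V) B = em ?R (A \<times> B)" .
qed

lemma nni_polar:
 fixes V :: "'a::euclidean_space set"
 assumes V: "subspace V" and d: "dim V = Suc m" and [measurable]: "g : bmeas borel"
 shows "(II x. g x dd leb V)
  = (II a. II r. g (r *R a) * (enn (real (Suc m) * unit_ball_vol (real (Suc m)) * r ^ m) * ind {0<..} r) dd lborel dd sph V)"
proof -
 let ?f = "%r. enn (real (Suc m) * unit_ball_vol (real (Suc m)) * r ^ m) * ind {0<..} r"
 interpret S: sigma_finite_measure "sph V" using V by (rule sf_sph)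
 have "norm x *R sgn x = x" for x :: 'a by (cases "x = 0") (simp_all add: sgn_div_norm)
 then have "(II x. g x dd leb V) = (II x. (%(r, w). g (r *R w)) (norm x, sgn x) dd leb V)" by simp
 also have "... = (II z. (%(r, w). g (r *R w)) z dd distr (leb V) (borel xx borel) (%x. (norm x, sgn x)))" by (rule nn_integral_distr[symmetric]) measurable
 also have "... = (II z. (%(r, w). g (r *R w)) z dd (density lborel ?f xx sph V))" by (simp only: polar_measure[OF V d])
 also have "... = (II r. II w. g (r *R w) dd sph V dd density lborel ?f)" by (subst S.nn_integral_fst[symmetric]) auto
 also have "... = (II r. ?f r * (II w. g (r *R w) dd sph V) dd lborel)" by (subst nn_integral_density) auto
 also have "... = (II r. II w. g (r *R w) * ?f r dd sph V dd lborel)" by (intro nn_integral_cong) (subst nn_integral_multc, auto simp: mult.commute)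
 also have "... = (II w. II r. g (r *R w) * ?f r dd lborel dd sph V)" by (rule nni_swap) (auto intro: S.sigma_finite_measure_axioms lborel.sigma_finite_measure_axioms)
 finally show ?thesis .
qed

lemma span_singleton_unit:
 fixes e :: "'a::euclidean_space"
 shows "(%t::real. t *R e) ` UNIV = span {e}" by (auto simp: span_singleton)

lemma leb_line:
 fixes e :: "'a::euclidean_space"
 assumes "norm e = 1"
 shows "leb (span {e}) = distr lborel borel (%t. t *R e)"
proof -
 have "linear (%t::real. t *R e)" by (rule linearI) (auto simp: scaleR_add_left)
 from leb_isometry[OF subspace_UNIV this] assms show ?thesis by (simp add: span_singleton_unit leb_UNIV)
qed

lemma comp_span_singleton: "(span {e})^o = {e}^o" for e :: "'a::euclidean_space" by (auto simp: comp_iff span_singleton)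

lemma dim_Int_comp_unit:
 fixes V :: "'a::euclidean_space set"
 assumes "subspace V" "e : V" "norm e = 1"
 shows "Suc (dim (V Int {e}^o)) = dim V"
proof -
 have "dim (span {e}) = 1" using assms(3) by (auto simp: dim_singleton)
 moreover have "span {e} \<subseteq> V" using assms by (intro span_minimal) auto
 ultimately show ?thesis using dim_Int_comp[OF assms(1) subspace_span[of "{e}"]] by (simp add: comp_span_singleton)
qed

lemma nni_leb_slice:
 fixes V :: "'a::euclidean_space set"
 assumes V: "subspace V" and e: "e : V" "norm e = 1" and [measurable]: "g : bmeas borel"
 shows "(II x. g x dd leb V) = (II t. II y. g (t *R e + y) dd leb (V Int {e}^o) dd lborel)"
proof -
 interpret sigma_finite_measure "leb (V Int {e}^o)" by (intro sf_leb subspace_Int_comp V)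
 have "span {e} \<subseteq> V" using V e by (intro span_minimal) auto
 from nni_leb_decomp[OF V subspace_span this, of g]
 have "(II x. g x dd leb V) = (II x. II y. g (x + y) dd leb (V Int {e}^o) dd leb (span {e}))" by (simp add: comp_span_singleton)
 also have "... = (II t. II y. g (t *R e + y) dd leb (V Int {e}^o) dd lborel)" unfolding leb_line[OF e(2)] by (subst nn_integral_distr) auto
 finally show ?thesis .
qed

lemma nni_scaled_power:
 assumes "0 < a" "0 <= c"
 shows "(II r. enn (c * r ^ m) * (ind {0<..} r * ind {..<1} (r * a)) dd lborel) = enn (c / (real (Suc m) * a ^ Suc m))"
proof -
 have "(II r. enn (c * r ^ m) * (ind {0<..} r * ind {..<1} (r * a)) dd lborel)
  = (II r. enn c * (enn (r ^ m) * ind {0<..<1 / a} r) dd lborel)" using assms by (intro nn_integral_cong) (auto simp: indicator_def field_simps ennreal_mult')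
 also have "... = enn c * enn ((1 / a) ^ Suc m / real (Suc m))" using assms by (subst nn_integral_cmult) (auto simp: nni_power_upto simp del: power_Suc)
 also have "... = enn (c / (real (Suc m) * a ^ Suc m))" using assms by (subst ennreal_mult'[symmetric]) (auto simp: power_divide divide_simps mult_ac simp del: power_Suc)
 finally show ?thesis .
qed

text \<open>Integrate over the unit ball: slice it along \<open>e\<close>, use polar coordinates in
  the slices and put t = r s. The direction is then (p + s e) / sqrt (1 + s^2) and the radius
  integrates out. As the (d-1)-sphere has area d times the volume of the unit ball, \<open>C\<close>
  is the area of the m-sphere divided by that of the (m+1)-sphere.\<close>

lemma nni_sphere_slice:
 fixes V :: "'a::euclidean_space set"
 assumes V: "subspace V" and e: "e : V" "norm e = 1" and d: "dim V = Suc (Suc m)" and [measurable]: "g : bmeas borel"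
 defines "C \<equiv> real (Suc m) * unit_ball_vol (real (Suc m)) / (real (Suc (Suc m)) * unit_ball_vol (real (Suc (Suc m))))"
 shows "(II x. g x dd sph V)
  = (II s. II p. g ((1 / sqrt (1 + s^2)) *R (p + s *R e)) * enn (C / sqrt (1 + s^2) ^ Suc (Suc m)) dd sph (V Int {e}^o) dd lborel)"
proof -
 let ?W = "V Int {e}^o"
 have W: "subspace ?W" using V by (rule subspace_Int_comp)
 have dW: "dim ?W = Suc m" using dim_Int_comp_unit[OF V e] d by simp
 interpret S: prob_space "sph ?W" using W by (rule prob_sph)
 interpret sl: sigma_finite_measure "leb ?W" using W by (rule sf_leb)
 let ?v = "unit_ball_vol (real (Suc (Suc m)))" and ?w = "real (Suc m) * unit_ball_vol (real (Suc m))"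
 have v: "0 < ?v" "0 < ?w" by auto
 let ?f = "%r. enn (?w * r ^ m) * ind {0<..} r"
 let ?h = "%x. g (sgn x) * ind (ball 0 1) x"
 have S1: "AE p in sph ?W. norm (p + s *R e) = sqrt (1 + s^2)" for s
 proof -
  have "AE p in sph ?W. p : ?W Int sphere 0 1" using W dW by (intro AE_sph) auto
  then show ?thesis
  proof eventually_elim
   fix p assume "p : ?W Int sphere 0 1"
   then have "orthogonal p (s *R e)" "norm p = 1" by (auto simp: comp_iff orthogonal_def)
   then have "(norm (p + s *R e))^2 = 1 + s^2" using e by (simp add: norm_add_Pythagorean)
   then show "norm (p + s *R e) = sqrt (1 + s^2)" by (metis norm_ge_zero real_sqrt_unique)
  qed
 qed
 have "(II x. ?h x dd leb V) = (II t. II y. ?h (t *R e + y) dd leb ?W dd lborel)" by (rule nni_leb_slice[OF V e]) measurable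
 also have "... = (II t. (II p. II r. ?h (t *R e + r *R p) * ?f r dd lborel dd sph ?W) dd lborel)" by (rule nn_integral_cong, rule nni_polar[OF W dW]) measurable
 also have "... = (II p. (II t. II r. ?h (t *R e + r *R p) * ?f r dd lborel dd lborel) dd sph ?W)" by (rule nni_swap) (auto intro: S.sigma_finite_measure_axioms lborel.sigma_finite_measure_axioms)
 also have "... = (II p. (II r. II t. ?h (t *R e + r *R p) * ?f r dd lborel dd lborel) dd sph ?W)" by (rule nn_integral_cong, rule nni_swap) (auto intro: lborel.sigma_finite_measure_axioms)
 also have "... = (II p. (II r. II s. ?h (r *R (p + s *R e)) * (enn r * ?f r) dd lborel dd lborel) dd sph ?W)"
 proof (rule nn_integral_cong, rule nn_integral_cong)
  fix p :: 'a and r :: real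
  show "(II t. ?h (t *R e + r *R p) * ?f r dd lborel) = (II s. ?h (r *R (p + s *R e)) * (enn r * ?f r) dd lborel)"
  proof (cases "0 < r")
   case True
   have "(II t. ?h (t *R e + r *R p) * ?f r dd lborel)
    = enn \<bar>r\<bar> * (II s. ?h ((0 + r * s) *R e + r *R p) * ?f r dd lborel)" using True by (intro nn_integral_real_affine) auto
   also have "... = (II s. enn r * (?h ((0 + r * s) *R e + r *R p) * ?f r) dd lborel)" using True by (subst nn_integral_cmult) auto
   also have "... = (II s. ?h (r *R (p + s *R e)) * (enn r * ?f r) dd lborel)" by (intro nn_integral_cong) (simp add: scaleR_add_right add.commute mult_ac)
   finally show ?thesis .
  qed simp
 qed
 also have "... = (II p. (II s. II r. ?h (r *R (p + s *R e)) * (enn r * ?f r) dd lborel dd lborel) dd sph ?W)" by (rule nn_integral_cong, rule nni_swap) (auto intro: lborel.sigma_finite_measure_axioms)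
 also have "... = (II s. (II p. II r. ?h (r *R (p + s *R e)) * (enn r * ?f r) dd lborel dd sph ?W) dd lborel)" by (rule nni_swap) (auto intro: S.sigma_finite_measure_axioms lborel.sigma_finite_measure_axioms)
 \<comment> \<open>Since p and e are orthogonal, lying in the unit ball means r sqrt (1 + s^2) < 1;
   the integral of r^(m+1) up to this bound gives the power m + 2.\<close>
 also have "... = (II s. (II p. g ((1 / sqrt (1 + s^2)) *R (p + s *R e)) * enn (?w / (real (Suc (Suc m)) * sqrt (1 + s^2) ^ Suc (Suc m))) dd sph ?W) dd lborel)"
 proof (rule nn_integral_cong, rule nn_integral_cong_AE)
  fix s
  show "AE p in sph ?W. (II r. ?h (r *R (p + s *R e)) * (enn r * ?f r) dd lborel)
   = g ((1 / sqrt (1 + s^2)) *R (p + s *R e)) * enn (?w / (real (Suc (Suc m)) * sqrt (1 + s^2) ^ Suc (Suc m)))" using S1[of s]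
  proof eventually_elim
   fix p assume n: "norm (p + s *R e) = sqrt (1 + s^2)"
   let ?a = "sqrt (1 + s^2)"
   have a: "0 < ?a" by (simp add: add_pos_nonneg)
   have "?h (r *R (p + s *R e)) * (enn r * ?f r)
    = g ((1 / ?a) *R (p + s *R e)) * (enn (?w * r ^ Suc m) * (ind {0<..} r * ind {..<1} (r * ?a)))" for r
   proof (cases "0 < r")
    case True
    have "sgn (r *R (p + s *R e)) = (1 / ?a) *R (p + s *R e)" using True n by (simp add: sgn_scaleR sgn_div_norm divide_inverse)
    moreover have "ind (ball 0 1) (r *R (p + s *R e)) = (ind {..<1} (r * ?a) :: ennreal)" using True n by (simp add: indicator_def)
    moreover have "enn r * enn (?w * r ^ m) = enn (?w * r ^ Suc m)" using True v by (simp add: ennreal_mult'[symmetric] mult_ac power_Suc)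
    ultimately show ?thesis using True by (simp add: mult_ac del: power_Suc)
   qed simp
   then show "(II r. ?h (r *R (p + s *R e)) * (enn r * ?f r) dd lborel)
    = g ((1 / ?a) *R (p + s *R e)) * enn (?w / (real (Suc (Suc m)) * ?a ^ Suc (Suc m)))" using v by (simp only:) (subst nn_integral_cmult, auto simp: nni_scaled_power[OF a] simp del: power_Suc of_nat_Suc)
  qed
 qed
 finally have *: "(II x. ?h x dd leb V) = ..." .
 have "(II x. g x dd sph V) = (II x. ?h x dd leb V) / enn ?v" using nni_sph[OF V, of g] d by simp
 also have "... = (II s. (II p. g ((1 / sqrt (1 + s^2)) *R (p + s *R e)) * enn (?w / (real (Suc (Suc m)) * sqrt (1 + s^2) ^ Suc (Suc m))) / enn ?v dd sph ?W) dd lborel)" unfolding * by (simp add: nn_integral_divide del: power_Suc of_nat_Suc)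
 also have "... = (II s. (II p. g ((1 / sqrt (1 + s^2)) *R (p + s *R e)) * enn (C / sqrt (1 + s^2) ^ Suc (Suc m)) dd sph ?W) dd lborel)"
 proof (rule nn_integral_cong, rule nn_integral_cong)
  fix s :: real and p :: 'a
  have "enn (?w / (real (Suc (Suc m)) * sqrt (1 + s^2) ^ Suc (Suc m))) / enn ?v = enn (C / sqrt (1 + s^2) ^ Suc (Suc m))" using v by (subst divide_ennreal) (auto simp: C_def mult_ac simp del: power_Suc)
  then show "g ((1 / sqrt (1 + s^2)) *R (p + s *R e)) * enn (?w / (real (Suc (Suc m)) * sqrt (1 + s^2) ^ Suc (Suc m))) / enn ?v
   = g ((1 / sqrt (1 + s^2)) *R (p + s *R e)) * enn (C / sqrt (1 + s^2) ^ Suc (Suc m))" by (simp only: ennreal_times_divide[symmetric])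
 qed
 finally show ?thesis .
qed

declare of_nat_Suc [simp] power_Suc [simp]

declare of_nat_Suc [simp del] power_Suc [simp del]

lemma norm_add_orthogonal_unit:
 assumes "w *. e = 0" "norm e = 1"
 shows "norm (w + h *R e) = sqrt ((norm w)^2 + h^2)"
proof -
 have "(norm (w + h *R e))^2 = (norm w)^2 + h^2" using assms by (simp add: norm_add_Pythagorean orthogonal_def)
 then show ?thesis by (metis norm_ge_zero real_sqrt_unique)
qed

text \<open>Central projection of a hemisphere to the affine hyperplane at height \<open>h\<close>;
  evenness of \<open>g\<close> accounts for the other hemisphere, hence the 2 over the area of the
  sphere. The height is kept free because the Radon transform will use 1 / |z'|, with z' the first
  component of z.\<close>

lemma nni_sphere_gnomonic:
 fixes V :: "'a::euclidean_space set"
 assumes V: "subspace V" and e: "e : V" "norm e = 1" and d: "dim V = Suc m" and h: "0 < h"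
  and [measurable]: "g : bmeas borel" and even: "!!x. g (- x) = g x"
 shows "(II x. g x dd sph V)
  = (II w. g (sgn (w + h *R e)) * enn (2 / (real (Suc m) * unit_ball_vol (real (Suc m))) * (h / norm (w + h *R e) ^ Suc m))
dd leb (V Int {e}^o))"
proof -
 let ?W = "V Int {e}^o"
 have W: "subspace ?W" using V by (rule subspace_Int_comp)
 have dW: "dim ?W = m" using dim_Int_comp_unit[OF V e] d by simp
 have sW: "sfin (leb ?W)" using W by (rule sf_leb)
 interpret sW: sigma_finite_measure "leb ?W" by (rule sW)
 let ?v = "unit_ball_vol (real (Suc m))"
 have v: "0 < ?v" by simp
 let ?h = "%x. g (sgn x) * ind (ball 0 1) x"
 have gs: "g (sgn (- x)) = g (sgn x)" for x by (metis sgn_minus even)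
 let ?I = "%t. II y. ?h (t *R e + y) dd leb ?W"
 have Ieven: "?I (- t) = ?I t" for t
 proof -
  have "?I (- t) = (II y. ?h (- t *R e + (-1) *R y) dd leb ?W)" using nni_leb_scale[OF W, of "-1" "%y. ?h (- t *R e + y)"] by simp
  also have "... = ?I t"
  proof (rule nn_integral_cong)
   fix y
   have "- t *R e + (-1) *R y = - (t *R e + y)" by simp
   then show "?h (- t *R e + (-1) *R y) = ?h (t *R e + y)" using gs[of "t *R e + y"] by (simp only: mem_ball_0 norm_minus_cancel indicator_def)
  qed
  finally show ?thesis .
 qed
 have mI[measurable]: "?I : bmeas borel" by measurable
 have "(II x. ?h x dd leb V) = (II t. ?I t dd lborel)" by (rule nni_leb_slice[OF V e]) measurable
 also have "... = (II t. ?I t * ind {0<..} t + ?I t * ind {..<0} t dd lborel)" by (rule nn_integral_cong_AE, use AE_lborel_singleton[of 0] in eventually_elim) (auto simp: indicator_def)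
 also have "... = (II t. ?I t * ind {0<..} t dd lborel) + (II t. ?I t * ind {..<0} t dd lborel)" by (rule nn_integral_add) auto
 also have "(II t. ?I t * ind {..<0} t dd lborel) = (II t. ?I t * ind {0<..} t dd lborel)"
 proof -
  have "(II t. ?I t * ind {..<0} t dd lborel) = enn \<bar>-1\<bar> * (II t. ?I (0 + -1 * t) * ind {..<0} (0 + -1 * t) dd lborel)" by (rule nn_integral_real_affine) auto
  also have "... = (II t. ?I (- t) * ind {..<0} (- t) dd lborel)" by simp
  also have "... = (II t. ?I t * ind {0<..} t dd lborel)" unfolding Ieven by (intro nn_integral_cong) (auto simp: indicator_def)
  finally show ?thesis .
 qed
 \<comment> \<open>The substitution y = (t / h) w brings all slices to the common height
   \<open>h\<close>.\<close>
 also have "(II t. ?I t * ind {0<..} t dd lborel) = (II t. II w. ?h ((t / h) *R (w + h *R e)) * (enn ((1 / h) ^ m * t ^ m) * ind {0<..} t) dd leb ?W dd lborel)"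
 proof (rule nn_integral_cong)
  fix t :: real
  show "?I t * ind {0<..} t = (II w. ?h ((t / h) *R (w + h *R e)) * (enn ((1 / h) ^ m * t ^ m) * ind {0<..} t) dd leb ?W)"
  proof (cases "0 < t")
   case True
   have "?I t = enn (\<bar>t / h\<bar> ^ dim ?W) * (II w. ?h (t *R e + (t / h) *R w) dd leb ?W)" using True h by (intro nni_leb_scale[OF W]) auto
   also have "enn (\<bar>t / h\<bar> ^ dim ?W) = enn ((1 / h) ^ m * t ^ m)" unfolding dW using True h by (simp add: power_divide)
   also have "enn ((1 / h) ^ m * t ^ m) * (II w. ?h (t *R e + (t / h) *R w) dd leb ?W)
    = (II w. ?h (t *R e + (t / h) *R w) * enn ((1 / h) ^ m * t ^ m) dd leb ?W)" by (subst mult.commute, rule nn_integral_multc[symmetric]) measurable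
   also have "... = (II w. ?h ((t / h) *R (w + h *R e)) * enn ((1 / h) ^ m * t ^ m) dd leb ?W)" using h by (intro nn_integral_cong) (simp add: scaleR_add_right add.commute)
   finally show ?thesis using True by simp
  qed simp
 qed
 also have "... = (II w. II t. ?h ((t / h) *R (w + h *R e)) * (enn ((1 / h) ^ m * t ^ m) * ind {0<..} t) dd lborel dd leb ?W)" by (rule nni_swap) (auto intro: sW lborel.sigma_finite_measure_axioms)
 also have "... = (II w. g (sgn (w + h *R e)) * enn (h / (real (Suc m) * norm (w + h *R e) ^ Suc m)) dd leb ?W)"
 proof (rule nn_integral_cong_AE, use AE_leb[OF W] in eventually_elim)
  fix w assume "w : ?W"
  then have "norm (w + h *R e) = sqrt ((norm w)^2 + h^2)" using e by (intro norm_add_orthogonal_unit) (auto simp: comp_iff)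
  then have a: "0 < norm (w + h *R e) / h" using h by (simp add: add_nonneg_pos)
  have "?h ((t / h) *R (w + h *R e)) * (enn ((1 / h) ^ m * t ^ m) * ind {0<..} t)
   = g (sgn (w + h *R e)) * (enn ((1 / h) ^ m * t ^ m) * (ind {0<..} t * ind {..<1} (t * (norm (w + h *R e) / h))))" for t
  proof (cases "0 < t")
   case True
   have "sgn ((t / h) *R (w + h *R e)) = sgn (w + h *R e)" using True h by (simp only: sgn_scaleR) simp
   moreover have "ind (ball 0 1) ((t / h) *R (w + h *R e)) = (ind {..<1} (t * (norm (w + h *R e) / h)) :: ennreal)" using True h by (simp only: indicator_def mem_ball_0 norm_scaleR) simp
   ultimately show ?thesis by (simp only: mult_ac)
  next
   case False
   then have "ind {0<..} t = (0::ennreal)" by simp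
   then show ?thesis by (simp only: mult_zero_right mult_zero_left)
  qed
  then have "(II t. ?h ((t / h) *R (w + h *R e)) * (enn ((1 / h) ^ m * t ^ m) * ind {0<..} t) dd lborel)
   = g (sgn (w + h *R e)) * (II t. enn ((1 / h) ^ m * t ^ m) * (ind {0<..} t * ind {..<1} (t * (norm (w + h *R e) / h))) dd lborel)" by (simp only:) (rule nn_integral_cmult, simp)
  also have "... = g (sgn (w + h *R e)) * enn ((1 / h) ^ m / (real (Suc m) * (norm (w + h *R e) / h) ^ Suc m))" using h by (subst nni_scaled_power[OF a]) auto
  also have "(1 / h) ^ m / (real (Suc m) * (norm (w + h *R e) / h) ^ Suc m) = h / (real (Suc m) * norm (w + h *R e) ^ Suc m)" using h by (simp add: power_divide power_Suc)
  finally show "(II t. ?h ((t / h) *R (w + h *R e)) * (enn ((1 / h) ^ m * t ^ m) * ind {0<..} t) dd lborel)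
   = g (sgn (w + h *R e)) * enn (h / (real (Suc m) * norm (w + h *R e) ^ Suc m))" .
 qed
 finally have *: "(II x. ?h x dd leb V) = 2 * (II w. g (sgn (w + h *R e)) * enn (h / (real (Suc m) * norm (w + h *R e) ^ Suc m)) dd leb ?W)" by (simp only: mult_2)
 have "(II x. g x dd sph V) = (II x. ?h x dd leb V) / enn ?v" using nni_sph[OF V, of g] d by simp
 also have "... = (II w. 2 * (g (sgn (w + h *R e)) * enn (h / (real (Suc m) * norm (w + h *R e) ^ Suc m))) / enn ?v dd leb ?W)" unfolding * by (simp add: nn_integral_divide nn_integral_cmult)
 also have "... = (II w. g (sgn (w + h *R e)) * enn (2 / (real (Suc m) * ?v) * (h / norm (w + h *R e) ^ Suc m)) dd leb ?W)"
 proof (rule nn_integral_cong)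
  fix w
  have "2 * enn (h / (real (Suc m) * norm (w + h *R e) ^ Suc m)) / enn ?v
   = enn (2 * (h / (real (Suc m) * norm (w + h *R e) ^ Suc m)) / ?v)"
  proof -
   have "2 * enn (h / (real (Suc m) * norm (w + h *R e) ^ Suc m)) = enn (2 * (h / (real (Suc m) * norm (w + h *R e) ^ Suc m)))" by (subst ennreal_mult') auto
   then show ?thesis using h v by (simp only: divide_ennreal[OF _ v] mult_nonneg_nonneg divide_nonneg_nonneg
     zero_le_power norm_ge_zero of_nat_0_le_iff less_imp_le zero_le_numeral)
  qed
  also have "2 * (h / (real (Suc m) * norm (w + h *R e) ^ Suc m)) / ?v = 2 / (real (Suc m) * ?v) * (h / norm (w + h *R e) ^ Suc m)" by simp
  finally have E: "2 * enn (h / (real (Suc m) * norm (w + h *R e) ^ Suc m)) / enn ?v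
   = enn (2 / (real (Suc m) * ?v) * (h / norm (w + h *R e) ^ Suc m))" .
  show "2 * (g (sgn (w + h *R e)) * enn (h / (real (Suc m) * norm (w + h *R e) ^ Suc m))) / enn ?v
   = g (sgn (w + h *R e)) * enn (2 / (real (Suc m) * ?v) * (h / norm (w + h *R e) ^ Suc m))" unfolding E[symmetric] ennreal_times_divide by (simp only: mult.left_commute)
 qed
 finally show ?thesis .
qed

text \<open>Passing to the graph stretches only the direction of \<open>a\<close>, by sqrt (1 +
  |a|^2); on the complement of that direction the functional vanishes and the graph is flat.\<close>

lemma nni_graph_image:
 fixes X :: "'a::euclidean_space set" and a :: 'a
 assumes X: "subspace X" and a: "a : X" and d: "0 < dim X" and [measurable]: "g : bmeas borel"
 defines "L \<equiv> %y. (y, a *. y)"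
 shows "(II z. g z dd leb (L ` X)) = enn (sqrt (1 + (norm a)^2)) * (II y. g (L y) dd leb X)"
proof -
 have L: "linear L" unfolding L_def by (rule linearI) (auto simp: inner_add_right)
 note [measurable] = bm_linear[OF L]
 \<comment> \<open>For \<open>a = 0\<close> any unit vector of \<open>X\<close> serves; positive
   dimension provides one.\<close>
 obtain e where e: "e : X" "norm e = 1" and ae: "a = norm a *R e"
 proof (cases "a = 0")
  case True
  have "X ~= {0}" using d by auto
  then obtain b where "b : X" "b ~= 0" using subspace_0[OF X] by blast
  then have "sgn b : X" "norm (sgn b) = 1" using X by (simp_all add: norm_sgn) (simp add: sgn_div_norm subspace_scale)
  moreover have "a = norm a *R sgn b" using True by simp
  ultimately show ?thesis by (rule that)
 next
  case False
  then have "sgn a : X" "norm (sgn a) = 1" using X a by (simp_all add: norm_sgn) (simp add: sgn_div_norm subspace_scale)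
  moreover have "a = norm a *R sgn a" using False by (simp add: sgn_div_norm)
  ultimately show ?thesis by (rule that)
 qed
 let ?c = "sqrt (1 + (norm a)^2)"
 have c: "0 < ?c" by (simp add: add_pos_nonneg)
 define e' where "e' = (1 / ?c) *R L e"
 have ee: "e *. e = 1" using e(2) by (simp add: norm_eq_1)
 have ia: "a *. y = norm a * (e *. y)" for y by (subst ae) simp
 have Le: "L e = (e, norm a)" by (simp add: L_def ia ee)
 have "norm (L e) = ?c" unfolding Le by (simp add: norm_Pair e)
 then have e'1: "norm e' = 1" unfolding e'_def using c by simp
 have LX: "subspace (L ` X)" using X L by (rule linear_subspace_image[rotated])
 have e'2: "e' : L ` X" unfolding e'_def using e LX by (intro subspace_scale) auto
 let ?J = "%y::'a. (y, 0::real)"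
 have J: "linear ?J" by (rule linearI) auto
 have img: "L ` X Int {e'}^o = ?J ` (X Int {e}^o)"
 proof -
  have "L y *. e' = ?c * (y *. e)" for y
  proof -
   have "L y *. e' = (1 / ?c) * (y *. e + (norm a)^2 * (y *. e))" unfolding e'_def Le L_def ia by (simp add: inner_commute power2_eq_square ee distrib_right add_divide_distrib)
   also have "... = (1 / ?c) * ((1 + (norm a)^2) * (y *. e))" by (simp add: distrib_right)
   also have "... = ?c * (y *. e)"
   proof -
    have "(1 / k) * (k * k * z) = k * z" if "0 < k" for k z :: real using that by simp
    from this[OF c] show ?thesis by (simp only: real_sqrt_mult_self) (simp add: add_nonneg_nonneg)
   qed
   finally show ?thesis .
  qed
  then have 1: "L y : {e'}^o <-> y : {e}^o" for y using c by (simp add: comp_iff)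
  have 2: "L y = ?J y" if "y : {e}^o" for y using that ia[of y] by (simp add: L_def comp_iff inner_commute)
  have "L ` X Int {e'}^o = L ` (X Int {e}^o)" by (auto simp: 1)
  also have "... = ?J ` (X Int {e}^o)" by (rule image_cong[OF refl]) (auto simp: 2)
  finally show ?thesis .
 qed
 have sig: "sfin (leb (X Int {e}^o))" by (intro sf_leb subspace_Int_comp X)
 interpret sigma_finite_measure "leb (X Int {e}^o)" by (rule sig)
 have Jm[measurable]: "?J : bmeas borel" by (rule bm_linear[OF J])
 have "(II z. g z dd leb (L ` X)) = (II t. II z. g (t *R e' + z) dd leb (?J ` (X Int {e}^o)) dd lborel)" using nni_leb_slice[OF LX e'2 e'1, of g] unfolding img by simp
 also have "... = (II t. II y. g (t *R e' + ?J y) dd leb (X Int {e}^o) dd lborel)"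
 proof -
  have "leb (?J ` (X Int {e}^o)) = distr (leb (X Int {e}^o)) borel ?J" by (rule leb_isometry[OF subspace_Int_comp[OF X] J]) (simp add: norm_Pair)
  then show ?thesis by (simp add: nn_integral_distr)
 qed
 also have "... = enn \<bar>?c\<bar> * (II t. II y. g ((0 + ?c * t) *R e' + ?J y) dd leb (X Int {e}^o) dd lborel)" using c by (intro nn_integral_real_affine) auto
 also have "(II t. II y. g ((0 + ?c * t) *R e' + ?J y) dd leb (X Int {e}^o) dd lborel)
  = (II t. II y. g (L (t *R e + y)) dd leb (X Int {e}^o) dd lborel)"
 proof (rule nn_integral_cong, rule nn_integral_cong_AE, use AE_leb[OF subspace_Int_comp[OF X]] in eventually_elim)
  fix t y assume "y : X Int {e}^o"
  then have "a *. y = 0" using ia[of y] by (simp add: comp_iff inner_commute)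
  then have "L (t *R e + y) = t *R L e + ?J y" by (simp add: linear_add[OF L] linear_scale[OF L]) (simp add: L_def)
  also have "t *R L e = (0 + ?c * t) *R e'" unfolding e'_def using c by simp
  finally show "g ((0 + ?c * t) *R e' + ?J y) = g (L (t *R e + y))" by simp
 qed
 also have "... = (II y. g (L y) dd leb X)" by (rule nni_leb_slice[OF X e, symmetric]) measurable
 finally show ?thesis using c by simp
qed

text \<open>The section of a sphere by \<open>{z}^o\<close> is the unit sphere of such a graph when
  the last coordinate of z is nonzero. Polar coordinates in \<open>X\<close> push the area factor of
  the graph down to the spheres.\<close>

lemma nni_sphere_graph:
 fixes X :: "'a::euclidean_space set" and a :: 'a
 assumes X: "subspace X" and a: "a : X" and d: "dim X = Suc m" and [measurable]: "g : bmeas borel"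
 defines "L \<equiv> %y. (y, a *. y)"
 shows "(II z. g z dd sph (L ` X))
  = enn (sqrt (1 + (norm a)^2)) * (II w. g (sgn (L w)) * enn (1 / norm (L w) ^ Suc m) dd sph X)"
proof -
 have L: "linear L" unfolding L_def by (rule linearI) (auto simp: inner_add_right)
 note [measurable] = bm_linear[OF L]
 have LX: "subspace (L ` X)" using X L by (rule linear_subspace_image[rotated])
 have "inj_on L X" by (rule inj_onI) (simp add: L_def)
 then have dL: "dim (L ` X) = Suc m" using X L d by (subst dim_image_eq) (auto simp: span_eq_iff[THEN iffD2])
 let ?v = "unit_ball_vol (real (Suc m))"
 have v: "0 < ?v" by simp
 let ?h = "%z. g (sgn z) * ind (ball 0 1) z"
 let ?f = "%r. enn (real (Suc m) * ?v * r ^ m) * ind {0<..} r"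
 have dpos: "0 < dim X" using d by simp
 have "(II z. g z dd sph (L ` X)) = (II z. ?h z dd leb (L ` X)) / enn ?v" using nni_sph[OF LX, of g] dL by simp
 also have "(II z. ?h z dd leb (L ` X)) = enn (sqrt (1 + (norm a)^2)) * (II y. ?h (L y) dd leb X)" using nni_graph_image[OF X a dpos, of ?h] unfolding L_def by simp
 also have "(II y. ?h (L y) dd leb X) = (II w. II r. ?h (L (r *R w)) * ?f r dd lborel dd sph X)" by (rule nni_polar[OF X d]) measurable
 also have "... = (II w. enn ?v * (g (sgn (L w)) * enn (1 / norm (L w) ^ Suc m)) dd sph X)"
 proof (rule nn_integral_cong_AE, use AE_sph[OF X dpos] in eventually_elim)
  fix w assume w: "w : X Int sphere 0 1"
  have "norm w <= norm (L w)" unfolding L_def by (metis fst_conv norm_fst_le)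
  then have p: "0 < norm (L w)" using w by auto
  have "?h (L (r *R w)) * ?f r = g (sgn (L w)) * (enn (real (Suc m) * ?v * r ^ m) * (ind {0<..} r * ind {..<1} (r * norm (L w))))" for r
  proof (cases "0 < r")
   case True
   have "sgn (L (r *R w)) = sgn (L w)" using True by (simp add: linear_scale[OF L] sgn_scaleR)
   moreover have "ind (ball 0 1) (L (r *R w)) = (ind {..<1} (r * norm (L w)) :: ennreal)" using True by (simp add: indicator_def linear_scale[OF L])
   ultimately show ?thesis by (simp only: mult_ac)
  next
   case False
   then have "ind {0<..} r = (0::ennreal)" by simp
   then show ?thesis by (simp only: mult_zero_right mult_zero_left)
  qed
  then have "(II r. ?h (L (r *R w)) * ?f r dd lborel)
   = g (sgn (L w)) * (II r. enn (real (Suc m) * ?v * r ^ m) * (ind {0<..} r * ind {..<1} (r * norm (L w))) dd lborel)" by (simp only:) (rule nn_integral_cmult, simp)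
  also have "... = g (sgn (L w)) * enn (real (Suc m) * ?v / (real (Suc m) * norm (L w) ^ Suc m))" using v by (subst nni_scaled_power[OF p]) auto
  also have "real (Suc m) * ?v / (real (Suc m) * norm (L w) ^ Suc m) = ?v * (1 / norm (L w) ^ Suc m)" by simp
  also have "g (sgn (L w)) * enn (?v * (1 / norm (L w) ^ Suc m)) = enn ?v * (g (sgn (L w)) * enn (1 / norm (L w) ^ Suc m))"
  proof -
   have "enn (?v * (1 / norm (L w) ^ Suc m)) = enn ?v * enn (1 / norm (L w) ^ Suc m)" using v by (intro ennreal_mult') simp
   then show ?thesis by (simp only: mult.left_commute)
  qed
  finally show "(II r. ?h (L (r *R w)) * ?f r dd lborel) = enn ?v * (g (sgn (L w)) * enn (1 / norm (L w) ^ Suc m))" .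
 qed
 also have "... = enn ?v * (II w. (g (sgn (L w)) * enn (1 / norm (L w) ^ Suc m)) dd sph X)" by (rule nn_integral_cmult) measurable
 finally have *: "(II z. g z dd sph (L ` X)) = enn (sqrt (1 + (norm a)^2)) * (enn ?v * (II w. (g (sgn (L w)) * enn (1 / norm (L w) ^ Suc m)) dd sph X)) / enn ?v" .
 show ?thesis unfolding * ennreal_times_divide[symmetric] ennreal_times_divide_cancel[OF v] ..
qed

text \<open>The substitution \<open>c = s / sqrt (1 + s^2)\<close>.\<close>

lemma nni_slice_substitution:
 fixes h :: "real => ennreal"
 assumes [measurable]: "h : bmeas borel"
 shows "(II s. h (s / sqrt (1 + s^2)) * enn (1 / sqrt (1 + s^2) ^ Suc (Suc m)) dd lborel)
  = (II c. h c * enn ((1 - c^2) powr ((real m - 1) / 2)) * ind {-1<..<1} c dd lborel)"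
proof -
 define q where "q s = s / sqrt (1 + s^2)" for s :: real
 have pos: "0 < 1 + s^2" for s :: real by (simp add: add_pos_nonneg)
 have q2: "1 - (q s)^2 = 1 / (1 + s^2)" for s
 proof -
  have nz: "1 + s^2 ~= 0" using pos[of s] by linarith
  have "(q s)^2 = s^2 / (1 + s^2)" unfolding q_def power_divide by (subst real_sqrt_pow2) (use pos[of s] in linarith, rule refl)
  moreover have "1 / (1 + s^2) = ((1 + s^2) - s^2) / (1 + s^2)" by simp
  moreover have "... = 1 - s^2 / (1 + s^2)" using nz by (subst diff_divide_distrib) simp
  ultimately show ?thesis by (simp only:)
 qed
 have q1: "-1 < q s" "q s < 1" for s
 proof -
  have "0 < 1 / (1 + s^2)" using pos[of s] by simp
  then have "(q s)^2 < 1" using q2[of s] by linarith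
  then show "-1 < q s" "q s < 1" by (auto simp: abs_square_less_1)
 qed
 have der: "(q has_real_derivative 1 / sqrt (1 + s^2) ^ 3) (at s)" for s
 proof -
  have alg: "(1 * u - r * (inverse u / 2 * (2 * r))) / (u * u) = 1 / u ^ 3" if "0 < u" "u * u = 1 + r * r" for u r :: real
  proof -
   have "1 * u - r * (inverse u / 2 * (2 * r)) = (u * u - r * r) / u" using that(1) by (simp add: field_simps)
   also have "... = 1 / u" unfolding that(2) by simp
   finally show ?thesis by (simp add: power3_eq_cube)
  qed
  have "((%s. 1 + s^2) has_real_derivative 2 * s) (at s)" by (auto intro!: derivative_eq_intros)
  from DERIV_chain2[OF DERIV_real_sqrt[OF pos] this]
  have "((%s. sqrt (1 + s^2)) has_real_derivative inverse (sqrt (1 + s^2)) / 2 * (2 * s)) (at s)" .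
  from DERIV_divide[OF DERIV_ident this] pos[of s]
  have "(q has_real_derivative (1 * sqrt (1 + s^2) - s * (inverse (sqrt (1 + s^2)) / 2 * (2 * s))) / (sqrt (1 + s^2) * sqrt (1 + s^2))) (at s)" unfolding q_def by simp
  also have "(1 * sqrt (1 + s^2) - s * (inverse (sqrt (1 + s^2)) / 2 * (2 * s))) / (sqrt (1 + s^2) * sqrt (1 + s^2)) = 1 / sqrt (1 + s^2) ^ 3" by (rule alg) (use pos[of s] in \<open>simp_all add: power2_eq_square\<close>)
  finally show ?thesis .
 qed
 let ?w = "%c. enn ((1 - c^2) powr ((real m - 1) / 2))"
 \<comment> \<open>In powers of sqrt (1 + s^2): the weight contributes 1 - m and the derivative of
   \<open>q\<close> contributes -3, together -(m + 2).\<close>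
 have w: "(1 - (q s)^2) powr ((real m - 1) / 2) * (1 / sqrt (1 + s^2) ^ 3) = 1 / sqrt (1 + s^2) ^ Suc (Suc m)" for s
 proof -
  define u where "u = sqrt (1 + s^2)"
  have u: "0 < u" "1 + s^2 = u ^ 2" using pos[of s] by (auto simp: u_def)
  have p2: "1 / u^2 = u powr (-2)" and p3: "1 / u ^ 3 = u powr (-3)" using powr_minus[of u 2] powr_minus[of u 3] powr_numeral[of u "num.Bit0 num.One"] powr_numeral[of u "num.Bit1 num.One"] u(1) by (simp_all only: less_imp_le divide_inverse mult_1)
  have "(1 - (q s)^2) powr ((real m - 1) / 2) = u powr (-2 * ((real m - 1) / 2))" unfolding q2 u(2) p2 by (rule powr_powr)
  also have "-2 * ((real m - 1) / 2) = 1 - real m" by simp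
  finally have "(1 - (q s)^2) powr ((real m - 1) / 2) * (1 / u ^ 3) = u powr (1 - real m) * u powr (-3)" unfolding p3 by (rule arg_cong)
  also have "... = u powr (1 - real m + -3)" by (rule powr_add[symmetric])
  also have "1 - real m + -3 = - real (Suc (Suc m))" by (simp add: of_nat_Suc)
  also have "u powr (- real (Suc (Suc m))) = 1 / u ^ Suc (Suc m)" using powr_minus[of u "real (Suc (Suc m))"] powr_realpow[OF u(1), of "Suc (Suc m)"] by (simp only: divide_inverse mult_1)
  finally show ?thesis by (simp only: u_def)
 qed
 have mono: "q a <= q b" if "a <= b" for a b
 proof (rule DERIV_nonneg_imp_nondecreasing[OF that])
  fix x assume "a <= x" "x <= b"
  show "EX y. (q has_real_derivative y) (at x) & 0 <= y" by (intro exI[of _ "1 / sqrt (1 + x^2) ^ 3"] conjI der) simp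
 qed
 have [measurable]: "q : bmeas borel" unfolding q_def by measurable
 \<comment> \<open>Substitution on the compact intervals [-N, N]; since \<open>q\<close> maps the
   line onto (-1, 1), monotone convergence finishes on both sides.\<close>
 have sub: "(II c. h c * ?w c * ind {q (- real N)..q (real N)} c dd lborel)
  = (II s. h (q s) * enn (1 / sqrt (1 + s^2) ^ Suc (Suc m)) * ind {- real N..real N} s dd lborel)" for N
 proof (cases "N = 0")
  case False
  have "(II c. h c * ?w c * ind {q (- real N)..q (real N)} c dd lborel)
   = (II s. h (q s) * ?w (q s) * enn (1 / sqrt (1 + s^2) ^ 3) * ind {- real N..real N} s dd lborel)"
  proof (rule nn_integral_substitution_aux)
   show "continuous_on {- real N..real N} (%s. 1 / sqrt (1 + s^2) ^ 3)"
   proof (intro continuous_on_divide continuous_on_const continuous_on_power continuous_on_real_sqrt continuous_on_add continuous_on_id ballI)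
    fix s show "sqrt (1 + s^2) ^ 3 ~= 0" using pos[of s] by simp
   qed
  qed (use der False in auto)
  also have "... = (II s. h (q s) * enn (1 / sqrt (1 + s^2) ^ Suc (Suc m)) * ind {- real N..real N} s dd lborel)" by (rule nn_integral_cong) (simp only: mult.assoc ennreal_mult'[symmetric] w powr_ge_zero)
  finally show ?thesis .
 next
  case True
  have "(II s. k s * ind {0..0} s dd lborel) = 0" for k :: "real => ennreal"
  proof -
   have "(II s. k s * ind {0..0} s dd lborel) = (II s. 0 dd (lborel :: real measure))" by (rule nn_integral_cong_AE, use AE_lborel_singleton[of 0] in eventually_elim) (auto simp: indicator_def)
   then show ?thesis by simp
  qed
  moreover have "q 0 = 0" by (simp add: q_def)
  ultimately show ?thesis using True by simp
 qed
 have "(II c. h c * ?w c * ind {-1<..<1} c dd lborel) = (II c. (SUP N. h c * ?w c * ind {q (- real N)..q (real N)} c) dd lborel)"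
 proof (rule nn_integral_cong)
  fix c
  show "h c * ?w c * ind {-1<..<1} c = (SUP N. h c * ?w c * ind {q (- real N)..q (real N)} c)"
  proof (cases "c : {-1<..<1}")
   case True
   define s where "s = c / sqrt (1 - c^2)"
   have c1: "0 < 1 - c^2" using True by (simp add: abs_square_less_1 abs_less_iff)
   have "1 + s^2 = 1 / (1 - c^2)" using c1 by (simp add: s_def power_divide field_simps)
   then have qs: "q s = c" using c1 by (simp add: q_def real_sqrt_divide) (simp add: s_def)
   obtain N where N: "\<bar>s\<bar> <= real N" using real_arch_simple by blast
   then have "c : {q (- real N)..q (real N)}" using mono[of "- real N" s] mono[of s "real N"] qs by auto
   then have "h c * ?w c * ind {-1<..<1} c <= h c * ?w c * ind {q (- real N)..q (real N)} c" using True by simp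
   also have "... <= (SUP N. h c * ?w c * ind {q (- real N)..q (real N)} c)" by (rule SUP_upper) simp
   finally show ?thesis using True by (intro antisym SUP_least) (auto simp: indicator_def)
  next
   case False
   then have "c ~: {q (- real N)..q (real N)}" for N using q1[of "- real N"] q1[of "real N"] by auto
   then have z1: "h c * ?w c * ind {q (- real N)..q (real N)} c = 0" for N by simp
   have z2: "ind {-1<..<1} c = (0::ennreal)" using False by simp
   show ?thesis unfolding z1 z2 by simp
  qed
 qed
 also have "... = (SUP N. (II c. h c * ?w c * ind {q (- real N)..q (real N)} c dd lborel))"
 proof (rule nn_integral_monotone_convergence_SUP)
  show "incseq (%N c. h c * ?w c * ind {q (- real N)..q (real N)} c)"
  proof (intro incseq_SucI le_funI mult_left_mono)
   fix N c
   show "ind {q (- real N)..q (real N)} c <= (ind {q (- real (Suc N))..q (real (Suc N))} c :: ennreal)" using mono[of "real N" "real (Suc N)"] mono[of "- real (Suc N)" "- real N"] by (auto simp: indicator_def of_nat_Suc)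
  qed simp
 qed measurable
 also have "... = (SUP N. (II s. h (q s) * enn (1 / sqrt (1 + s^2) ^ Suc (Suc m)) * ind {- real N..real N} s dd lborel))" unfolding sub ..
 also have "... = (II s. (SUP N. h (q s) * enn (1 / sqrt (1 + s^2) ^ Suc (Suc m)) * ind {- real N..real N} s) dd lborel)"
 proof (rule nn_integral_monotone_convergence_SUP[symmetric])
  show "incseq (%N s. h (q s) * enn (1 / sqrt (1 + s^2) ^ Suc (Suc m)) * ind {- real N..real N} s)" by (intro incseq_SucI le_funI mult_left_mono) (auto simp: indicator_def of_nat_Suc)
 qed measurable
 also have "... = (II s. h (q s) * enn (1 / sqrt (1 + s^2) ^ Suc (Suc m)) dd lborel)"
 proof (rule nn_integral_cong)
  fix s
  let ?k = "h (q s) * enn (1 / sqrt (1 + s^2) ^ Suc (Suc m))"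
  obtain N where N: "\<bar>s\<bar> <= real N" using real_arch_simple by blast
  then have "?k = ?k * ind {- real N..real N} s" by (simp add: abs_le_iff)
  also have "... <= (SUP N. ?k * ind {- real N..real N} s)" by (rule SUP_upper) simp
  finally show "(SUP N. ?k * ind {- real N..real N} s) = ?k" by (intro antisym SUP_least) (auto simp: indicator_def)
 qed
 finally show ?thesis by (simp add: q_def)
qed

declare of_nat_Suc [simp] power_Suc [simp]

section \<open>The Funk transform and means over sections of the sphere\<close>

lemma mem_comp_singleton: "x : {e}^o <-> x *. e = 0" by (simp add: comp_iff)

text \<open>For a unit vector q of \<open>Y\<close> this is the normalised projection of x to the
  complement of q in \<open>Y\<close>. A uniform x gives a uniform point of the equator of q, so the
  random parameter does not depend on q.\<close>

definition pole_dir :: "'a::euclidean_space set => 'a => 'a => 'a" where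
 "pole_dir Y q x = sgn (proj Y x - (x *. q) *R q)"

text \<open>For random \<open>x\<close>, \<open>cap Y r q x\<close> is a random point of the section
 $\{\sigma : \sigma\cdot q = r\}$ of the unit sphere of \<open>Y\<close>.\<close>

definition cap :: "'a::euclidean_space set => real => 'a => 'a => 'a" where
 "cap Y r q x = r *R q + sqrt (1 - r^2) *R pole_dir Y q x"

lemma bm_pole_dir[measurable]:
 fixes Y :: "'a::euclidean_space set"
 assumes Y: "subspace Y" and f: "f : bmeas M" "g : bmeas M"
 shows "(%x. pole_dir Y (f x) (g x)) : bmeas M"
proof -
 note [measurable] = bm_proj[OF Y] f
 show ?thesis unfolding pole_dir_def by measurable
qed

lemma bm_cap[measurable]:
 fixes Y :: "'a::euclidean_space set"
 assumes Y: "subspace Y" and f: "f : bmeas M" "g : bmeas M" "r : bmeas M"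
 shows "(%x. cap Y (r x) (f x) (g x)) : bmeas M"
proof -
 note [measurable] = f bm_pole_dir[OF Y f(1,2)]
 show ?thesis unfolding cap_def by measurable
qed

lemma proj_line:
 fixes q :: "'a::euclidean_space"
 assumes "norm q = 1" shows "proj (span {q}) x = (x *. q) *R q"
proof (rule proj_subspaceI)
 have "q *. q = 1" using assms by (simp add: norm_eq_1)
 then show "x - (x *. q) *R q : (span {q})^o" by (simp add: comp_span_singleton comp_iff inner_diff_left)
qed (auto intro: span_scale span_base)

lemma proj_Int_comp_unit:
 fixes Y :: "'a::euclidean_space set"
 assumes Y: "subspace Y" and q: "q : Y" "norm q = 1"
 shows "proj (Y Int {q}^o) x = proj Y x - (x *. q) *R q"
proof -
 have "span {q} \<subseteq> Y" using Y q by (intro span_minimal) auto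
 from proj_Int_comp[OF Y subspace_span this] show ?thesis by (simp add: comp_span_singleton proj_line[OF q(2)])
qed

lemma sph_comp:
 fixes Y :: "'a::euclidean_space set"
 assumes Y: "subspace Y" and q: "q : Y" "norm q = 1" and d: "2 <= dim Y"
 shows "sph (Y Int {q}^o) = distr (sph UNIV) borel (pole_dir Y q)"
proof -
 have "0 < dim (Y Int {q}^o)" using dim_Int_comp_unit[OF Y q] d by simp
 from sph_eq_distr[OF subspace_Int_comp[OF Y] this] show ?thesis by (simp add: proj_Int_comp_unit[OF Y q] pole_dir_def[abs_def])
qed

lemma nni_sphere_comp:
 fixes Y :: "'a::euclidean_space set"
 assumes "subspace Y" "q : Y" "norm q = 1" "2 <= dim Y" and [measurable]: "g : bmeas borel"
 shows "(II s. g s dd sph (Y Int {q}^o)) = (II x. g (pole_dir Y q x) dd sph UNIV)" unfolding sph_comp[OF assms(1-4)] by (rule nn_integral_distr) (use bm_pole_dir[OF assms(1), of "%_. q" "sph UNIV" "%x. x"] in auto)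

lemma AE_pole_dir:
 fixes Y :: "'a::euclidean_space set"
 assumes Y: "subspace Y" and q: "q : Y" "norm q = 1" and d: "2 <= dim Y"
 shows "AE x in sph UNIV. pole_dir Y q x : Y Int {q}^o Int sphere 0 1"
proof -
 let ?W = "Y Int {q}^o"
 have W: "subspace ?W" "0 < dim ?W" using dim_Int_comp_unit[OF Y q] d subspace_Int_comp[OF Y] by auto
 have "closed (?W Int sphere 0 1)" using closed_subspace[OF W(1)] closed_sphere by (rule closed_Int)
 then have m: "{x : space borel. x : ?W Int sphere 0 1} : sets borel" by (simp only: space_borel UNIV_I simp_thms Collect_mem_eq borel_closed)
 have "pole_dir Y q : measurable (sph UNIV) borel" using bm_pole_dir[OF Y, of "%_. q" "sph UNIV" "%x. x"] by simp
 then show ?thesis using AE_sph[OF W] unfolding sph_comp[OF Y q d] by (subst (asm) AE_distr_iff[OF _ m]) auto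
qed

lemma cap_in_sphere:
 assumes "subspace Y" "q : Y" "norm q = 1" "pole_dir Y q x : Y Int {q}^o Int sphere 0 1" "\<bar>r\<bar> <= 1"
 shows "cap Y r q x : Y Int sphere 0 1"
proof -
 let ?p = "pole_dir Y q x"
 have "orthogonal (r *R q) (sqrt (1 - r^2) *R ?p)" using assms(4) by (auto simp: orthogonal_def comp_iff inner_commute)
 then have "(norm (cap Y r q x))^2 = r^2 + (sqrt (1 - r^2))^2" unfolding cap_def using assms by (simp add: norm_add_Pythagorean power_mult_distrib)
 also have "... = 1" using assms(5) by (simp add: abs_square_le_1)
 finally have "(norm (cap Y r q x))^2 = 1" .
 then have "norm (cap Y r q x) = 1" by (simp add: power2_eq_1_iff) (use norm_ge_zero[of "cap Y r q x"] in linarith)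
 then show ?thesis using assms unfolding cap_def by (auto intro!: subspace_add subspace_scale)
qed

lemma distr_pair_AE:
 assumes M: "sfin M" and N: "sfin N"
  and "{z : space (M xx N). P z} : sets (M xx N)" "AE x in M. AE y in N. P (x, y)"
 shows "AE z in M xx N. P z"
proof -
 interpret M: sigma_finite_measure M by fact
 interpret N: sigma_finite_measure N by fact
 interpret pair_sigma_finite M N ..
 show ?thesis using assms(3,4) by (rule AE_pair_measure)
qed

lemma sph_UNIV_reflection:
 assumes "norm u = 1"
 shows "distr (sph UNIV) borel (reflection u) = (sph UNIV :: 'a::euclidean_space measure)"
proof -
 have "orth (reflection u)" using assms by (rule orth_reflection)
 then have "linear (reflection u)" "norm (reflection u x) = norm x" for x by (auto simp: orthogonal_transformation)
 from sph_isometry[OF subspace_UNIV this] reflection_image[OF subspace_UNIV UNIV_I assms]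
 show ?thesis by simp
qed

lemma sph_reflection:
 fixes Y :: "'a::euclidean_space set"
 assumes "subspace Y" "u : Y" "norm u = 1"
 shows "distr (sph Y) borel (reflection u) = sph Y"
proof -
 have "orth (reflection u)" using assms(3) by (rule orth_reflection)
 then have "linear (reflection u)" "norm (reflection u x) = norm x" for x by (auto simp: orthogonal_transformation)
 from sph_isometry[OF assms(1) this] reflection_image[OF assms]
 show ?thesis by simp
qed

lemma cap_reflection:
 fixes Y :: "'a::euclidean_space set"
 assumes Y: "subspace Y" and u: "u : Y" "norm u = 1"
 shows "reflection u (cap Y r q x) = cap Y r (reflection u q) (reflection u x)"
proof -
 have R: "orth (reflection u)" using u(2) by (rule orth_reflection)
 then have lin: "linear (reflection u)" and nrm: "!!x. norm (reflection u x) = norm x"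
  and inn: "!!x y. reflection u x *. reflection u y = x *. y" by (auto simp: orthogonal_transformation) (simp add: orthogonal_transformation_def R[unfolded orthogonal_transformation_def])
 have "reflection u (proj Y x) = proj Y (reflection u x)" by (simp add: reflection_def linear_diff[OF linear_proj[OF Y]] linear_scale[OF linear_proj[OF Y]]
    proj_subspace_eq[OF Y u(1)] proj_dot_subspace[OF Y u(1)])
 then have "reflection u (pole_dir Y q x) = pole_dir Y (reflection u q) (reflection u x)" unfolding pole_dir_def linear_sgn[OF lin nrm] inn by (simp add: linear_diff[OF lin] linear_scale[OF lin])
 then show ?thesis unfolding cap_def by (simp add: linear_add[OF lin] linear_scale[OF lin])
qed

text \<open>\<open>cap\<close> commutes with reflections along vectors of \<open>Y\<close>, so the
  mixture of all sections at height \<open>r\<close> is invariant and hence uniform. This controls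
  means over sections in L1, and it is the common distribution to which
  \<open>L1_compose_limit\<close> is applied.\<close>

lemma sph_cap:
 fixes Y :: "'a::euclidean_space set"
 assumes Y: "subspace Y" and d: "2 <= dim Y" and r: "\<bar>r\<bar> <= 1"
 shows "distr (sph Y xx sph UNIV) borel (%(q, x). cap Y r q x) = sph Y"
proof (rule sph_eqI[OF Y])
 let ?U = "sph (UNIV :: 'a set)" and ?S = "sph Y"
 interpret U: prob_space ?U by (rule prob_sph) simp
 interpret S: prob_space ?S using Y by (rule prob_sph)
 interpret US: pair_prob_space ?S ?U ..
 have m[measurable]: "(%(q, x). cap Y r q x) : bmeas (borel xx borel)" using bm_cap[OF Y, of fst "borel xx borel" snd "%_. r"] by (simp add: case_prod_beta')
 have m2[measurable]: "(%(q, x). cap Y r q x) : measurable (?S xx ?U) borel" using m measurable_cong_sets[OF sets_pair_measure_cong[OF sets_sph sets_sph] refl] by blast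
 show "prob_space (distr (?S xx ?U) borel (%(q, x). cap Y r q x))" by (rule US.prob_space_distr) (rule m2)
 have cl: "closed (Y Int sphere 0 1)" using closed_subspace[OF Y] by (intro closed_Int) auto
 then have m1: "{x : space borel. x : Y Int sphere 0 1} : sets borel" by (simp only: space_borel UNIV_I simp_thms Collect_mem_eq borel_closed)
 show "AE x in distr (?S xx ?U) borel (%(q, x). cap Y r q x). x : Y Int sphere 0 1"
 proof (subst AE_distr_iff[OF m2 m1], rule distr_pair_AE[OF S.sigma_finite_measure_axioms U.sigma_finite_measure_axioms])
  have "(%(q, x). cap Y r q x) -` (Y Int sphere 0 1) Int space (?S xx ?U) : sets (?S xx ?U)" using m2 by (rule measurable_sets) (use cl in auto)
  then show "{z : space (?S xx ?U). (case z of (q, x) => cap Y r q x) : Y Int sphere 0 1} : sets (?S xx ?U)" by (simp add: vimage_def Int_def conj_commute)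
  have "AE q in ?S. q : Y Int sphere 0 1" using d by (intro AE_sph[OF Y]) simp
  then show "AE q in ?S. AE x in ?U. (case (q, x) of (q, x) => cap Y r q x) : Y Int sphere 0 1"
  proof eventually_elim
   fix q assume "q : Y Int sphere 0 1"
   then have q: "q : Y" "norm q = 1" by auto
   show "AE x in ?U. (case (q, x) of (q, x) => cap Y r q x) : Y Int sphere 0 1" using AE_pole_dir[OF Y q d] by eventually_elim (use cap_in_sphere[OF Y q _ r] in simp)
  qed
 qed
 fix u assume u: "u : Y" "norm u = 1"
 have "linear (reflection u)" using orth_reflection[OF u(2)] by (simp add: orthogonal_transformation)
 note Rm[measurable] = bm_linear[OF this]
 have "distr (distr (?S xx ?U) borel (%(q, x). cap Y r q x)) borel (reflection u)
  = distr (?S xx ?U) borel (reflection u \<circ> (%(q, x). cap Y r q x))" by (rule distr_distr[OF Rm m2])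
 also have "reflection u \<circ> (%(q, x). cap Y r q x) = (%(q, x). cap Y r q x) \<circ> (%(q, x). (reflection u q, reflection u x))" by (auto simp: cap_reflection[OF Y u] fun_eq_iff)
 also have "distr (?S xx ?U) borel ... = distr (distr (?S xx ?U) (borel xx borel) (%(q, x). (reflection u q, reflection u x))) borel (%(q, x). cap Y r q x)" by (rule distr_distr[symmetric, OF m]) measurable
 also have "distr (?S xx ?U) (borel xx borel) (%(q, x). (reflection u q, reflection u x))
  = distr ?S borel (reflection u) xx distr ?U borel (reflection u)" by (rule pair_measure_distr[symmetric])
   (auto simp: sph_UNIV_reflection[OF u(2)] intro: U.sigma_finite_measure_axioms)
 also have "... = ?S xx ?U" by (simp only: sph_UNIV_reflection[OF u(2)] sph_reflection[OF Y u])
 finally show "distr (distr (?S xx ?U) borel (%(q, x). cap Y r q x)) borel (reflection u)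
  = distr (?S xx ?U) borel (%(q, x). cap Y r q x)" .
qed (use d in auto)

lemma nni_sphere_cap:
 fixes Y :: "'a::euclidean_space set"
 assumes Y: "subspace Y" and d: "2 <= dim Y" and r: "\<bar>r\<bar> <= 1" and [measurable]: "g : bmeas borel"
 shows "(II q. II x. g (cap Y r q x) dd sph UNIV dd sph Y) = (II s. g s dd sph Y)"
proof -
 interpret U: sigma_finite_measure "sph (UNIV :: 'a set)" by (rule sf_sph) simp
 note [measurable] = bm_cap[OF Y]
 have "(II s. g s dd sph Y) = (II s. g s dd distr (sph Y xx sph UNIV) borel (%(q, x). cap Y r q x))" by (simp only: sph_cap[OF Y d r])
 also have "... = (II z. g (case z of (q, x) => cap Y r q x) dd (sph Y xx sph UNIV))" by (rule nn_integral_distr) measurable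
 also have "... = (II q. II x. g (cap Y r q x) dd sph UNIV dd sph Y)" by (subst U.nn_integral_fst[symmetric]) (auto simp: case_prod_beta')
 finally show ?thesis ..
qed

definition slice_const :: "nat => real" where
 "slice_const m = real (Suc m) * unit_ball_vol (real (Suc m)) / (real (Suc (Suc m)) * unit_ball_vol (real (Suc (Suc m))))"

lemma slice_const_pos: "0 < slice_const m" by (simp add: slice_const_def)

text \<open>The mean of a Funk transform over a section of the sphere, in terms of the means of the
 function itself over parallel sections.\<close>

lemma nni_funk_cap:
 fixes Y :: "'a::euclidean_space set"
 assumes Y: "subspace Y" and d: "dim Y = Suc (Suc (Suc m))" and h: "h : Y" "norm h = 1" and s: "0 <= s" "s <= 1"
  and [measurable]: "g : bmeas borel"
 shows "(II x. II z. g (pole_dir Y (cap Y (sqrt (1 - s^2)) h x) z) dd sph UNIV dd sph UNIV)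
  = (II c. enn (slice_const m) * (II x. g (cap Y (s * c) h x) dd sph UNIV)
    * enn ((1 - c^2) powr ((real m - 1) / 2)) * ind {-1<..<1} c dd lborel)"
proof -
 let ?U = "sph (UNIV :: 'a set)"
 have sU: "sfin ?U" by (rule sf_sph) simp
 interpret U: sigma_finite_measure ?U by (rule sU)
 define W where "W = Y Int {h}^o"
 have W: "subspace W" unfolding W_def using Y by (rule subspace_Int_comp)
 have dW: "dim W = Suc (Suc m)" using dim_Int_comp_unit[OF Y h] d by (simp add: W_def)
 have sW: "sfin (sph W)" using W by (rule sf_sph)
 interpret sW: sigma_finite_measure "sph W" by (rule sW)
 note [measurable] = bm_pole_dir[OF Y] bm_pole_dir[OF W] bm_cap[OF Y] bm_cap[OF W]
 have d2: "2 <= dim Y" "2 <= dim W" using d dW by auto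
 define t where "t = sqrt (1 - s^2)"
 have s2: "s^2 <= 1" using s by (simp add: power_le_one)
 have t: "t^2 = 1 - s^2" "0 <= t" using s2 by (auto simp: t_def)
 have st: "sqrt (1 - t^2) = s" using s by (simp add: t)
 have hh: "h *. h = 1" using h(2) by (simp add: norm_eq_1)
 \<comment> \<open>\<open>?w P\<close> is the point of the cap in the direction \<open>P\<close>,
   and \<open>?e P\<close> the unit vector orthogonal to it in the plane of h and P. The subsphere
   orthogonal to \<open>?w P\<close> is sliced along \<open>?e P\<close>.\<close>
 let ?w = "%P. t *R h + s *R P" and ?e = "%P. s *R h - t *R P"
 let ?q = "%u. sqrt (1 + u^2)"
 let ?G = "%u P z. g ((1 / ?q u) *R (pole_dir W P z + u *R ?e P)) * enn (slice_const m / ?q u ^ Suc (Suc m))"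
 have "(II x. II z. g (pole_dir Y (cap Y t h x) z) dd ?U dd ?U)
  = (II x. (%P. II z. g (pole_dir Y (?w P) z) dd ?U) (pole_dir Y h x) dd ?U)" by (simp add: cap_def st)
 also have "... = (II P. II z. g (pole_dir Y (?w P) z) dd ?U dd sph W)" unfolding W_def by (rule nni_sphere_comp[OF Y h d2(1), symmetric]) measurable
 also have "... = (II P. II u. II z. ?G u P z dd ?U dd lborel dd sph W)"
 proof (rule nn_integral_cong_AE)
  have "AE P in sph W. P : W Int sphere 0 1" using dW by (intro AE_sph[OF W]) simp
  then show "AE P in sph W. (II z. g (pole_dir Y (?w P) z) dd ?U) = (II u. II z. ?G u P z dd ?U dd lborel)"
  proof eventually_elim
   fix P assume "P : W Int sphere 0 1"
   then have P: "P : Y" "P : W" "norm P = 1" "P *. P = 1" "P *. h = 0" by (auto simp: W_def comp_iff norm_eq_1)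
   have tts: "t * t + s * s = 1" using t by (simp add: power2_eq_square)
   have w: "?w P : Y" "norm (?w P) = 1" using P h Y tts hh by (auto intro!: subspace_add subspace_scale simp: norm_eq_1 inner_add_left inner_add_right inner_commute)
   have e: "?e P : Y Int {?w P}^o" "norm (?e P) = 1" using P h Y tts hh by (auto intro!: subspace_diff subspace_scale
      simp: norm_eq_1 inner_add_left inner_add_right inner_diff_left inner_diff_right inner_commute comp_iff)
   \<comment> \<open>The pairs w, e and h, P span the same plane, so the slices are sections of the
     sphere of \<open>W\<close> by \<open>{P}^o\<close>, whatever \<open>s\<close> is.\<close>
   have sets: "Y Int {?w P}^o Int {?e P}^o = W Int {P}^o"
   proof -
    have iff: "y *. ?w P = 0 & y *. ?e P = 0 <-> y *. h = 0 & y *. P = 0" for y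
    proof
     assume *: "y *. ?w P = 0 & y *. ?e P = 0"
     have "y *. h = (t * t + s * s) * (y *. h)" using tts by simp
     also have "... = t * (y *. ?w P) + s * (y *. ?e P)" by (simp add: inner_add_right inner_diff_right algebra_simps)
     finally have 1: "y *. h = 0" using * by simp
     have "y *. P = (t * t + s * s) * (y *. P)" using tts by simp
     also have "... = s * (y *. ?w P) - t * (y *. ?e P)" by (simp add: inner_add_right inner_diff_right algebra_simps)
     finally show "y *. h = 0 & y *. P = 0" using * 1 by simp
    qed (simp add: inner_add_right inner_diff_right)
    show ?thesis by (simp only: set_eq_iff Int_iff mem_comp_singleton W_def conj_assoc iff simp_thms)
   qed
   have dd: "dim (Y Int {?w P}^o) = Suc (Suc m)" using dim_Int_comp_unit[OF Y w] d by simp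
   have "(II z. g (pole_dir Y (?w P) z) dd ?U) = (II v. g v dd sph (Y Int {?w P}^o))" by (rule nni_sphere_comp[OF Y w d2(1), symmetric]) measurable
   also have "... = (II u. II r. g ((1 / ?q u) *R (r + u *R ?e P)) * enn (slice_const m / ?q u ^ Suc (Suc m)) dd sph (W Int {P}^o) dd lborel)" using nni_sphere_slice[OF subspace_Int_comp[OF Y] e dd, of g] unfolding sets slice_const_def by simp
   also have "... = (II u. II z. ?G u P z dd ?U dd lborel)" by (rule nn_integral_cong, rule nni_sphere_comp[OF W P(2,3) d2(2)]) measurable
   finally show "(II z. g (pole_dir Y (?w P) z) dd ?U) = (II u. II z. ?G u P z dd ?U dd lborel)" .
  qed
 qed
 also have "... = (II u. II P. II z. ?G u P z dd ?U dd sph W dd lborel)" by (rule nni_swap[OF sW lborel.sigma_finite_measure_axioms]) measurable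
 also have "... = (II u. (%c. enn (slice_const m) * (II x. g (cap Y (s * c) h x) dd ?U)) (u / ?q u) * enn (1 / ?q u ^ Suc (Suc m)) dd lborel)"
 proof (rule nn_integral_cong)
  fix u :: real
  define b where "b = 1 / ?q u"
  define c where "c = u / ?q u"
  have q: "0 < ?q u" "?q u * ?q u = 1 + u^2" by (auto simp: add_pos_nonneg)
  have bc: "b^2 + c^2 = 1" "0 < b"
  proof -
   have "b^2 = 1 / (1 + u^2)" "c^2 = u^2 / (1 + u^2)" unfolding b_def c_def power_divide by simp_all
   moreover have "1 / (1 + u^2) + u^2 / (1 + u^2) = 1" unfolding add_divide_distrib[symmetric] using q by (intro divide_self) auto
   ultimately show "b^2 + c^2 = 1" by simp
   show "0 < b" using q by (simp add: b_def)
  qed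
  define k where "k = sqrt (1 - (s * c)^2)"
  have b2: "0 < b^2" using bc(2) by simp
  have "(s * c)^2 <= c^2" using s2 by (simp add: power_mult_distrib mult_left_le_one_le)
  then have "(s * c)^2 < 1" using bc b2 by linarith
  then have k: "0 < k" "k^2 = 1 - (s * c)^2" by (auto simp: k_def)
  \<comment> \<open>The sliced point has component s c along h; the rest has length k and its
    direction makes the cosine a with P. Averaging over P therefore makes that direction uniform on
    the sphere of \<open>W\<close>, by \<open>nni_sphere_cap\<close>.\<close>
  define a where "a = - (c * t) / k"
  have "(k * a)^2 = (c * t)^2" using k by (simp add: a_def)
  then have ka: "k^2 * a^2 = c^2 * t^2" by (simp add: power_mult_distrib)
  have a1: "1 - a^2 = (b / k)^2"
  proof -
   have "k^2 * (1 - a^2) = k^2 - c^2 * t^2" by (simp add: right_diff_distrib ka)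
   also have "... = 1 - c^2" unfolding k t by (simp add: algebra_simps power_mult_distrib)
   also have "... = b^2" using bc by simp
   finally show ?thesis using k(1) by (simp add: power_divide field_simps)
  qed
  have sa: "sqrt (1 - a^2) = b / k" unfolding a1 using bc k by simp
  have "0 <= 1 - a^2" unfolding a1 by simp
  then have a: "\<bar>a\<bar> <= 1" by (simp add: abs_square_le_1)
  have pt: "(1 / ?q u) *R (pole_dir W P z + u *R ?e P) = (s * c) *R h + k *R cap W a P z" for P z
  proof -
   have "k * a = - (c * t)" "k * (b / k) = b" using k by (auto simp: a_def)
   then have "k *R cap W a P z = b *R pole_dir W P z - (c * t) *R P" unfolding cap_def sa by (simp add: scaleR_add_right)
   moreover have "(1 / ?q u) *R (pole_dir W P z + u *R ?e P) = b *R pole_dir W P z + c *R ?e P" by (simp add: b_def c_def scaleR_add_right)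
   ultimately show ?thesis by (simp add: scaleR_diff_right mult.commute)
  qed
  have "(II P. II z. ?G u P z dd ?U dd sph W)
   = (II P. II z. (%p. g ((s * c) *R h + k *R p) * enn (slice_const m / ?q u ^ Suc (Suc m))) (cap W a P z) dd ?U dd sph W)" unfolding pt ..
  also have "... = (II p. g ((s * c) *R h + k *R p) * enn (slice_const m / ?q u ^ Suc (Suc m)) dd sph W)" by (rule nni_sphere_cap[OF W d2(2) a]) measurable
  also have "... = (II x. g ((s * c) *R h + k *R pole_dir Y h x) * enn (slice_const m / ?q u ^ Suc (Suc m)) dd ?U)" unfolding W_def by (rule nni_sphere_comp[OF Y h d2(1)]) measurable
  also have "... = (II x. g (cap Y (s * c) h x) dd ?U) * enn (slice_const m / ?q u ^ Suc (Suc m))" unfolding cap_def k_def[symmetric] by (rule nn_integral_multc) measurable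
  finally have F: "(II P. II z. ?G u P z dd ?U dd sph W)
   = (II x. g (cap Y (s * c) h x) dd ?U) * enn (slice_const m / ?q u ^ Suc (Suc m))" .
  have E: "enn (slice_const m / ?q u ^ Suc (Suc m)) = enn (slice_const m) * enn (1 / ?q u ^ Suc (Suc m))" using slice_const_pos[of m] by (subst ennreal_mult'[symmetric]) auto
  show "(II P. II z. ?G u P z dd ?U dd sph W)
   = (%c. enn (slice_const m) * (II x. g (cap Y (s * c) h x) dd ?U)) (u / ?q u) * enn (1 / ?q u ^ Suc (Suc m))" unfolding F unfolding E c_def[symmetric] by (simp only: mult_ac)
 qed
 also have "... = (II c. enn (slice_const m) * (II x. g (cap Y (s * c) h x) dd ?U) * enn ((1 - c^2) powr ((real m - 1) / 2)) * ind {-1<..<1} c dd lborel)" by (rule nni_slice_substitution) measurable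
 finally show ?thesis unfolding t_def .
qed

text \<open>Adding the reflected integral replaces the weight by w y + w (-y) = 1.\<close>

lemma nni_even_half:
 fixes k :: "real => ennreal" and w :: "real => real"
 assumes [measurable]: "k : bmeas borel" "w : bmeas borel"
  and k: "!!y. k (- y) = k y" and w: "!!y. 0 <= w y" "!!y. w y + w (- y) = 1"
 shows "(II y. k y * enn (w y) dd lborel) = enn (1 / 2) * (II y. k y dd lborel)"
proof -
 let ?I = "II y. k y * enn (w y) dd lborel"
 have "?I = enn \<bar>-1\<bar> * (II y. k (0 + -1 * y) * enn (w (0 + -1 * y)) dd lborel)" by (rule nn_integral_real_affine) auto
 then have "?I + ?I = ?I + (II y. k y * enn (w (- y)) dd lborel)" by (simp add: k)
 also have "... = (II y. k y * enn (w y) + k y * enn (w (- y)) dd lborel)" by (rule nn_integral_add[symmetric]) auto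
 also have "... = (II y. k y dd lborel)"
 proof (rule nn_integral_cong)
  fix y
  have "k y * enn (w y) + k y * enn (w (- y)) = k y * (enn (w y) + enn (w (- y)))" by (rule distrib_left[symmetric])
  also have "enn (w y) + enn (w (- y)) = 1" using w(1)[of y] w(1)[of "-y"] w(2)[of y] by (subst ennreal_plus[symmetric]) auto
  finally show "k y * enn (w y) + k y * enn (w (- y)) = k y" by simp
 qed
 finally have 1: "?I + ?I = (II y. k y dd lborel)" .
 have "?I = (enn (1/2) + enn (1/2)) * ?I" by (subst ennreal_plus[symmetric]) auto
 also have "... = enn (1/2) * (?I + ?I)" by (simp only: distrib_left distrib_right)
 finally show ?thesis unfolding 1 .
qed

lemma nni_beta_scale:
 assumes L: "0 < L"
 shows "(II y. enn ((L^2 - y^2) powr ((real m - 1) / 2)) * ind {-L<..<L} y dd lborel)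
  = enn (L ^ m) * (II c. enn ((1 - c^2) powr ((real m - 1) / 2)) * ind {-1<..<1} c dd lborel)"
proof -
 let ?a = "(real m - 1) / 2"
 have "(II y. enn ((L^2 - y^2) powr ?a) * ind {-L<..<L} y dd lborel)
  = enn \<bar>L\<bar> * (II c. enn ((L^2 - (0 + L * c)^2) powr ?a) * ind {-L<..<L} (0 + L * c) dd lborel)" using L by (intro nn_integral_real_affine) auto
 also have "... = (II c. enn L * (enn ((L^2 - (0 + L * c)^2) powr ?a) * ind {-L<..<L} (0 + L * c)) dd lborel)" using L by (subst nn_integral_cmult) auto
 also have "... = (II c. enn (L ^ m) * (enn ((1 - c^2) powr ?a) * ind {-1<..<1} c) dd lborel)"
 proof (rule nn_integral_cong)
  fix c
  show "enn L * (enn ((L^2 - (0 + L * c)^2) powr ?a) * ind {-L<..<L} (0 + L * c))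
   = enn (L ^ m) * (enn ((1 - c^2) powr ?a) * ind {-1<..<1} c)"
  proof (cases "c : {-1<..<1}")
   case True
   then have c: "0 <= 1 - c^2" by (simp add: abs_square_le_1 abs_le_iff)
   have "L * (L * L) powr ?a = L powr 1 * (L powr 1 * L powr 1) powr ?a" using L by simp
   also have "... = L powr (1 + (1 + 1) * ?a)" by (simp only: powr_add[symmetric] powr_powr)
   also have "1 + (1 + 1) * ?a = real m" by (simp add: field_simps)
   also have "L powr real m = L ^ m" using L by (rule powr_realpow)
   finally have 1: "L * (L * L) powr ?a = L ^ m" .
   have "L^2 - (0 + L * c)^2 = (L * L) * (1 - c^2)" by (simp add: power2_eq_square algebra_simps)
   then have "L * (L^2 - (0 + L * c)^2) powr ?a = L ^ m * (1 - c^2) powr ?a" using 1 L c by (simp only: powr_mult mult.assoc[symmetric] mult_nonneg_nonneg less_imp_le)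
   then have "enn L * enn ((L^2 - (0 + L * c)^2) powr ?a) = enn (L ^ m) * enn ((1 - c^2) powr ?a)" using L by (simp only: ennreal_mult'[symmetric] powr_ge_zero)
     (simp only: ennreal_mult''[symmetric] powr_ge_zero)
   moreover have "ind {-L<..<L} (0 + L * c) = (ind {-1<..<1} c :: ennreal)" using True L mult_strict_left_mono[of c 1 L] mult_strict_left_mono[of "-1" c L] by (simp add: indicator_def)
   ultimately show ?thesis by (simp only: mult.assoc[symmetric])
  next
   case False
   then have "0 + L * c ~: {-L<..<L}" using L mult_left_mono[of 1 c L] mult_left_mono[of c "-1" L] by (auto simp: not_less)
   then show ?thesis using False by simp
  qed
 qed
 also have "... = enn (L ^ m) * (II c. enn ((1 - c^2) powr ?a) * ind {-1<..<1} c dd lborel)" by (rule nn_integral_cmult) auto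
 finally show ?thesis .
qed

text \<open>The substitution \<open>y = s - t r / s\<close> rests on
 $(t^2-s^2)(1-r^2/s^2) = (t-r)^2 - (s - tr/s)^2$.\<close>

lemma nni_funk_kernel:
 assumes r: "0 < r" "r < t"
 shows "(II s. enn (((t^2 - s^2) * (1 - (r / s)^2)) powr ((real m - 1) / 2)) * ind {r<..<t} s dd lborel)
  = enn ((t - r) ^ m / 2) * (II c. enn ((1 - c^2) powr ((real m - 1) / 2)) * ind {-1<..<1} c dd lborel)"
proof -
 let ?a = "(real m - 1) / 2"
 define L where "L = t - r"
 have L: "0 < L" using r by (simp add: L_def)
 have tr: "0 < t * r" using r by simp
 define R where "R y = sqrt (y^2 + 4 * (t * r))" for y
 have pos: "0 < y^2 + 4 * (t * r)" for y using tr by (intro add_nonneg_pos) auto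
 have R: "0 < R y" "(R y)^2 = y^2 + 4 * (t * r)" for y using pos[of y] by (auto simp: R_def)
 \<comment> \<open>The positive root of s^2 - y s - t r = 0, that is, the inverse of the
   substitution y = s - t r / s.\<close>
 define g where "g y = (y + R y) / 2" for y
 define g' where "g' y = (1 + y / R y) / 2" for y
 have absR: "\<bar>y\<bar> < R y" for y
 proof -
  have "\<bar>y\<bar>^2 < (R y)^2" unfolding R(2) using tr by simp
  from power2_less_imp_less[OF this less_imp_le[OF R(1)[of y]]] show ?thesis .
 qed
 have g0: "0 < g y" for y using absR[of y] by (simp add: g_def)
 have gy: "g y - t * r / g y = y" for y
 proof -
  have R2: "R y * R y = y * y + 4 * (t * r)" using R(2)[of y] by (simp only: power2_eq_square)
  have "(y + R y) * (y + R y) = 2 * y * (y + R y) + 4 * (t * r)" by (simp add: distrib_left distrib_right R2)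
  moreover have "g y * g y = (y + R y) * (y + R y) / 4" by (simp add: g_def)
  moreover have "y * g y = 2 * y * (y + R y) / 4" by (simp add: g_def)
  ultimately have "g y * g y - t * r = y * g y" by linarith
  then have "(g y * g y - t * r) / g y = y" using g0[of y] by simp
  then show ?thesis using g0[of y] by (simp add: diff_divide_distrib)
 qed
 have dR: "(R has_real_derivative y / R y) (at y)" for y
 proof -
  have "((%y. y^2 + 4 * (t * r)) has_real_derivative 2 * y) (at y)" by (auto intro!: derivative_eq_intros)
  from DERIV_chain2[OF DERIV_real_sqrt[OF pos] this]
  have "(R has_real_derivative inverse (R y) / 2 * (2 * y)) (at y)" unfolding R_def .
  moreover have "inverse (R y) / 2 * (2 * y) = y / R y" by (simp only: divide_inverse) simp
  ultimately show ?thesis by (simp only:)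
 qed
 have dg: "(g has_real_derivative g' y) (at y)" for y
 proof -
  have "((%y. (y + R y) / 2) has_real_derivative (1 + y / R y) / 2) (at y)" by (intro DERIV_cdivide DERIV_add DERIV_ident dR)
  then show ?thesis unfolding g_def g'_def .
 qed
 have g'0: "0 <= g' y" for y
 proof -
  have "- (y / R y) <= 1" using absR[of y] R(1)[of y] by (simp add: field_simps)
  then show ?thesis by (simp add: g'_def)
 qed
 have Rneg: "R (- y) = R y" for y by (simp add: R_def)
 have [measurable]: "R : bmeas borel" unfolding R_def by measurable
 have [measurable]: "g' : bmeas borel" unfolding g'_def by measurable
 have contR: "continuous_on A R" for A unfolding R_def by (intro continuous_intros)
 have RL: "R L = t + r" "R (- L) = t + r"
 proof -
  have "L^2 + 4 * (t * r) = (t + r)^2" by (simp add: L_def power2_eq_square algebra_simps)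
  then show "R L = t + r" using r by (simp add: R_def)
  then show "R (- L) = t + r" by (simp add: Rneg)
 qed
 have ends: "g (- L) = r" "g L = t" by (simp_all add: g_def RL) (simp_all add: L_def)
 define f where "f s = enn ((L^2 - (s - t * r / s)^2) powr ?a)" for s
 have [measurable]: "f : bmeas borel" unfolding f_def by measurable
 have "(II s. enn (((t^2 - s^2) * (1 - (r / s)^2)) powr ?a) * ind {r<..<t} s dd lborel)
  = (II s. f s * ind {g (-L)..g L} s dd lborel)"
 proof (rule nn_integral_cong_AE, use AE_lborel_singleton[of r] AE_lborel_singleton[of t] in eventually_elim)
  fix s assume s: "s ~= r" "s ~= t"
  show "enn (((t^2 - s^2) * (1 - (r / s)^2)) powr ?a) * ind {r<..<t} s = f s * ind {g (-L)..g L} s"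
  proof (cases "s : {r<..<t}")
   case True
   then have s0: "s ~= 0" using r by auto
   define q where "q = r / s"
   have rq: "r = q * s" "t * r / s = t * q" using s0 by (simp_all add: q_def)
   have "(t^2 - s^2) * (1 - q^2) = (t - q * s)^2 - (s - t * q)^2" by (simp add: power2_eq_square algebra_simps)
   then have "(t^2 - s^2) * (1 - (r / s)^2) = L^2 - (s - t * r / s)^2" unfolding L_def rq(2) q_def[symmetric] by (simp only: rq(1)[symmetric])
   then show ?thesis using True unfolding f_def ends by (simp only:) simp
  next
   case False
   then have "s ~: {r..t}" using s by auto
   then show ?thesis using False by (simp add: ends)
  qed
 qed
 also have "... = (II y. f (g y) * enn (g' y) * ind {-L..L} y dd lborel)"
 proof (rule nn_integral_substitution_aux)
  show "continuous_on {- L..L} g'" unfolding g'_def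
  proof (intro continuous_on_divide continuous_on_add continuous_on_const continuous_on_id contR ballI)
   show "R y ~= 0" for y using R(1)[of y] by simp
  qed simp
 qed (use dg g'0 L in auto)
 also have "... = (II y. enn ((L^2 - y^2) powr ?a) * ind {-L<..<L} y * enn (g' y) dd lborel)"
 proof (rule nn_integral_cong_AE, use AE_lborel_singleton[of L] AE_lborel_singleton[of "-L"] in eventually_elim)
  fix y assume "y ~= L" "y ~= -L"
  then have "ind {-L..L} y = (ind {-L<..<L} y :: ennreal)" by (auto simp: indicator_def)
  then show "f (g y) * enn (g' y) * ind {-L..L} y = enn ((L^2 - y^2) powr ?a) * ind {-L<..<L} y * enn (g' y)" unfolding f_def gy by (simp only: mult_ac)
 qed
 \<comment> \<open>As \<open>R\<close> is even, \<open>g' y + g' (- y) = 1\<close>, while the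
   remaining integrand is even; this is the source of the factor 1/2 in the kernel.\<close>
 also have "... = enn (1 / 2) * (II y. enn ((L^2 - y^2) powr ?a) * ind {-L<..<L} y dd lborel)"
 proof (rule nni_even_half)
  show "enn ((L^2 - (- y)^2) powr ?a) * ind {-L<..<L} (- y) = enn ((L^2 - y^2) powr ?a) * ind {-L<..<L} y" for y by (auto simp: indicator_def)
  show "g' y + g' (- y) = 1" for y by (simp add: g'_def Rneg add_divide_distrib[symmetric])
 qed (use g'0 in auto)
 also have "... = enn (1 / 2) * (enn (L ^ m) * (II c. enn ((1 - c^2) powr ?a) * ind {-1<..<1} c dd lborel))" unfolding nni_beta_scale[OF L] ..
 also have "... = enn (L ^ m / 2) * (II c. enn ((1 - c^2) powr ?a) * ind {-1<..<1} c dd lborel)"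
 proof -
  have "enn (1 / 2) * enn (L ^ m) = enn (L ^ m / 2)" using L by (subst ennreal_mult'[symmetric]) auto
  then show ?thesis by (simp only: mult.assoc[symmetric])
 qed
 finally show ?thesis by (simp only: L_def)
qed

text \<open>\<open>nni_funk_cap\<close> with r = s c turns the left side into a double integral
  whose integral in s is \<open>nni_funk_kernel\<close>. On a sphere of dimension d = m + 2 the
  exponent (d - 3) / 2 is (m - 1) / 2, and the two half-integral orders add up to the integer kernel
  of order m + 1.\<close>

lemma nni_funk_primitive:
 fixes Y :: "'a::euclidean_space set"
 assumes Y: "subspace Y" and d: "dim Y = Suc (Suc (Suc m))" and e: "e : Y" "norm e = 1" and t: "0 < t" "t <= 1"
  and [measurable]: "g : bmeas borel"
 shows "(II s. enn ((t^2 - s^2) powr ((real m - 1) / 2) * s) * ind {0<..<t} s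
   * (II x. II z. g (pole_dir Y (cap Y (sqrt (1 - s^2)) e x) z) dd sph UNIV dd sph UNIV) dd lborel)
  = (II r. enn ((t - \<bar>r\<bar>) ^ m / 2) * ind {-t<..<t} r * (II x. g (cap Y r e x) dd sph UNIV) dd lborel)"
proof -
 let ?U = "sph (UNIV :: 'a set)" and ?a = "(real m - 1) / 2"
 interpret U: prob_space ?U by (rule prob_sph) simp
 note [measurable] = bm_pole_dir[OF Y] bm_cap[OF Y]
 define C where "C = enn (slice_const m)"
 define h where "h r = (II x. g (cap Y r e x) dd ?U)" for r
 have [measurable]: "h : bmeas borel" unfolding h_def by measurable
 define B where "B = (II c. enn ((1 - c^2) powr ?a) * ind {-1<..<1} c dd lborel)"
 \<comment> \<open>Testing \<open>nni_funk_cap\<close> on the constant 1 shows that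
   \<open>slice_const m\<close> is the reciprocal of the Beta integral \<open>B\<close>, whose value
   is therefore never computed.\<close>
 have CB: "C * B = 1"
 proof -
  have "(II x. II z. 1 dd ?U dd ?U) = (II c. C * (II x. 1 dd ?U) * enn ((1 - c^2) powr ?a) * ind {-1<..<1} c dd lborel)" unfolding C_def by (rule nni_funk_cap[OF Y d e, of 0 "%_. 1"]) auto
  also have "... = (II c. C * (enn ((1 - c^2) powr ?a) * ind {-1<..<1} c) dd lborel)" by (simp add: U.emeasure_space_1[simplified] mult.assoc)
  also have "... = C * B" unfolding B_def by (rule nn_integral_cmult) auto
  finally show ?thesis by (simp add: U.emeasure_space_1[simplified])
 qed
 let ?F = "%s r. C * h r * (enn (((t^2 - s^2) * (1 - (r / s)^2)) powr ?a) * ind {\<bar>r\<bar><..<t} s)"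
 have "(II s. enn ((t^2 - s^2) powr ?a * s) * ind {0<..<t} s
   * (II x. II z. g (pole_dir Y (cap Y (sqrt (1 - s^2)) e x) z) dd ?U dd ?U) dd lborel)
  = (II s. II r. ?F s r dd lborel dd lborel)"
 proof (rule nn_integral_cong)
  fix s :: real
  show "enn ((t^2 - s^2) powr ?a * s) * ind {0<..<t} s
   * (II x. II z. g (pole_dir Y (cap Y (sqrt (1 - s^2)) e x) z) dd ?U dd ?U) = (II r. ?F s r dd lborel)"
  proof (cases "s : {0<..<t}")
   case False
   then have "?F s r = 0" for r by (auto simp: indicator_def)
   then show ?thesis using False by simp
  next
   case True
   then have s: "0 < s" "s < t" "0 <= s" "s <= 1" using t by auto
   have t2: "0 <= t^2 - s^2" using power_mono[of s t 2] s by simp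
   have "(II r. ?F s r dd lborel) = enn \<bar>s\<bar> * (II c. ?F s (0 + s * c) dd lborel)"
   proof (rule nn_integral_real_affine)
    show "(%r. ?F s r) : bmeas borel" unfolding indicator_def greaterThanLessThan_iff by measurable
    show "s ~= 0" using s(1) by simp
   qed
   also have "... = enn s * (II c. enn ((t^2 - s^2) powr ?a) * (C * h (s * c) * enn ((1 - c^2) powr ?a) * ind {-1<..<1} c) dd lborel)"
   proof -
    have FF: "?F s (0 + s * c) = enn ((t^2 - s^2) powr ?a) * (C * h (s * c) * enn ((1 - c^2) powr ?a) * ind {-1<..<1} c)" for c
    proof -
     have i: "ind {\<bar>s * c\<bar><..<t} s = (ind {-1<..<1} c :: ennreal)"
     proof -
      have "\<bar>s * c\<bar> < s <-> \<bar>c\<bar> < 1" using s by (simp add: abs_mult)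
      then show ?thesis using s by (auto simp: indicator_def abs_less_iff)
     qed
     have q: "s * c / s = c" using s by simp
     show ?thesis
     proof (cases "c : {-1<..<1}")
      case True
      then have c: "0 <= 1 - c^2" by (simp add: abs_square_le_1 abs_le_iff)
      have E: "enn (((t^2 - s^2) * (1 - c^2)) powr ?a) = enn ((t^2 - s^2) powr ?a) * enn ((1 - c^2) powr ?a)" using t2 c by (simp only: powr_mult) (rule ennreal_mult', rule powr_ge_zero)
      show ?thesis unfolding add_0 i q E by (simp only: mult_ac)
     qed (simp add: i)
    qed
    show ?thesis unfolding FF abs_of_pos[OF s(1)] ..
   qed
   also have "... = enn s * (enn ((t^2 - s^2) powr ?a) * (II c. C * h (s * c) * enn ((1 - c^2) powr ?a) * ind {-1<..<1} c dd lborel))" by (subst nn_integral_cmult) auto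
   also have "(II c. C * h (s * c) * enn ((1 - c^2) powr ?a) * ind {-1<..<1} c dd lborel)
    = (II x. II z. g (pole_dir Y (cap Y (sqrt (1 - s^2)) e x) z) dd ?U dd ?U)" unfolding C_def h_def by (rule nni_funk_cap[OF Y d e s(3,4), symmetric]) measurable
   finally have G: "(II r. ?F s r dd lborel) = enn s * (enn ((t^2 - s^2) powr ?a) *
    (II x. II z. g (pole_dir Y (cap Y (sqrt (1 - s^2)) e x) z) dd ?U dd ?U))" .
   have E: "enn ((t^2 - s^2) powr ?a * s) = enn ((t^2 - s^2) powr ?a) * enn s" by (rule ennreal_mult') simp
   have I: "ind {0<..<t} s = (1::ennreal)" using True by simp
   show ?thesis unfolding G E I by (simp only: mult_ac mult_1 mult_1_right)
  qed
 qed
 also have "... = (II r. II s. ?F s r dd lborel dd lborel)" by (rule nni_swap) (unfold indicator_def, auto intro: lborel.sigma_finite_measure_axioms)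
 also have "... = (II r. enn ((t - \<bar>r\<bar>) ^ m / 2) * ind {-t<..<t} r * h r dd lborel)"
 proof (rule nn_integral_cong_AE, use AE_lborel_singleton[of 0] in eventually_elim)
  fix r :: real assume r0: "r ~= 0"
  have "(II s. ?F s r dd lborel) = C * h r * (II s. enn (((t^2 - s^2) * (1 - (r / s)^2)) powr ?a) * ind {\<bar>r\<bar><..<t} s dd lborel)" by (rule nn_integral_cmult) auto
  also have "... = enn ((t - \<bar>r\<bar>) ^ m / 2) * ind {-t<..<t} r * h r"
  proof (cases "\<bar>r\<bar> < t")
   case True
   then have i: "ind {-t<..<t} r = (1::ennreal)" by (simp add: abs_less_iff)
   have "(\<bar>r\<bar> / s)^2 = (r / s)^2" for s by (simp add: power_divide)
   then have "(II s. enn (((t^2 - s^2) * (1 - (r / s)^2)) powr ?a) * ind {\<bar>r\<bar><..<t} s dd lborel) = enn ((t - \<bar>r\<bar>) ^ m / 2) * B" using nni_funk_kernel[of "\<bar>r\<bar>" t m] r0 True unfolding B_def by simp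
   then have "C * h r * (II s. enn (((t^2 - s^2) * (1 - (r / s)^2)) powr ?a) * ind {\<bar>r\<bar><..<t} s dd lborel)
    = (C * B) * (enn ((t - \<bar>r\<bar>) ^ m / 2) * h r)" by (simp only: mult_ac)
   then show ?thesis unfolding CB i by (simp only: mult_1 mult_1_right)
  next
   case False
   then have "ind {\<bar>r\<bar><..<t} s = (0::ennreal)" for s by (auto simp: indicator_def)
   moreover have "ind {-t<..<t} r = (0::ennreal)" using False by (auto simp: indicator_def)
   ultimately show ?thesis by simp
  qed
  finally show "(II s. ?F s r dd lborel) = enn ((t - \<bar>r\<bar>) ^ m / 2) * ind {-t<..<t} r * h r" .
 qed
 finally show ?thesis unfolding h_def .
qed

section \<open>Derivatives in the mean\<close>

text \<open>Points with limit in \<open>U\<close> but not yet in \<open>U\<close> are handled by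
  dominated convergence, as \<open>U\<close> is open. Points in \<open>U\<close> with limit outside
  have the same measure, because \<open>p n\<close> and \<open>q\<close> have the same
  distribution.\<close>

lemma open_set_compose_limit:
 fixes Q :: "'q measure" and p :: "nat => 'q => 'c::euclidean_space"
 assumes Q: "prob_space Q" and [measurable]: "!!n. p n : bmeas Q" "q : bmeas Q"
  and distr: "!!n. distr Q borel (p n) = \<mu>" "distr Q borel q = \<mu>"
  and lim: "!!x. (%n. p n x) ---> q x" and U: "open U"
 shows "(%n. II x. ind {x. (p n x : U) ~= (q x : U)} x dd Q) ---> 0"
proof -
 interpret Q: prob_space Q by fact
 have [measurable]: "U : sets borel" using U by simp
 have "(%n. II x. ind {x. q x : U & p n x ~: U} x dd Q) ---> (II x. 0 dd Q)"
 proof (rule nn_integral_dominated_convergence[where w="%_. 1"])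
  show "AE x in Q. (%n. ind {x. q x : U & p n x ~: U} x) ---> (0::ennreal)"
  proof (rule AE_I2)
   fix x
   show "(%n. ind {x. q x : U & p n x ~: U} x) ---> (0::ennreal)"
   proof (cases "q x : U")
    case True
    have "\<forall>\<^sub>F n in sequentially. p n x : U" using topological_tendstoD[OF lim U True] .
    then have "\<forall>\<^sub>F n in sequentially. ind {x. q x : U & p n x ~: U} x = (0::ennreal)" by eventually_elim simp
    then show ?thesis by (rule tendsto_eventually)
   qed simp
  qed
 qed (auto simp: Q.emeasure_space_1 indicator_def)
 then have 1: "(%n. em Q {x:space Q. q x : U & p n x ~: U}) ---> 0"
 proof -
  have "(II x. ind {x. q x : U & p n x ~: U} x dd Q) = em Q {x:space Q. q x : U & p n x ~: U}" for n
  proof -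
   have "(II x. ind {x. q x : U & p n x ~: U} x dd Q) = (II x. ind {x:space Q. q x : U & p n x ~: U} x dd Q)" by (intro nn_integral_cong) (auto simp: indicator_def)
   also have "... = em Q {x:space Q. q x : U & p n x ~: U}" by (intro nn_integral_indicator) measurable
   finally show ?thesis .
  qed
  then show ?thesis using \<open>(%n. II x. ind {x. q x : U & p n x ~: U} x dd Q) ---> (II x. 0 dd Q)\<close> by (simp only: nn_integral_const mult_zero_left)
 qed
 have eq: "em Q {x:space Q. p n x : U & q x ~: U} = em Q {x:space Q. q x : U & p n x ~: U}" for n
 proof -
  have "em Q (p n -` U Int space Q) = em \<mu> U" "em Q (q -` U Int space Q) = em \<mu> U" using emeasure_distr[of "p n" Q borel U] emeasure_distr[of q Q borel U] distr(1)[of n] distr(2) by simp_all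
  then have e: "measure Q (p n -` U Int space Q) = measure Q (q -` U Int space Q)" by (simp add: measure_def)
  have "measure Q {x:space Q. p n x : U & q x ~: U} + measure Q {x:space Q. p n x : U & q x : U} = measure Q (p n -` U Int space Q)" by (subst Q.finite_measure_Union[symmetric]) (auto intro!: arg_cong[where f="measure Q"])
  moreover have "measure Q {x:space Q. q x : U & p n x ~: U} + measure Q {x:space Q. p n x : U & q x : U} = measure Q (q -` U Int space Q)" by (subst Q.finite_measure_Union[symmetric]) (auto intro!: arg_cong[where f="measure Q"])
  ultimately show ?thesis using e by (simp add: Q.emeasure_eq_measure)
 qed
 have "(II x. ind {x. (p n x : U) ~= (q x : U)} x dd Q)
  = em Q {x:space Q. p n x : U & q x ~: U} + em Q {x:space Q. q x : U & p n x ~: U}" for n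
 proof -
  have "(II x. ind {x. (p n x : U) ~= (q x : U)} x dd Q) = (II x. ind {x:space Q. (p n x : U) ~= (q x : U)} x dd Q)" by (intro nn_integral_cong) (auto simp: indicator_def)
  also have "... = em Q {x:space Q. (p n x : U) ~= (q x : U)}" by (intro nn_integral_indicator) measurable
  also have "{x:space Q. (p n x : U) ~= (q x : U)} = {x:space Q. p n x : U & q x ~: U} \<union> {x:space Q. q x : U & p n x ~: U}" by auto
  also have "em Q ... = em Q {x:space Q. p n x : U & q x ~: U} + em Q {x:space Q. q x : U & p n x ~: U}" by (intro plus_emeasure[symmetric]) auto
  finally show ?thesis .
 qed
 then have "(II x. ind {x. (p n x : U) ~= (q x : U)} x dd Q)
  = em Q {x:space Q. q x : U & p n x ~: U} + em Q {x:space Q. q x : U & p n x ~: U}" for n by (simp only: eq)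
 moreover have "(%n. em Q {x:space Q. q x : U & p n x ~: U} + em Q {x:space Q. q x : U & p n x ~: U}) ---> 0 + 0" by (intro tendsto_add 1)
 ultimately show ?thesis by (simp only: add_0)
qed

text \<open>By outer regularity of the common distribution, \<open>A\<close> is replaced by an open
  superset at a cost of e/4 for each of \<open>p n\<close> and \<open>q\<close>, uniformly in
  n.\<close>

lemma borel_set_compose_limit:
 fixes Q :: "'q measure" and p :: "nat => 'q => 'c::euclidean_space"
 assumes Q: "prob_space Q" and m[measurable]: "!!n. p n : bmeas Q" "q : bmeas Q"
  and distr: "!!n. distr Q borel (p n) = \<mu>" "distr Q borel q = \<mu>"
  and lim: "!!x. (%n. p n x) ---> q x" and A[measurable]: "A : sets borel"
 shows "(%n. II x. ind {x. (p n x : A) ~= (q x : A)} x dd Q) ---> 0"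
proof (rule tendsto_zero_ennreal)
 fix e :: real assume e: "0 < e"
 interpret Q: prob_space Q by fact
 have sm: "sets \<mu> = sets borel" using distr(2) by auto
 interpret \<mu>: prob_space \<mu> using Q.prob_space_distr[OF m(2)] distr(2) by simp
 have "enn (measure \<mu> A) < enn (measure \<mu> A + e / 4)" using e by (intro ennreal_lessI) (auto intro: add_nonneg_pos)
 then have "em \<mu> A < em \<mu> A + enn (e / 4)" using e by (simp add: \<mu>.emeasure_eq_measure ennreal_plus)
 moreover have "em \<mu> A = (INF U \<in> {U. A \<subseteq> U & open U}. em \<mu> U)" by (rule outer_regular) (simp_all add: sm A)
 ultimately obtain U where U: "A \<subseteq> U" "open U" "em \<mu> U < em \<mu> A + enn (e / 4)" by (auto simp: INF_less_iff)
 then have [measurable]: "U : sets borel" by simp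
 have d: "em \<mu> (U - A) <= enn (e / 4)"
 proof -
  have "measure \<mu> U < measure \<mu> A + e / 4" using U(3) e by (simp add: \<mu>.emeasure_eq_measure ennreal_plus[symmetric] ennreal_less_iff del: ennreal_plus)
  moreover have "measure \<mu> (U - A) = measure \<mu> U - measure \<mu> A" using U(1) by (intro \<mu>.finite_measure_Diff) (auto simp: sm)
  ultimately have "measure \<mu> (U - A) <= e / 4" by linarith
  then show ?thesis unfolding \<mu>.emeasure_eq_measure by (rule ennreal_leI)
 qed
 have dp: "(II x. ind (U - A) (r x) dd Q) <= enn (e / 4)" if [measurable]: "r : bmeas Q" and "distr Q borel r = \<mu>" for r
 proof -
  have "(II x. ind (U - A) (r x) dd Q) = (II x. ind (U - A) x dd distr Q borel r)" by (rule nn_integral_distr[symmetric]) auto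
  then show ?thesis using d that(2) by (simp add: sm)
 qed
 have "(%n. II x. ind {x. (p n x : U) ~= (q x : U)} x dd Q) ---> 0" by (rule open_set_compose_limit[OF Q m distr lim U(2)])
 then have "\<forall>\<^sub>F n in sequentially. (II x. ind {x. (p n x : U) ~= (q x : U)} x dd Q) < enn (e / 4)" using e by (intro order_tendstoD) auto
 then show "\<forall>\<^sub>F n in sequentially. (II x. ind {x. (p n x : A) ~= (q x : A)} x dd Q) < enn e"
 proof eventually_elim
  fix n assume n: "(II x. ind {x. (p n x : U) ~= (q x : U)} x dd Q) < enn (e / 4)"
  have "(II x. ind {x. (p n x : A) ~= (q x : A)} x dd Q)
   <= (II x. ind {x. (p n x : U) ~= (q x : U)} x + (ind (U - A) (p n x) + ind (U - A) (q x)) dd Q)" using U(1) by (intro nn_integral_mono) (auto simp: indicator_def)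
  also have "... = (II x. ind {x. (p n x : U) ~= (q x : U)} x dd Q) + ((II x. ind (U - A) (p n x) dd Q) + (II x. ind (U - A) (q x) dd Q))" by (subst nn_integral_add, measurable, subst nn_integral_add, measurable)
  also have "... <= enn (e / 4) + (enn (e / 4) + enn (e / 4))" using n dp[OF m(1) distr(1)] dp[OF m(2) distr(2)] by (intro add_mono) auto
  also have "... = enn (e / 4 + (e / 4 + e / 4))" using e by (simp add: ennreal_plus[symmetric] del: ennreal_plus)
  also have "... < enn e" using e by (intro ennreal_lessI) auto
  finally show "(II x. ind {x. (p n x : A) ~= (q x : A)} x dd Q) < enn e" .
 qed
qed

lemma ennreal_norm_four_point:
 fixes a b c d :: "'b::real_normed_vector"
 shows "enn (norm (a - d)) <= enn (norm (a - b)) + (enn (norm (b - c)) + enn (norm (d - c)))"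
proof -
 have "norm (a - d) = norm ((a - b) + ((b - c) + (c - d)))" by simp
 then have "norm (a - d) <= norm (a - b) + (norm (b - c) + norm (c - d))" using norm_triangle_ineq[of "a - b" "(b - c) + (c - d)"] norm_triangle_ineq[of "b - c" "c - d"] by linarith
 then have "enn (norm (a - d)) <= enn (norm (a - b) + (norm (b - c) + norm (d - c)))" by (intro ennreal_leI) (simp add: norm_minus_commute)
 then show ?thesis by (simp add: ennreal_plus)
qed

text \<open>Composition with a convergent sequence of maps having one common distribution
 is continuous in the mean; this replaces an approximation by continuous functions.\<close>

lemma L1_compose_limit:
 fixes Q :: "'q measure" and p :: "nat => 'q => 'c::euclidean_space" and f :: "'c => 'b::euclidean_space"
 assumes Q: "prob_space Q" and m[measurable]: "!!n. p n : bmeas Q" "q : bmeas Q"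
  and distr: "!!n. distr Q borel (p n) = \<mu>" "distr Q borel q = \<mu>"
  and lim: "!!x. (%n. p n x) ---> q x" and f: "integrable \<mu> f"
 shows "(%n. II x. enn (norm (f (p n x) - f (q x))) dd Q) ---> 0"
proof -
 interpret Q: prob_space Q by fact
 have sm[measurable_cong]: "sets \<mu> = sets borel" using distr(2) by auto
 interpret \<mu>: prob_space \<mu> using Q.prob_space_distr[OF m(2)] distr(2) by simp
 show ?thesis using f
 proof (induct rule: integrable_induct)
  case (base A c)
  then have A[measurable]: "A : sets borel" by (simp add: sm)
  have "(II x. enn (norm (ind A (p n x) *R c - ind A (q x) *R c)) dd Q)
   = enn (norm c) * (II x. ind {x. (p n x : A) ~= (q x : A)} x dd Q)" for n
  proof -
   have "(II x. enn (norm (ind A (p n x) *R c - ind A (q x) *R c)) dd Q)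
    = (II x. enn (norm c) * ind {x. (p n x : A) ~= (q x : A)} x dd Q)" by (intro nn_integral_cong) (auto simp: indicator_def)
   also have "... = enn (norm c) * (II x. ind {x. (p n x : A) ~= (q x : A)} x dd Q)" using A by (intro nn_integral_cmult) measurable
   finally show ?thesis .
  qed
  moreover have "(%n. enn (norm c) * (II x. ind {x. (p n x : A) ~= (q x : A)} x dd Q)) ---> enn (norm c) * 0" by (intro ennreal_tendsto_cmult borel_set_compose_limit[OF Q m distr lim A]) auto
  ultimately show ?case by (simp only: mult_zero_right)
 next
  case (add f g)
  note [measurable] = borel_measurable_integrable[OF add(1)] borel_measurable_integrable[OF add(3)]
  have le: "(II x. enn (norm (f (p n x) + g (p n x) - (f (q x) + g (q x)))) dd Q)
   <= (II x. enn (norm (f (p n x) - f (q x))) dd Q) + (II x. enn (norm (g (p n x) - g (q x))) dd Q)" for n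
  proof -
   have "(II x. enn (norm (f (p n x) + g (p n x) - (f (q x) + g (q x)))) dd Q)
    <= (II x. enn (norm (f (p n x) - f (q x))) + enn (norm (g (p n x) - g (q x))) dd Q)" by (intro nn_integral_mono) (simp add: ennreal_plus[symmetric] ennreal_leI norm_diff_triangle_ineq del: ennreal_plus)
   also have "... = (II x. enn (norm (f (p n x) - f (q x))) dd Q) + (II x. enn (norm (g (p n x) - g (q x))) dd Q)" by (rule nn_integral_add) measurable
   finally show ?thesis .
  qed
  have lm: "(%n. (II x. enn (norm (f (p n x) - f (q x))) dd Q) + (II x. enn (norm (g (p n x) - g (q x))) dd Q)) ---> 0" using tendsto_add[OF add(2) add(4)] by (simp only: add_0)
  show ?case by (rule tendsto_sandwich[OF _ _ tendsto_const lm]; rule always_eventually; rule allI) (rule zero_le, rule le)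
 next
  case (lim f s)
  note [measurable] = borel_measurable_integrable[OF lim(1)] borel_measurable_integrable[OF lim(5)]
  show ?case
  proof (rule tendsto_zero_ennreal)
   fix e :: real assume e: "0 < e"
   have "(%i. II x. enn (norm (f x - s i x)) dd \<mu>) ---> (II x. 0 dd \<mu>)"
   proof (rule nn_integral_dominated_convergence[where w="%x. enn (3 * norm (f x))"])
    show "(II x. enn (3 * norm (f x)) dd \<mu>) < \<infinity>" using integrable_iff_bounded[THEN iffD1, OF integrable_mult_right[OF integrable_norm[OF lim(5)], of 3]] by simp
    show "AE x in \<mu>. enn (norm (f x - s j x)) <= enn (3 * norm (f x))" for j
    proof (rule AE_I2, rule ennreal_leI)
     fix x assume "x : space \<mu>"
     then have "norm (s j x) <= 2 * norm (f x)" by (rule lim(4))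
     then show "norm (f x - s j x) <= 3 * norm (f x)" using norm_triangle_ineq4[of "f x" "s j x"] by linarith
    qed
    show "AE x in \<mu>. (%i. enn (norm (f x - s i x))) ---> 0"
    proof (rule AE_I2)
     fix x assume "x : space \<mu>"
     then have "(%i. s i x) ---> f x" by (rule lim(3))
     then have "(%i. norm (f x - s i x)) ---> norm (f x - f x)" by (intro tendsto_norm tendsto_diff tendsto_const)
     then show "(%i. enn (norm (f x - s i x))) ---> 0" using tendsto_ennrealI by fastforce
    qed
   qed measurable
   then have "\<forall>\<^sub>F i in sequentially. (II x. enn (norm (f x - s i x)) dd \<mu>) < enn (e / 4)" using e by (intro order_tendstoD) auto
   then obtain i where i: "(II x. enn (norm (f x - s i x)) dd \<mu>) < enn (e / 4)" by (auto simp: eventually_sequentially)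
   have dp: "(II x. enn (norm (f (r x) - s i (r x))) dd Q) = (II x. enn (norm (f x - s i x)) dd \<mu>)"
    if [measurable]: "r : bmeas Q" and "distr Q borel r = \<mu>" for r
   proof -
    have "(II x. enn (norm (f x - s i x)) dd distr Q borel r) = (II x. enn (norm (f (r x) - s i (r x))) dd Q)" by (rule nn_integral_distr) measurable
    then show ?thesis using that(2) by simp
   qed
   have "\<forall>\<^sub>F n in sequentially. (II x. enn (norm (s i (p n x) - s i (q x))) dd Q) < enn (e / 4)" using order_tendstoD(2)[OF lim(2), of "enn (e / 4)" i] e by simp
   then show "\<forall>\<^sub>F n in sequentially. (II x. enn (norm (f (p n x) - f (q x))) dd Q) < enn e"
   proof eventually_elim
    fix n assume n: "(II x. enn (norm (s i (p n x) - s i (q x))) dd Q) < enn (e / 4)"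
    have "(II x. enn (norm (f (p n x) - f (q x))) dd Q)
     <= (II x. enn (norm (f (p n x) - s i (p n x))) + (enn (norm (s i (p n x) - s i (q x))) + enn (norm (f (q x) - s i (q x)))) dd Q)" by (intro nn_integral_mono ennreal_norm_four_point)
    also have "... = (II x. enn (norm (f (p n x) - s i (p n x))) dd Q) + ((II x. enn (norm (s i (p n x) - s i (q x))) dd Q) + (II x. enn (norm (f (q x) - s i (q x))) dd Q))" by (subst nn_integral_add, measurable, subst nn_integral_add, measurable)
    also have "... <= enn (e / 4) + (enn (e / 4) + enn (e / 4))" unfolding dp[OF m(1) distr(1)] dp[OF m(2) distr(2)] using n i by (intro add_mono) auto
    also have "... = enn (e / 4 + (e / 4 + e / 4))" using e by (simp add: ennreal_plus[symmetric] del: ennreal_plus)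
    also have "... < enn e" using e by (intro ennreal_lessI) auto
    finally show "(II x. enn (norm (f (p n x) - f (q x))) dd Q) < enn e" .
   qed
  qed
 qed
qed

section \<open>Continuous curves in L1 and their primitives\<close>

definition L1_norm :: "'c measure => ('c => 'b::euclidean_space) => ennreal" where
 "L1_norm M f = (II x. enn (norm (f x)) dd M)"

lemma integrable_L1_norm:
 assumes "f : bmeas M" "L1_norm M f <= enn K" shows "integrable M f" using assms le_less_trans[OF assms(2) ennreal_less_top] by (intro integrableI_bounded) (auto simp: L1_norm_def)

lemma int_norm_L1_norm:
 assumes "f : bmeas M" "L1_norm M f <= enn K" "0 <= K"
 shows "(LINT x|M. norm (f x)) <= K"
proof -
 have "enn (LINT x|M. norm (f x)) = L1_norm M f" unfolding L1_norm_def using integrable_norm[OF integrable_L1_norm[OF assms(1,2)]] by (intro nn_integral_eq_integral[symmetric]) auto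
 then have "enn (LINT x|M. norm (f x)) <= enn K" using assms(2) by simp
 then show ?thesis using assms(3) by (simp add: ennreal_le_iff)
qed

text \<open>Continuity in L1 speaks of classes of functions, while \<open>primitive\<close>
  integrates pointwise: joint measurability gives that integral a meaning, and the bound
  \<open>K\<close> makes it converge almost everywhere.\<close>

definition L1_curve :: "'c measure => (real => 'c => 'b::euclidean_space) => bool" where
 "L1_curve M u <-> (%(r, x). u r x) : bmeas (borel xx M) &
  (EX K>0. ALL r:{0..1}. L1_norm M (u r) <= enn K) &
  (ALL t:{0..1}. ALL e>0. EX d>0. ALL r:{0..1}. \<bar>r - t\<bar> < d --> L1_norm M (%x. u r x - u t x) <= enn e)"

definition primitive :: "(real => 'c => 'b::euclidean_space) => real => 'c => 'b" where
 "primitive u t x = (LINT r|lborel. ind {0..t} r *R u r x)"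

lemma norm_int_le_nn: 
 fixes f :: "'a => 'b::euclidean_space"
 shows "enn (norm (integral\<^sup>L M f)) <= (II x. enn (norm (f x)) dd M)" by (cases "integrable M f") (auto simp: integral_norm_bound_ennreal not_integrable_integral_eq)

lemma L1_norm_int_le:
 fixes w :: "real => 'c => 'b::euclidean_space"
 assumes sf: "sfin M" and [measurable]: "(%(r, x). w r x) : bmeas (borel xx M)"
  and ab: "a <= b" and e: "0 <= e" and le: "!!r. r : {a..b} ==> L1_norm M (w r) <= enn e"
 shows "L1_norm M (%x. LINT r|lborel. ind {a..b} r *R w r x) <= enn (e * (b - a))"
proof -
 interpret sigma_finite_measure M by fact
 have "L1_norm M (%x. LINT r|lborel. ind {a..b} r *R w r x)
  <= (II x. II r. enn (norm (ind {a..b} r *R w r x)) dd lborel dd M)" unfolding L1_norm_def by (intro nn_integral_mono norm_int_le_nn)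
 also have "... = (II r. II x. enn (norm (ind {a..b} r *R w r x)) dd M dd lborel)" by (rule nni_swap[symmetric, OF lborel.sigma_finite_measure_axioms sf]) measurable
 also have "... <= (II r. enn e * ind {a..b} r dd lborel)"
 proof (rule nn_integral_mono)
  fix r
  show "(II x. enn (norm (ind {a..b} r *R w r x)) dd M) <= enn e * ind {a..b} r" using le[of r] by (cases "r : {a..b}") (auto simp: L1_norm_def)
 qed
 also have "... = enn (e * (b - a))" using ab e by (subst nn_integral_cmult) (auto simp: ennreal_mult')
 finally show ?thesis .
qed

lemma L1_curve_D:
 assumes "L1_curve M u"
 shows L1_curve_measurable: "(%(r, x). u r x) : bmeas (borel xx M)"
  and L1_curve_measurable1: "u r : bmeas M"
  and L1_curve_bounded: "EX K>0. ALL r:{0..1}. L1_norm M (u r) <= enn K"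
  and L1_curve_continuous: "[|t : {0..1}; 0 < e|] ==> EX d>0. ALL r:{0..1}. \<bar>r - t\<bar> < d --> L1_norm M (%x. u r x - u t x) <= enn e"
proof -
 show 1: "(%(r, x). u r x) : bmeas (borel xx M)" using assms by (simp add: L1_curve_def)
 show "u r : bmeas M" using measurable_Pair2[OF 1, of r] by simp
qed (use assms in \<open>auto simp: L1_curve_def\<close>)

lemma AE_set_integrable_curve:
 assumes u: "L1_curve M u" and sf: "sfin M"
 shows "AE x in M. integrable lborel (%r. ind {0..1} r *R u r x)"
proof -
 interpret sigma_finite_measure M by fact
 note um[measurable] = L1_curve_measurable[OF u]
 obtain K where K: "0 < K" "!!r. r : {0..1} ==> L1_norm M (u r) <= enn K" using L1_curve_bounded[OF u] by auto
 have "(II x. II r. enn (norm (ind {0..1::real} r *R u r x)) dd lborel dd M)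
  = (II r. II x. enn (norm (ind {0..1::real} r *R u r x)) dd M dd lborel)" by (rule nni_swap[symmetric, OF lborel.sigma_finite_measure_axioms sf]) measurable
 also have "... <= (II r. enn K * ind {0..1::real} r dd lborel)"
 proof (rule nn_integral_mono)
  fix r :: real
  show "(II x. enn (norm (ind {0..1} r *R u r x)) dd M) <= enn K * ind {0..1} r" using K(2)[of r] by (cases "r : {0..1}") (auto simp: L1_norm_def)
 qed
 also have "... < \<infinity>" by (subst nn_integral_cmult) (auto simp: ennreal_mult_less_top)
 finally have fin: "(II x. II r. enn (norm (ind {0..1::real} r *R u r x)) dd lborel dd M) ~= \<infinity>" by simp
 have "AE x in M. (II r. enn (norm (ind {0..1::real} r *R u r x)) dd lborel) ~= \<infinity>" by (rule nn_integral_PInf_AE[OF _ fin]) measurable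
 then show ?thesis using AE_space
 proof eventually_elim
  fix x assume "(II r. enn (norm (ind {0..1::real} r *R u r x)) dd lborel) ~= \<infinity>" and x: "x : space M"
  moreover have "(%r. u r x) : bmeas lborel" using measurable_Pair1[OF um x] by simp
  ultimately show "integrable lborel (%r. ind {0..1} r *R u r x)" by (intro integrableI_bounded) (auto simp: less_top)
 qed
qed

lemma integrable_indicator_subset:
 fixes w :: "real => 'b::euclidean_space"
 assumes "integrable lborel (%r. ind B r *R w r)" "A \<subseteq> B" "A : sets borel"
 shows "integrable lborel (%r. ind A r *R w r)"
proof -
 have "integrable lborel (%r. ind A r *R (ind B r *R w r))" by (rule integrable_mult_indicator[OF _ assms(1)]) (use assms(3) in simp)
 moreover have eq: "ind A r *R (ind B r *R w r) = ind A r *R w r" for r using assms(2) by (auto simp: indicator_def)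
 ultimately show ?thesis by (simp only: eq)
qed

lemma primitive_diff:
 assumes "integrable lborel (%r. ind {0..1} r *R u r x)" "0 <= s" "s <= t" "t <= 1"
 shows "primitive u t x - primitive u s x = (LINT r|lborel. ind {s..t} r *R u r x)"
proof -
 have i: "integrable lborel (%r. ind A r *R u r x)" if "A \<subseteq> {0..1}" "A : sets borel" for A by (rule integrable_indicator_subset[OF assms(1) that])
 have "primitive u t x = (LINT r|lborel. ind {0..s} r *R u r x + ind {s..t} r *R u r x)" unfolding primitive_def
 proof (rule integral_cong_AE)
  have "integrable lborel (%r. ind {0..s} r *R u r x + ind {s..t} r *R u r x)" using assms by (intro Bochner_Integration.integrable_add i) auto
  then show "(%r. ind {0..s} r *R u r x + ind {s..t} r *R u r x) : bmeas lborel" by auto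
  have "integrable lborel (%r. ind {0..t} r *R u r x)" using assms by (intro i) auto
  then show "(%r. ind {0..t} r *R u r x) : bmeas lborel" by auto
  show "AE r in lborel. ind {0..t} r *R u r x = ind {0..s} r *R u r x + ind {s..t} r *R u r x" using AE_lborel_singleton[of s] by eventually_elim (use assms in \<open>auto simp: indicator_def\<close>)
 qed
 also have "... = primitive u s x + (LINT r|lborel. ind {s..t} r *R u r x)" unfolding primitive_def using assms by (intro Bochner_Integration.integral_add i) auto
 finally show ?thesis by simp
qed

lemma primitive_meas:
 fixes u :: "real => 'c => 'b::euclidean_space"
 assumes [measurable]: "(%(r, x). u r x) : bmeas (borel xx M)"
 shows "(%(t, x). primitive u t x) : bmeas (borel xx M)" unfolding primitive_def indicator_def atLeastAtMost_iff by measurable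

lemma L1_norm_primitive_diff:
 assumes u: "L1_curve M u" and sf: "sfin M" and st: "0 <= s" "s <= t" "t <= 1"
  and K: "0 <= K" "!!r. r : {0..1} ==> L1_norm M (u r) <= enn K"
 shows "L1_norm M (%x. primitive u t x - primitive u s x) <= enn (K * (t - s))"
proof -
 have "L1_norm M (%x. primitive u t x - primitive u s x) = L1_norm M (%x. LINT r|lborel. ind {s..t} r *R u r x)" unfolding L1_norm_def by (rule nn_integral_cong_AE, use AE_set_integrable_curve[OF u sf] in eventually_elim)
   (simp only: primitive_diff[OF _ st])
 also have "... <= enn (K * (t - s))" using st by (intro L1_norm_int_le[OF sf L1_curve_measurable[OF u]] K) auto
 finally show ?thesis .
qed

lemma L1_norm_minus_commute: "L1_norm M (%x. f x - g x) = L1_norm M (%x. g x - f x)" by (simp add: L1_norm_def norm_minus_commute)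

text \<open>A primitive is Lipschitz in L1 with constant \<open>K\<close>; in particular primitives
  can be iterated.\<close>

lemma L1_curve_primitive:
 assumes u: "L1_curve M u" and sf: "sfin M"
 shows "L1_curve M (primitive u)" unfolding L1_curve_def
proof (intro conjI ballI allI impI)
 show "(%(r, x). primitive u r x) : bmeas (borel xx M)" by (rule primitive_meas[OF L1_curve_measurable[OF u]])
 obtain K where K: "0 < K" "!!r. r : {0..1} ==> L1_norm M (u r) <= enn K" using L1_curve_bounded[OF u] by auto
 have K0: "0 <= K" using K by simp
 have "L1_norm M (primitive u r) <= enn K" if r: "r : {0..1}" for r
 proof -
  have "L1_norm M (primitive u r) <= enn (K * (r - 0))" unfolding primitive_def using r by (intro L1_norm_int_le[OF sf L1_curve_measurable[OF u]] K(2) K0) auto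
  also have "... <= enn K" using r K0 by (intro ennreal_leI) (auto intro: mult_left_le)
  finally show ?thesis .
 qed
 then show "EX K>0. ALL r:{0..1}. L1_norm M (primitive u r) <= enn K" using K(1) by blast
 fix t e :: real assume t: "t : {0..1}" and e: "0 < e"
 show "EX d>0. ALL r:{0..1}. \<bar>r - t\<bar> < d --> L1_norm M (%x. primitive u r x - primitive u t x) <= enn e"
 proof (intro exI[of _ "e / K"] conjI ballI impI)
  show "0 < e / K" using e K by simp
  fix r :: real assume r: "r : {0..1}" "\<bar>r - t\<bar> < e / K"
  have "L1_norm M (%x. primitive u r x - primitive u t x) <= enn (K * \<bar>r - t\<bar>)"
  proof (cases "t <= r")
   case True
   then show ?thesis using L1_norm_primitive_diff[OF u sf _ True _ K0 K(2)] t r by simp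
  next
   case False
   then have "r <= t" by simp
   then show ?thesis using L1_norm_primitive_diff[OF u sf _ \<open>r <= t\<close> _ K0 K(2)] t r by (simp add: L1_norm_minus_commute[of M "primitive u r"])
  qed
  also have "... <= enn e" using r K(1) by (intro ennreal_leI) (simp add: field_simps)
  finally show "L1_norm M (%x. primitive u r x - primitive u t x) <= enn e" .
 qed
qed

lemma L1_tendstoI:
 assumes g: "integrable M g" and G: "\<forall>\<^sub>F t in F. G t : bmeas M"
  and e: "!!e. 0 < e ==> \<forall>\<^sub>F t in F. L1_norm M (%x. G t x - g x) <= enn e"
 shows "L1_tendsto M G g F"
proof -
 have i: "integrable M (%x. G t x - g x)" "(LINT x|M. norm (G t x - g x)) <= e"
  if "G t : bmeas M" "L1_norm M (%x. G t x - g x) <= enn e" "0 < e" for t e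
 proof -
  have "(%x. G t x - g x) : bmeas M" using that(1) g by (intro borel_measurable_diff) auto
  then show "integrable M (%x. G t x - g x)" "(LINT x|M. norm (G t x - g x)) <= e" using that by (auto intro: integrable_L1_norm int_norm_L1_norm)
 qed
 show ?thesis unfolding L1_tendsto_def
 proof (intro conjI g)
  show "\<forall>\<^sub>F t in F. integrable M (G t)" using G e[OF zero_less_one]
  proof eventually_elim
   fix t assume "G t : bmeas M" "L1_norm M (%x. G t x - g x) <= ennreal 1"
   then have "integrable M (%x. (G t x - g x) + g x)" using i(1)[of t 1] g by (intro Bochner_Integration.integrable_add) auto
   then show "integrable M (G t)" by simp
  qed
  show "((%t. LINT x|M. norm (G t x - g x)) \<longlongrightarrow> 0) F"
  proof (rule tendstoI)
   fix d :: real assume "0 < d"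
   then have "0 < d / 2" by simp
   from G e[OF this] show "\<forall>\<^sub>F t in F. dist (LINT x|M. norm (G t x - g x)) 0 < d"
   proof eventually_elim
    fix t assume "G t : bmeas M" "L1_norm M (%x. G t x - g x) <= enn (d / 2)"
    then have "(LINT x|M. norm (G t x - g x)) <= d / 2" using i(2) \<open>0 < d / 2\<close> by blast
    moreover have "0 <= (LINT x|M. norm (G t x - g x))" by (intro integral_nonneg_AE) auto
    ultimately show "dist (LINT x|M. norm (G t x - g x)) 0 < d" using \<open>0 < d\<close> by simp
   qed
  qed
 qed
qed

lemma L1_curve_integrable:
 assumes "L1_curve M u" "t : {0..1}" shows "integrable M (u t)"
proof -
 obtain K where "ALL r:{0..1}. L1_norm M (u r) <= enn K" using L1_curve_bounded[OF assms(1)] by blast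
 then have "L1_norm M (u t) <= enn K" using assms(2) by (rule bspec)
 then show ?thesis by (rule integrable_L1_norm[OF L1_curve_measurable1[OF assms(1)]])
qed

lemma L1_curve_at_left_1:
 assumes u: "L1_curve M u" shows "L1_tendsto M u (u 1) (at_left 1)"
proof (rule L1_tendstoI)
 show "integrable M (u 1)" using u by (rule L1_curve_integrable) simp
 show "\<forall>\<^sub>F t in at_left 1. u t : bmeas M" by (intro always_eventually allI L1_curve_measurable1[OF u])
 fix e :: real assume "0 < e"
 then obtain d where d: "0 < d" "!!r. r : {0..1} ==> \<bar>r - 1\<bar> < d ==> L1_norm M (%x. u r x - u 1 x) <= enn e" using L1_curve_continuous[OF u, of 1 e] by auto
 have "\<forall>\<^sub>F r in at_left 1. r : {max 0 (1 - d)<..<1}" using d by (intro eventually_at_left_real) auto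
 then show "\<forall>\<^sub>F t in at_left 1. L1_norm M (%x. u t x - u 1 x) <= enn e" by eventually_elim (rule d(2), auto)
qed

text \<open>The difference quotient minus \<open>u t\<close> is the mean of \<open>u r - u t\<close>
  over the interval between s and t, so its L1 norm is at most the largest of theirs, which is small
  by continuity.\<close>

lemma L1_curve_primitive_derivative:
 assumes u: "L1_curve M u" and sf: "sfin M" and t: "t : {0<..<1}"
 shows "L1_tendsto M (%s x. (1 / (s - t)) *R (primitive u s x - primitive u t x)) (u t) (at t)"
proof (rule L1_tendstoI)
 note um[measurable] = L1_curve_measurable[OF u]
 note [measurable] = L1_curve_measurable1[OF u] L1_curve_measurable1[OF L1_curve_primitive[OF u sf]]
 show "integrable M (u t)" using u t by (intro L1_curve_integrable) auto
 show "\<forall>\<^sub>F s in at t. (%x. (1 / (s - t)) *R (primitive u s x - primitive u t x)) : bmeas M" by (intro always_eventually allI) measurable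
 fix e :: real assume e: "0 < e"
 then obtain d where d: "0 < d" "!!r. r : {0..1} ==> \<bar>r - t\<bar> < d ==> L1_norm M (%x. u r x - u t x) <= enn e" using L1_curve_continuous[OF u, of t e] t by auto
 define \<delta> where "\<delta> = min d (min t (1 - t))"
 have \<delta>: "0 < \<delta>" "\<delta> <= d" "\<delta> <= t" "\<delta> <= 1 - t" using d t by (auto simp: \<delta>_def)
 have "\<forall>\<^sub>F s in at t. s ~= t & \<bar>s - t\<bar> < \<delta>" using \<delta>(1) by (auto simp: eventually_at dist_real_def intro!: exI[of _ \<delta>])
 then show "\<forall>\<^sub>F s in at t. L1_norm M (%x. (1 / (s - t)) *R (primitive u s x - primitive u t x) - u t x) <= enn e"
 proof eventually_elim
  fix s assume s: "s ~= t & \<bar>s - t\<bar> < \<delta>"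
  \<comment> \<open>Ordered endpoints, so that quotients from the left and from the right are
    treated together.\<close>
  define a where "a = min s t"
  define b where "b = max s t"
  have ab: "0 <= a" "a <= b" "b <= 1" "a < b" "b - a = \<bar>s - t\<bar>" using s \<delta> t by (auto simp: a_def b_def min_def max_def)
  have near: "\<bar>r - t\<bar> < d" "r : {0..1}" if "r : {a..b}" for r using that s \<delta> ab by (auto simp: a_def b_def min_def max_def split: if_splits)
  have "L1_norm M (%x. (1 / (s - t)) *R (primitive u s x - primitive u t x) - u t x)
   = L1_norm M (%x. (1 / (b - a)) *R (LINT r|lborel. ind {a..b} r *R (u r x - u t x)))" unfolding L1_norm_def
  proof (rule nn_integral_cong_AE, use AE_set_integrable_curve[OF u sf] in eventually_elim)
   fix x assume x: "integrable lborel (%r. ind {0..1} r *R u r x)"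
   have "(1 / (s - t)) *R (primitive u s x - primitive u t x) = (1 / (b - a)) *R (primitive u b x - primitive u a x)"
   proof (cases "s < t")
    case True
    have "(1 / (s - t)) *R (primitive u s x - primitive u t x) = (- (1 / (s - t))) *R (primitive u t x - primitive u s x)" by (simp add: scaleR_diff_right)
    moreover have "- (1 / (s - t)) = 1 / (t - s)" using True by (simp add: field_simps)
    ultimately show ?thesis using True by (simp add: a_def b_def min_def max_def)
   next
    case False
    then show ?thesis using s by (simp add: a_def b_def min_def max_def)
   qed
   also have "primitive u b x - primitive u a x = (LINT r|lborel. ind {a..b} r *R u r x)" by (rule primitive_diff[where u=u and x=x, OF x ab(1,2,3)])
   finally have 1: "(1 / (s - t)) *R (primitive u s x - primitive u t x) = (1 / (b - a)) *R (LINT r|lborel. ind {a..b} r *R u r x)" .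
   have i2: "integrable lborel (%r. ind {a..b} r *R u t x)" by (intro integrable_scaleR_left integrable_real_indicator) (simp_all add: emeasure_lborel_Icc[OF ab(2)])
   have "(LINT r|lborel. ind {a..b} r *R u r x) - (b - a) *R u t x = (LINT r|lborel. ind {a..b} r *R (u r x - u t x))"
   proof -
    have "(LINT r|lborel. ind {a..b} r *R u t x) = (b - a) *R u t x" using ab(2) by simp
    moreover have "(LINT r|lborel. ind {a..b} r *R u r x - ind {a..b} r *R u t x) = (LINT r|lborel. ind {a..b} r *R u r x) - (LINT r|lborel. ind {a..b} r *R u t x)" using ab by (intro Bochner_Integration.integral_diff i2 integrable_indicator_subset[OF x]) auto
    ultimately show ?thesis by (simp only: scaleR_diff_right)
   qed
   then have "(1 / (b - a)) *R ((LINT r|lborel. ind {a..b} r *R u r x) - (b - a) *R u t x) = (1 / (b - a)) *R (LINT r|lborel. ind {a..b} r *R (u r x - u t x))" by (rule arg_cong)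
   then show "enn (norm ((1 / (s - t)) *R (primitive u s x - primitive u t x) - u t x))
    = enn (norm ((1 / (b - a)) *R (LINT r|lborel. ind {a..b} r *R (u r x - u t x))))" unfolding 1 using ab(4) by (simp add: scaleR_diff_right)
  qed
  also have "... = enn (1 / (b - a)) * L1_norm M (%x. LINT r|lborel. ind {a..b} r *R (u r x - u t x))"
  proof -
   have "(%x. LINT r|lborel. ind {a..b} r *R (u r x - u t x)) : bmeas M" by measurable
   moreover have "enn (norm ((1 / (b - a)) *R v)) = enn (1 / (b - a)) * enn (norm v)" for v :: 'b unfolding norm_scaleR using ab(4) by (subst ennreal_mult'[symmetric]) auto
   ultimately show ?thesis unfolding L1_norm_def by (simp only:) (rule nn_integral_cmult, measurable)
  qed
  also have "... <= enn (1 / (b - a)) * enn (e * (b - a))" using ab e near d by (intro mult_left_mono L1_norm_int_le[OF sf]) auto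
  also have "... = enn e" using ab(4) e by (subst ennreal_mult'[symmetric]) auto
  finally show "L1_norm M (%x. (1 / (s - t)) *R (primitive u s x - primitive u t x) - u t x) <= enn e" .
 qed
qed

text \<open>The bridge from the completed measures of the definitions to Borel measures: a function
  almost everywhere equal to a Borel function inherits its measurability, integrability and
  integral.\<close>

lemma completion_AE_eq:
 fixes f g :: "'a => 'b::{banach, second_countable_topology}"
 assumes AE: "AE x in M. f x = g x" and g: "g : bmeas M"
 shows borel_measurable_completion_AE: "f : bmeas (completion M)"
  and integrable_completion_AE: "integrable (completion M) f <-> integrable M g"
  and integral_completion_AE: "integral\<^sup>L (completion M) f = integral\<^sup>L M g"
proof -
 obtain N where N: "N : null_sets M" "{x : space M. f x ~= g x} \<subseteq> N" using AE by (auto simp: eventually_ae_filter)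
 show f: "f : bmeas (completion M)"
 proof (rule measurableI)
  fix A :: "'b set" assume A: "A : sets borel"
  have eq: "f -` A Int space M = ((g -` A Int space M) - N) \<union> (f -` A Int space M Int N)" using N(2) by auto
  have "g -` A Int space M - N : sets (completion M)" using measurable_sets[OF g A] N(1) by (intro sets_completionI_sets) auto
  moreover have "f -` A Int space M Int N : sets (completion M)" using N(1) by (intro sets_completionI_sub[of N M]) auto
  ultimately show "f -` A Int space (completion M) : sets (completion M)" unfolding space_completion by (subst eq) (rule sets.Un)
 qed simp
 have g': "g : bmeas (completion M)" using g by (rule measurable_completion)
 have AE': "AE x in completion M. f x = g x" using AE by (rule AE_completion)
 show "integrable (completion M) f <-> integrable M g" using integrable_cong_AE[OF f g' AE'] integrable_completion[OF g] by simp
 show "integral\<^sup>L (completion M) f = integral\<^sup>L M g" using integral_cong_AE[OF f g' AE'] integral_completion[OF g] by simp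
qed

lemma completion_ex_bm_euclidean:
 fixes f :: "'a => 'b::euclidean_space"
 assumes f: "f : bmeas (completion M)"
 obtains g where "g : bmeas M" "AE x in M. f x = g x"
proof -
 have "EX h:bmeas M. AE x in M. f x *. b = h x" for b using f by (intro completion_ex_borel_measurable_real borel_measurable_inner) auto
 then obtain h where h: "!!b. h b : bmeas M" "!!b. AE x in M. f x *. b = h b x" by metis
 have "AE x in M. ALL b:Basis. f x *. b = h b x" by (rule AE_finite_allI) (auto intro: h)
 then have "AE x in M. f x = (\<Sum>b\<in>Basis. h b x *R b)"
 proof eventually_elim
  fix x assume "ALL b:Basis. f x *. b = h b x"
  then have "(\<Sum>b\<in>Basis. h b x *R b) = (\<Sum>b\<in>Basis. (f x *. b) *R b)" by (intro sum.cong) auto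
  then show "f x = (\<Sum>b\<in>Basis. h b x *R b)" by (simp add: euclidean_representation)
 qed
 then show ?thesis using h(1) by (intro that) auto
qed

lemma power_kernel_int:
 fixes r t :: real
 shows "(LINT s|lborel. ind {0..t} s * (ind {0..s} r * ((s - r) ^ m / fact m))) = ind {0..t} r * ((t - r) ^ Suc m / fact (Suc m))"
proof (cases "0 <= r & r <= t")
 case True
 have "((%s. (s - r) ^ Suc m / fact (Suc m)) has_real_derivative (real (Suc m) * (s - r) ^ m) / fact (Suc m)) (at s)" for s by (intro DERIV_cdivide) (auto intro!: derivative_eq_intros simp del: of_nat_Suc power_Suc)
 then have der: "((%s. (s - r) ^ Suc m / fact (Suc m)) has_real_derivative (s - r) ^ m / fact m) (at s)" for s by (simp add: divide_simps del: power_Suc)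
 have "(LINT s|lborel. ind {0..t} s * (ind {0..s} r * ((s - r) ^ m / fact m))) = (LINT s|lborel. ((s - r) ^ m / fact m) * ind {r..t} s)" using True by (intro Bochner_Integration.integral_cong) (auto simp: indicator_def)
 also have "... = (t - r) ^ Suc m / fact (Suc m) - (r - r) ^ Suc m / fact (Suc m)" using True by (intro integral_FTC_Icc_real der) (auto intro!: continuous_intros)
 finally show ?thesis using True by simp
next
 case False
 then have "(LINT s|lborel. ind {0..t} s * (ind {0..s} r * ((s - r) ^ m / fact m))) = (LINT (s::real)|lborel. (0::real))" by (intro Bochner_Integration.integral_cong) (auto simp: indicator_def)
 then show ?thesis using False by simp
qed

text \<open>Cauchy's formula for repeated integration.\<close>

lemma primitive_iterate:
 fixes u :: "real => 'c => 'b::euclidean_space"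
 assumes u: "integrable lborel (%r. ind {0..1} r *R u r x)" and t: "t : {0..1}"
 shows "(primitive ^^ Suc m) u t x = (LINT r|lborel. (ind {0..t} r * ((t - r) ^ m / fact m)) *R u r x)" using t
proof (induction m arbitrary: t)
 case 0
 then show ?case by (simp add: primitive_def)
next
 case (Suc m)
 let ?w = "%r. ind {0..1} r *R u r x"
 let ?k = "%s r. ind {0..t} s * (ind {0..s} r * ((s - r) ^ m / fact m)) :: real"
 have wm[measurable]: "?w : bmeas borel" using borel_measurable_integrable[OF u] by simp
 have km[measurable]: "(%(s, r). ?k s r) : bmeas (borel xx borel)" unfolding indicator_def atLeastAtMost_iff by measurable
 have kw: "?k s r *R u r x = ?k s r *R ?w r" for s r using Suc.prems by (auto simp: indicator_def)
 have k1: "norm (?k s r) <= ind {0..1} s" for s r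
 proof (cases "s : {0..t} & r : {0..s}")
  case True
  then have "0 <= s - r" "s - r <= 1" using Suc.prems by auto
  then have "(s - r) ^ m <= 1" by (intro power_le_one) auto
  moreover have "(1::real) <= fact m" by (rule fact_ge_1)
  ultimately have "(s - r) ^ m / fact m <= 1"  using order_trans[OF \<open>(s - r) ^ m <= 1\<close> \<open>1 <= fact m\<close>] by (simp add: divide_le_eq)
  then show ?thesis using True Suc.prems \<open>0 <= s - r\<close> by simp
 next
  case False
  then have k0: "?k s r = 0" by (auto simp: indicator_def)
  show ?thesis unfolding k0 by simp
 qed
 have int: "integrable (lborel xx lborel) (%(s, r). ?k s r *R ?w r)"
 proof (rule integrableI_bounded)
  show "(%(s, r). ?k s r *R ?w r) : bmeas (lborel xx lborel)" by measurable
  then have m: "(%z. enn (norm (case z of (s, r) => ?k s r *R ?w r))) : bmeas (lborel xx lborel)" by measurable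
  have "(II z. enn (norm (case z of (s, r) => ?k s r *R ?w r)) dd (lborel xx lborel))
   = (II s. II r. enn (norm (?k s r *R ?w r)) dd lborel dd lborel)" by (simp only: lborel.nn_integral_fst[OF m, symmetric] prod.case)
  also have "... <= (II s. II r. ind {0..1} s * enn (norm (?w r)) dd lborel dd (lborel :: real measure))"
  proof (rule nn_integral_mono, rule nn_integral_mono)
   fix s r :: real
   have "norm (?k s r *R ?w r) <= ind {0..1} s * norm (?w r)" unfolding norm_scaleR using k1[of s r] by (intro mult_right_mono) auto
   then have "enn (norm (?k s r *R ?w r)) <= enn (ind {0..1} s * norm (?w r))" by (rule ennreal_leI)
   then show "enn (norm (?k s r *R ?w r)) <= ind {0..1} s * enn (norm (?w r))" by (simp add: ennreal_mult' ennreal_indicator)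
  qed
  also have "... = (II r. enn (norm (?w r)) dd lborel)" by (subst nn_integral_cmult, measurable, subst nn_integral_multc, simp, simp)
  also have "... < \<infinity>" using u unfolding integrable_iff_bounded by simp
  finally show "(II z. enn (norm (case z of (s, r) => ?k s r *R ?w r)) dd (lborel xx lborel)) < \<infinity>" .
 qed
 have "(primitive ^^ Suc (Suc m)) u t x = (LINT s|lborel. ind {0..t} s *R (primitive ^^ Suc m) u s x)" by (simp add: primitive_def)
 also have "... = (LINT s|lborel. LINT r|lborel. ?k s r *R ?w r)"
 proof (rule Bochner_Integration.integral_cong[OF refl])
  fix s
  show "ind {0..t} s *R (primitive ^^ Suc m) u s x = (LINT r|lborel. ?k s r *R ?w r)"
  proof (cases "s : {0..t}")
   case True
   then have s1: "s : {0..1}" using Suc.prems by auto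
   show ?thesis unfolding Suc.IH[OF s1] kw[symmetric] using True by simp
  qed simp
 qed
 also have "... = (LINT r|lborel. LINT s|lborel. ?k s r *R ?w r)" using lborel_pair.Fubini_integral[OF int] by simp
 also have "... = (LINT r|lborel. (LINT s|lborel. ?k s r) *R ?w r)"
 proof (rule Bochner_Integration.integral_cong[OF refl], rule integral_scaleR_left)
  fix r :: real
  show "integrable lborel (%s. ?k s r)"
  proof (rule Bochner_Integration.integrable_bound)
   show "integrable lborel (ind {0..1::real} :: real => real)" by (rule integrable_real_indicator) auto
   show "AE s in lborel. norm (?k s r) <= norm (ind {0..1::real} s :: real)" using k1 by (intro AE_I2) simp
  qed measurable
 qed
 also have "... = (LINT r|lborel. (ind {0..t} r * ((t - r) ^ Suc m / fact (Suc m))) *R u r x)" unfolding power_kernel_int using Suc.prems by (intro Bochner_Integration.integral_cong) (auto simp: indicator_def)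
 finally show ?case .
qed

text \<open>For Borel functions, \<open>funk_mean\<close> at s is this mean at sqrt (1 - s^2), as
  \<open>funk_mean_AE\<close> shows. At r = 1 the section shrinks to q, so the curve ends at the
  function itself; hence the limit t to 1 in the inversion formula.\<close>

definition cap_mean :: "'a::euclidean_space set => ('a => 'b::euclidean_space) => real => 'a => 'b" where
 "cap_mean Y f r q = (LINT x|sph UNIV. f (cap Y r q x))"

lemma sph_uminus:
 fixes V :: "'a::euclidean_space set"
 assumes "subspace V" shows "distr (sph V) borel uminus = sph V"
proof -
 have "uminus ` V = V" using subspace_neg[OF assms] by (auto simp: image_iff intro!: bexI[of _ "- x" for x])
 then show ?thesis using sph_isometry[OF assms, of uminus] by (simp add: linear_uminus)
qed

lemma cap_uminus:
 fixes Y :: "'a::euclidean_space set"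
 assumes "subspace Y" shows "cap Y (- r) q x = - cap Y r q (- x)"
proof -
 have "proj Y (- x) - (- x *. q) *R q = - (proj Y x - (x *. q) *R q)" by (simp add: linear_neg[OF linear_proj[OF assms]])
 then have "pole_dir Y q (- x) = - pole_dir Y q x" unfolding pole_dir_def by (simp only: sgn_minus)
 then show ?thesis by (simp add: cap_def)
qed

lemma cap_mean_even:
 fixes f :: "'a::euclidean_space => 'b::euclidean_space"
 assumes Y: "subspace Y" and [measurable]: "f : bmeas borel" and even: "!!x. f (- x) = f x"
 shows "cap_mean Y f (- r) q = cap_mean Y f r q"
proof -
 note [measurable] = bm_cap[OF Y]
 have "cap_mean Y f r q = (LINT x|distr (sph UNIV) borel uminus. f (cap Y r q x))" unfolding cap_mean_def sph_uminus[OF subspace_UNIV] ..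
 also have "... = (LINT x|sph UNIV. f (cap Y r q (- x)))" by (rule integral_distr) measurable
 also have "... = cap_mean Y f (- r) q" unfolding cap_mean_def cap_uminus[OF Y] even ..
 finally show ?thesis ..
qed

lemma cap_mean_meas:
 fixes f :: "'a::euclidean_space => 'b::euclidean_space"
 assumes Y: "subspace Y" and [measurable]: "f : bmeas borel"
 shows "(%(r, q). cap_mean Y f r q) : bmeas (borel xx borel)"
proof -
 interpret sigma_finite_measure "sph (UNIV :: 'a set)" by (rule sf_sph) simp
 note [measurable] = bm_cap[OF Y]
 show ?thesis unfolding cap_mean_def by measurable
qed

lemma cap_one: "cap Y 1 q x = q" by (simp add: cap_def)

lemma cap_mean_one: "cap_mean Y f 1 q = f q" for Y :: "'a::euclidean_space set"
proof -
 interpret prob_space "sph (UNIV :: 'a set)" by (rule prob_sph) simp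
 have "measure (sph (UNIV :: 'a set)) UNIV = 1" using prob_space by (simp add: sph_def)
 then show ?thesis by (simp add: cap_mean_def cap_one sph_def)
qed

text \<open>For |r| <= 1 the map from (q, x) to \<open>cap Y r q x\<close> always has the
  distribution \<open>sph Y\<close>, and it depends continuously on r;
  \<open>L1_compose_limit\<close> then applies to any integrable f.\<close>

lemma L1_curve_cap_mean:
 fixes f :: "'a::euclidean_space => 'b::euclidean_space"
 assumes Y: "subspace Y" and d: "2 <= dim Y" and [measurable]: "f : bmeas borel"
  and f: "integrable (sph Y) f"
 shows "L1_curve (sph Y) (cap_mean Y f)" unfolding L1_curve_def
proof (intro conjI ballI allI impI)
 let ?S = "sph Y" and ?U = "sph (UNIV :: 'a set)"
 interpret U: prob_space ?U by (rule prob_sph) simp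
 interpret S: prob_space ?S using Y by (rule prob_sph)
 interpret US: pair_prob_space ?S ?U ..
 note [measurable] = bm_cap[OF Y] cap_mean_meas[OF Y assms(3)]
 show "(%(r, x). cap_mean Y f r x) : bmeas (borel xx ?S)" by measurable
 have I: "(II q. II x. enn (norm (f (cap Y r q x))) dd ?U dd ?S) = L1_norm ?S f" if "\<bar>r\<bar> <= 1" for r unfolding L1_norm_def by (rule nni_sphere_cap[OF Y d that]) measurable
 have fin: "L1_norm ?S f < \<infinity>" using f unfolding integrable_iff_bounded L1_norm_def by simp
 then obtain K where K: "L1_norm ?S f = enn K" "0 <= K" by (cases "L1_norm ?S f") auto
 have "L1_norm ?S (cap_mean Y f r) <= enn (K + 1)" if "r : {0..1}" for r
 proof -
  have "L1_norm ?S (cap_mean Y f r) <= (II q. II x. enn (norm (f (cap Y r q x))) dd ?U dd ?S)" unfolding L1_norm_def cap_mean_def by (intro nn_integral_mono norm_int_le_nn)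
  also have "... = enn K" using that K by (subst I) auto
  finally show ?thesis by (rule order_trans) (simp add: ennreal_leI)
 qed
 then show "EX K>0. ALL r:{0..1}. L1_norm ?S (cap_mean Y f r) <= enn K" using K(2) by (intro exI[of _ "K + 1"]) auto
 have AE_int: "AE q in ?S. integrable ?U (%x. f (cap Y r q x))" if "\<bar>r\<bar> <= 1" for r
 proof -
  have "AE q in ?S. (II x. enn (norm (f (cap Y r q x))) dd ?U) ~= \<infinity>" by (rule nn_integral_PInf_AE) (use I[OF that] fin in auto)
  then show ?thesis by eventually_elim (auto intro!: integrableI_bounded simp: less_top)
 qed
 have le: "L1_norm ?S (%q. cap_mean Y f r q - cap_mean Y f t q)
  <= (II z. enn (norm (f ((%(q, x). cap Y r q x) z) - f ((%(q, x). cap Y t q x) z))) dd (?S xx ?U))"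
  if "\<bar>r\<bar> <= 1" "\<bar>t\<bar> <= 1" for r t
 proof -
  have "L1_norm ?S (%q. cap_mean Y f r q - cap_mean Y f t q)
   <= (II q. II x. enn (norm (f (cap Y r q x) - f (cap Y t q x))) dd ?U dd ?S)" unfolding L1_norm_def
  proof (rule nn_integral_mono_AE, use AE_int[OF that(1)] AE_int[OF that(2)] in eventually_elim)
   fix q assume i: "integrable ?U (%x. f (cap Y r q x))" "integrable ?U (%x. f (cap Y t q x))"
   show "enn (norm (cap_mean Y f r q - cap_mean Y f t q)) <= (II x. enn (norm (f (cap Y r q x) - f (cap Y t q x))) dd ?U)" unfolding cap_mean_def Bochner_Integration.integral_diff[OF i, symmetric] by (rule norm_int_le_nn)
  qed
  also have "... = (II z. enn (norm (f ((%(q, x). cap Y r q x) z) - f ((%(q, x). cap Y t q x) z))) dd (?S xx ?U))" by (subst U.nn_integral_fst[symmetric]) auto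
  finally show ?thesis .
 qed
 fix t e :: real assume t: "t : {0..1}" and e: "0 < e"
 show "EX d>0. ALL r:{0..1}. \<bar>r - t\<bar> < d --> L1_norm ?S (%q. cap_mean Y f r q - cap_mean Y f t q) <= enn e"
 proof (rule ccontr)
  \<comment> \<open>The limit theorem is about sequences, so a failure of continuity is first turned
    into a sequence \<open>r n\<close> tending to t.\<close>
  assume neg: "~ ?thesis"
  have "EX r. r : {0..1} & \<bar>r - t\<bar> < inverse (real (Suc n)) & ~ L1_norm ?S (%q. cap_mean Y f r q - cap_mean Y f t q) <= enn e" for n
  proof (rule ccontr)
   assume "~ ?thesis"
   then have "ALL r:{0..1}. \<bar>r - t\<bar> < inverse (real (Suc n)) --> L1_norm ?S (%q. cap_mean Y f r q - cap_mean Y f t q) <= enn e" by blast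
   moreover have "0 < inverse (real (Suc n))" by simp
   ultimately show False using neg by blast
  qed
  then obtain r where r: "!!n. r n : {0..1}" "!!n. \<bar>r n - t\<bar> < inverse (real (Suc n))"
   "!!n. ~ L1_norm ?S (%q. cap_mean Y f (r n) q - cap_mean Y f t q) <= enn e" by metis
  have "(%n. r n - t) ---> 0"
  proof (rule Lim_null_comparison[OF _ LIMSEQ_inverse_real_of_nat])
   show "\<forall>\<^sub>F n in sequentially. norm (r n - t) <= inverse (real (Suc n))" using r(2) by (intro always_eventually allI less_imp_le) (simp only: real_norm_def)
  qed
  then have rt: "r ---> t" by (rule LIM_zero_cancel)
  have abs: "\<bar>r n\<bar> <= 1" "\<bar>t\<bar> <= 1" for n using r(1)[of n] t by auto
  have "(%n. II z. enn (norm (f ((%(q, x). cap Y (r n) q x) z) - f ((%(q, x). cap Y t q x) z))) dd (?S xx ?U)) ---> 0"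
  proof (rule L1_compose_limit[where \<mu>="?S"])
   show "prob_space (?S xx ?U)" by (rule US.prob_space_axioms)
   show "(%n. case z of (q, x) => cap Y (r n) q x) ---> (case z of (q, x) => cap Y t q x)" for z unfolding cap_def case_prod_beta by (intro tendsto_intros rt)
   show "distr (?S xx ?U) borel (%(q, x). cap Y (r n) q x) = ?S" for n by (rule sph_cap[OF Y d abs(1)])
   show "distr (?S xx ?U) borel (%(q, x). cap Y t q x) = ?S" by (rule sph_cap[OF Y d abs(2)])
  qed (use f in \<open>auto simp: case_prod_beta'\<close>)
  then have "\<forall>\<^sub>F n in sequentially. (II z. enn (norm (f ((%(q, x). cap Y (r n) q x) z) - f ((%(q, x). cap Y t q x) z))) dd (?S xx ?U)) < enn e" using e by (intro order_tendstoD(2)) auto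
  then obtain n where "(II z. enn (norm (f ((%(q, x). cap Y (r n) q x) z) - f ((%(q, x). cap Y t q x) z))) dd (?S xx ?U)) < enn e" by (auto simp: eventually_sequentially)
  then show False using r(3)[of n] order_trans[OF le[OF abs] less_imp_le] by blast
 qed
qed

section \<open>Inversion of the Funk transform\<close>

text \<open>The identity for all nonnegative Borel g says that two weighted product measures have
  the same image. The vector-valued integrals of f are then integrals over one measure, and Fubini
  restores the iterated form on each side.\<close>

lemma density_pair_distr_eq:
 fixes F :: "real \<times> 'p => 'c::euclidean_space" and G :: "real \<times> 'q => 'c"
 assumes P: "sfin P" and Q: "sfin Q"
  and w[measurable]: "w : bmeas borel" and v[measurable]: "v : bmeas borel"
  and wv0: "!!r. 0 <= w r" "!!r. 0 <= v r"
  and F[measurable]: "F : bmeas (borel xx P)" and G[measurable]: "G : bmeas (borel xx Q)"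
  and eq: "!!g. g : bmeas borel ==> (II s. enn (w s) * (II z. g (F (s, z)) dd P) dd lborel)
    = (II r. enn (v r) * (II z. g (G (r, z)) dd Q) dd lborel)"
  and f[measurable]: "f : bmeas borel"
  and fin: "(II r. enn (v r) * (II z. enn (norm (f (G (r, z)) :: 'b::euclidean_space)) dd Q) dd lborel) < \<infinity>"
 shows "(LINT s|lborel. w s *R (LINT z|P. f (F (s, z)))) = (LINT r|lborel. v r *R (LINT z|Q. f (G (r, z))))"
  and "integrable lborel (%r. v r *R (LINT z|Q. f (G (r, z))))"
proof -
 have gen: "(II z. g (H z) dd (density lborel (%r. enn (k r)) xx R)) = (II r. enn (k r) * (II z. g (H (r, z)) dd R) dd lborel)"
  if R: "sfin R" and [measurable]: "k : bmeas borel" "H : bmeas (borel xx R)" "g : bmeas borel"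
  for R :: "'x measure" and k and H :: "real \<times> 'x => 'c" and g :: "'c => ennreal"
 proof -
  interpret R: sigma_finite_measure R by fact
  have "(II z. g (H z) dd (density lborel (%r. enn (k r)) xx R)) = (II r. II z. g (H (r, z)) dd R dd density lborel (%r. enn (k r)))" by (rule R.nn_integral_fst[symmetric]) measurable
  also have "... = (II r. enn (k r) * (II z. g (H (r, z)) dd R) dd lborel)" by (rule nn_integral_density) measurable
  finally show ?thesis .
 qed
 have genL: "(LINT z|(density lborel (%r. enn (k r)) xx R). f (H z)) = (LINT r|lborel. k r *R (LINT z|R. f (H (r, z))))"
  "integrable lborel (%r. k r *R (LINT z|R. f (H (r, z))))"
  if R: "sfin R" and [measurable]: "k : bmeas borel" "H : bmeas (borel xx R)" and k0: "!!r. 0 <= k r"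
   and i: "integrable (density lborel (%r. enn (k r)) xx R) (%z. f (H z))"
  for R :: "'x measure" and k and H :: "real \<times> 'x => 'c"
 proof -
  interpret R: sigma_finite_measure R by fact
  interpret D: sigma_finite_measure "density lborel (%r. enn (k r))" by (subst sigma_finite_measure.sigma_finite_iff_density_finite[OF lborel.sigma_finite_measure_axioms]) auto
  interpret DR: pair_sigma_finite "density lborel (%r. enn (k r))" R ..
  have m: "(%r. LINT z|R. f (H (r, z))) : bmeas lborel" by measurable
  have "(LINT z|(density lborel (%r. enn (k r)) xx R). f (H z)) = (LINT r|density lborel (%r. enn (k r)). LINT z|R. f (H (r, z)))" by (rule DR.integral_fst'[OF i, symmetric])
  also have "... = (LINT r|lborel. k r *R (LINT z|R. f (H (r, z))))" by (rule integral_density[OF m]) (auto simp: k0)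
  finally show "(LINT z|(density lborel (%r. enn (k r)) xx R). f (H z)) = (LINT r|lborel. k r *R (LINT z|R. f (H (r, z))))" .
  have "integrable (density lborel (%r. enn (k r))) (%r. LINT z|R. f (H (r, z)))" by (rule DR.integrable_fst'[OF i])
  then show "integrable lborel (%r. k r *R (LINT z|R. f (H (r, z))))" by (subst (asm) integrable_density[OF m]) (auto simp: k0)
 qed
 let ?W = "density lborel (%r. enn (w r)) xx P" and ?V = "density lborel (%r. enn (v r)) xx Q"
 have FW: "F : bmeas ?W" and GV: "G : bmeas ?V" by measurable
 have "distr ?W borel F = distr ?V borel G"
 proof (rule measure_eqI)
  fix A :: "'c set" assume "A : sets (distr ?W borel F)"
  then have A[measurable]: "A : sets borel" by simp
  have "em (distr ?W borel F) A = (II z. ind A z dd distr ?W borel F)" by simp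
  also have "... = (II z. ind A (F z) dd ?W)" by (rule nn_integral_distr[OF FW]) measurable
  also have "... = (II z. ind A (G z) dd ?V)" using eq[of "ind A"] by (simp add: gen[OF P w F] gen[OF Q v G])
  also have "... = (II z. ind A z dd distr ?V borel G)" by (rule nn_integral_distr[OF GV, symmetric]) measurable
  finally show "em (distr ?W borel F) A = em (distr ?V borel G) A" by simp
 qed simp
 note de = this
 have "integrable ?V (%z. f (G z))"
 proof (rule integrableI_bounded)
  have "(II z. (%y. enn (norm (f y))) (G z) dd ?V) < \<infinity>" using fin by (subst gen[OF Q v G]) auto
  then show "(II z. enn (norm (f (G z))) dd ?V) < \<infinity>" .
 qed measurable
 note iV = this
 then have "integrable (distr ?V borel G) f" by (subst integrable_distr_eq[OF GV]) auto
 then have iW: "integrable ?W (%z. f (F z))" unfolding de[symmetric] by (subst (asm) integrable_distr_eq[OF FW]) auto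
 have "(LINT z|?W. f (F z)) = (LINT z|?V. f (G z))" using integral_distr[OF FW f] integral_distr[OF GV f] de by simp
 then show "(LINT s|lborel. w s *R (LINT z|P. f (F (s, z)))) = (LINT r|lborel. v r *R (LINT z|Q. f (G (r, z))))" using genL(1)[OF P w F wv0(1) iW] genL(1)[OF Q v G wv0(2) iV] by simp
 show "integrable lborel (%r. v r *R (LINT z|Q. f (G (r, z))))" by (rule genL(2)[OF Q v G wv0(2) iV])
qed

text \<open>Evenness of k folds the two-sided kernel (t - |r|)^m / 2 onto [0, t], which uses up the
  factor 1/2.\<close>

lemma int_symmetric_kernel:
 fixes k :: "real => 'b::euclidean_space"
 assumes k[measurable]: "k : bmeas borel" and even: "!!r. k (- r) = k r" and t: "0 < t"
  and i: "integrable lborel (%r. ((t - \<bar>r\<bar>) ^ m / 2 * ind {-t<..<t} r) *R k r)"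
 shows "(LINT r|lborel. ((t - \<bar>r\<bar>) ^ m / 2 * ind {-t<..<t} r) *R k r) = (LINT r|lborel. (ind {0..t} r * (t - r) ^ m) *R k r)"
proof -
 let ?v = "%r. (t - \<bar>r\<bar>) ^ m / 2 * ind {-t<..<t} r" and ?p = "%r. ind {0..t} r * (t - r) ^ m"
 have ae: "AE r in lborel. ?p r + ?p (- r) = 2 * ?v r" using AE_lborel_singleton[of 0] AE_lborel_singleton[of t] AE_lborel_singleton[of "-t"] by eventually_elim (auto simp: indicator_def)
 have p0: "0 <= ?p r" for r by (auto simp: indicator_def)
 have ip: "integrable lborel (%r. ?p r *R k r)"
 proof (rule Bochner_Integration.integrable_bound)
  show "integrable lborel (%r. 2 *R (?v r *R k r))" by (intro integrable_scaleR_right i)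
  show "AE r in lborel. norm (?p r *R k r) <= norm (2 *R (?v r *R k r))" using ae
  proof eventually_elim
   fix r assume *: "?p r + ?p (- r) = 2 * ?v r"
   have "\<bar>?p r\<bar> <= \<bar>2 * ?v r\<bar>" using p0[of r] p0[of "- r"] * by linarith
   then have "\<bar>?p r\<bar> * norm (k r) <= \<bar>2 * ?v r\<bar> * norm (k r)" by (rule mult_right_mono) simp
   then show "norm (?p r *R k r) <= norm (2 *R (?v r *R k r))" by (simp only: norm_scaleR scaleR_scaleR)
  qed
 qed measurable
 have ip': "integrable lborel (%r. ?p (- r) *R k r)" and eq: "(LINT r|lborel. ?p (- r) *R k r) = (LINT r|lborel. ?p r *R k r)" using lborel_integrable_real_affine[OF ip, of "-1" 0] lborel_integral_real_affine[of "-1" "%r. ?p r *R k r" 0] by (simp_all add: even)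
 have "2 *R (LINT r|lborel. ?v r *R k r) = (LINT r|lborel. 2 *R (?v r *R k r))" by (rule integral_scaleR_right[symmetric])
 also have "... = (LINT r|lborel. ?p r *R k r + ?p (- r) *R k r)"
 proof (rule integral_cong_AE)
  show "AE r in lborel. 2 *R (?v r *R k r) = ?p r *R k r + ?p (- r) *R k r" using ae by eventually_elim (simp only: scaleR_scaleR scaleR_add_left[symmetric])
 qed measurable
 also have "... = 2 *R (LINT r|lborel. ?p r *R k r)" unfolding Bochner_Integration.integral_add[OF ip ip'] eq by (simp add: scaleR_2)
 finally show ?thesis by simp
qed

text \<open>\<open>g\<close> is known only up to null sets, yet \<open>funk_mean\<close> integrates
  it over sections that are themselves null. By \<open>nni_sphere_cap\<close> the mass of the
  exceptional set on the sections averages to 0, so for almost every pole almost every section is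
  unaffected.\<close>

lemma funk_mean_AE:
 fixes Y :: "'a::euclidean_space set" and k :: "'a => 'b::euclidean_space"
 assumes Y: "subspace Y" and d: "2 <= dim Y" and k[measurable]: "k : bmeas borel"
  and g: "AE h in sph Y. g h = k h"
 shows "AE h in sph Y. AE s in lborel. s : {0<..<1} --> funk_mean Y g h s = cap_mean Y k (sqrt (1 - s^2)) h"
proof -
 let ?S = "sph Y" and ?U = "sph (UNIV :: 'a set)"
 interpret U: prob_space ?U by (rule prob_sph) simp
 have sS: "sfin ?S" using Y by (rule sf_sph)
 interpret S: sigma_finite_measure ?S by (rule sS)
 note [measurable] = bm_cap[OF Y] bm_pole_dir[OF Y]
 obtain N where N: "N : null_sets ?S" "{h : space ?S. g h ~= k h} \<subseteq> N" using g by (auto simp: eventually_ae_filter)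
 then have Nb[measurable]: "N : sets borel" by (auto simp: null_sets_def)
 let ?q = "%s::real. sqrt (1 - s^2)"
 have "(II h. II s. ind {0<..<1} s * (II x. ind N (cap Y (?q s) h x) dd ?U) dd lborel dd ?S)
  = (II s. II h. ind {0<..<1} s * (II x. ind N (cap Y (?q s) h x) dd ?U) dd ?S dd lborel)" by (rule nni_swap[OF sS lborel.sigma_finite_measure_axioms]) measurable
 also have "... = (II s. 0 dd (lborel :: real measure))"
 proof (rule nn_integral_cong)
  fix s :: real
  have q: "\<bar>?q s\<bar> <= 1" if "s : {0<..<1}" using that by (simp add: power_le_one real_le_lsqrt abs_square_le_1)
  have "(II h. II x. ind N (cap Y (?q s) h x) dd ?U dd ?S) = 0" if "s : {0<..<1}" using nni_sphere_cap[OF Y d q[OF that], of "ind N"] N(1) by (simp add: null_sets_def)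
  then show "(II h. ind {0<..<1} s * (II x. ind N (cap Y (?q s) h x) dd ?U) dd ?S) = 0" by (cases "s : {0<..<1}") simp_all
 qed
 finally have "AE h in ?S. (II s. ind {0<..<1} s * (II x. ind N (cap Y (?q s) h x) dd ?U) dd lborel) = 0" by (subst nn_integral_0_iff_AE[symmetric]) auto
 moreover have "AE h in ?S. h : Y Int sphere 0 1" using d by (intro AE_sph[OF Y]) simp
 ultimately show ?thesis
 proof eventually_elim
  fix h assume z: "(II s. ind {0<..<1} s * (II x. ind N (cap Y (?q s) h x) dd ?U) dd lborel) = 0"
   and "h : Y Int sphere 0 1"
  then have h: "h : Y" "norm h = 1" by auto
  have "(%s. ind {0<..<1} s * (II x. ind N (cap Y (?q s) h x) dd ?U)) : bmeas lborel" by measurable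
  from nn_integral_0_iff_AE[OF this] z
  have "AE s in lborel. ind {0<..<1} s * (II x. ind N (cap Y (?q s) h x) dd ?U) = 0" by simp
  then show "AE s in lborel. s : {0<..<1} --> funk_mean Y g h s = cap_mean Y k (?q s) h"
  proof (eventually_elim, intro impI)
   fix s :: real assume z: "ind {0<..<1} s * (II x. ind N (cap Y (?q s) h x) dd ?U) = 0" and s: "s : {0<..<1}"
   have qs: "sqrt (1 - (?q s)^2) = s" using s by (simp add: power_le_one)
   have "(%x. ind N (cap Y (?q s) h x) :: ennreal) : bmeas ?U" by measurable
   from nn_integral_0_iff_AE[OF this] z s have "AE x in ?U. ind N (cap Y (?q s) h x) = (0::ennreal)" by simp
   then have a: "AE x in ?U. g (s *R pole_dir Y h x + ?q s *R h) = k (s *R pole_dir Y h x + ?q s *R h)"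
   proof eventually_elim
    fix x assume "ind N (cap Y (?q s) h x) = (0::ennreal)"
    then have "cap Y (?q s) h x ~: N" by (simp add: indicator_eq_0_iff)
    moreover have "cap Y (?q s) h x = s *R pole_dir Y h x + ?q s *R h" unfolding cap_def qs by (rule add.commute)
    ultimately show "g (s *R pole_dir Y h x + ?q s *R h) = k (s *R pole_dir Y h x + ?q s *R h)" using N(2) by auto
   qed
   have pm: "pole_dir Y h : measurable ?U borel" using bm_pole_dir[OF Y, of "%_. h" ?U "%x. x"] by simp
   have km: "(%v. k (s *R v + ?q s *R h)) : bmeas borel" by measurable
   have qN: "cap Y (?q s) h x = s *R pole_dir Y h x + ?q s *R h" for x unfolding cap_def qs by (rule add.commute)
   have "(%v. s *R v + ?q s *R h) -` N : sets borel" using measurable_sets[of "%v. s *R v + ?q s *R h" borel borel N] by simp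
   then have Nm: "{v : space borel. s *R v + ?q s *R h ~: N} : sets borel" by (simp add: vimage_def Collect_neg_eq borel_comp)
   have "AE v in distr ?U borel (pole_dir Y h). s *R v + ?q s *R h ~: N" using \<open>AE x in ?U. ind N (cap Y (?q s) h x) = (0::ennreal)\<close> unfolding AE_distr_iff[OF pm Nm] qN by (simp add: indicator_eq_0_iff)
   then have "AE v in sph (Y Int {h}^o). g (s *R v + ?q s *R h) = k (s *R v + ?q s *R h)" unfolding sph_comp[OF Y h d] by eventually_elim (use N(2) in auto)
   then have "funk_mean Y g h s = (LINT v|sph (Y Int {h}^o). k (s *R v + ?q s *R h))" unfolding funk_mean_def sphere_measure_eq by (rule integral_completion_AE) (use km in simp)
   also have "... = (LINT x|?U. k (s *R pole_dir Y h x + ?q s *R h))" unfolding sph_comp[OF Y h d] by (rule integral_distr[OF pm km])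
   finally show "funk_mean Y g h s = cap_mean Y k (?q s) h" unfolding cap_mean_def qN .
  qed
 qed
qed

text \<open>\<open>density_pair_distr_eq\<close> carries \<open>nni_funk_primitive\<close> over to
  f; after folding, the kernel is the one in Cauchy's formula.\<close>

lemma funk_primitive_AE:
 fixes Y :: "'a::euclidean_space set" and f :: "'a => 'b::euclidean_space"
 assumes Y: "subspace Y" and d: "dim Y = Suc (Suc (Suc m))" and f[measurable]: "f : bmeas borel"
  and even: "!!x. f (- x) = f x" and fi: "integrable (sph Y) f"
  and h: "AE q in sph Y. h q = (LINT z|sph UNIV. f (pole_dir Y q z))" and t: "t : {0<..<1}"
 shows "AE q in sph Y. funk_primitive Y h t q = (primitive ^^ Suc m) (cap_mean Y f) t q"
proof -
 let ?S = "sph Y" and ?U = "sph (UNIV :: 'a set)"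
 interpret U: prob_space ?U by (rule prob_sph) simp
 interpret UU: pair_prob_space ?U ?U ..
 have sS: "sfin ?S" using Y by (rule sf_sph)
 interpret S: sigma_finite_measure ?S by (rule sS)
 note [measurable] = bm_cap[OF Y] bm_pole_dir[OF Y] cap_mean_meas[OF Y f]
 have d2: "2 <= dim Y" using d by simp
 define k where "k a = (LINT z|?U. f (pole_dir Y a z))" for a
 have km[measurable]: "k : bmeas borel" unfolding k_def by measurable
 define w where "w s = (t^2 - s^2) powr ((real m - 1) / 2) * s * ind {0<..<t} s" for s
 define v where "v r = (t - \<bar>r\<bar>) ^ m / 2 * ind {-t<..<t} r" for r
 have [measurable]: "w : bmeas borel" "v : bmeas borel" unfolding w_def v_def by measurable
 have wv0: "0 <= w r" "0 <= v r" for r by (auto simp: w_def v_def indicator_def)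
 \<comment> \<open>Averaging over q replaces each section mean of |f| by its full L1 norm, and
   \<open>v\<close> is at most 1 on a bounded interval; so the integrals are finite at almost every
   pole.\<close>
 have fin: "(II q. II r. enn (v r) * (II x. enn (norm (f (cap Y r q x))) dd ?U) dd lborel dd ?S) < \<infinity>"
 proof -
  have "(II q. II r. enn (v r) * (II x. enn (norm (f (cap Y r q x))) dd ?U) dd lborel dd ?S)
   = (II r. II q. enn (v r) * (II x. enn (norm (f (cap Y r q x))) dd ?U) dd ?S dd lborel)" by (rule nni_swap[OF sS lborel.sigma_finite_measure_axioms]) measurable
  also have "... <= (II r. ind {-1..1::real} r * L1_norm ?S f dd lborel)"
  proof (rule nn_integral_mono)
   fix r :: real
   have 1: "(II q. enn (v r) * (II x. enn (norm (f (cap Y r q x))) dd ?U) dd ?S)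
    = enn (v r) * (II q. II x. enn (norm (f (cap Y r q x))) dd ?U dd ?S)" by (rule nn_integral_cmult) measurable
   show "(II q. enn (v r) * (II x. enn (norm (f (cap Y r q x))) dd ?U) dd ?S) <= ind {-1..1} r * L1_norm ?S f"
   proof (cases "r : {-t<..<t}")
    case True
    then have r: "\<bar>r\<bar> <= 1" "\<bar>r\<bar> <= t" using t by auto
    have "(t - \<bar>r\<bar>) ^ m <= 1" using r t by (intro power_le_one) auto
    then have "enn (v r) <= ennreal 1" by (intro ennreal_leI) (simp add: v_def indicator_def)
    moreover have "(II q. II x. enn (norm (f (cap Y r q x))) dd ?U dd ?S) = L1_norm ?S f" unfolding L1_norm_def by (rule nni_sphere_cap[OF Y d2 r(1)]) measurable
    moreover have "ind {-1..1} r = (1::ennreal)" using r by (simp add: abs_le_iff)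
    ultimately show ?thesis unfolding 1 using mult_right_mono[of "enn (v r)" 1 "L1_norm ?S f"] by simp
   next
    case False
    then have "v r = 0" by (simp add: v_def)
    then show ?thesis unfolding 1 by simp
   qed
  qed
  also have "... = 2 * L1_norm ?S f" by (subst nn_integral_multc) auto
  also have "... < \<infinity>" using fi unfolding integrable_iff_bounded L1_norm_def by (simp add: ennreal_mult_less_top)
  finally show ?thesis .
 qed
 have "AE q in ?S. (II r. enn (v r) * (II x. enn (norm (f (cap Y r q x))) dd ?U) dd lborel) ~= \<infinity>" by (rule nn_integral_PInf_AE) (use fin in auto)
 moreover have "AE q in ?S. q : Y Int sphere 0 1" using d by (intro AE_sph[OF Y]) simp
 moreover have "AE q in ?S. AE s in lborel. s : {0<..<1} --> funk_mean Y h q s = cap_mean Y k (sqrt (1 - s^2)) q" by (rule funk_mean_AE[OF Y d2 km]) (use h in \<open>simp add: k_def\<close>)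
 moreover have "AE q in ?S. integrable lborel (%r. ind {0..1} r *R cap_mean Y f r q)" by (rule AE_set_integrable_curve[OF L1_curve_cap_mean[OF Y d2 f fi] sS])
 ultimately show ?thesis
 proof eventually_elim
  fix q
  assume finr: "(II r. enn (v r) * (II x. enn (norm (f (cap Y r q x))) dd ?U) dd lborel) ~= \<infinity>"
   and "q : Y Int sphere 0 1"
   and fm: "AE s in lborel. s : {0<..<1} --> funk_mean Y h q s = cap_mean Y k (sqrt (1 - s^2)) q"
   and ii: "integrable lborel (%r. ind {0..1} r *R cap_mean Y f r q)"
  then have q: "q : Y" "norm q = 1" by auto
  let ?F = "%(s, (x, z)). pole_dir Y (cap Y (sqrt (1 - s^2)) q x) z" and ?G = "%(r, x). cap Y r q x"
  have nn: "(II s. enn (w s) * (II p. g (?F (s, p)) dd (?U xx ?U)) dd lborel)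
   = (II r. enn (v r) * (II x. g (?G (r, x)) dd ?U) dd lborel)" if [measurable]: "g : bmeas borel" for g
  proof -
   have "(II s. enn (w s) * (II p. g (?F (s, p)) dd (?U xx ?U)) dd lborel)
    = (II s. enn ((t^2 - s^2) powr ((real m - 1) / 2) * s) * ind {0<..<t} s
     * (II x. II z. g (pole_dir Y (cap Y (sqrt (1 - s^2)) q x) z) dd ?U dd ?U) dd lborel)"
   proof (rule nn_integral_cong)
    fix s :: real
    have "(II p. g (?F (s, p)) dd (?U xx ?U)) = (II x. II z. g (pole_dir Y (cap Y (sqrt (1 - s^2)) q x) z) dd ?U dd ?U)" by (subst U.nn_integral_fst[symmetric]) (auto simp: case_prod_beta)
    moreover have "enn (w s) = enn ((t^2 - s^2) powr ((real m - 1) / 2) * s) * ind {0<..<t} s" by (simp add: w_def indicator_def)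
    ultimately show "enn (w s) * (II p. g (?F (s, p)) dd (?U xx ?U)) = enn ((t^2 - s^2) powr ((real m - 1) / 2) * s) * ind {0<..<t} s
     * (II x. II z. g (pole_dir Y (cap Y (sqrt (1 - s^2)) q x) z) dd ?U dd ?U)" by (simp only:)
   qed
   also have "... = (II r. enn ((t - \<bar>r\<bar>) ^ m / 2) * ind {-t<..<t} r * (II x. g (cap Y r q x) dd ?U) dd lborel)" using t by (intro nni_funk_primitive[OF Y d q]) auto
   also have "... = (II r. enn (v r) * (II x. g (?G (r, x)) dd ?U) dd lborel)" by (intro nn_integral_cong) (simp add: v_def indicator_def)
   finally show ?thesis .
  qed
  have finr': "(II r. enn (v r) * (II x. enn (norm (f (?G (r, x)))) dd ?U) dd lborel) < \<infinity>" using finr by (simp add: less_top)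
  have sUU: "sfin (?U xx ?U)" by (rule UU.sigma_finite_measure_axioms)
  have Fm: "?F : bmeas (borel xx (?U xx ?U))" "?G : bmeas (borel xx ?U)" by measurable
  note main = density_pair_distr_eq[OF sUU U.sigma_finite_measure_axioms _ _ wv0 Fm nn f finr']
  have eq1: "(LINT s|lborel. w s *R (LINT p|(?U xx ?U). f (?F (s, p)))) = (LINT r|lborel. v r *R cap_mean Y f r q)" using main(1) by (simp add: cap_mean_def)
  have iv: "integrable lborel (%r. v r *R cap_mean Y f r q)" using main(2) by (simp add: cap_mean_def)
  \<comment> \<open>Fubini in the pair (x, z) needs integrability at the individual s. The total
    integral is finite and \<open>w\<close> is positive on (0, t), so this holds for almost every
    s.\<close>
  have AEi: "AE s in lborel. s : {0<..<t} --> (LINT p|(?U xx ?U). f (?F (s, p))) = cap_mean Y k (sqrt (1 - s^2)) q"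
  proof -
   have "(II s. enn (w s) * (II p. enn (norm (f (?F (s, p)))) dd (?U xx ?U)) dd lborel) ~= \<infinity>" using nn[of "%y. enn (norm (f y))"] finr' by simp
   then have "AE s in lborel. enn (w s) * (II p. enn (norm (f (?F (s, p)))) dd (?U xx ?U)) ~= \<infinity>" by (rule nn_integral_PInf_AE[rotated]) measurable
   then show ?thesis
   proof (eventually_elim, intro impI)
    fix s assume 1: "enn (w s) * (II p. enn (norm (f (?F (s, p)))) dd (?U xx ?U)) ~= \<infinity>" and s: "s : {0<..<t}"
    have "s^2 < t^2" using s by (simp add: power_strict_mono)
    then have "0 < w s" using s by (simp add: w_def)
    then have "(II p. enn (norm (f (?F (s, p)))) dd (?U xx ?U)) < \<infinity>" using 1 by (auto simp: ennreal_mult_eq_top_iff less_top)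
    then have "integrable (?U xx ?U) (%p. f (?F (s, p)))" by (intro integrableI_bounded) auto
    from UU.integral_fst'[OF this] show "(LINT p|(?U xx ?U). f (?F (s, p))) = cap_mean Y k (sqrt (1 - s^2)) q" by (simp add: cap_mean_def k_def)
   qed
  qed
  have "(LINT s:{0..t}|lebesgue. ((t^2 - s^2) powr ((real (dim Y - 1) - 3) / 2) * s) *R funk_mean Y h q s)
   = (LINT s|lborel. w s *R (LINT p|(?U xx ?U). f (?F (s, p))))" unfolding set_lebesgue_integral_def
  proof (rule integral_completion_AE)
   show "(%s. w s *R (LINT p|(?U xx ?U). f (?F (s, p)))) : bmeas lborel" using Fm by measurable
   show "AE s in lborel. ind {0..t} s *R ((t^2 - s^2) powr ((real (dim Y - 1) - 3) / 2) * s) *R funk_mean Y h q s = w s *R (LINT p|(?U xx ?U). f (?F (s, p)))" using AEi fm AE_lborel_singleton[of 0] AE_lborel_singleton[of t]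
   proof eventually_elim
    fix s assume *: "s : {0<..<t} --> (LINT p|(?U xx ?U). f (?F (s, p))) = cap_mean Y k (sqrt (1 - s^2)) q"
     "s : {0<..<1} --> funk_mean Y h q s = cap_mean Y k (sqrt (1 - s^2)) q" "s ~= 0" "s ~= t"
    have e: "(real (dim Y - 1) - 3) / 2 = (real m - 1) / 2" unfolding d by simp
    show "ind {0..t} s *R ((t^2 - s^2) powr ((real (dim Y - 1) - 3) / 2) * s) *R funk_mean Y h q s = w s *R (LINT p|(?U xx ?U). f (?F (s, p)))"
    proof (cases "s : {0<..<t}")
     case True
     then have "s : {0<..<1}" using t by auto
     then have E: "(LINT p|(?U xx ?U). f (?F (s, p))) = funk_mean Y h q s" using *(1,2) True by (simp only: simp_thms)
     show ?thesis unfolding E e w_def using True by simp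
    next
     case False
     then have "s ~: {0..t}" using *(3,4) by auto
     then show ?thesis using False by (simp add: w_def)
    qed
   qed
  qed
  also have "... = (LINT r|lborel. (ind {0..t} r * (t - r) ^ m) *R cap_mean Y f r q)" unfolding eq1 v_def
  proof (rule int_symmetric_kernel)
   show "(%r. cap_mean Y f r q) : bmeas borel" by measurable
   show "cap_mean Y f (- r) q = cap_mean Y f r q" for r by (rule cap_mean_even[OF Y f even])
  qed (use t iv in \<open>auto simp: v_def\<close>)
  \<comment> \<open>Here d - 2 = (dim Y - 1) - 2 = m, which supplies the 1 / m! of Cauchy's
    formula.\<close>
  finally have "funk_primitive Y h t q = (1 / fact m) *R (LINT r|lborel. (ind {0..t} r * (t - r) ^ m) *R cap_mean Y f r q)" unfolding funk_primitive_def Let_def using d by simp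
  also have "... = (LINT r|lborel. (ind {0..t} r * ((t - r) ^ m / fact m)) *R cap_mean Y f r q)" by (subst integral_scaleR_right[symmetric]) simp
  also have "... = (primitive ^^ Suc m) (cap_mean Y f) t q" using t by (intro primitive_iterate[where u = "cap_mean Y f" and x = q, OF ii, symmetric]) auto
  finally show "funk_primitive Y h t q = (primitive ^^ Suc m) (cap_mean Y f) t q" .
 qed
qed

section \<open>Versions, uniqueness of the inverse and the inversion theorem\<close>

lemma L1_tendsto_completion_AE:
 assumes L: "L1_tendsto M G g F" and G: "\<forall>\<^sub>F t in F. AE x in M. G' t x = G t x" and g: "AE x in M. g' x = g x"
 shows "L1_tendsto (completion M) G' g' F" unfolding L1_tendsto_def
proof (intro conjI)
 have gi: "integrable M g" and Gi: "\<forall>\<^sub>F t in F. integrable M (G t)"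
  and lim: "((%t. LINT x|M. norm (G t x - g x)) \<longlongrightarrow> 0) F" using L by (auto simp: L1_tendsto_def)
 have gm: "g : bmeas M" using gi by simp
 show "integrable (completion M) g'" using integrable_completion_AE[OF g gm] gi by simp
 show "\<forall>\<^sub>F t in F. integrable (completion M) (G' t)" using G Gi by eventually_elim (simp add: integrable_completion_AE)
 have "\<forall>\<^sub>F t in F. (LINT x|M. norm (G t x - g x)) = (LINT x|completion M. norm (G' t x - g' x))" using G Gi
 proof eventually_elim
  fix t assume t: "AE x in M. G' t x = G t x" and i: "integrable M (G t)"
  have m: "(%x. norm (G t x - g x)) : bmeas M" using i gm by measurable
  have "AE x in M. norm (G' t x - g' x) = norm (G t x - g x)" using t g by eventually_elim simp
  from integral_completion_AE[OF this m] show "(LINT x|M. norm (G t x - g x)) = (LINT x|completion M. norm (G' t x - g' x))" ..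
 qed
 then show "((%t. LINT x|completion M. norm (G' t x - g' x)) \<longlongrightarrow> 0) F" using lim by (rule Lim_transform_eventually[rotated])
qed

lemma L1_tendsto_unique:
 assumes G: "L1_tendsto M G g F" and G': "L1_tendsto M G' g' F"
  and eq: "\<forall>\<^sub>F t in F. AE x in M. G t x = G' t x" and F: "F ~= bot"
 shows "AE x in M. g x = g' x"
proof -
 have i: "integrable M g" "integrable M g'" using G G' by (auto simp: L1_tendsto_def)
 have "\<forall>\<^sub>F t in F. (LINT x|M. norm (g x - g' x)) <= (LINT x|M. norm (G t x - g x)) + (LINT x|M. norm (G' t x - g' x))"
 proof -
  have "\<forall>\<^sub>F t in F. integrable M (G t)" "\<forall>\<^sub>F t in F. integrable M (G' t)" using G G' by (auto simp: L1_tendsto_def)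
  then show ?thesis using eq
  proof eventually_elim
   fix t assume a: "integrable M (G t)" "integrable M (G' t)" "AE x in M. G t x = G' t x"
   have "(LINT x|M. norm (g x - g' x)) <= (LINT x|M. norm (G t x - g x) + norm (G' t x - g' x))"
   proof (rule integral_mono_AE)
    show "AE x in M. norm (g x - g' x) <= norm (G t x - g x) + norm (G' t x - g' x)" using a(3)
    proof eventually_elim
     fix x assume "G t x = G' t x"
     then have e: "g x - g' x = (G' t x - g' x) - (G t x - g x)" by simp
     have "norm (g x - g' x) <= norm (G' t x - g' x) + norm (G t x - g x)" unfolding e by (rule norm_triangle_ineq4)
     then show "norm (g x - g' x) <= norm (G t x - g x) + norm (G' t x - g' x)" by simp
    qed
   qed (use a i in auto)
   also have "... = (LINT x|M. norm (G t x - g x)) + (LINT x|M. norm (G' t x - g' x))" using a i by (intro Bochner_Integration.integral_add) auto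
   finally show "(LINT x|M. norm (g x - g' x)) <= (LINT x|M. norm (G t x - g x)) + (LINT x|M. norm (G' t x - g' x))" .
  qed
 qed
 moreover have "((%t. (LINT x|M. norm (G t x - g x)) + (LINT x|M. norm (G' t x - g' x))) \<longlongrightarrow> 0 + 0) F" using G G' by (intro tendsto_add) (auto simp: L1_tendsto_def)
 ultimately have "(LINT x|M. norm (g x - g' x)) <= 0" using tendsto_lowerbound[OF _ _ F] by auto
 moreover have "0 <= (LINT x|M. norm (g x - g' x))" by simp
 ultimately have "(LINT x|M. norm (g x - g' x)) = 0" by linarith
 then have "AE x in M. norm (g x - g' x) = 0" using i by (subst (asm) integral_nonneg_eq_0_iff_AE) auto
 then show ?thesis by eventually_elim simp
qed

lemma L1_derivatives_unique:
 assumes D: "!!i. i < n ==> L1_has_derivative_01 M (D i) (D (Suc i))"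
  and D': "!!i. i < n ==> L1_has_derivative_01 M (D' i) (D' (Suc i))"
  and 0: "!!t. t : {0<..<1} ==> AE x in M. D 0 t x = D' 0 t x" and t: "t : {0<..<1}"
 shows "AE x in M. D n t x = D' n t x"
proof -
 have "i <= n ==> t : {0<..<1} ==> AE x in M. D i t x = D' i t x" for i t
 proof (induction i arbitrary: t)
  case (Suc i)
  have "\<forall>\<^sub>F s in at t. s : {0<..<1}" using Suc.prems(2) by (intro eventually_at_in_open') auto
  then have ev: "\<forall>\<^sub>F s in at t. AE x in M. (1 / (s - t)) *R (D i s x - D i t x) = (1 / (s - t)) *R (D' i s x - D' i t x)"
  proof eventually_elim
   fix s :: real assume "s : {0<..<1}"
   then have "AE x in M. D i s x = D' i s x" "AE x in M. D i t x = D' i t x" using Suc by auto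
   then show "AE x in M. (1 / (s - t)) *R (D i s x - D i t x) = (1 / (s - t)) *R (D' i s x - D' i t x)" by eventually_elim simp
  qed
  have "i < n" using Suc.prems(1) by simp
  show ?case by (rule L1_tendsto_unique[OF _ _ ev]) (use D[OF \<open>i < n\<close>] D'[OF \<open>i < n\<close>] Suc.prems(2) in \<open>auto simp: L1_has_derivative_01_def\<close>)
 qed (rule 0)
 then show ?thesis using t by blast
qed

text \<open>Any two sequences of derivatives start from the same \<open>funk_primitive\<close>;
  derivatives and limits in L1 are unique up to null sets.\<close>

lemma is_funk_inverse_unique:
 assumes "is_funk_inverse Y h g" "is_funk_inverse Y h g'"
 shows "AE q in sphere_measure Y. g q = g' q"
proof -
 obtain D where D: "D 0 = funk_primitive Y h" "!!m. m < dim Y - 2 ==> L1_has_derivative_01 (sphere_measure Y) (D m) (D (Suc m))"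
  "L1_tendsto (sphere_measure Y) (D (dim Y - 2)) g (at_left 1)" using assms(1) unfolding is_funk_inverse_def by blast
 obtain D' where D': "D' 0 = funk_primitive Y h" "!!m. m < dim Y - 2 ==> L1_has_derivative_01 (sphere_measure Y) (D' m) (D' (Suc m))"
  "L1_tendsto (sphere_measure Y) (D' (dim Y - 2)) g' (at_left 1)" using assms(2) unfolding is_funk_inverse_def by blast
 have "\<forall>\<^sub>F t in at_left (1::real). t : {0<..<1}" by (intro eventually_at_left_real) auto
 then have ev: "\<forall>\<^sub>F t in at_left 1. AE q in sphere_measure Y. D (dim Y - 2) t q = D' (dim Y - 2) t q"
 proof eventually_elim
  fix t :: real assume t: "t : {0<..<1}"
  show "AE q in sphere_measure Y. D (dim Y - 2) t q = D' (dim Y - 2) t q" by (rule L1_derivatives_unique[where n = "dim Y - 2" and D = D and D' = D', OF D(2) D'(2) _ t]) (simp_all add: D(1) D'(1))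
 qed
 show ?thesis by (rule L1_tendsto_unique[OF D(3) D'(3) ev]) simp
qed

text \<open>The mean of a Borel version and its reflection is even at every point of the space; it
  is still a version because the reflection preserves \<open>sph Y\<close>.\<close>

lemma even_borel_version:
 fixes Y :: "'a::euclidean_space set" and f :: "'a => 'b::euclidean_space"
 assumes Y: "subspace Y" "0 < dim Y" and f: "f : even_L1 Y"
 obtains g where "g : bmeas borel" "AE q in sph Y. f q = g q" "!!x. g (- x) = g x" "integrable (sph Y) g"
proof -
 have fi: "integrable (completion (sph Y)) f" and fe: "!!q. q : Y Int sphere 0 1 ==> f (- q) = f q" using f by (auto simp: even_L1_def sphere_measure_eq)
 obtain h where h: "h : bmeas (sph Y)" "AE x in sph Y. f x = h x" using completion_ex_bm_euclidean[of f] fi by (metis borel_measurable_integrable)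
 have hm[measurable]: "h : bmeas borel" using h(1) by simp
 have "AE x in distr (sph Y) borel uminus. f x = h x" unfolding sph_uminus[OF Y(1)] by (rule h(2))
 then have 2: "AE x in sph Y. f (- x) = h (- x)" by (rule AE_distrD[rotated]) simp
 let ?g = "%x. (1/2) *R (h x + h (- x))"
 have ae: "AE x in sph Y. f x = ?g x" using h(2) 2 AE_sph[OF Y]
 proof eventually_elim
  fix x assume a: "f x = h x" "f (- x) = h (- x)" "x : Y Int sphere 0 1"
  have "?g x = (1/2) *R (f x + f x)" using fe[OF a(3)] a(1,2) by simp
  then show "f x = ?g x" by (simp add: scaleR_half_double)
 qed
 show ?thesis
 proof (rule that[OF _ ae])
  show "integrable (sph Y) ?g" by (rule integrable_completion_AE[OF ae, THEN iffD1]) (use fi in auto)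
 qed (auto simp: add.commute)
qed

lemma funk_AE_eq:
 fixes Y :: "'a::euclidean_space set" and f :: "'a => 'b::euclidean_space"
 assumes Y: "subspace Y" and d: "2 <= dim Y" and g[measurable]: "g : bmeas borel"
  and f: "AE q in sph Y. f q = g q"
 shows "AE q in sph Y. funk Y f q = (LINT z|sph UNIV. g (pole_dir Y q z))"
proof -
 let ?S = "sph Y" and ?U = "sph (UNIV :: 'a set)"
 interpret U: prob_space ?U by (rule prob_sph) simp
 note [measurable] = bm_cap[OF Y] bm_pole_dir[OF Y]
 obtain N where N: "N : null_sets ?S" "{q : space ?S. f q ~= g q} \<subseteq> N" using f by (auto simp: eventually_ae_filter)
 then have Nb[measurable]: "N : sets borel" by (auto simp: null_sets_def)
 have "(II q. II x. ind N (cap Y 0 q x) dd ?U dd ?S) = 0" using nni_sphere_cap[OF Y d, of 0 "ind N"] N(1) by (simp add: null_sets_def)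
 then have "AE q in ?S. (II x. ind N (cap Y 0 q x) dd ?U) = 0" by (subst (asm) nn_integral_0_iff_AE) auto
 moreover have "AE q in ?S. q : Y Int sphere 0 1" using d by (intro AE_sph[OF Y]) simp
 ultimately show ?thesis
 proof eventually_elim
  fix q assume z: "(II x. ind N (cap Y 0 q x) dd ?U) = 0" and "q : Y Int sphere 0 1"
  then have q: "q : Y" "norm q = 1" by auto
  have pm: "pole_dir Y q : measurable ?U borel" using bm_pole_dir[OF Y, of "%_. q" ?U "%x. x"] by simp
  have Nm: "{s : space borel. s ~: N} : sets borel" by measurable
  have "AE x in ?U. ind N (cap Y 0 q x) = (0::ennreal)" using z by (subst (asm) nn_integral_0_iff_AE) auto
  then have "AE s in distr ?U borel (pole_dir Y q). s ~: N" unfolding AE_distr_iff[OF pm Nm] by (simp add: indicator_eq_0_iff cap_def)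
  then have "AE s in sph (Y Int {q}^o). f s = g s" unfolding sph_comp[OF Y q d] by eventually_elim (use N(2) in \<open>auto simp: sph_def\<close>)
  then have "funk Y f q = (LINT s|sph (Y Int {q}^o). g s)" unfolding funk_def sphere_measure_eq by (rule integral_completion_AE) simp
  also have "... = (LINT x|?U. g (pole_dir Y q x))" unfolding sph_comp[OF Y q d] by (rule integral_distr[OF pm g])
  finally show "funk Y f q = (LINT x|?U. g (pole_dir Y q x))" .
 qed
qed

theorem funk_inversion:
 fixes Y :: "'a::euclidean_space set" and f :: "'a => 'b::euclidean_space"
 assumes Y: "subspace Y" and d: "3 <= dim Y" and f: "f : even_L1 Y"
  and h: "AE q in sphere_measure Y. h q = funk Y f q"
 shows "is_funk_inverse Y h f"
proof -
 let ?S = "sph Y"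
 obtain m where m: "dim Y = Suc (Suc (Suc m))" using d by (metis add_Suc le_Suc_ex numeral_3_eq_3 plus_nat.add_0)
 have d2: "2 <= dim Y" "0 < dim Y" using d by auto
 have sS: "sfin ?S" using Y by (rule sf_sph)
 obtain g where g[measurable]: "g : bmeas borel" and fg: "AE q in ?S. f q = g q"
  and ge: "!!x. g (- x) = g x" and gi: "integrable ?S g" using even_borel_version[OF Y d2(2) f] by blast
 have h': "AE q in ?S. h q = (LINT z|sph UNIV. g (pole_dir Y q z))" using h[unfolded sphere_measure_eq AE_completion_iff] funk_AE_eq[OF Y d2(1) g fg] by eventually_elim simp
 \<comment> \<open>\<open>u i\<close> plays the role of the i-th derivative of the (m+1)-fold
   primitive; since dim Y - 2 = m + 1, the last one is \<open>cap_mean Y g\<close> itself.\<close>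
 define u where "u i = (primitive ^^ (Suc m - i)) (cap_mean Y g)" for i
 have u: "L1_curve ?S ((primitive ^^ i) (cap_mean Y g))" for i by (induction i) (auto intro: L1_curve_primitive sS L1_curve_cap_mean[OF Y d2(1) g gi])
 have uS: "u i = primitive (u (Suc i))" if "i < Suc m" for i using that by (simp add: u_def Suc_diff_le[of i m])
 \<comment> \<open>\<open>D 0\<close> has to be \<open>funk_primitive\<close> literally, whereas for
   the later derivatives any version is admissible.\<close>
 define D where "D i = (if i = 0 then funk_primitive Y h else u i)" for i :: nat
 have DA: "AE q in ?S. D i t q = u i t q" if "t : {0<..<1}" for i t using funk_primitive_AE[OF Y m g ge gi h' that] by (auto simp: D_def u_def)
 show ?thesis unfolding is_funk_inverse_def
 proof (intro conjI exI[of _ D] bexI[OF _ f] h f allI impI)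
  show "D 0 = funk_primitive Y h" by (simp add: D_def)
 next
  fix i assume "i < dim Y - 2"
  then have i: "i < Suc m" using m by simp
  show "L1_has_derivative_01 (sphere_measure Y) (D i) (D (Suc i))" unfolding L1_has_derivative_01_def sphere_measure_eq
  proof (intro ballI)
   fix t :: real assume t: "t : {0<..<1}"
   have "\<forall>\<^sub>F s in at t. s : {0<..<1}" using t by (intro eventually_at_in_open') auto
   then have ev: "\<forall>\<^sub>F s in at t. AE x in ?S. (1 / (s - t)) *R (D i s x - D i t x) = (1 / (s - t)) *R (u i s x - u i t x)"
   proof eventually_elim
    fix s :: real assume "s : {0<..<1}"
    from DA[OF this, of i] DA[OF t, of i] show "AE x in ?S. (1 / (s - t)) *R (D i s x - D i t x) = (1 / (s - t)) *R (u i s x - u i t x)" by eventually_elim simp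
   qed
   have "L1_tendsto ?S (%s x. (1 / (s - t)) *R (u i s x - u i t x)) (u (Suc i) t) (at t)" unfolding uS[OF i] by (rule L1_curve_primitive_derivative[OF _ sS t]) (unfold u_def, rule u)
   from L1_tendsto_completion_AE[OF this ev DA[OF t]]
   show "L1_tendsto (completion ?S) (%s x. (1 / (s - t)) *R (D i s x - D i t x)) (D (Suc i) t) (at t)" .
  qed
 next
  have e: "D (dim Y - 2) = cap_mean Y g" using m by (simp add: D_def u_def)
  have "L1_tendsto ?S (cap_mean Y g) (cap_mean Y g 1) (at_left 1)" using u[of 0] by (intro L1_curve_at_left_1) simp
  then show "L1_tendsto (sphere_measure Y) (D (dim Y - 2)) f (at_left 1)" unfolding sphere_measure_eq e by (rule L1_tendsto_completion_AE) (use fg in \<open>simp_all add: cap_mean_one\<close>)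
 qed
qed

section \<open>Invariant measures on Grassmannians and flags\<close>

text \<open>The operator norm is bounded by the sum of the moduli of the matrix entries, so each
  entry is approximated to e / (2 N), with N the number of entries.\<close>

lemma blinfun_rational_dense:
 fixes f :: "'a::euclidean_space \<Rightarrow>\<^sub>L 'b::euclidean_space"
 assumes "0 < e"
 shows "EX m : PiE (Basis \<times> Basis) (%_. \<rat>). dist f (blinfun_of_matrix (%i j. m (i, j))) < e"
proof -
 define N where "N = real DIM('a) * real DIM('b)"
 have N: "0 < N" by (simp add: N_def)
 have "EX q. q : \<rat> & \<bar>f j *. i - q\<bar> < e / (2 * N)" for i j
 proof -
  obtain q where "q : \<rat>" "f j *. i - e / (2 * N) < q" "q < f j *. i" using Rats_dense_in_real[of "f j *. i - e / (2 * N)" "f j *. i"] assms N by auto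
  then show ?thesis by (intro exI[of _ q]) auto
 qed
 then have "ALL i j. EX q. q : \<rat> & \<bar>f j *. i - q\<bar> < e / (2 * N)" by blast
 then obtain q where q: "!!i j. q i j : \<rat> & \<bar>f j *. i - q i j\<bar> < e / (2 * N)" unfolding choice_iff by blast
 let ?m = "restrict (%(i, j). q i j) (Basis \<times> Basis)"
 have "dist f (blinfun_of_matrix (%i j. ?m (i, j))) = norm (blinfun_of_matrix ((%i j. f j *. i) - (%i j. ?m (i, j))))" unfolding blinfun_of_matrix_minus[symmetric] blinfun_of_matrix_works dist_norm ..
 also have "... <= (\<Sum>i\<in>Basis. \<Sum>j\<in>Basis. \<bar>((%i j. f j *. i) - (%i j. ?m (i, j))) i j\<bar>)" by (rule norm_blinfun_of_matrix)
 also have "... <= (\<Sum>i\<in>(Basis::'b set). \<Sum>j\<in>(Basis::'a set). e / (2 * N))" by (intro sum_mono) (use q in \<open>auto intro: less_imp_le\<close>)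
 also have "... = e / 2" using N by (simp add: N_def)
 also have "... < e" using assms by simp
 finally show ?thesis using q by (intro bexI[of _ ?m]) auto
qed

text \<open>Subspaces will be compared through their projections in the operator norm, and
  \<open>prob_eqI_homogeneous\<close> works in second countable metric spaces.\<close>

instance blinfun :: (euclidean_space, euclidean_space) second_countable_topology
proof
 let ?Q = "(%m. blinfun_of_matrix (%i j. m (i, j))) ` PiE (Basis \<times> Basis) (%_. \<rat>) :: ('a \<Rightarrow>\<^sub>L 'b) set"
 let ?B = "(%(x, r). ball x r) ` (?Q \<times> (\<rat> :: real set))"
 have "countable ?Q" by (rule countable_image, rule countable_PiE) (auto simp: countable_rat)
 then have "countable (?Q \<times> (\<rat> :: real set))" by (rule countable_SIGMA) (rule countable_rat)
 then have cB: "countable ?B" by (rule countable_image)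
 have "topological_basis ?B"
 proof (rule topological_basisI)
  fix U :: "('a \<Rightarrow>\<^sub>L 'b) set" and x assume "open U" "x : U"
  then obtain e where e: "0 < e" "ball x e \<subseteq> U" using open_contains_ball by blast
  obtain r where r: "r : \<rat>" "0 < r" "r < e / 2" using Rats_dense_in_real[of 0 "e / 2"] e(1) by auto
  obtain q where q: "q : ?Q" "dist x q < r" using blinfun_rational_dense[OF r(2), of x] by blast
  have "ball q r \<subseteq> ball x e"
  proof
   fix y assume "y : ball q r"
   then have "dist x y < e" using q(2) r(3) dist_triangle[of x y q] by simp
   then show "y : ball x e" by simp
  qed
  moreover have "ball q r : ?B" using q(1) r(1) by (intro image_eqI[of _ _ "(q, r)"]) auto
  ultimately show "EX B':?B. x : B' & B' \<subseteq> U" using e(2) q(2) by (intro bexI[of _ "ball q r"]) (auto simp: dist_commute)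
 qed auto
 then show "EX B :: ('a \<Rightarrow>\<^sub>L 'b) set set. countable B & open = generate_topology B" using cB topological_basis_imp_subbasis by blast
qed

text \<open>A contraction \<open>F\<close> taking \<open>H x\<close> to \<open>H y\<close> and
  preserving a measure maps a ball about the former into the ball about the latter, so ball masses
  can only grow; exchanging x and y makes them equal.\<close>

lemma distr_eqI_transitive:
 fixes H :: "'x => 'c::{second_countable_topology, metric_space}"
 assumes prob: "prob_space P" "prob_space Q" and AE: "AE x in P. x : \<Omega>" "AE x in Q. x : \<Omega>"
  and H: "H : bmeas P" "H : bmeas Q"
  and tr: "!!x y. x : \<Omega> ==> y : \<Omega> ==> EX F:bmeas borel. (ALL a b. dist (F a) (F b) <= dist a b) & F (H x) = H y
   & distr (distr P borel H) borel F = distr P borel H & distr (distr Q borel H) borel F = distr Q borel H"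
 shows "distr P borel H = distr Q borel H"
proof -
 let ?M = "distr P borel H" and ?N = "distr Q borel H"
 interpret M: prob_space ?M using prob(1) H(1) by (rule prob_space.prob_space_distr)
 interpret N: prob_space ?N using prob(2) H(2) by (rule prob_space.prob_space_distr)
 have le: "em R (cball (H x) r) <= em R (cball (H y) r)"
  if xy: "x : \<Omega>" "y : \<Omega>" and R: "R = ?M \<or> R = ?N" for x y r R
 proof -
  obtain F where F[measurable]: "F : bmeas borel" and d: "!!a b. dist (F a) (F b) <= dist a b" "F (H x) = H y"
   and inv: "distr R borel F = R" using tr[OF xy] R by blast
  have [measurable_cong]: "sets R = sets borel" using R by auto
  have sp: "space R = UNIV" using R by auto
  have "em R (cball (H x) r) <= em R (F -` cball (H y) r Int space R)"
  proof (rule emeasure_mono)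
   show "cball (H x) r \<subseteq> F -` cball (H y) r Int space R"
   proof
    fix z assume "z : cball (H x) r"
    then have "dist (H y) (F z) <= r" using d(1)[of "H x" z] d(2) by simp
    then show "z : F -` cball (H y) r Int space R" by (simp add: sp)
   qed
   show "F -` cball (H y) r Int space R : sets R" by measurable
  qed
  also have "... = em (distr R borel F) (cball (H y) r)" by (subst emeasure_distr) auto
  finally show ?thesis unfolding inv .
 qed
 obtain a where a: "a : \<Omega>"
 proof (rule ccontr)
  assume *: "~ thesis"
  interpret P: prob_space P by fact
  have "AE x in P. False" using AE(1) by eventually_elim (use * that in blast)
  then show False by simp
 qed
 let ?e = "%n. inverse (real (Suc n))"
 \<comment> \<open>The image of \<Omega> under \<open>H\<close> may fail to be Borel. The set of
   points with the right ball masses contains it and is Borel.\<close>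
 define S where "S = {z. ALL n. em ?M (cball z (?e n)) = em ?M (cball (H a) (?e n)) & em ?N (cball z (?e n)) = em ?N (cball (H a) (?e n))}"
 have HS: "H x : S" if "x : \<Omega>" for x unfolding S_def using le[OF that a, of ?M] le[OF a that, of ?M] le[OF that a, of ?N] le[OF a that, of ?N] by (auto intro!: antisym)
 have m: "(%z. em R (cball z r)) : bmeas borel" if "prob_space R" and R[measurable_cong]: "sets R = sets borel" for R :: "'c measure" and r
 proof -
  interpret R: prob_space R by fact
  have sp: "space R = UNIV" using R[THEN sets_eq_imp_space_eq] by simp
  have "{p : space (borel xx R). dist (fst p) (snd p) <= r} : sets (borel xx R)" by measurable
  from R.measurable_emeasure_Pair[OF this] show ?thesis by (simp add: vimage_def cball_def space_pair_measure sp)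
 qed
 note [measurable] = m[OF M.prob_space_axioms sets_distr] m[OF N.prob_space_axioms sets_distr]
 have Sm: "{z : space borel. z : S} : sets borel" unfolding S_def mem_Collect_eq by measurable
 show ?thesis
 proof (rule prob_eqI_homogeneous[where S=S])
  show "AE x in ?M. x : S" unfolding AE_distr_iff[OF H(1) Sm] using AE(1) by eventually_elim (rule HS)
  show "AE x in ?N. x : S" unfolding AE_distr_iff[OF H(2) Sm] using AE(2) by eventually_elim (rule HS)
 qed (auto simp: S_def M.prob_space_axioms N.prob_space_axioms)
qed

section \<open>Borel structure of planes, and subspaces as projections\<close>

lemma space_plane_borel[simp]: "space (plb P) = P" by (simp add: plane_borel_def)

lemma meas_proj_plane: "(%t. proj t x) : bmeas (plb P)"
proof -
 have "(%t x. proj t x) : measurable (plb P) (\<Pi>\<^sub>M x\<in>UNIV. borel)" unfolding plane_borel_def by (rule measurable_vimage_algebra1) (auto simp: space_PiM)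
 from measurable_compose[OF this measurable_component_singleton[of x]] show ?thesis by simp
qed

lemma meas_plane_borelI:
 assumes "f : space N \<rightarrow> P" "!!x. (%n. proj (f n) x) : bmeas N"
 shows "f : measurable N (plb P)" unfolding plane_borel_def by (rule measurable_vimage_algebra2[OF assms(1)], rule measurable_PiM_single') (auto simp: assms(2) space_PiM)

text \<open>\<open>plane_borel\<close> gives measurability of the projection of a fixed point only.
  Expanding in the basis, linearity extends it to a point that varies along with the
  subspace.\<close>

lemma meas_proj_subspace:
 assumes f[measurable]: "f : measurable N (plb P)" and P: "!!x. x : P ==> subspace x" and [measurable]: "g : bmeas N"
 shows "(%n. proj (f n) (g n)) : bmeas N"
proof -
 have "proj (f n) (g n) = (\<Sum>b\<in>Basis. (g n *. b) *R proj (f n) b)" if "n : space N" for n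
 proof -
  have l: "linear (proj (f n))" using measurable_space[OF f that] P by (intro linear_proj) auto
  have "proj (f n) (g n) = proj (f n) (\<Sum>b\<in>Basis. (g n *. b) *R b)" by (simp add: euclidean_representation)
  also have "... = (\<Sum>b\<in>Basis. (g n *. b) *R proj (f n) b)" by (simp add: linear_sum[OF l] linear_cmul[OF l])
  finally show ?thesis .
 qed
 moreover have "(%n. \<Sum>b\<in>Basis. (g n *. b) *R proj (f n) b) : bmeas N" using measurable_compose[OF f meas_proj_plane] by measurable
 ultimately show ?thesis by (simp cong: measurable_cong)
qed

lemma grassmannianD:
 assumes "x : Gr X j" shows "subspace x" "x \<subseteq> X" "dim x = j" using assms by (auto simp: grassmannian_def)

definition grass_borel :: "'a::euclidean_space set => nat => 'a set measure" where
 "grass_borel X j = (THE M. is_invariant_prob X j M)"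

lemma grass_measure_eq: "grass_measure X j = completion (grass_borel X j)" by (simp add: grass_measure_def grass_borel_def)

text \<open>This places the Grassmannian in a metric space on which orthogonal maps act by
  conjugations that do not increase distances.\<close>

definition projection :: "'a::euclidean_space set => 'a \<Rightarrow>\<^sub>L 'a" where
 "projection x = Blinfun (proj x)"

lemma projection_apply:
 assumes "subspace y" shows "blinfun_apply (projection y) x = proj y x" unfolding projection_def by (simp add: bounded_linear_Blinfun_apply linear_conv_bounded_linear[symmetric] linear_proj[OF assms])

lemma meas_blinfun_apply[measurable]: "(%A. blinfun_apply A x) : bmeas borel" for x :: "'a::euclidean_space" by (intro borel_measurable_continuous_onI linear_continuous_on blinfun.bounded_linear_left)

lemma meas_projection:
 "projection : bmeas (plb (Gr X j))"
proof -
 let ?E = "%i j. Blinfun (%x. (x *. j) *R i) :: 'a \<Rightarrow>\<^sub>L 'a"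
 have E: "blinfun_apply (?E i j) x = (x *. j) *R i" for i j x by (subst bounded_linear_Blinfun_apply) (auto intro: bounded_linear_intros)
 have "projection y = (\<Sum>j\<in>Basis. \<Sum>i\<in>Basis. (proj y j *. i) *R ?E i j)"
  if "y : space (plb (Gr X j))" for y
 proof (rule blinfun_eqI)
  have y: "subspace y" using that by (simp add: grassmannian_def)
  note l = linear_proj[OF y]
  fix x
  have "proj y x = proj y (\<Sum>j\<in>Basis. (x *. j) *R j)" by (simp add: euclidean_representation)
  also have "... = (\<Sum>j\<in>Basis. (x *. j) *R proj y j)" by (simp add: linear_sum[OF l] linear_cmul[OF l])
  also have "... = (\<Sum>j\<in>Basis. (x *. j) *R (\<Sum>i\<in>Basis. (proj y j *. i) *R i))" by (simp add: euclidean_representation)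
  also have "... = blinfun_apply (\<Sum>j\<in>Basis. \<Sum>i\<in>Basis. (proj y j *. i) *R ?E i j) x" unfolding blinfun.sum_left blinfun.scaleR_left E scaleR_sum_right by (simp add: mult.commute)
  finally show "blinfun_apply (projection y) x = blinfun_apply (\<Sum>j\<in>Basis. \<Sum>i\<in>Basis. (proj y j *. i) *R ?E i j) x" by (simp add: projection_apply[OF y])
 qed
 moreover have "(%y. \<Sum>j\<in>Basis. \<Sum>i\<in>Basis. (proj y j *. i) *R ?E i j) : bmeas (plb (Gr X j))" using meas_proj_plane[where P="Gr X j"] by measurable
 ultimately show ?thesis by (subst measurable_cong)
qed

text \<open>The generating maps of \<open>plane_borel\<close> factor through
  \<open>projection\<close>; hence a measure on the Grassmannian is determined by its image among
  the operators.\<close>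

lemma sets_plane_borel_projection:
 fixes X :: "'a::euclidean_space set"
 assumes "A : sets (plb (Gr X j))"
 obtains B where "B : sets borel" "A = projection -` B Int Gr X j"
proof -
 let ?G = "Gr X j"
 obtain C where C: "C : sets (\<Pi>\<^sub>M x\<in>UNIV. borel)" "A = (%t x. proj t x) -` C Int ?G" using assms unfolding plane_borel_def by (subst (asm) sets_vimage_algebra2) (auto simp: space_PiM)
 have "(blinfun_apply :: ('a \<Rightarrow>\<^sub>L 'a) => _) : measurable borel (\<Pi>\<^sub>M x\<in>UNIV. borel)" by (rule measurable_PiM_single') (auto simp: meas_blinfun_apply)
 from measurable_sets[OF this C(1)] have "blinfun_apply -` C : sets borel" by simp
 moreover have "A = projection -` (blinfun_apply -` C) Int ?G"
 proof -
  have "blinfun_apply (projection y) = (%x. proj y x)" if "y : ?G" for y using that by (intro ext projection_apply) (simp add: grassmannian_def)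
  then show ?thesis unfolding C(2) by auto
 qed
 ultimately show ?thesis by (rule that)
qed

lemma proj_orthogonal_image:
 fixes V :: "'a::euclidean_space set" and T :: "'a => 'a"
 assumes T: "orth T" and V: "subspace V"
 shows "proj (T ` V) x = T (proj V (inv T x))"
proof (rule proj_subspaceI)
 have lT: "linear T" using T by (simp add: orthogonal_transformation_linear)
 have TT: "T (inv T x) = x" using orthogonal_transformation_surj[OF T] by (simp add: surj_f_inv_f)
 note * = proj_subspace[OF V, of "inv T x"]
 show "subspace (T ` V)" using lT V by (rule linear_subspace_image)
 show "T (proj V (inv T x)) : T ` V" using * by simp
 have "x - T (proj V (inv T x)) = T (inv T x - proj V (inv T x))" by (simp add: linear_diff[OF lT] TT)
 then show "x - T (proj V (inv T x)) : (T ` V)^o" using *(2) T by (auto simp: comp_iff orthogonal_transformation_def)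
qed

lemma gr_image:
 assumes T: "orth T" "T ` X = X" and "x : Gr X j"
 shows "T ` x : Gr X j"
proof -
 have lT: "linear T" using T by (simp add: orthogonal_transformation_linear)
 have "dim (T ` x) = dim x" by (rule dim_image_eq[OF lT]) (use orthogonal_transformation_inj[OF T(1)] in \<open>auto intro: inj_on_subset\<close>)
 then show ?thesis using assms lT by (auto simp: grassmannian_def linear_subspace_image)
qed

lemma meas_image_plane:
 assumes T: "orth T" "T ` X = X"
 shows "image T : measurable (plb (Gr X j)) (plb (Gr X j))"
proof (rule meas_plane_borelI)
 show "image T : space (plb (Gr X j)) \<rightarrow> Gr X j" using gr_image[OF T] by auto
 fix x
 have [measurable]: "T : bmeas borel" using T by (intro bm_linear) (simp add: orthogonal_transformation_linear)
 note [measurable] = meas_proj_plane[where P="Gr X j"]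
 have "(%y. T (proj y (inv T x))) : bmeas (plb (Gr X j))" by measurable
 then show "(%y. proj (T ` y) x) : bmeas (plb (Gr X j))" by (subst measurable_cong[where g="%y. T (proj y (inv T x))"]) (auto simp: proj_orthogonal_image[OF T(1)] grassmannian_def)
qed

definition conjugation :: "('a::euclidean_space => 'a) => ('a \<Rightarrow>\<^sub>L 'a) => ('a \<Rightarrow>\<^sub>L 'a)" where
 "conjugation T A = Blinfun T o\<^sub>L A o\<^sub>L Blinfun (inv T)"

lemma conjugation_apply:
 assumes T: "orth T"
 shows "blinfun_apply (conjugation T A) x = T (blinfun_apply A (inv T x))"
proof -
 have "bounded_linear T" "bounded_linear (inv T)" using T orthogonal_transformation_inv[OF T] by (simp_all add: orthogonal_transformation_linear linear_conv_bounded_linear[symmetric])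
 then show ?thesis unfolding conjugation_def by (simp add: bounded_linear_Blinfun_apply)
qed

lemma conjugation_projection:
 assumes T: "orth T" and V: "subspace V"
 shows "conjugation T (projection V) = projection (T ` V)"
proof (rule blinfun_eqI)
 have "subspace (T ` V)" using T V by (simp add: orthogonal_transformation_linear linear_subspace_image)
 then show "blinfun_apply (conjugation T (projection V)) x = blinfun_apply (projection (T ` V)) x" for x by (simp add: conjugation_apply[OF T] projection_apply V proj_orthogonal_image[OF T V])
qed

lemma bm_conjugation[measurable]:
 "conjugation T : bmeas borel" unfolding conjugation_def by (intro borel_measurable_continuous_onI bounded_bilinear.continuous_on[OF bounded_bilinear_blinfun_compose] continuous_on_const continuous_on_id)

lemma dist_conjugation_le:
 assumes T: "orth T"
 shows "dist (conjugation T A) (conjugation T B) <= dist A B" unfolding dist_norm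
proof (rule norm_blinfun_bound)
 fix x
 have "norm (blinfun_apply (conjugation T A - conjugation T B) x) = norm (T (blinfun_apply (A - B) (inv T x)))" using T by (simp add: blinfun.diff_left conjugation_apply linear_diff orthogonal_transformation_linear)
 also have "... = norm (blinfun_apply (A - B) (inv T x))" using T by (rule orthogonal_transformation_norm)
 also have "... <= norm (A - B) * norm (inv T x)" by (rule norm_blinfun)
 also have "norm (inv T x) = norm x" using orthogonal_transformation_inv[OF T] by (rule orthogonal_transformation_norm)
 finally show "norm (blinfun_apply (conjugation T A - conjugation T B) x) <= norm (A - B) * norm x" .
qed simp

text \<open>Isometries from y to z and between their complements in \<open>X\<close> are glued
  together with the identity on the complement of \<open>X\<close>. The three parts are mutually
  orthogonal, so Pythagoras gives preservation of the norm.\<close>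

lemma gr_transitive:
 fixes X :: "'a::euclidean_space set"
 assumes X: "subspace X" and y: "y : Gr X j" and z: "z : Gr X j"
 obtains T where "orth T" "T ` X = X" "T ` y = z"
proof -
 note g = grassmannianD[OF y] grassmannianD[OF z]
 let ?U = "X Int y^o" and ?V = "X Int z^o"
 have d: "dim ?U = dim ?V" using dim_Int_comp[OF X g(1,2)] dim_Int_comp[OF X g(4,5)] g by simp
 have sub: "subspace ?U" "subspace ?V" using X by (auto intro: subspace_Int_comp)
 obtain a where a: "linear a" "a ` y = z" "!!x. x : y ==> norm (a x) = norm x" using isometries_subspaces[OF g(1,4)] g(3,6) by metis
 obtain b where b: "linear b" "b ` ?U = ?V" "!!x. x : ?U ==> norm (b x) = norm x" using isometries_subspaces[OF sub d] by metis
 let ?P = "proj y" and ?Q = "proj ?U" and ?R = "proj X"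
 define T where "T x = a (?P x) + b (?Q x) + (x - ?R x)" for x
 have mem: "?P x : y" "?Q x : ?U" "x - ?R x : X^o" for x using proj_subspace[OF g(1), of x] proj_subspace[OF sub(1), of x] proj_subspace[OF X, of x] by auto
 have lin: "linear T" unfolding T_def using linear_compose[OF linear_proj[OF g(1)] a(1)] linear_compose[OF linear_proj[OF sub(1)] b(1)] linear_proj[OF X] by (intro linear_compose_add linear_compose_sub linear_id[unfolded id_def]) (auto simp: o_def)
 have sum: "x = ?P x + ?Q x + (x - ?R x)" for x using proj_Int_comp[OF X g(1,2), of x] by simp
 have pyth: "(norm (u + v + w))^2 = (norm u)^2 + (norm v)^2 + (norm w)^2" if "u *. v = 0" "u *. w = 0" "v *. w = 0" for u v w :: 'a using that by (simp add: power2_norm_eq_inner inner_add_left inner_add_right inner_commute)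
 have norm: "norm (T x) = norm x" for x
 proof -
  have m: "a (?P x) : z" "b (?Q x) : ?V" using mem a(2) b(2) by blast+
  have o: "u *. v = 0" if "u : W" "v : W^o" for u v W using that by (auto simp: comp_iff inner_commute)
  have X1: "a (?P x) : X" "b (?Q x) : X" "?P x : X" "?Q x : X" using m mem g by auto
  have "(norm (T x))^2 = (norm (a (?P x)))^2 + (norm (b (?Q x)))^2 + (norm (x - ?R x))^2" unfolding T_def by (rule pyth) (use o[OF m(1)] m(2) o[OF X1(1) mem(3)] o[OF X1(2) mem(3)] in auto)
  also have "... = (norm (?P x))^2 + (norm (?Q x))^2 + (norm (x - ?R x))^2" using a(3) b(3) mem by simp
  also have "... = (norm (?P x + ?Q x + (x - ?R x)))^2" by (rule pyth[symmetric]) (use o[OF mem(1)] mem(2) o[OF X1(3) mem(3)] o[OF X1(4) mem(3)] in auto)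
  finally show ?thesis using sum[of x] by (simp add: power2_eq_iff_nonneg)
 qed
 have T: "orth T" using lin norm by (simp add: orthogonal_transformation)
 have Ty: "T x = a x" if "x : y" for x
 proof -
  have "?P x = x" "?R x = x" using that g X by (auto intro: closest_point_self)
  moreover then have "?Q x = 0" using proj_Int_comp[OF X g(1,2), of x] by simp
  ultimately show ?thesis unfolding T_def by (simp add: linear_0[OF b(1)])
 qed
 have TX: "T ` X \<subseteq> X"
 proof safe
  fix x assume "x : X"
  then have "?R x = x" by (rule closest_point_self)
  moreover have "a (?P x) : X" "b (?Q x) : X" using mem a(2) b(2) g by blast+
  ultimately show "T x : X" unfolding T_def using X by (simp add: subspace_add)
 qed
 have "dim (T ` X) = dim X" by (rule dim_image_eq[OF lin]) (use orthogonal_transformation_inj[OF T] in \<open>auto intro: inj_on_subset\<close>)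
 then have "T ` X = X" using TX X lin by (intro subspace_dim_equal) (auto simp: linear_subspace_image)
 moreover have "T ` y = z" using Ty a(2) by auto
 ultimately show ?thesis using T that by blast
qed

text \<open>The images under \<open>projection\<close> agree by \<open>distr_eqI_transitive\<close>
  with conjugations as contractions, and they determine the measures.\<close>

lemma is_invariant_prob_unique:
 fixes X :: "'a::euclidean_space set"
 assumes X: "subspace X" and M: "is_invariant_prob X j M" and N: "is_invariant_prob X j N"
 shows "M = N"
proof -
 let ?G = "Gr X j"
 have pr: "prob_space P" "space P = ?G" "sets P = sets (plb ?G)" "!!T. orth T ==> T ` X = X ==> distr P P (image T) = P"
  if "P = M \<or> P = N" for P using that M N by (auto simp: is_invariant_prob_def)
 have pm: "projection : bmeas P" if "P = M \<or> P = N" for P using meas_projection[of X j] measurable_cong_sets[OF pr(3)[OF that] refl] by blast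
 have inv: "distr (distr P borel projection) borel (conjugation T) = distr P borel projection"
  if P: "P = M \<or> P = N" and T: "orth T" "T ` X = X" for P T
 proof -
  have im: "image T : measurable P P" using meas_image_plane[OF T, of j] measurable_cong_sets[OF pr(3)[OF P] pr(3)[OF P]] by blast
  have "distr (distr P borel projection) borel (conjugation T) = distr P borel (conjugation T \<circ> projection)" by (rule distr_distr) (use pm[OF P] in auto)
  also have "... = distr P borel (projection \<circ> image T)" by (rule distr_cong) (auto simp: pr(2)[OF P] grassmannian_def conjugation_projection[OF T(1)])
  also have "... = distr (distr P P (image T)) borel projection" by (rule distr_distr[symmetric, OF pm[OF P] im])
  finally show ?thesis unfolding pr(4)[OF P T] .
 qed
 have eq: "distr M borel projection = distr N borel projection"
 proof (rule distr_eqI_transitive[where \<Omega>="?G"])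
  fix y z assume x: "y : ?G" "z : ?G"
  obtain T where T: "orth T" "T ` X = X" "T ` y = z" using gr_transitive[OF X x] by blast
  show "EX F:bmeas borel. (ALL a b. dist (F a) (F b) <= dist a b) & F (projection y) = projection z
   & distr (distr M borel projection) borel F = distr M borel projection & distr (distr N borel projection) borel F = distr N borel projection" using inv[OF _ T(1,2)] dist_conjugation_le[OF T(1)] conjugation_projection[OF T(1)] T(3) x by (intro bexI[of _ "conjugation T"]) (auto simp: grassmannian_def)
 qed (use pr pm in \<open>auto intro!: AE_I2\<close>)
 show ?thesis
 proof (rule measure_eqI)
  show "sets M = sets N" using pr(3) by auto
  fix A assume "A : sets M"
  then have "A : sets (plb ?G)" using pr(3) by auto
  then obtain B where B: "B : sets borel" "A = projection -` B Int ?G" using sets_plane_borel_projection by blast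
  have "em P A = em (distr P borel projection) B" if P: "P = M \<or> P = N" for P unfolding B(2) by (subst emeasure_distr[OF pm[OF P] B(1)]) (simp add: pr(2)[OF P])
  then show "em M A = em N A" using eq by simp
 qed
qed

text \<open>The default \<open>x0\<close> keeps the value inside the Grassmannian when w is not a
  unit vector of V, which happens with probability 0 only. Measurability can then be stated on the
  full product space.\<close>

definition cut_plane :: "'a::euclidean_space set => 'a set => 'a => 'a set" where
 "cut_plane x0 V w = (if w : V & norm w = 1 then V Int {w}^o else x0)"

lemma cut_plane_eq: "w : V ==> norm w = 1 ==> cut_plane x0 V w = V Int {w}^o" by (simp add: cut_plane_def)

lemma cut_plane_in_gr:
 assumes "V : Gr X (Suc j)" "x0 : Gr X j"
 shows "cut_plane x0 V w : Gr X j" using assms dim_Int_comp_unit[of V w] by (auto simp: cut_plane_def grassmannian_def subspace_Int_comp)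

text \<open>Membership of w in V is the equation proj V w = w, a measurable condition on the
  pair.\<close>

lemma meas_cut_plane:
 fixes X :: "'a::euclidean_space set"
 assumes f[measurable]: "f : measurable N (plb (Gr X (Suc j)))" and g[measurable]: "g : bmeas N"
  and 0: "y0 : Gr X j"
 shows "(%n. cut_plane y0 (f n) (g n)) : measurable N (plb (Gr X j))"
proof (rule meas_plane_borelI)
 have fs: "f n : Gr X (Suc j)" if "n : space N" for n using measurable_space[OF f that] by simp
 show "(%n. cut_plane y0 (f n) (g n)) : space N \<rightarrow> Gr X j" using cut_plane_in_gr[OF fs 0] by auto
 fix x
 have sub: "y : Gr X (Suc j) ==> subspace y" for y :: "'a set" by (simp add: grassmannian_def)
 note [measurable] = meas_proj_subspace[OF f sub]
 have eq: "proj (cut_plane y0 (f n) (g n)) x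
  = (if proj (f n) (g n) = g n & norm (g n) = 1 then proj (f n) x - (x *. g n) *R g n else proj y0 x)"
  if "n : space N" for n
 proof -
  have V: "subspace (f n)" using fs[OF that] by (simp add: grassmannian_def)
  then have "proj (f n) (g n) = g n <-> g n : f n" using proj_subspace(1)[OF V, of "g n"] closest_point_self[of "g n" "f n"] by auto
  then show ?thesis using proj_Int_comp_unit[OF V] by (simp add: cut_plane_def)
 qed
 show "(%n. proj (cut_plane y0 (f n) (g n)) x) : bmeas N" by (subst measurable_cong[OF eq], assumption) measurable
qed

lemma comp_in_gr:
 assumes "x : Gr (UNIV :: 'a::euclidean_space set) j" shows "x^o : Gr UNIV (DIM('a) - j)" using assms dim_Int_comp[of UNIV x] by (auto simp: grassmannian_def subspace_orthogonal_comp)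

lemma meas_comp_plane:
 fixes f :: "'n => 'a::euclidean_space set"
 assumes f[measurable]: "f : measurable N (plb (Gr UNIV j))"
 shows "(%n. (f n)^o) : measurable N (plb (Gr UNIV (DIM('a) - j)))"
proof (rule meas_plane_borelI)
 have fs: "f n : Gr UNIV j" if "n : space N" for n using measurable_space[OF f that] by simp
 then show "(%n. (f n)^o) : space N \<rightarrow> Gr UNIV (DIM('a) - j)" by (auto intro: comp_in_gr)
 fix x
 have "(%n. x - proj (f n) x) : bmeas N" by (intro borel_measurable_diff meas_proj_subspace[OF f]) (auto simp: grassmannian_def)
 moreover have "proj ((f n)^o) x = x - proj (f n) x" if "n : space N" for n using fs[OF that] by (intro proj_comp) (simp add: grassmannian_def)
 ultimately show "(%n. proj ((f n)^o) x) : bmeas N" by (simp cong: measurable_cong)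
qed

lemma cut_plane_image:
 assumes T: "orth T" and w: "w : V" "norm w = 1"
 shows "cut_plane y0 (T ` V) (T w) = T ` cut_plane y0 V w"
proof -
 have "T x : {T w}^o <-> x : {w}^o" for x using T by (simp add: mem_comp_singleton orthogonal_transformation_def)
 then have "T ` V Int {T w}^o = T ` (V Int {w}^o)" by auto
 then show ?thesis using w orthogonal_transformation_norm[OF T] by (simp add: cut_plane_eq)
qed

lemma AE_sgn_proj:
 fixes V :: "'a::euclidean_space set"
 assumes V: "subspace V" "0 < dim V"
 shows "AE x in sph UNIV. sgn (proj V x) : V & norm (sgn (proj V x)) = 1"
proof -
 note [measurable] = bm_proj[OF V(1)]
 have "closed (V Int sphere 0 1)" by (rule closed_Int[OF closed_subspace[OF V(1)] closed_sphere])
 then have m: "{x : space borel. x : V Int sphere 0 1} : sets borel" by (simp only: space_borel UNIV_I simp_thms Collect_mem_eq borel_closed)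
 have "AE x in distr (sph UNIV) borel (%x. sgn (proj V x)). x : V Int sphere 0 1" unfolding sph_eq_distr[OF V, symmetric] by (rule AE_sph[OF V])
 then have "AE x in sph UNIV. sgn (proj V x) : V Int sphere 0 1" by (subst (asm) AE_distr_iff[OF _ m]) auto
 then show ?thesis by eventually_elim auto
qed

lemma nni_sph_UNIV:
 fixes V :: "'a::euclidean_space set"
 assumes V: "subspace V" "0 < dim V" and [measurable]: "g : bmeas borel"
 shows "(II w. g w dd sph V) = (II x. g (sgn (proj V x)) dd sph UNIV)"
proof -
 note [measurable] = bm_proj[OF V(1)]
 show ?thesis unfolding sph_eq_distr[OF V] by (rule nn_integral_distr) auto
qed

lemma AE_sgn_pair:
 fixes f :: "'a::euclidean_space set => 'a set"
 assumes M: "prob_space M" and f: "f : measurable M (plb (Gr Y (Suc j)))"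
 shows "AE p in M xx sph UNIV. sgn (proj (f (fst p)) (snd p)) : f (fst p) & norm (sgn (proj (f (fst p)) (snd p))) = 1"
proof -
 let ?U = "sph (UNIV :: 'a set)"
 interpret U: prob_space ?U by (rule prob_sph) simp
 interpret M: prob_space M by fact
 interpret MU: pair_prob_space M ?U ..
 have fV: "f V : Gr Y (Suc j)" if "V : space M" for V using measurable_space[OF f that] by simp
 have [measurable]: "(%p. proj (f (fst p)) (snd p)) : bmeas (M xx ?U)" by (rule meas_proj_subspace[OF measurable_compose[OF measurable_fst f]]) (auto simp: grassmannian_def)
 have "AE p in M xx ?U. proj (f (fst p)) (snd p) ~= 0"
 proof (rule MU.AE_pair_measure)
  show "AE V in M. AE x in ?U. proj (f (fst (V, x))) (snd (V, x)) ~= 0"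
  proof (rule AE_I2)
   fix V assume "V : space M"
   then have "AE x in ?U. sgn (proj (f V) x) : f V & norm (sgn (proj (f V) x)) = 1" using fV by (intro AE_sgn_proj) (auto simp: grassmannian_def)
   then show "AE x in ?U. proj (f (fst (V, x))) (snd (V, x)) ~= 0" by eventually_elim auto
  qed
 qed measurable
 then show ?thesis using AE_space
 proof eventually_elim
  fix p assume p: "proj (f (fst p)) (snd p) ~= 0" "p : space (M xx ?U)"
  then have "subspace (f (fst p))" using fV by (auto simp: space_pair_measure grassmannian_def)
  then show "sgn (proj (f (fst p)) (snd p)) : f (fst p) & norm (sgn (proj (f (fst p)) (snd p))) = 1" using p(1) proj_subspace(1) by (auto simp: norm_sgn sgn_div_norm intro: subspace_scale)
 qed
qed

text \<open>The product of an invariant measure with \<open>sph UNIV\<close> is invariant under the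
  diagonal action. Equivariance is asked almost everywhere only, to leave room for the defaults in
  \<open>cut_plane\<close>.\<close>

lemma equivariant_distr:
 fixes X :: "'a::euclidean_space set"
 assumes M: "is_invariant_prob X m M" and T: "orth T" "T ` X = X"
  and K: "K : measurable (M xx sph UNIV) N" and t: "t : measurable N N"
  and eq: "AE p in M xx sph UNIV. t (K p) = K (T ` fst p, T (snd p))"
 shows "distr (distr (M xx sph UNIV) N K) N t = distr (M xx sph UNIV) N K"
proof -
 let ?U = "sph (UNIV :: 'a set)" and ?T = "%(V, x). (T ` V, T x)"
 interpret U: prob_space ?U by (rule prob_sph) simp
 have sM: "sets M = sets (plb (Gr X m))" and inv: "distr M M (image T) = M" using M T by (auto simp: is_invariant_prob_def)
 have lT: "linear T" using T by (simp add: orthogonal_transformation_linear)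
 have [measurable]: "T : bmeas borel" using lT by (rule bm_linear)
 have im[measurable]: "image T : measurable M M" using meas_image_plane[OF T, of m] measurable_cong_sets[OF sM sM] by auto
 have "distr ?U borel T = ?U" using sph_isometry[OF subspace_UNIV lT] T(1) orthogonal_transformation_surj[OF T(1)] by (simp add: orthogonal_transformation_norm)
 moreover have "distr ?U ?U T = distr ?U borel T" by (rule distr_cong) auto
 ultimately have TU: "distr ?U ?U T = ?U" by simp
 have "distr M M (image T) xx distr ?U ?U T = distr (M xx ?U) (M xx ?U) ?T" by (rule pair_measure_distr) (use im in \<open>auto simp: TU U.sigma_finite_measure_axioms\<close>)
 then have pair: "distr (M xx ?U) (M xx ?U) ?T = M xx ?U" unfolding inv TU ..
 have Tm: "?T : measurable (M xx ?U) (M xx ?U)" by measurable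
 have "distr (distr (M xx ?U) N K) N t = distr (M xx ?U) N (t \<circ> K)" by (rule distr_distr[OF t K])
 also have "... = distr (M xx ?U) N (K \<circ> ?T)"
 proof (rule distr_cong_AE)
  show "AE p in M xx ?U. (t \<circ> K) p = (K \<circ> ?T) p" using eq by eventually_elim (simp add: case_prod_unfold)
 qed (auto intro: measurable_comp[OF Tm K] measurable_comp[OF K t])
 also have "... = distr (distr (M xx ?U) (M xx ?U) ?T) N K" by (rule distr_distr[symmetric, OF K Tm])
 finally show ?thesis unfolding pair .
qed

lemma sgn_proj_image:
 fixes V :: "'a::euclidean_space set" and T :: "'a => 'a"
 assumes T: "orth T" and V: "subspace V"
 shows "sgn (proj (T ` V) (T x)) = T (sgn (proj V x))"
proof -
 have "linear T" using T by (simp add: orthogonal_transformation_linear)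
 then have "T (sgn y) = sgn (T y)" for y by (rule linear_sgn) (rule orthogonal_transformation_norm[OF T])
 then show ?thesis using orthogonal_transformation_inj[OF T] by (simp add: proj_orthogonal_image[OF T V] inv_f_f)
qed

lemma meas_sgn_pair:
 assumes "f : measurable M (plb (Gr X m))"
 shows "(%p. sgn (proj (f (fst p)) (snd p))) : bmeas (M xx sph UNIV)"
proof -
 have "(%p. proj (f (fst p)) (snd p)) : bmeas (M xx sph UNIV)" by (rule meas_proj_subspace[OF measurable_compose[OF measurable_fst assms]]) (auto simp: grassmannian_def)
 then show ?thesis by measurable
qed

text \<open>A uniformly random hyperplane inside an invariantly distributed subspace: the
  construction is equivariant outside the null set of degenerate directions.\<close>

lemma invariant_prob_cut:
 fixes X :: "'a::euclidean_space set"
 assumes X: "subspace X" and M: "is_invariant_prob X (Suc j) M" and 0: "y0 : Gr X j"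
 shows "is_invariant_prob X j (distr (M xx sph UNIV) (plb (Gr X j))
  (%p. cut_plane y0 (fst p) (sgn (proj (fst p) (snd p)))))"
proof -
 let ?U = "sph (UNIV :: 'a set)" and ?PB = "plb (Gr X j)"
 let ?K = "%p. cut_plane y0 (fst p) (sgn (proj (fst p) (snd p)))"
 interpret U: prob_space ?U by (rule prob_sph) simp
 interpret M: prob_space M using M by (simp add: is_invariant_prob_def)
 interpret MU: pair_prob_space M ?U ..
 have sp: "space M = Gr X (Suc j)" and sM: "sets M = sets (plb (Gr X (Suc j)))" using M by (auto simp: is_invariant_prob_def)
 have id: "(%x. x) : measurable M (plb (Gr X (Suc j)))" using measurable_ident_sets[OF sM] by (simp add: id_def)
 have K: "?K : measurable (M xx ?U) ?PB" by (rule meas_cut_plane[OF measurable_compose[OF measurable_fst id] meas_sgn_pair[OF id] 0])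
 show ?thesis unfolding is_invariant_prob_def
 proof (intro conjI allI impI)
  show "prob_space (distr (M xx ?U) ?PB ?K)" by (rule MU.prob_space_distr[OF K])
  fix T assume "orth T & T ` X = X"
  then have T: "orth T" "T ` X = X" by auto
  have "distr (distr (M xx ?U) ?PB ?K) ?PB (image T) = distr (M xx ?U) ?PB ?K"
  proof (rule equivariant_distr[OF M T K meas_image_plane[OF T]])
   show "AE p in M xx ?U. T ` ?K p = ?K (T ` fst p, T (snd p))" using AE_sgn_pair[OF M.prob_space_axioms id] AE_space
   proof eventually_elim
    fix p assume p: "sgn (proj (fst p) (snd p)) : fst p & norm (sgn (proj (fst p) (snd p))) = 1" "p : space (M xx ?U)"
    have V: "subspace (fst p)" using p(2) by (auto simp: space_pair_measure sp grassmannian_def)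
    show "T ` ?K p = ?K (T ` fst p, T (snd p))" using cut_plane_image[OF T(1), of "sgn (proj (fst p) (snd p))" "fst p" y0] p(1) by (simp add: sgn_proj_image[OF T(1) V])
   qed
  qed
  then show "distr (distr (M xx ?U) ?PB ?K) (distr (M xx ?U) ?PB ?K) (image T) = distr (M xx ?U) ?PB ?K" by (subst (asm) distr_cong[OF refl, of ?PB "distr (M xx ?U) ?PB ?K"]) auto
 qed auto
qed

lemma invariant_prob_top:
 fixes X :: "'a::euclidean_space set"
 assumes X: "subspace X"
 shows "is_invariant_prob X (dim X) (return (plb (Gr X (dim X))) X)"
proof -
 let ?PB = "plb (Gr X (dim X))"
 have "X : Gr X (dim X)" using X by (simp add: grassmannian_def)
 moreover have "distr (return ?PB X) (return ?PB X) (image T) = return ?PB X" if "orth T" "T ` X = X" for T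
 proof -
  have "image T : measurable ?PB (return ?PB X)" using meas_image_plane[OF that, of "dim X"] by (simp cong: measurable_cong_sets)
  then have "distr (return ?PB X) (return ?PB X) (image T) = return (return ?PB X) (T ` X)" using \<open>X : _\<close> by (intro distr_return) auto
  then show ?thesis unfolding that(2) using return_cong[of "return ?PB X" ?PB] by simp
 qed
 ultimately show ?thesis unfolding is_invariant_prob_def by (auto intro: prob_space_return)
qed

lemma gr_nonempty:
 fixes X :: "'a::euclidean_space set"
 assumes "subspace X" "j <= dim X" obtains x where "x : Gr X j"
proof -
 obtain T where "subspace T" "T \<subseteq> span X" "dim T = j" using choose_subspace_of_subspace[OF assms(2)] .
 then have "T : Gr X j" using span_eq_iff[THEN iffD2, OF assms(1)] by (simp add: grassmannian_def)
 then show ?thesis by (rule that)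
qed

text \<open>Existence by descending induction: the Grassmannian of dimension \<open>dim X\<close> is
  a single point, and each step cuts off a random direction. With uniqueness, the \<open>THE\<close>
  in the definition is justified.\<close>

lemma grass_borel_invariant:
 fixes X :: "'a::euclidean_space set"
 assumes X: "subspace X" and j: "j <= dim X"
 shows "is_invariant_prob X j (grass_borel X j)"
proof -
 have "EX M. is_invariant_prob X j M" using j
 proof (induction "dim X - j" arbitrary: j)
  case 0
  then have "j = dim X" by simp
  then show ?case using invariant_prob_top[OF X] by blast
 next
  case (Suc n)
  then have "n = dim X - Suc j" "Suc j <= dim X" by auto
  then obtain M where "is_invariant_prob X (Suc j) M" using Suc.hyps(1) by blast
  moreover obtain x where "x : Gr X j" using gr_nonempty[OF X Suc.prems] .
  ultimately show ?case using invariant_prob_cut[OF X] by blast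
 qed
 then have "\<exists>!M. is_invariant_prob X j M" using is_invariant_prob_unique[OF X] by blast
 then show ?thesis unfolding grass_borel_def by (rule theI')
qed

lemma grass_borel_props:
 fixes X :: "'a::euclidean_space set"
 assumes X: "subspace X" and j: "j <= dim X"
 shows "prob_space (grass_borel X j)" "space (grass_borel X j) = Gr X j"
  "sets (grass_borel X j) = sets (plb (Gr X j))" using grass_borel_invariant[OF assms] by (auto simp: is_invariant_prob_def)

text \<open>A single step of that construction, started from \<open>X\<close> with certainty;
  uniqueness identifies its outcome with the invariant measure.\<close>

lemma grass_borel_hyperplanes:
 fixes X :: "'a::euclidean_space set"
 assumes X: "subspace X" and d: "dim X = Suc j" and 0: "z0 : Gr X j"
 shows "grass_borel X j = distr (sph X) (plb (Gr X j)) (cut_plane z0 X)"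
proof -
 let ?R = "return (plb (Gr X (Suc j))) X" and ?U = "sph (UNIV :: 'a set)" and ?PB = "plb (Gr X j)"
 interpret U: prob_space ?U by (rule prob_sph) simp
 have X': "X : Gr X (Suc j)" using X d by (simp add: grassmannian_def)
 have top: "is_invariant_prob X (Suc j) ?R" using invariant_prob_top[OF X] d by simp
 have cm: "cut_plane z0 X : measurable borel ?PB" by (rule meas_cut_plane[OF _ _ 0]) (use X' in auto)
 note [measurable] = bm_proj[OF X]
 have sm: "(%x. sgn (proj X x)) : measurable ?U borel" by measurable
 have [measurable_cong]: "sets ?R = sets (plb (Gr X (Suc j)))" by simp
 have id: "(%x. x) : measurable ?R (plb (Gr X (Suc j)))" by measurable
 have K: "(%p. cut_plane z0 (fst p) (sgn (proj (fst p) (snd p)))) : measurable (?R xx ?U) ?PB" by (rule meas_cut_plane[OF measurable_compose[OF measurable_fst id] meas_sgn_pair[OF id] 0])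
 have "grass_borel X j = distr (?R xx ?U) ?PB (%p. cut_plane z0 (fst p) (sgn (proj (fst p) (snd p))))" using d by (intro is_invariant_prob_unique[OF X grass_borel_invariant[OF X] invariant_prob_cut[OF X top 0]]) simp
 also have "... = distr (distr ?U borel (%x. sgn (proj X x))) ?PB (cut_plane z0 X)"
 proof (rule measure_eqI)
  fix A assume A: "A : sets (distr (?R xx ?U) ?PB (%p. cut_plane z0 (fst p) (sgn (proj (fst p) (snd p)))))"
  then have A[measurable]: "A : sets ?PB" by simp
  let ?K = "%p. cut_plane z0 (fst p) (sgn (proj (fst p) (snd p)))" and ?I = "ind A :: 'a set => ennreal"
  have I: "?I : bmeas ?PB" by (rule borel_measurable_indicator[OF A])
  have gm: "(%p. ?I (?K p)) : bmeas (?R xx ?U)" by (rule measurable_compose[OF K I])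
  have "em (distr (?R xx ?U) ?PB ?K) A = (II y. ?I y dd distr (?R xx ?U) ?PB ?K)" by simp
  also have "... = (II p. ?I (?K p) dd (?R xx ?U))" by (rule nn_integral_distr[OF K]) (simp only: measurable_distr_eq1 I)
  also have "... = (II V. II x. ?I (?K (V, x)) dd ?U dd ?R)" by (rule U.nn_integral_fst[OF gm, symmetric])
  also have "... = (II x. ?I (?K (X, x)) dd ?U)" by (rule nn_integral_return) (use X' U.borel_measurable_nn_integral_fst[OF gm] in simp_all)
  also have "... = (II x. ?I (cut_plane z0 X (sgn (proj X x))) dd ?U)" by (simp only: fst_conv snd_conv)
  also have "... = (II x. ?I (cut_plane z0 X x) dd distr ?U borel (%x. sgn (proj X x)))" by (rule nn_integral_distr[OF sm, symmetric]) (simp only: measurable_distr_eq1 measurable_compose[OF cm I])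
  also have "... = (II y. ?I y dd distr (distr ?U borel (%x. sgn (proj X x))) ?PB (cut_plane z0 X))" by (rule nn_integral_distr[symmetric]) (simp_all only: measurable_distr_eq1 I cm)
  also have "... = em (distr (distr ?U borel (%x. sgn (proj X x))) ?PB (cut_plane z0 X)) A" by simp
  finally show "em (distr (?R xx ?U) ?PB (%p. cut_plane z0 (fst p) (sgn (proj (fst p) (snd p))))) A
   = em (distr (distr ?U borel (%x. sgn (proj X x))) ?PB (cut_plane z0 X)) A" .
 qed (simp only: sets_distr)
 also have "distr ?U borel (%x. sgn (proj X x)) = sph X" using d by (intro sph_eq_distr[OF X, symmetric]) simp
 finally show ?thesis .
qed

lemma comp_image:
 fixes T :: "'a::euclidean_space => 'a"
 assumes T: "orth T"
 shows "T ` (V^o) = (T ` V)^o"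
proof -
 have *: "T x : (T ` V)^o <-> x : V^o" for x using T by (auto simp: comp_iff orthogonal_transformation_def)
 have "(T ` V)^o \<subseteq> T ` (V^o)"
 proof
  fix y assume "y : (T ` V)^o"
  moreover have "T (inv T y) = y" using orthogonal_transformation_surj[OF T] by (rule surj_f_inv_f)
  ultimately show "y : T ` (V^o)" using *[of "inv T y"] by (intro image_eqI[of _ _ "inv T y"]) simp_all
 qed
 then show ?thesis using * by auto
qed

lemma comp_comp: "subspace V ==> V^o^o = V" for V :: "'a::euclidean_space set" by (rule orthogonal_comp_self)

text \<open>Complements commute with orthogonal maps, so the image is invariant and uniqueness
  applies. It passes from \<eta> to \<eta>^o.\<close>

lemma grass_borel_comp:
 assumes k: "k <= DIM('a)"
 shows "distr (grass_borel UNIV k) (plb (Gr UNIV (DIM('a) - k))) (%y. y^o)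
  = grass_borel (UNIV :: 'a::euclidean_space set) (DIM('a) - k)"
proof -
 let ?M = "grass_borel (UNIV :: 'a set) k" and ?PB = "plb (Gr (UNIV :: 'a set) (DIM('a) - k))"
 have dk: "k <= dim (UNIV :: 'a set)" "DIM('a) - k <= dim (UNIV :: 'a set)" using k by auto
 have inv: "is_invariant_prob UNIV k ?M" using dk by (intro grass_borel_invariant) auto
 then interpret M: prob_space ?M by (simp add: is_invariant_prob_def)
 have sp: "space ?M = Gr UNIV k" and sM: "sets ?M = sets (plb (Gr UNIV k))" using inv by (auto simp: is_invariant_prob_def)
 have c: "(%y. y^o) : measurable ?M ?PB" by (rule meas_comp_plane) (use measurable_ident_sets[OF sM] in \<open>simp add: id_def\<close>)
 show ?thesis
 proof (rule is_invariant_prob_unique[OF subspace_UNIV _ grass_borel_invariant[OF subspace_UNIV dk(2)]])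
  show "is_invariant_prob UNIV (DIM('a) - k) (distr ?M ?PB (%y. y^o))" unfolding is_invariant_prob_def
  proof (intro conjI allI impI)
   show "prob_space (distr ?M ?PB (%y. y^o))" by (rule M.prob_space_distr[OF c])
   fix T :: "'a => 'a" assume "orth T & range T = UNIV"
   then have T: "orth T" "range T = UNIV" by auto
   have im: "image T : measurable ?M ?M" "image T : measurable ?PB ?PB" using meas_image_plane[OF T] measurable_cong_sets[OF sM sM] by auto
   have "distr (distr ?M ?PB (%y. y^o)) ?PB (image T) = distr ?M ?PB (image T \<circ> (%y. y^o))" by (rule distr_distr[OF im(2) c])
   also have "... = distr ?M ?PB ((%y. y^o) \<circ> image T)" by (simp add: o_def comp_image[OF T(1)])
   also have "... = distr (distr ?M ?M (image T)) ?PB (%y. y^o)" by (rule distr_distr[OF c im(1), symmetric])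
   also have "distr ?M ?M (image T) = ?M" using inv T by (auto simp: is_invariant_prob_def)
   finally have "distr (distr ?M ?PB (%y. y^o)) ?PB (image T) = distr ?M ?PB (%y. y^o)" .
   then show "distr (distr ?M ?PB (%y. y^o)) (distr ?M ?PB (%y. y^o)) (image T) = distr ?M ?PB (%y. y^o)" by (subst (asm) distr_cong[OF refl, of ?PB "distr ?M ?PB (%y. y^o)"]) auto
  qed auto
 qed
qed

text \<open>Once x has been moved to z, both unit vectors lie in \<open>z^o\<close>; the reflection
  along their difference exchanges them and fixes z pointwise.\<close>

lemma gr_flag_transitive:
 fixes x z :: "'a::euclidean_space set"
 assumes x: "x : Gr UNIV j" "w : x^o" "norm w = 1" and z: "z : Gr UNIV j" "N : z^o" "norm N = 1"
 obtains T where "orth T" "range T = UNIV" "T ` x = z" "T w = N"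
proof -
 obtain T where T: "orth T" "range T = UNIV" "T ` x = z" using gr_transitive[OF subspace_UNIV x(1) z(1)] .
 have Tw: "T w : z^o" "norm (T w) = 1" using x comp_image[OF T(1), of x] T(3) orthogonal_transformation_norm[OF T(1)] by auto
 show ?thesis
 proof (cases "T w = N")
  case False
  let ?u = "sgn (T w - N)"
  let ?R = "reflection ?u \<circ> T"
  have u: "norm ?u = 1" "?u : z^o" using False Tw z by (auto simp: norm_sgn sgn_div_norm intro!: subspace_scale subspace_diff subspace_orthogonal_comp)
  have "reflection ?u y = y" if "y : z" for y using u(2) that by (simp add: reflection_def comp_iff inner_commute)
  then have "?R ` x = z" unfolding image_comp[symmetric] T(3) by simp
  moreover have "orth ?R" by (rule orthogonal_transformation_compose[OF orth_reflection[OF u(1)] T(1)])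
  moreover have "?R w = N" using reflection_swap[of "T w" N] False Tw z by simp
  ultimately show ?thesis using that orthogonal_transformation_surj by blast
 qed (use T that in blast)
qed

text \<open>The argument of \<open>is_invariant_prob_unique\<close> with the unit vector as a second
  coordinate, on which an orthogonal map acts isometrically.\<close>

lemma flag_measure_unique:
 fixes P Q :: "('a::euclidean_space set \<times> 'a) measure"
 assumes prob: "prob_space P" "prob_space Q"
  and sets: "sets P = sets (plb (Gr UNIV j) xx borel)" "sets Q = sets (plb (Gr UNIV j) xx borel)"
  and AE: "AE p in P. snd p : (fst p)^o & norm (snd p) = 1" "AE p in Q. snd p : (fst p)^o & norm (snd p) = 1"
  and inv: "!!T. orth T ==> range T = UNIV ==> distr P P (map_prod (image T) T) = P"
   "!!T. orth T ==> range T = UNIV ==> distr Q Q (map_prod (image T) T) = Q"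
 shows "P = Q"
proof -
 let ?PB = "plb (Gr (UNIV :: 'a set) j)" and ?G = "Gr (UNIV :: 'a set) j"
 let ?H = "%p. (projection (fst p), snd p) :: ('a \<Rightarrow>\<^sub>L 'a) \<times> 'a" and ?B = "borel :: 'a measure"
 define \<Omega> where "\<Omega> = {p. fst p : ?G & snd p : (fst p)^o & norm (snd p) = 1}"
 have sp: "space R = ?G \<times> UNIV" if "sets R = sets (?PB xx ?B)" for R using sets_eq_imp_space_eq[OF that] by (simp add: space_pair_measure)
 have Hm0: "?H : bmeas (?PB xx ?B)" unfolding borel_prod[symmetric] by (intro measurable_Pair measurable_compose[OF measurable_fst meas_projection] measurable_snd)
 have Hm: "?H : bmeas R" if "sets R = sets (?PB xx ?B)" for R using Hm0 measurable_cong_sets[OF that refl] by blast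
 have iH: "distr (distr R borel ?H) borel (map_prod (conjugation T) T) = distr R borel ?H"
  if R: "sets R = sets (?PB xx ?B)" "distr R R (map_prod (image T) T) = R" and T: "orth T" "range T = UNIV" for R T
 proof -
  have [measurable]: "T : bmeas borel" using T by (intro bm_linear) (simp add: orthogonal_transformation_linear)
  have im: "image T : measurable ?PB ?PB" using meas_image_plane[OF T] .
  have "map_prod (image T) T : measurable (?PB xx ?B) (?PB xx ?B)" unfolding map_prod_def case_prod_unfold by (intro measurable_Pair measurable_compose[OF measurable_fst im]) auto
  then have pm: "map_prod (image T) T : measurable R R" using measurable_cong_sets[OF R(1) R(1)] by blast
  have cm: "map_prod (conjugation T) T : bmeas borel" unfolding borel_prod[symmetric] map_prod_def case_prod_unfold by measurable
  have "distr (distr R borel ?H) borel (map_prod (conjugation T) T) = distr R borel (map_prod (conjugation T) T \<circ> ?H)" by (rule distr_distr[OF cm Hm[OF R(1)]])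
  also have "... = distr R borel (?H \<circ> map_prod (image T) T)" by (rule distr_cong) (auto simp: sp[OF R(1)] grassmannian_def conjugation_projection[OF T(1)])
  also have "... = distr (distr R R (map_prod (image T) T)) borel ?H" by (rule distr_distr[symmetric, OF Hm[OF R(1)] pm])
  finally show ?thesis unfolding R(2) .
 qed
 have eq: "distr P borel ?H = distr Q borel ?H"
 proof (rule distr_eqI_transitive[OF prob _ _ Hm[OF sets(1)] Hm[OF sets(2)]])
  show "AE p in P. p : \<Omega>" using AE(1) AE_space by eventually_elim (auto simp: \<Omega>_def sp[OF sets(1)])
  show "AE p in Q. p : \<Omega>" using AE(2) AE_space by eventually_elim (auto simp: \<Omega>_def sp[OF sets(2)])
  fix p q assume pq: "p : \<Omega>" "q : \<Omega>"
  then obtain T where T: "orth T" "range T = UNIV" "T ` fst p = fst q" "T (snd p) = snd q" using gr_flag_transitive[of "fst p" j "snd p" "fst q" "snd q"] by (auto simp: \<Omega>_def)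
  let ?F = "map_prod (conjugation T) T"
  have [measurable]: "T : bmeas borel" using T by (intro bm_linear) (simp add: orthogonal_transformation_linear)
  show "EX F:bmeas borel. (ALL a b. dist (F a) (F b) <= dist a b) & F (?H p) = ?H q
   & distr (distr P borel ?H) borel F = distr P borel ?H & distr (distr Q borel ?H) borel F = distr Q borel ?H"
  proof (intro bexI[of _ ?F] conjI allI)
   fix a b :: "('a \<Rightarrow>\<^sub>L 'a) \<times> 'a"
   have lT: "linear T" using T(1) by (simp add: orthogonal_transformation_linear)
   have "dist (T (snd a)) (T (snd b)) = dist (snd a) (snd b)" unfolding dist_norm linear_diff[OF lT, symmetric] by (rule orthogonal_transformation_norm[OF T(1)])
   then show "dist (?F a) (?F b) <= dist a b" unfolding dist_prod_def fst_map_prod snd_map_prod by (intro real_sqrt_le_mono add_mono power_mono[OF dist_conjugation_le[OF T(1)] zero_le_dist]) simp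
   show "?F (?H p) = ?H q" using pq T conjugation_projection[OF T(1), of "fst p"] by (simp add: \<Omega>_def grassmannian_def)
   show "?F : bmeas borel" unfolding borel_prod[symmetric] map_prod_def case_prod_unfold by measurable
   show "distr (distr P borel ?H) borel ?F = distr P borel ?H" by (rule iH[OF sets(1) inv(1)[OF T(1,2)] T(1,2)])
   show "distr (distr Q borel ?H) borel ?F = distr Q borel ?H" by (rule iH[OF sets(2) inv(2)[OF T(1,2)] T(1,2)])
  qed
 qed
 interpret P: prob_space P by fact
 interpret Q: prob_space Q by fact
 show ?thesis
 proof (rule measure_eqI_generator_eq[OF Int_stable_pair_measure_generator[of ?PB ?B], where A="%_. ?G \<times> UNIV" and \<Omega>="space ?PB \<times> space ?B"])
  show "sets P = sigma_sets (space ?PB \<times> space ?B) {a \<times> b |a b. a : sets ?PB & b : sets ?B}"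
   "sets Q = sigma_sets (space ?PB \<times> space ?B) {a \<times> b |a b. a : sets ?PB & b : sets ?B}" by (simp_all only: sets sets_pair_measure)
  fix X assume "X : {a \<times> b |a b. a : sets ?PB & b : sets ?B}"
  then obtain A b where X: "X = A \<times> b" "A : sets ?PB" "b : sets ?B" by auto
  obtain A' where A': "A' : sets borel" "A = projection -` A' Int ?G" using sets_plane_borel_projection[OF X(2)] .
  have m: "A' \<times> b : sets borel" unfolding borel_prod[symmetric] using A'(1) X(3) by auto
  have "em R X = em (distr R borel ?H) (A' \<times> b)" if "sets R = sets (?PB xx ?B)" for R unfolding X(1) A'(2) by (subst emeasure_distr[OF Hm[OF that] m], rule arg_cong[of _ _ "em R"]) (auto simp: sp[OF that])
  from this[OF sets(1)] this[OF sets(2)] show "em P X = em Q X" using eq by simp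
 next
  show "range (%_::nat. ?G \<times> UNIV) \<subseteq> {a \<times> b |a b. a : sets ?PB & b : sets ?B}" using sets.top[of ?PB] sets.top[of ?B] by (auto intro!: exI[of _ ?G] exI[of _ "UNIV :: 'a set"])
  show "{a \<times> b |a b. a : sets ?PB & b : sets ?B} \<subseteq> Pow (space ?PB \<times> space ?B)" using sets.sets_into_space[of _ ?PB] by auto
 qed (auto simp: P.emeasure_eq_measure)
qed

text \<open>A pair (\<xi>, \<omega>) is drawn in two ways: first \<eta>^o and then \<omega> in it,
  \<xi> being what remains; or first \<xi> and then \<omega> in its complement. Both laws are
  invariant, hence equal. The plane \<eta> is determined as the common complement of \<xi> and
  \<omega>.\<close>

lemma nni_flags:
 fixes g :: "'a::euclidean_space set \<times> 'a set \<times> 'a => ennreal"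
 assumes n: "Suc (j + k) = DIM('a)"
  and g: "g : bmeas (plb (Gr UNIV j) xx (plb (Gr UNIV k) xx borel))"
 shows "(II b. II w. g (b^o Int {w}^o, b, w) dd sph (b^o) dd grass_borel UNIV k)
  = (II z. II w. g (z, z^o Int {w}^o, w) dd sph (z^o) dd grass_borel UNIV j)"
proof -
 let ?U = "sph (UNIV :: 'a set)" and ?PB = "%m. plb (Gr (UNIV :: 'a set) m)" and ?gb = "grass_borel (UNIV :: 'a set)"
 let ?B = "borel :: 'a measure" and ?pd = "%V (x::'a). sgn (proj V x)"
 interpret U: prob_space ?U by (rule prob_sph) simp
 have le: "m <= dim (UNIV :: 'a set)" if "m <= Suc (j + k)" for m using that n by simp
 have dk: "DIM('a) - k = Suc j" "DIM('a) - j = Suc k" "DIM('a) - Suc j = k" using n by auto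
 have inv: "is_invariant_prob UNIV m (?gb m)" if "m <= Suc (j + k)" for m by (rule grass_borel_invariant[OF subspace_UNIV le[OF that]])
 have pr: "prob_space (?gb m)" "space (?gb m) = Gr UNIV m" "sets (?gb m) = sets (?PB m)" if "m <= Suc (j + k)" for m using inv[OF that] by (auto simp: is_invariant_prob_def)
 obtain z0 :: "'a set" where z0: "z0 : Gr UNIV j" using gr_nonempty[OF subspace_UNIV le, of j] by auto
 obtain b0 :: "'a set" where b0: "b0 : Gr UNIV k" using gr_nonempty[OF subspace_UNIV le, of k] by auto
 have id: "(%x. x) : measurable (?gb m) (?PB m)" if "m <= Suc (j + k)" for m using measurable_ident_sets[OF pr(3)[OF that]] by (simp add: id_def)
 have idp: "fst : measurable (?PB m xx ?B) (?PB m)" for m by measurable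
 have cj: "(%z. z^o) : measurable (?PB j) (?PB (Suc k))" "(%V. V^o) : measurable (?PB (Suc j)) (?PB k)" using meas_comp_plane[of "%x. x" "?PB j" j] meas_comp_plane[of "%x. x" "?PB (Suc j)" "Suc j"] n by (auto simp: dk)
 define G where "G p = g (fst p, cut_plane b0 ((fst p)^o) (snd p), snd p)" for p
 have Gm: "G : bmeas (?PB j xx ?B)" unfolding G_def by (rule measurable_compose[OF _ g]) (intro measurable_Pair measurable_fst measurable_snd meas_cut_plane[OF measurable_compose[OF measurable_fst cj(1)] measurable_snd b0])
 \<comment> \<open>\<open>?K1\<close> cuts the random space V = \<eta>^o by the direction \<omega>,
   \<open>?K2\<close> keeps \<xi> and draws \<omega> from its complement; in both, \<omega> is
   produced from \<open>sph UNIV\<close>.\<close>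
 let ?K1 = "%p. (cut_plane z0 (fst p) (?pd (fst p) (snd p)), ?pd (fst p) (snd p))" and ?K2 = "%p. (fst p, ?pd ((fst p)^o) (snd p))"
 have mj: "j <= Suc (j + k)" "Suc j <= Suc (j + k)" "k <= Suc (j + k)" by auto
 note idj = id[OF mj(1)] and idS = id[OF mj(2)]
 have K1: "?K1 : measurable (?gb (Suc j) xx ?U) (?PB j xx ?B)" by (intro measurable_Pair meas_cut_plane[OF measurable_compose[OF measurable_fst idS] _ z0] meas_sgn_pair[OF idS])
 have K2: "?K2 : measurable (?gb j xx ?U) (?PB j xx ?B)" by (intro measurable_Pair measurable_compose[OF measurable_fst idj] meas_sgn_pair[OF measurable_compose[OF idj cj(1)]])
 have eq: "distr (?gb (Suc j) xx ?U) (?PB j xx ?B) ?K1 = distr (?gb j xx ?U) (?PB j xx ?B) ?K2" (is "?M1 = ?M2")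
 proof (rule flag_measure_unique)
  interpret M: prob_space "?gb (Suc j)" using pr(1)[OF mj(2)] .
  interpret MU: pair_prob_space "?gb (Suc j)" ?U ..
  interpret N: prob_space "?gb j" using pr(1)[OF mj(1)] .
  interpret NU: pair_prob_space "?gb j" ?U ..
  show "prob_space ?M1" "prob_space ?M2" by (auto intro: MU.prob_space_distr NU.prob_space_distr K1 K2)
  show "sets ?M1 = sets (?PB j xx ?B)" "sets ?M2 = sets (?PB j xx ?B)" by simp_all
  have m: "{p : space (?PB j xx ?B). snd p : (fst p)^o & norm (snd p) = 1} : sets (?PB j xx ?B)"
  proof -
   have [measurable]: "(%p. proj (fst p) (snd p)) : bmeas (?PB j xx ?B)" by (rule meas_proj_subspace[OF idp]) (auto simp: grassmannian_def)
   have "x : V^o <-> proj V x = 0" if "V : Gr UNIV j" for V :: "'a set" and x using that proj_subspace[of V x] proj_subspace_eq_0[of V x] by (auto simp: grassmannian_def)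
   then have "{p : space (?PB j xx ?B). snd p : (fst p)^o & norm (snd p) = 1}
    = {p : space (?PB j xx ?B). proj (fst p) (snd p) = 0 & norm (snd p) = 1}" by (auto simp: space_pair_measure)
   also have "... : sets (?PB j xx ?B)" by measurable
   finally show ?thesis .
  qed
  note good1 = AE_sgn_pair[OF pr(1)[OF mj(2)] idS]
  show "AE p in ?M1. snd p : (fst p)^o & norm (snd p) = 1" unfolding AE_distr_iff[OF K1 m] using good1 by eventually_elim (auto simp: cut_plane_eq comp_iff inner_commute)
  show "AE p in ?M2. snd p : (fst p)^o & norm (snd p) = 1" unfolding AE_distr_iff[OF K2 m] using AE_sgn_pair[OF pr(1)[OF mj(1)] measurable_compose[OF idj cj(1)]] by eventually_elim auto
  fix T :: "'a => 'a" assume T: "orth T" "range T = UNIV"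
  have [measurable]: "T : bmeas borel" using T by (intro bm_linear) (simp add: orthogonal_transformation_linear)
  have tm: "map_prod (image T) T : measurable (?PB j xx ?B) (?PB j xx ?B)" unfolding map_prod_def case_prod_unfold by (intro measurable_Pair measurable_compose[OF measurable_fst meas_image_plane[OF T]]) auto
  have "distr ?M1 (?PB j xx ?B) (map_prod (image T) T) = ?M1"
  proof (rule equivariant_distr[OF inv[OF mj(2)] T K1 tm])
   show "AE p in ?gb (Suc j) xx ?U. map_prod (image T) T (?K1 p) = ?K1 (T ` fst p, T (snd p))" using good1 AE_space
   proof eventually_elim
    fix p assume p: "?pd (fst p) (snd p) : fst p & norm (?pd (fst p) (snd p)) = 1" "p : space (?gb (Suc j) xx ?U)"
    have "subspace (fst p)" using p(2) by (auto simp: space_pair_measure pr(2)[OF mj(2)] grassmannian_def)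
    then show "map_prod (image T) T (?K1 p) = ?K1 (T ` fst p, T (snd p))" using p(1) cut_plane_image[OF T(1), of "?pd (fst p) (snd p)" "fst p" z0] by (simp add: sgn_proj_image[OF T(1)])
   qed
  qed
  then show "distr ?M1 ?M1 (map_prod (image T) T) = ?M1" by (subst (asm) distr_cong[OF refl, of "?PB j xx ?B" ?M1]) auto
  have "distr ?M2 (?PB j xx ?B) (map_prod (image T) T) = ?M2" by (rule equivariant_distr[OF inv[OF mj(1)] T K2 tm])
    (auto intro!: AE_I2 simp: comp_image[OF T(1), symmetric] sgn_proj_image[OF T(1)] subspace_orthogonal_comp)
  then show "distr ?M2 ?M2 (map_prod (image T) T) = ?M2" by (subst (asm) distr_cong[OF refl, of "?PB j xx ?B" ?M2]) auto
 qed
 have inner: "(II w. g (V Int {w}^o, V^o, w) dd sph V) = (II x. G (?K1 (V, x)) dd ?U)"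
  if V: "V : Gr UNIV (Suc j)" for V
 proof -
  note V' = grassmannianD[OF V]
  have cm: "(%w. G (cut_plane z0 V w, w)) : bmeas borel" by (rule measurable_compose[OF _ Gm], intro measurable_Pair meas_cut_plane[OF measurable_const _ z0]) (use V in auto)
  have "(II w. g (V Int {w}^o, V^o, w) dd sph V) = (II w. G (cut_plane z0 V w, w) dd sph V)"
  proof (rule nn_integral_cong_AE)
   have "AE w in sph V. w : V Int sphere 0 1" using V' by (intro AE_sph) auto
   then show "AE w in sph V. g (V Int {w}^o, V^o, w) = G (cut_plane z0 V w, w)"
   proof eventually_elim
    fix w assume "w : V Int sphere 0 1"
    then have w: "w : V" "norm w = 1" by auto
    let ?W = "V Int {w}^o"
    have W: "subspace ?W" "w : ?W^o" using V'(1) by (auto simp: subspace_Int_comp comp_iff inner_commute)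
    \<comment> \<open>This recovers \<eta> from the pair: a vector orthogonal to w and to the part
      of V orthogonal to w is orthogonal to all of V.\<close>
    have "?W^o Int {w}^o = V^o"
    proof
     show "?W^o Int {w}^o \<subseteq> V^o"
     proof
      fix x assume x: "x : ?W^o Int {w}^o"
      show "x : V^o" unfolding comp_iff
      proof
       fix y assume y: "y : V"
       have "y - (y *. w) *R w : ?W" using y w V'(1) by (auto simp: mem_comp_singleton inner_diff_left dot_square_norm intro!: subspace_diff subspace_scale)
       then have "x *. (y - (y *. w) *R w) = 0" using x by (auto simp: comp_iff)
       then show "x *. y = 0" using x by (simp add: inner_diff_right mem_comp_singleton)
      qed
     qed
     show "V^o \<subseteq> ?W^o Int {w}^o" using w(1) by (auto simp: comp_iff)
    qed
    then show "g (V Int {w}^o, V^o, w) = G (cut_plane z0 V w, w)" using W(2) w by (simp add: G_def cut_plane_eq)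
   qed
  qed
  also have "... = (II x. G (?K1 (V, x)) dd ?U)" using nni_sph_UNIV[OF V'(1) _ cm] V'(3) by simp
  finally show ?thesis .
 qed
 have GK: "(%p. G (?K1 p)) : bmeas (?gb (Suc j) xx ?U)" "(%p. G (?K2 p)) : bmeas (?gb j xx ?U)" by (rule measurable_compose[OF K1 Gm], rule measurable_compose[OF K2 Gm])
 have hm: "(%V. II x. G (?K1 (V, x)) dd ?U) : bmeas (?PB (Suc j))" using U.borel_measurable_nn_integral_fst[OF GK(1)] measurable_cong_sets[OF pr(3)[OF mj(2)] refl] by blast
 have ck: "(%b. b^o) : measurable (?gb k) (?PB (Suc j))" using meas_comp_plane[OF id[OF mj(3)]] by (simp only: dk)
 have "(II b. II w. g (b^o Int {w}^o, b, w) dd sph (b^o) dd ?gb k) = (II b. (II x. G (?K1 (b^o, x)) dd ?U) dd ?gb k)"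
 proof (rule nn_integral_cong)
  fix b assume "b : space (?gb k)"
  then have "b : Gr UNIV k" using pr(2)[OF mj(3)] by simp
  then have "subspace b" "b^o : Gr UNIV (Suc j)" using comp_in_gr[of b k] by (auto simp: grassmannian_def dk)
  from inner[OF this(2)] comp_comp[OF this(1)]
  show "(II w. g (b^o Int {w}^o, b, w) dd sph (b^o)) = (II x. G (?K1 (b^o, x)) dd ?U)" by simp
 qed
 also have "... = (II V. (II x. G (?K1 (V, x)) dd ?U) dd distr (?gb k) (?PB (Suc j)) (%b. b^o))" by (rule nn_integral_distr[OF ck, symmetric]) (simp only: measurable_distr_eq1 hm)
 also have "distr (?gb k) (?PB (Suc j)) (%b. b^o) = ?gb (Suc j)" using grass_borel_comp[of k, where 'a='a] n by (simp add: dk)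
 also have "(II V. (II x. G (?K1 (V, x)) dd ?U) dd ?gb (Suc j)) = (II p. G (?K1 p) dd (?gb (Suc j) xx ?U))" by (rule U.nn_integral_fst[OF GK(1)])
 also have "... = (II p. G p dd ?M1)" by (rule nn_integral_distr[OF K1, symmetric]) (simp only: measurable_distr_eq1 Gm)
 also have "... = (II p. G p dd ?M2)" unfolding eq ..
 also have "... = (II p. G (?K2 p) dd (?gb j xx ?U))" by (rule nn_integral_distr[OF K2]) (simp only: measurable_distr_eq1 Gm)
 also have "... = (II z. II x. G (?K2 (z, x)) dd ?U dd ?gb j)" by (rule U.nn_integral_fst[OF GK(2), symmetric])
 also have "... = (II z. II w. g (z, z^o Int {w}^o, w) dd sph (z^o) dd ?gb j)"
 proof (rule nn_integral_cong)
  fix z assume "z : space (?gb j)"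
  then have z: "z : Gr UNIV j" using pr(2)[OF mj(1)] by simp
  then have W: "subspace (z^o)" "0 < dim (z^o)" using comp_in_gr[OF z] by (auto simp: grassmannian_def dk)
  have Gx: "(%w. G (z, w)) : bmeas borel" by (rule measurable_compose[OF _ Gm], intro measurable_Pair measurable_const) (use z in auto)
  have "(II x. G (?K2 (z, x)) dd ?U) = (II w. G (z, w) dd sph (z^o))" using nni_sph_UNIV[OF W Gx] by simp
  also have "... = (II w. g (z, z^o Int {w}^o, w) dd sph (z^o))" by (rule nn_integral_cong_AE, use AE_sph[OF W] in eventually_elim) (auto simp: G_def cut_plane_eq)
  finally show "(II x. G (?K2 (z, x)) dd ?U) = (II w. g (z, z^o Int {w}^o, w) dd sph (z^o))" .
 qed
 finally show ?thesis .
qed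

section \<open>Affine planes\<close>

lemma proj_plane:
 fixes y :: "'a::euclidean_space set"
 assumes y: "subspace y" shows "proj ((+) u ` y) x = u + proj y (x - u)"
proof (rule closest_point_unique[symmetric])
 let ?p = "proj y (x - u)"
 have cl: "convex y" "closed y" "y ~= {}" using y by (auto simp: subspace_imp_convex closed_subspace subspace_0 dest: subspace_0)
 then show "convex ((+) u ` y)" "closed ((+) u ` y)" by (auto intro: convex_translation closed_translation)
 show "u + ?p : (+) u ` y" using proj_subspace(1)[OF y] by simp
 show "ALL z:(+) u ` y. dist x (u + ?p) <= dist x z" using closest_point_le[OF cl(2), of _ "x - u"] by (auto simp: dist_norm algebra_simps)
qed

lemma plane_in_aff_gr:
 assumes x: "x : Gr X j" and X: "subspace X" and u: "u : X"
 shows "(+) u ` x : aGr X j"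
proof -
 note g = grassmannianD[OF x]
 have "affine ((+) u ` x)" unfolding affine_translation[symmetric] by (rule subspace_imp_affine[OF g(1)])
 moreover have "aff_dim ((+) u ` x) = int j" unfolding aff_dim_translation_eq using aff_dim_subspace[OF g(1)] g(3) by simp
 ultimately show ?thesis using g(2) subspace_add[OF X u] by (auto simp: affine_grassmannian_def)
qed

lemma foot_plane: "subspace x ==> foot ((+) u ` x) = u - proj x u" for x :: "'a::euclidean_space set" by (simp add: foot_def proj_plane linear_neg[OF linear_proj])

lemma plane_at_foot:
 fixes x :: "'a::euclidean_space set"
 assumes "subspace x" shows "(+) (u - proj x u) ` x = (+) u ` x"
proof -
 let ?c = "proj x u"
 note c = proj_subspace(1)[OF assms, of u]
 have "u - ?c + y : (+) u ` x" "u + y : (+) (u - ?c) ` x" if "y : x" for y using subspace_diff[OF assms that c] subspace_add[OF assms that c] by (auto intro!: image_eqI[of _ _ "y - ?c"] image_eqI[of _ _ "y + ?c"])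
 then show ?thesis by auto
qed

lemma direction_plane:
 fixes y :: "'a::euclidean_space set"
 assumes "subspace y" shows "direction ((+) u ` y) = y"
proof -
 have "direction ((+) u ` y) = (%x. x - foot ((+) u ` y)) ` (+) (u - proj y u) ` y" unfolding direction_def plane_at_foot[OF assms] ..
 also have "... = y" unfolding foot_plane[OF assms] image_image by simp
 finally show ?thesis .
qed

lemma meas_plane:
 fixes X :: "'a::euclidean_space set"
 assumes f: "f : measurable N (plb (Gr X j))" and g[measurable]: "g : bmeas N"
  and X: "subspace X" "!!n. n : space N ==> g n : X"
 shows "(%n. (+) (g n) ` f n) : measurable N (plb (aGr X j))"
proof (rule meas_plane_borelI)
 have fs: "f n : Gr X j" if "n : space N" for n using measurable_space[OF f that] by simp
 then show "(%n. (+) (g n) ` f n) : space N \<rightarrow> aGr X j" using X by (auto intro: plane_in_aff_gr)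
 fix x
 have "(%n. g n + proj (f n) (x - g n)) : bmeas N" by (intro borel_measurable_add g meas_proj_subspace[OF f] borel_measurable_diff) (auto simp: grassmannian_def)
 then show "(%n. proj ((+) (g n) ` f n) x) : bmeas N" by (subst measurable_cong[where g="%n. g n + proj (f n) (x - g n)"]) (use fs in \<open>auto simp: proj_plane grassmannian_def\<close>)
qed

text \<open>The measure $du$ on X Int \<xi>^o varies with \<xi>; as in \<open>nni_leb_eq\<close> it
  is traded for the fixed \<open>leb X\<close> with a weight in the j directions of \<xi>. The map
  \<open>proj X\<close> changes almost nothing, but puts every plane inside
  \<open>X\<close>.\<close>

definition aff_grass_borel :: "'a::euclidean_space set => nat => 'a set measure" where
 "aff_grass_borel X j = distr (density (grass_borel X j xx leb X) (%p. complement_weight j (proj (fst p) (snd p))))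
  (plb (aGr X j)) (%p. (+) (proj X (snd p)) ` fst p)"

lemma aff_grass_borel_props[simp]:
 "space (aff_grass_borel X j) = aGr X j"
 "sets (aff_grass_borel X j) = sets (plb (aGr X j))" by (simp_all add: aff_grass_borel_def)

lemma nni_plane_kernel:
 fixes X :: "'a::euclidean_space set"
 assumes X: "subspace X" and j: "j <= dim X" and h: "h : bmeas (plb (aGr X j))"
 defines "q \<equiv> %p. complement_weight j (proj (fst p) (snd p)) * h ((+) (proj X (snd p)) ` fst p)"
 shows "q : bmeas (plb (Gr X j) xx borel)"
  and "y : Gr X j ==> (II u. h ((+) u ` y) dd leb (X Int y^o)) = (II x. q (y, x) dd leb X)"
proof -
 let ?N = "plb (Gr X j) xx (borel :: 'a measure)"
 note [measurable] = bm_proj[OF X]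
 have [measurable]: "(%p. proj (fst p) (snd p)) : bmeas ?N" by (rule meas_proj_subspace[OF measurable_fst]) (auto simp: grassmannian_def)
 have [measurable]: "(%p. h ((+) (proj X (snd p)) ` fst p)) : bmeas ?N" by (rule measurable_compose[OF meas_plane[OF measurable_fst _ X] h]) (use proj_subspace(1)[OF X] in measurable)
 show "q : bmeas ?N" unfolding q_def by measurable
 assume g: "y : Gr X j"
 note y = grassmannianD[OF g]
 let ?V = "X Int y^o"
 have V: "subspace ?V" "?V \<subseteq> X" "dim X - dim ?V = j" using dim_Int_comp[OF X y(1,2)] y(3) X by (auto intro: subspace_Int_comp)
 have hm: "(%x. h ((+) (proj X x) ` y)) : bmeas borel" by (rule measurable_compose[OF meas_plane[OF _ _ X] h]) (use g proj_subspace(1)[OF X] in auto)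
 have "(II u. h ((+) u ` y) dd leb ?V) = (II u. h ((+) (proj X u) ` y) dd leb ?V)" by (rule nn_integral_cong_AE, use AE_leb[OF V(1)] in eventually_elim) (auto simp: closest_point_self)
 also have "... = (II x. h ((+) (proj X (proj ?V x)) ` y) * complement_weight j (x - proj ?V x) dd leb X)" using nni_leb_eq[OF X V(1,2) hm] V(3) by simp
 also have "... = (II x. q (y, x) dd leb X)"
 proof (rule nn_integral_cong_AE, use AE_leb[OF X] in eventually_elim)
  fix x assume x: "x : X"
  have "proj ?V x = x - proj y x" using proj_Int_comp[OF X y(1,2)] x by (simp add: closest_point_self)
  moreover have "proj X (proj ?V x) = proj ?V x" using proj_subspace(1)[OF V(1)] V(2) by (intro closest_point_self) blast
  ultimately show "h ((+) (proj X (proj ?V x)) ` y) * complement_weight j (x - proj ?V x) = q (y, x)" using x by (simp add: q_def closest_point_self plane_at_foot[OF y(1)] mult.commute)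
 qed
 finally show "(II u. h ((+) u ` y) dd leb ?V) = (II x. q (y, x) dd leb X)" .
qed

lemma nni_aff_grass_borel:
 fixes X :: "'a::euclidean_space set"
 assumes X: "subspace X" and j: "j <= dim X" and h: "h : bmeas (plb (aGr X j))"
 shows "(II t. h t dd aff_grass_borel X j) = (II y. II u. h ((+) u ` y) dd leb (X Int y^o) dd grass_borel X j)"
proof -
 let ?M = "grass_borel X j" and ?L = "leb X" and ?w = "%p::'a set \<times> 'a. complement_weight j (proj (fst p) (snd p)) :: ennreal"
 let ?T = "%p::'a set \<times> 'a. (+) (proj X (snd p)) ` fst p"
 interpret L: sigma_finite_measure ?L using X by (rule sf_leb)
 note pr = grass_borel_props[OF X j] and k = nni_plane_kernel[OF X j h]
 note [measurable] = bm_proj[OF X]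
 have id: "(%p. fst p) : measurable (?M xx ?L) (plb (Gr X j))" by (rule measurable_compose[OF measurable_fst]) (use measurable_ident_sets[OF pr(3)] in \<open>simp add: id_def\<close>)
 have [measurable]: "(%p. proj (fst p) (snd p)) : bmeas (?M xx ?L)" by (rule meas_proj_subspace[OF id]) (auto simp: grassmannian_def)
 have Tm: "?T : measurable (?M xx ?L) (plb (aGr X j))" by (rule meas_plane[OF id _ X]) (use proj_subspace(1)[OF X] in measurable)
 have hT[measurable]: "(%p. h (?T p)) : bmeas (?M xx ?L)" by (rule measurable_compose[OF Tm h])
 have "(II t. h t dd aff_grass_borel X j) = (II p. h (?T p) dd density (?M xx ?L) ?w)" unfolding aff_grass_borel_def by (rule nn_integral_distr) (use Tm h in simp_all)
 also have "... = (II p. ?w p * h (?T p) dd (?M xx ?L))" by (rule nn_integral_density) measurable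
 also have "... = (II y. II x. ?w (y, x) * h (?T (y, x)) dd ?L dd ?M)" by (rule L.nn_integral_fst[symmetric]) measurable
 also have "... = (II y. II u. h ((+) u ` y) dd leb (X Int y^o) dd ?M)" by (rule nn_integral_cong) (use k(2) pr(2) in simp)
 finally show ?thesis .
qed

text \<open>\<open>measure_of\<close> looks at the double integral on measurable sets only, where it
  is the mass under the Borel measure; the inner completions do not affect nonnegative
  integrals.\<close>

lemma aff_grass_measure_eq:
 fixes X :: "'a::euclidean_space set"
 assumes X: "subspace X" and j: "j <= dim X"
 shows "affine_grass_measure X j = completion (aff_grass_borel X j)"
proof -
 let ?S = "sets (plb (aGr X j))" and ?\<Omega> = "aGr X j"
 have e: "(II x. (II u. ind A ((+) u ` x) dd subspace_lebesgue (X Int x^o)) dd grass_measure X j) = em (aff_grass_borel X j) A"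
  if "A : ?S" for A using nni_aff_grass_borel[OF X j borel_measurable_indicator[OF that]] that by (simp add: grass_measure_eq subspace_lebesgue_def nn_integral_completion)
 have "measure_of ?\<Omega> ?S (%A. II x. (II u. ind A ((+) u ` x) dd subspace_lebesgue (X Int x^o)) dd grass_measure X j)
  = measure_of ?\<Omega> ?S (em (aff_grass_borel X j))" by (rule measure_of_eq) (use sets.sets_into_space[of _ "plb ?\<Omega>"] sets.sigma_sets_eq[of "plb ?\<Omega>"] e in auto)
 also have "... = aff_grass_borel X j" using measure_of_of_measure[of "aff_grass_borel X j"] by simp
 finally show ?thesis unfolding affine_grass_measure_def by simp
qed

text \<open>By \<open>grass_borel_hyperplanes\<close> a random hyperplane direction is given by its
  normal w, and the complement of that direction in \<open>X\<close> is the line of w.\<close>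

lemma nni_aff_hyperplanes:
 fixes X :: "'a::euclidean_space set"
 assumes X: "subspace X" and d: "dim X = Suc j" and h: "h : bmeas (plb (aGr X j))"
 shows "(II T. h T dd aff_grass_borel X j) = (II w. II t. h ((+) (t *R w) ` (X Int {w}^o)) dd lborel dd sph X)"
proof -
 let ?PB = "plb (Gr X j)"
 obtain y0 where 0: "y0 : Gr X j" using gr_nonempty[OF X, of j] d by auto
 have cm: "cut_plane y0 X : measurable (sph X) ?PB" by (rule meas_cut_plane[OF _ _ 0]) (use X d in \<open>auto simp: grassmannian_def\<close>)
 interpret L: sigma_finite_measure "leb X" using X by (rule sf_leb)
 have j: "j <= dim X" using d by simp
 note pr = grass_borel_props[OF X j]
 define K where "K y = (II x. complement_weight j (proj y x) * h ((+) (proj X x) ` y) dd leb X)" for y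
 have K: "(II u. h ((+) u ` y) dd leb (X Int y^o)) = K y" if "y : Gr X j" for y using nni_plane_kernel(2)[OF X j h that] by (simp add: K_def)
 have [measurable_cong]: "sets (leb X) = sets borel" by simp
 have qm: "(%p. complement_weight j (proj (fst p) (snd p)) * h ((+) (proj X (snd p)) ` fst p)) : bmeas (?PB xx leb X)" using nni_plane_kernel(1)[OF X j h] measurable_cong_sets[OF sets_pair_measure_cong[OF refl sets_leb] refl] by blast
 have Km: "K : bmeas ?PB" unfolding K_def using L.borel_measurable_nn_integral_fst[OF qm] by simp
 have "(II T. h T dd aff_grass_borel X j) = (II y. K y dd grass_borel X j)" unfolding nni_aff_grass_borel[OF X j h] by (rule nn_integral_cong) (simp add: K pr)
 also have "... = (II w. K (cut_plane y0 X w) dd sph X)" unfolding grass_borel_hyperplanes[OF X d 0] by (rule nn_integral_distr[OF cm]) (simp only: measurable_distr_eq1 Km)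
 also have "... = (II w. II t. h ((+) (t *R w) ` (X Int {w}^o)) dd lborel dd sph X)"
 proof (rule nn_integral_cong_AE)
  have "AE w in sph X. w : X Int sphere 0 1" using d by (intro AE_sph[OF X]) simp
  then show "AE w in sph X. K (cut_plane y0 X w) = (II t. h ((+) (t *R w) ` (X Int {w}^o)) dd lborel)"
  proof eventually_elim
   fix w assume "w : X Int sphere 0 1"
   then have w: "w : X" "norm w = 1" by auto
   let ?W = "X Int {w}^o"
   have W: "?W : Gr X j" using dim_Int_comp_unit[OF X w] d X by (auto simp: grassmannian_def subspace_Int_comp)
   have sp: "span {w} \<subseteq> X" using X w by (intro span_minimal) auto
   have sX: "X Int ?W^o = span {w}"
   proof (rule subspace_dim_equal[symmetric])
    show "span {w} \<subseteq> X Int ?W^o" using sp by (auto simp: span_singleton comp_iff inner_commute)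
    show "dim (X Int ?W^o) <= dim (span {w})" using dim_Int_comp[OF X grassmannianD(1,2)[OF W]] grassmannianD(3)[OF W] d w(2) by (auto simp: dim_singleton)
   qed (use X in \<open>auto intro: subspace_Int_comp\<close>)
   have hm: "(%u. h ((+) (proj X u) ` ?W)) : bmeas borel" by (rule measurable_compose[OF meas_plane[OF _ _ X] h]) (use W proj_subspace(1)[OF X] bm_proj[OF X] in auto)
   have "K ?W = (II u. h ((+) (proj X u) ` ?W) dd leb (span {w}))" unfolding K[OF W, symmetric] sX
   proof (rule nn_integral_cong_AE, use AE_leb[OF subspace_span[of "{w}"]] in eventually_elim)
    fix u assume "u : span {w}"
    then have "proj X u = u" using sp by (intro closest_point_self) blast
    then show "h ((+) u ` ?W) = h ((+) (proj X u) ` ?W)" by simp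
   qed
   also have "... = (II t. h ((+) (proj X (t *R w)) ` ?W) dd lborel)" unfolding leb_line[OF w(2)] by (rule nn_integral_distr) (use hm in simp_all)
   also have "... = (II t. h ((+) (t *R w) ` ?W) dd lborel)" using w(1) X by (simp add: closest_point_self subspace_scale)
   finally show "K (cut_plane y0 X w) = (II t. h ((+) (t *R w) ` ?W) dd lborel)" using w by (simp add: cut_plane_eq)
  qed
 qed
 finally show ?thesis .
qed

text \<open>Testing only positively homogeneous f lets a density pass from the measure into the
  function. The norm decides integrability, and the components with both signs determine the
  integral.\<close>

lemma int_eqI_nn:
 fixes q :: "'x => 'b::euclidean_space" and r :: "'y => 'b"
 assumes q: "q : bmeas M" and r: "r : bmeas N"
  and eq: "!!f. f : bmeas borel ==> (!!c x. 0 <= c ==> f (c *R x) = c * f x)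
   ==> (II x. enn (f (q x)) dd M) = (II y. enn (f (r y)) dd N)"
 shows "integrable M q <-> integrable N r" "integral\<^sup>L M q = integral\<^sup>L N r"
proof -
 show i: "integrable M q <-> integrable N r" using q r eq[of norm] by (simp add: integrable_iff_bounded)
 show "integral\<^sup>L M q = integral\<^sup>L N r"
 proof (cases "integrable M q")
  case True
  note I = True i[THEN iffD1, OF True]
  show ?thesis
  proof (rule euclidean_eqI)
   fix b :: 'b
   have "(II x. enn (q x *. b) dd M) = (II x. enn (r x *. b) dd N)" "(II x. enn (- (q x *. b)) dd M) = (II x. enn (- (r x *. b)) dd N)" using eq[of "%x. x *. b"] eq[of "%x. - (x *. b)"] by auto
   then have "(LINT x|M. q x *. b) = (LINT x|N. r x *. b)" unfolding real_lebesgue_integral_def[OF integrable_inner_left[OF I(1)]] real_lebesgue_integral_def[OF integrable_inner_left[OF I(2)]] by simp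
   then show "integral\<^sup>L M q *. b = integral\<^sup>L N r *. b" unfolding integral_inner_left[OF I(1)] integral_inner_left[OF I(2)] .
  qed
 qed (simp add: i not_integrable_integral_eq)
qed

section \<open>The sphere of X x R in coordinates of points and of hyperplanes\<close>

lemma bm_fst_snd[measurable]:
 "(fst :: 'a::second_countable_topology \<times> 'b::second_countable_topology => 'a) : bmeas borel"
 "(snd :: 'a \<times> 'b => 'b) : bmeas borel" unfolding borel_prod[symmetric] by (rule measurable_fst measurable_snd)+

lemma bm_sphere_pair:
 fixes g :: "'a::euclidean_space \<times> real => 'c::topological_space"
 assumes "g : bmeas borel" shows "g : bmeas (sph X xx lborel)"
proof -
 have "sets (sph X xx (lborel :: real measure)) = sets borel" unfolding borel_prod[symmetric] by (rule sets_pair_measure_cong) auto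
 then show ?thesis using assms measurable_cong_sets by blast
qed

lemma subspace_product: "subspace X ==> subspace (X \<times> (UNIV :: real set))" for X :: "'a::euclidean_space set" by (auto simp: subspace_def zero_prod_def)

lemma product_Int_comp: "X \<times> UNIV Int {(0, 1::real)}^o = (%x. (x, 0)) ` X" for X :: "'a::euclidean_space set" by (auto simp: mem_comp_singleton inner_Pair)

lemma dim_product:
 fixes X :: "'a::euclidean_space set"
 assumes X: "subspace X" shows "dim (X \<times> (UNIV :: real set)) = Suc (dim X)"
proof -
 have "linear (%x::'a. (x, 0::real))" by (rule linearI) auto
 then have "dim ((%x::'a. (x, 0::real)) ` X) = dim X" by (rule dim_image_eq) (auto intro: inj_onI)
 then show ?thesis using dim_Int_comp_unit[OF subspace_product[OF X], of "(0, 1)"] subspace_0[OF X] by (simp add: product_Int_comp)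
qed

lemma nni_product_0:
 fixes X :: "'a::euclidean_space set"
 assumes X: "subspace X" and [measurable]: "g : bmeas borel"
 shows "(II z. g z dd leb ((%x. (x, 0::real)) ` X)) = (II x. g (x, 0) dd leb X)"
proof -
 have l: "linear (%x::'a. (x, 0::real))" by (rule linearI) auto
 note [measurable] = bm_linear[OF l]
 have "leb ((%x. (x, 0::real)) ` X) = distr (leb X) borel (%x. (x, 0))" by (rule leb_isometry[OF X l]) simp
 then show ?thesis by (simp add: nn_integral_distr)
qed

text \<open>The density of the normalised sphere at the point (\<omega>, t) / sqrt (1 + t^2); the
  quotient of the constants is the area of the (d-1)-sphere over that of the d-sphere.\<close>

definition sphere_weight :: "nat => real => real" where
 "sphere_weight d t = (real d * unit_ball_vol (real d) / (real (Suc d) * unit_ball_vol (real (Suc d)))) / sqrt (1 + t^2) ^ Suc d"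

lemma sphere_weight_pos: "0 < d ==> 0 < sphere_weight d t" unfolding sphere_weight_def by (intro divide_pos_pos mult_pos_pos zero_less_power) (auto simp: add_pos_nonneg)

text \<open>The slice formula along the last axis. The pairs (\<omega>, t) are also the coordinates
  of hyperplanes, so null sets can be moved between the two settings.\<close>

lemma nni_sphere_product:
 fixes X :: "'a::euclidean_space set"
 assumes X: "subspace X" and d: "0 < dim X" and g[measurable]: "g : bmeas borel"
 shows "(II z. g z dd sph (X \<times> (UNIV :: real set)))
  = (II p. g ((1 / sqrt (1 + (snd p)^2)) *R p) * enn (sphere_weight (dim X) (snd p)) dd (sph X xx lborel))"
proof -
 let ?V = "X \<times> (UNIV :: real set)" and ?e = "(0::'a, 1::real)" and ?L = "%x::'a. (x, 0::real)"
 obtain m where m: "dim X = Suc m" using d by (cases "dim X") auto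
 have V: "subspace ?V" "dim ?V = Suc (Suc m)" using X m by (auto simp: subspace_product dim_product)
 have [measurable]: "sphere_weight k : bmeas borel" for k unfolding sphere_weight_def by measurable
 have WL: "?V Int {?e}^o = ?L ` X" by (simp add: product_Int_comp)
 have l: "linear ?L" by (rule linearI) auto
 note [measurable] = bm_linear[OF l]
 have "sph (?L ` X) = distr (sph X) borel ?L" by (rule sph_isometry[OF X l]) simp
 then have gr: "(II r. k r dd sph (?L ` X)) = (II w. k (w, 0) dd sph X)" if "k : bmeas borel" for k :: "'a \<times> real => ennreal" using that by (simp add: nn_integral_distr)
 have "(II z. g z dd sph ?V) = (II s. II r. g ((1 / sqrt (1 + s^2)) *R (r + s *R ?e)) * enn (sphere_weight (dim X) s) dd sph (?L ` X) dd lborel)" unfolding WL[symmetric] sphere_weight_def m by (rule nni_sphere_slice[OF V(1) _ _ V(2) g]) (use subspace_0[OF X] in auto)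
 also have "... = (II s. II w. g ((1 / sqrt (1 + s^2)) *R (w, s)) * enn (sphere_weight (dim X) s) dd sph X dd lborel)" by (intro arg_cong[where f="nn_integral lborel"] ext, subst gr) auto
 also have "... = (II w. II s. g ((1 / sqrt (1 + s^2)) *R (w, s)) * enn (sphere_weight (dim X) s) dd lborel dd sph X)" by (rule nni_swap[OF lborel.sigma_finite_measure_axioms sf_sph[OF X]]) measurable
 also have "... = (II p. g ((1 / sqrt (1 + (snd p)^2)) *R p) * enn (sphere_weight (dim X) (snd p)) dd (sph X xx lborel))" by (subst lborel.nn_integral_fst[symmetric]) (auto intro!: bm_sphere_pair)
 finally show ?thesis .
qed

lemma AE_sphere_productD:
 fixes X :: "'a::euclidean_space set"
 assumes X: "subspace X" and d: "0 < dim X" and Q: "AE z in sph (X \<times> (UNIV :: real set)). Q z"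
 shows "AE p in sph X xx lborel. Q ((1 / sqrt (1 + (snd p)^2)) *R p)"
proof -
 obtain N where N: "N : null_sets (sph (X \<times> (UNIV :: real set)))" "{z. ~ Q z} \<subseteq> N" using Q by (auto simp: eventually_ae_filter sph_def)
 then have [measurable]: "N : sets borel" by (auto simp: null_sets_def)
 have [measurable]: "sphere_weight k : bmeas borel" for k unfolding sphere_weight_def by measurable
 have "(II p. ind N ((1 / sqrt (1 + (snd p)^2)) *R p) * enn (sphere_weight (dim X) (snd p)) dd (sph X xx lborel)) = 0" using nni_sphere_product[OF X d, of "ind N"] N(1) by (simp add: null_sets_def)
 then have "AE p in sph X xx lborel. ind N ((1 / sqrt (1 + (snd p)^2)) *R p) * enn (sphere_weight (dim X) (snd p)) = 0" by (subst (asm) nn_integral_0_iff_AE, intro bm_sphere_pair) auto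
 then show ?thesis
 proof eventually_elim
  fix p :: "'a \<times> real" assume "ind N ((1 / sqrt (1 + (snd p)^2)) *R p) * enn (sphere_weight (dim X) (snd p)) = 0"
  then have "(1 / sqrt (1 + (snd p)^2)) *R p ~: N" using sphere_weight_pos[OF d, of "snd p"] by (auto simp: indicator_def ennreal_eq_0_iff split: if_splits)
  then show "Q ((1 / sqrt (1 + (snd p)^2)) *R p)" using N(2) by blast
 qed
qed

lemma AE_sphere_pair:
 fixes X :: "'a::euclidean_space set"
 assumes X: "subspace X" "0 < dim X" shows "AE p in sph X xx (lborel :: real measure). fst p : X & norm (fst p) = 1"
proof -
 interpret S: prob_space "sph X" using X(1) by (rule prob_sph)
 interpret SL: pair_sigma_finite "sph X" "lborel :: real measure" ..
 have "closed (X Int sphere 0 1)" by (rule closed_Int[OF closed_subspace[OF X(1)] closed_sphere])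
 then have [measurable]: "X Int sphere 0 1 : sets borel" by (rule borel_closed)
 have "AE p in sph X xx (lborel :: real measure). fst p : X Int sphere 0 1" by (rule SL.AE_pair_measure) (use AE_sph[OF X] in \<open>measurable, auto elim: eventually_mono\<close>)
 then show ?thesis by eventually_elim auto
qed

lemma AE_sphere_productI:
 fixes X :: "'a::euclidean_space set"
 assumes X: "subspace X" and d: "0 < dim X" and Q: "AE p in sph X xx lborel. Q p"
 shows "AE z in sph (X \<times> (UNIV :: real set)). Q ((1 / norm (fst z)) *R z) & fst z ~= 0"
proof -
 \<comment> \<open>Requiring a unit first component inside the condition puts the origin into
   \<open>N\<close>. The poles, where division by zero returns the origin, are then excluded as
   well.\<close>
 obtain N where N: "N : null_sets (sph X xx lborel)" "{p : space (sph X xx lborel). ~ (Q p & fst p : X & norm (fst p) = 1)} \<subseteq> N" using AE_conjI[OF Q AE_sphere_pair[OF X d]] unfolding eventually_ae_filter by blast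
 have sp: "space (sph X xx (lborel :: real measure)) = UNIV" by (simp add: space_pair_measure sph_def)
 have sb: "sets (sph X xx (lborel :: real measure)) = sets borel" unfolding borel_prod[symmetric] by (rule sets_pair_measure_cong) auto
 have [measurable]: "N : sets borel" using N(1) sb by (auto simp: null_sets_def)
 let ?g = "%z::'a \<times> real. ind N ((1 / norm (fst z)) *R z) :: ennreal"
 have gm: "?g : bmeas borel" by measurable
 have "(II z. ?g z dd sph (X \<times> (UNIV :: real set))) = (II p. ?g ((1 / sqrt (1 + (snd p)^2)) *R p) * enn (sphere_weight (dim X) (snd p)) dd (sph X xx lborel))" by (rule nni_sphere_product[OF X d gm])
 also have "... = (II p. 0 dd (sph X xx (lborel :: real measure)))"
 proof (rule nn_integral_cong_AE, use AE_sphere_pair[OF X d] AE_not_in[OF N(1)] in eventually_elim)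
  fix p :: "'a \<times> real" assume p: "fst p : X & norm (fst p) = 1" "p ~: N"
  have "0 < sqrt (1 + (snd p)^2)" by (simp add: add_pos_nonneg)
  then show "?g ((1 / sqrt (1 + (snd p)^2)) *R p) * enn (sphere_weight (dim X) (snd p)) = 0" using p by simp
 qed
 finally have "AE z in sph (X \<times> (UNIV :: real set)). ?g z = 0" using gm by (simp add: nn_integral_0_iff_AE)
 then show ?thesis
 proof eventually_elim
  fix z :: "'a \<times> real" assume "?g z = 0"
  then have "(1 / norm (fst z)) *R z ~: N" by (simp add: indicator_def split: if_splits)
  then have "Q ((1 / norm (fst z)) *R z)" "norm (fst ((1 / norm (fst z)) *R z)) = 1" using N(2) unfolding sp by blast+
  then show "Q ((1 / norm (fst z)) *R z) & fst z ~= 0" by (cases "fst z = 0") auto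
 qed
qed

lemma AE_sphere_gnomonic:
 fixes X :: "'a::euclidean_space set"
 assumes X: "subspace X" and Q: "AE x in leb X. Q x"
 shows "AE z in sph (X \<times> (UNIV :: real set)). Q ((1 / snd z) *R fst z) & snd z ~= 0"
proof -
 let ?V = "X \<times> (UNIV :: real set)" and ?e = "(0::'a, 1::real)"
 obtain N where N: "N : null_sets (leb X)" "{x. ~ Q x} \<subseteq> N" using Q by (auto simp: eventually_ae_filter subspace_lborel_def)
 then have [measurable]: "N : sets borel" by (auto simp: null_sets_def)
 \<comment> \<open>The equator has no image in the chart and is added to the exceptional set
   explicitly.\<close>
 let ?g = "%z. ind {z::'a \<times> real. (1 / snd z) *R fst z : N \<or> snd z = 0} z :: ennreal"
 have gm: "?g : bmeas borel"
 proof -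
  have "{z : space borel. (1 / snd z) *R fst z : N \<or> snd z = (0::real)} : sets borel" by measurable
  then show ?thesis by (intro borel_measurable_indicator) simp
 qed
 have "(II z. ?g z dd sph ?V) = (II w. ?g (sgn (w + 1 *R ?e)) * enn (2 / (real (Suc (dim X)) * unit_ball_vol (real (Suc (dim X)))) * (1 / norm (w + 1 *R ?e) ^ Suc (dim X))) dd leb (?V Int {?e}^o))" by (rule nni_sphere_gnomonic[OF subspace_product[OF X] _ _ dim_product[OF X] _ gm]) (use subspace_0[OF X] in \<open>auto simp: indicator_def\<close>)
 also have "... = (II x. ?g (sgn ((x, 0) + 1 *R ?e)) * enn (2 / (real (Suc (dim X)) * unit_ball_vol (real (Suc (dim X)))) * (1 / norm ((x, 0) + 1 *R ?e) ^ Suc (dim X))) dd leb X)" unfolding product_Int_comp by (rule nni_product_0[OF X]) (use gm in measurable)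
 also have "... = (II x. 0 dd leb X)"
 proof (rule nn_integral_cong_AE, use AE_not_in[OF N(1)] in eventually_elim)
  fix x assume "x ~: N"
  then have "?g (sgn ((x, 0) + 1 *R ?e)) = 0" by (auto simp: indicator_def sgn_div_norm norm_eq_zero zero_prod_def)
  then show "?g (sgn ((x, 0) + 1 *R ?e)) * enn (2 / (real (Suc (dim X)) * unit_ball_vol (real (Suc (dim X)))) * (1 / norm ((x, 0) + 1 *R ?e) ^ Suc (dim X))) = 0" by (simp only: mult_zero_left)
 qed
 finally have "AE z in sph ?V. ?g z = 0" using gm by (subst nn_integral_0_iff_AE[symmetric]) simp_all
 then show ?thesis by eventually_elim (use N(2) in \<open>auto simp: indicator_def split: if_splits\<close>)
qed

section \<open>Hyperplane transforms\<close>

lemma powr_minus_half: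
 fixes x :: real
 assumes "0 < x" shows "x powr (- (real d / 2)) = 1 / sqrt x ^ d"
proof -
 have "sqrt x ^ d = (x powr (1 / 2)) powr real d" using assms by (subst powr_realpow) (auto simp: powr_half_sqrt)
 also have "... = x powr (real d / 2)" by (simp add: powr_powr)
 finally show ?thesis by (simp only: powr_minus_divide)
qed

lemma uminus_image_subspace:
 fixes X :: "'a::euclidean_space set"
 assumes "subspace X" shows "uminus ` X = X"
proof (intro equalityI subsetI)
 fix x assume "x : X"
 then show "x : uminus ` X" using subspace_neg[OF assms, of x] by (intro image_eqI[of _ _ "- x"]) simp_all
qed (use subspace_neg[OF assms] in auto)

lemma plane_eq_hyperplane:
 fixes X :: "'a::euclidean_space set"
 assumes X: "subspace X" and w: "w : X" "norm w = 1"
 shows "(+) (t *R w) ` (X Int {w}^o) = {x : X. x *. w = t}"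
proof (intro equalityI subsetI)
 have ww: "w *. w = 1" using w(2) by (simp add: dot_square_norm)
 have t: "t *R w : X" using X w(1) by (rule subspace_scale)
 {
  fix x assume "x : (+) (t *R w) ` (X Int {w}^o)"
  then show "x : {x : X. x *. w = t}" using subspace_add[OF X t] ww by (auto simp: mem_comp_singleton inner_add_left)
 next
  fix x assume "x : {x : X. x *. w = t}"
  then show "x : (+) (t *R w) ` (X Int {w}^o)" using subspace_diff[OF X _ t, of x] ww by (intro image_eqI[of _ _ "x - t *R w"]) (simp_all add: mem_comp_singleton inner_diff_left)
 }
qed

lemma plane_norm_plane:
 fixes X :: "'a::euclidean_space set"
 assumes X: "subspace X" and w: "norm w = 1"
 shows "foot ((+) (t *R w) ` (X Int {w}^o)) = t *R w" "direction ((+) (t *R w) ` (X Int {w}^o)) = X Int {w}^o"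
  "plane_norm ((+) (t *R w) ` (X Int {w}^o)) = \<bar>t\<bar>"
proof -
 have W: "subspace (X Int {w}^o)" using X by (rule subspace_Int_comp)
 have "proj (X Int {w}^o) (t *R w) = 0" by (rule proj_subspace_eq_0[OF W]) (auto simp: comp_iff mem_comp_singleton inner_commute[of w])
 then show f: "foot ((+) (t *R w) ` (X Int {w}^o)) = t *R w" by (simp add: foot_plane[OF W])
 show "direction ((+) (t *R w) ` (X Int {w}^o)) = X Int {w}^o" by (rule direction_plane[OF W])
 show "plane_norm ((+) (t *R w) ` (X Int {w}^o)) = \<bar>t\<bar>" using w by (simp add: plane_norm_def f)
qed

text \<open>A hyperplane determines the line of its normals, so the choice in
  \<open>mu_tilde\<close> is free up to sign only. Reflecting the plane compensates the minus sign
  in the first component of \<open>mu_tilde\<close>.\<close>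

lemma mu_tilde_plane:
 fixes X :: "'a::euclidean_space set" and t :: real
 assumes X: "subspace X" and w: "w : X" "norm w = 1"
 defines "z \<equiv> (1 / sqrt (1 + t^2)) *R (w, t)"
 shows "mu_tilde X (uminus ` (+) (t *R w) ` (X Int {w}^o)) : {z, - z}"
proof -
 let ?T = "uminus ` (+) (t *R w) ` (X Int {w}^o)"
 have ww: "w *. w = 1" using w(2) by (simp add: dot_square_norm)
 have T: "?T = {x : X. x *. w = - t}" unfolding plane_eq_hyperplane[OF X w]
 proof (intro equalityI subsetI)
  fix x assume "x : {x : X. x *. w = - t}"
  then show "x : uminus ` {x : X. x *. w = t}" using subspace_neg[OF X, of x] by (intro image_eqI[of _ _ "- x"]) simp_all
 qed (use subspace_neg[OF X] in auto)
 let ?P = "%N. EX w0 s. w0 : X & norm w0 = 1 & 0 <= s & ?T = hyperplane X w0 s & N = (- cos (arctan s) *R w0, sin (arctan s))"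
 have "EX w0 s. w0 : X & norm w0 = 1 & 0 <= s & ?T = hyperplane X w0 s"
 proof (cases "0 <= - t")
  case True
  then show ?thesis using w unfolding T hyperplane_def by (intro exI[of _ w] exI[of _ "- t"] conjI) simp_all
 next
  case False
  have "{x : X. x *. w = - t} = {x : X. x *. - w = t}" by auto
  then show ?thesis using w subspace_neg[OF X] False unfolding T hyperplane_def by (intro exI[of _ "- w"] exI[of _ t] conjI) simp_all
 qed
 then have "EX N. ?P N" by blast
 then have "?P (mu_tilde X ?T)" unfolding mu_tilde_def by (rule someI_ex)
 then obtain w0 s where *: "w0 : X" "norm w0 = 1" "{x : X. x *. w = - t} = hyperplane X w0 s"
  and mu: "mu_tilde X ?T = (- cos (arctan s) *R w0, sin (arctan s))" unfolding T by blast
 have mem: "x *. w0 = s" if "x : X" "x *. w = - t" for x using that *(3) by (auto simp: hyperplane_def)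
 define c where "c = w0 *. w"
 \<comment> \<open>The part of the chosen normal w0 orthogonal to w. Moving along it stays in the
   hyperplane, so it is orthogonal to w0 as well and vanishes.\<close>
 define y where "y = w0 - c *R w"
 have y: "y : X" "y *. w = 0" using X * w ww by (auto simp: y_def c_def inner_diff_left intro!: subspace_diff subspace_scale)
 have t0: "(- t *R w) *. w0 = s" using X w ww by (intro mem subspace_scale) auto
 have "(- t *R w + y) *. w0 = s"
 proof (rule mem)
  show "- t *R w + y : X" using X w y by (intro subspace_add subspace_scale)
  show "(- t *R w + y) *. w = - t" unfolding inner_add_left y(2) using ww by simp
 qed
 then have "y *. w0 = 0" unfolding inner_add_left t0 by simp
 then have "y *. (w0 - c *R w) = 0" using y(2) by (simp add: inner_diff_right)
 then have e: "w0 = c *R w" by (simp add: y_def[symmetric]) (simp add: y_def)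
 then have "\<bar>c\<bar> = 1" using *(2) w(2) by simp
 then consider "c = 1" | "c = - 1" by linarith
 then show ?thesis
 proof cases
  case 1
  then have "w0 = w" "s = - t" using e t0 ww by auto
  then show ?thesis by (simp add: mu z_def cos_arctan sin_arctan)
 next
  case 2
  then have "w0 = - w" "s = t" using e t0 ww by auto
  then show ?thesis by (simp add: mu z_def cos_arctan sin_arctan)
 qed
qed

lemma B_star_inv_plane:
 fixes X :: "'a::euclidean_space set" and p :: "'a \<times> real => 'b::euclidean_space"
 assumes X: "subspace X" and w: "w : X" "norm w = 1" and p: "p : even_L1 (X \<times> UNIV)"
 shows "B_star_inv X p ((+) (t *R w) ` (X Int {w}^o)) = (1 / sqrt (1 + t^2) ^ dim X) *R p ((1 / sqrt (1 + t^2)) *R (w, t))"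
proof -
 let ?z = "(1 / sqrt (1 + t^2)) *R (w, t)"
 have pos: "0 < 1 + t^2" by (simp add: add_pos_nonneg)
 have "norm ?z = 1" unfolding norm_scaleR using w(2) pos by (simp add: norm_Pair)
 then have z: "?z : X \<times> UNIV Int sphere 0 1" using X w(1) by (auto intro: subspace_scale)
 have "ALL q:X \<times> UNIV Int sphere 0 1. p (- q) = p q" using p unfolding even_L1_def by blast
 from bspec[OF this z] have "p (mu_tilde X (uminus ` (+) (t *R w) ` (X Int {w}^o))) = p ?z" using mu_tilde_plane[OF X w, of t] by auto
 then show ?thesis unfolding B_star_inv_def plane_norm_plane(3)[OF X w(2)] power2_abs powr_minus_half[OF pos] by simp
qed

text \<open>The positively homogeneous extension of \<open>H\<close>, of degree -d, from the
  cylinder of unit first components. On the sphere it is the function that \<open>B_star_inv\<close>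
  turns back into \<open>H\<close>.\<close>

definition dual_density :: "nat => ('a::euclidean_space \<times> real => 'b::euclidean_space) => 'a \<times> real => 'b" where
 "dual_density d H z = (1 / norm (fst z) ^ d) *R H ((1 / norm (fst z)) *R z)"

lemma dual_density_scale: "norm (fst z) = 1 ==> 0 < c ==> dual_density d H (c *R z) = (1 / c ^ d) *R H z" by (simp add: dual_density_def)

text \<open>Off the equator the section by \<open>{z}^o\<close> is the graph of y |-> a . y with a =
  - z' / z_(d+1). By \<open>nni_sphere_graph\<close> the Funk transform of the density is the mean
  of \<open>H\<close> over the hyperplanes through a, times sqrt (1 + |a|^2) = 1 / |z_(d+1)|, the
  factor in \<open>A_star_inv\<close>.\<close>

lemma dual_radon_funk:
 fixes X :: "'a::euclidean_space set" and H :: "'a \<times> real => 'b::euclidean_space"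
 assumes X: "subspace X" and d: "2 <= dim X" and H[measurable]: "H : bmeas borel" and even: "!!z. H (- z) = H z"
  and fin: "(II p. enn (norm (H p) / (1 + \<bar>snd p\<bar>)) dd (sph X xx lborel)) < \<infinity>"
  and h: "AE y in leb X. h y = (LINT w|sph X. H (w, y *. w))"
 shows "is_funk_inverse (X \<times> UNIV) (A_star_inv h) (dual_density (dim X) H)" (is "is_funk_inverse ?V _ ?p")
proof -
 have V: "subspace ?V" "dim ?V = Suc (dim X)" using X by (auto simp: subspace_product dim_product)
 have d0: "0 < dim X" using d by simp
 have [measurable]: "?p : bmeas borel" unfolding dual_density_def by measurable
 have [measurable]: "sphere_weight k : bmeas borel" for k unfolding sphere_weight_def by measurable
 define C where "C = sphere_weight (dim X) 0"
 have C: "0 < C" using sphere_weight_pos[OF d0] by (simp add: C_def)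
 \<comment> \<open>The power d from the density meets the power -(d + 1) from
   \<open>sphere_weight\<close>. What remains is 1 / sqrt (1 + t^2), at most 2 / (1 + |t|).\<close>
 have "(II z. enn (norm (?p z)) dd sph ?V)
  = (II p. enn (norm (?p ((1 / sqrt (1 + (snd p)^2)) *R p))) * enn (sphere_weight (dim X) (snd p)) dd (sph X xx lborel))" by (rule nni_sphere_product[OF X d0]) measurable
 also have "... <= (II p. enn (2 * C) * enn (norm (H p) / (1 + \<bar>snd p\<bar>)) dd (sph X xx lborel))"
 proof (rule nn_integral_mono_AE, use AE_sphere_pair[OF X d0] in eventually_elim)
  fix p :: "'a \<times> real" assume p: "fst p : X & norm (fst p) = 1"
  let ?r = "sqrt (1 + (snd p)^2)"
  have "1 <= ?r" "\<bar>snd p\<bar> <= ?r" using real_sqrt_le_mono[of "(snd p)^2" "1 + (snd p)^2"] by auto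
  then have r: "0 < ?r" "1 + \<bar>snd p\<bar> <= 2 * ?r" by linarith+
  have "enn (norm (?p ((1 / ?r) *R p))) * enn (sphere_weight (dim X) (snd p)) = enn (C * (norm (H p) / ?r))"
  proof -
   have "sphere_weight (dim X) (snd p) = C / ?r ^ Suc (dim X)" by (simp add: C_def sphere_weight_def)
   moreover have "norm (?p ((1 / ?r) *R p)) = ?r ^ dim X * norm (H p)" using r(1) p by (simp add: dual_density_scale power_one_over)
   ultimately show ?thesis using r(1) C by (simp add: ennreal_mult[symmetric])
  qed
  also have "... <= enn (2 * C * (norm (H p) / (1 + \<bar>snd p\<bar>)))"
  proof (intro ennreal_leI)
   have "C * norm (H p) / ?r <= C * norm (H p) / ((1 + \<bar>snd p\<bar>) / 2)" using r C by (intro divide_left_mono mult_nonneg_nonneg mult_pos_pos) auto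
   then show "C * (norm (H p) / ?r) <= 2 * C * (norm (H p) / (1 + \<bar>snd p\<bar>))" by (simp add: mult_ac)
  qed
  also have "... = enn (2 * C) * enn (norm (H p) / (1 + \<bar>snd p\<bar>))" using C by (intro ennreal_mult) auto
  finally show "enn (norm (?p ((1 / ?r) *R p))) * enn (sphere_weight (dim X) (snd p)) <= enn (2 * C) * enn (norm (H p) / (1 + \<bar>snd p\<bar>))" .
 qed
 also have "... = enn (2 * C) * (II p. enn (norm (H p) / (1 + \<bar>snd p\<bar>)) dd (sph X xx lborel))" by (rule nn_integral_cmult, rule bm_sphere_pair) measurable
 also have "... < \<infinity>" using fin by (simp add: ennreal_mult_less_top)
 finally have pi: "integrable (sph ?V) ?p" by (intro integrableI_bounded) auto
 have "?p (- z) = ?p z" for z using even[of "(1 / norm (fst z)) *R z"] by (simp add: dual_density_def)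
 then have pe: "?p : even_L1 ?V" using pi by (simp add: even_L1_def sphere_measure_eq integrable_completion)
 show ?thesis
 proof (rule funk_inversion[OF V(1) _ pe])
  show "3 <= dim ?V" using V d by simp
  \<comment> \<open>\<open>A_star_inv\<close> evaluates at - z' / z_(d+1) but the chart gives z' /
    z_(d+1), so the null set is reflected first.\<close>
  have "distr (leb X) borel uminus = leb X" using leb_isometry[OF X linear_uminus] uminus_image_subspace[OF X] by simp
  then have "AE x in distr (leb X) borel uminus. h x = (LINT w|sph X. H (w, x *. w))" using h by (simp only:)
  then have "AE x in leb X. h (- x) = (LINT w|sph X. H (w, (- x) *. w))" by (rule AE_distrD[rotated]) simp
  note AE1 = AE_sphere_gnomonic[OF X this]
  have AE2: "AE z in sph ?V. z : ?V Int sphere 0 1" using V by (intro AE_sph) auto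
  from AE1 AE2 have "AE z in sph ?V. A_star_inv h z = funk ?V ?p z"
  proof eventually_elim
   fix z :: "'a \<times> real"
   assume *: "h (- ((1 / snd z) *R fst z)) = (LINT w|sph X. H (w, (- ((1 / snd z) *R fst z)) *. w)) & snd z ~= 0" and z: "z : ?V Int sphere 0 1"
   define a where "a = - ((1 / snd z) *R fst z)"
   have a: "a : X" "h a = (LINT w|sph X. H (w, a *. w))" "snd z ~= 0" using * z X by (auto simp: a_def intro!: subspace_neg subspace_scale)
   let ?L = "%y::'a. (y, a *. y)"
   have l: "linear ?L" by (rule linearI) (auto simp: inner_add_right)
   note [measurable] = bm_linear[OF l]
   have "(y, t) : {z}^o <-> t = a *. y" for y t
   proof -
    have "a *. y = - (y *. fst z) / snd z" by (simp add: a_def inner_commute)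
    then show ?thesis using a(3) by (simp add: mem_comp_singleton inner_prod_def) (auto simp: field_simps)
   qed
   then have W: "?V Int {z}^o = ?L ` X" by auto
   have "(norm (fst z))^2 + (snd z)^2 = 1" using z by (simp add: norm_prod_def)
   then have "1 + (norm a)^2 = (1 / \<bar>snd z\<bar>)^2" using a(3) by (simp add: a_def power_divide field_simps)
   then have sq: "sqrt (1 + (norm a)^2) = 1 / \<bar>snd z\<bar>" by simp
   obtain m where m: "dim X = Suc m" using d0 by (cases "dim X") auto
   have "(LINT y|sph (?L ` X). ?p y) = (LINT w|sph X. sqrt (1 + (norm a)^2) *R H (?L w))"
   proof (rule int_eqI_nn(2))
    fix f :: "'b => real" assume [measurable]: "f : bmeas borel" and f: "!!c x. 0 <= c ==> f (c *R x) = c * f x"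
    have "(II y. enn (f (?p y)) dd sph (?L ` X))
     = enn (sqrt (1 + (norm a)^2)) * (II w. enn (f (?p (sgn (?L w)))) * enn (1 / norm (?L w) ^ dim X) dd sph X)" unfolding m by (rule nni_sphere_graph[OF X a(1) m]) (unfold m[symmetric], measurable)
    also have "(II w. enn (f (?p (sgn (?L w)))) * enn (1 / norm (?L w) ^ dim X) dd sph X) = (II w. enn (f (H (?L w))) dd sph X)"
    proof (rule nn_integral_cong_AE, use AE_sph[OF X d0] in eventually_elim)
     fix w assume "w : X Int sphere 0 1"
     then have n: "norm (fst (?L w)) = 1" "0 < norm (?L w)" by (auto simp: prod_eq_iff)
     have "?p (sgn (?L w)) = norm (?L w) ^ dim X *R H (?L w)" using dual_density_scale[OF n(1), of "1 / norm (?L w)" "dim X" H] n(2) by (simp only: sgn_div_norm inverse_eq_divide power_one_over zero_less_divide_1_iff) simp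
     then show "enn (f (?p (sgn (?L w)))) * enn (1 / norm (?L w) ^ dim X) = enn (f (H (?L w)))" using n(2) by (subst ennreal_mult''[symmetric]) (simp_all add: f)
    qed
    also have "enn (sqrt (1 + (norm a)^2)) * ... = (II w. enn (f (sqrt (1 + (norm a)^2) *R H (?L w))) dd sph X)" by (subst nn_integral_cmult[symmetric]) (auto simp: f ennreal_mult')
    finally show "(II y. enn (f (?p y)) dd sph (?L ` X)) = (II w. enn (f (sqrt (1 + (norm a)^2) *R H (?L w))) dd sph X)" .
   qed measurable
   also have "... = (1 / \<bar>snd z\<bar>) *R h a" unfolding a(2) sq by simp
   finally have "funk ?V ?p z = (1 / \<bar>snd z\<bar>) *R h a" unfolding funk_def sphere_measure_eq W by (subst integral_completion) auto
   then show "A_star_inv h z = funk ?V ?p z" by (simp add: A_star_inv_def a_def)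
  qed
  then show "AE z in sphere_measure ?V. A_star_inv h z = funk ?V ?p z" unfolding sphere_measure_eq by (rule AE_completion)
 qed
qed

text \<open>The Gamma-function constant in \<open>A_inv\<close> is matched with the form d times the
  volume of the unit ball used in the integral formulas.\<close>

lemma sphere_area_eq:
 assumes "0 < d" shows "sphere_area (d - 1) = real d * unit_ball_vol (real d)"
proof -
 have "real d / 2 ~: \<int>\<^sub>\<le>\<^sub>0" using assms by (auto dest: nonpos_Ints_nonpos)
 then have G: "Gamma (real d / 2 + 1) = real d / 2 * Gamma (real d / 2)" by (rule Gamma_plus1)
 have "real (d - 1) + 1 = real d" using assms by simp
 then show ?thesis unfolding sphere_area_def unit_ball_vol_def G using assms by simp
qed

text \<open>\<open>mu_tilde_inv X z\<close> is the hyperplane x . \<omega> = - t when z is a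
  multiple of (\<omega>, t), so null sets of pairs have to be reflected in t.\<close>

lemma AE_sphere_pair_reflect:
 fixes X :: "'a::euclidean_space set"
 assumes "AE p in sph X xx lborel. P (fst p) (snd p)"
 shows "AE p in sph X xx lborel. P (fst p) (- snd p :: real)"
proof -
 let ?S = "sph X" and ?R = "%(w, t). (w, - t :: real)"
 have lb: "distr lborel lborel uminus = (lborel :: real measure)"
 proof -
  have "distr lborel borel uminus = (lborel :: real measure)"
  proof -
   have "leb (range (uminus :: real => real)) = distr (leb UNIV) borel uminus" by (rule leb_isometry) (auto simp: linear_uminus)
   then show ?thesis by (simp add: leb_UNIV)
  qed
  moreover have "distr lborel lborel uminus = distr lborel (borel :: real measure) uminus" by (rule distr_cong) auto
  ultimately show ?thesis by simp
 qed
 have "distr ?S ?S (%x. x) xx distr lborel lborel uminus = distr (?S xx lborel) (?S xx lborel) ?R" by (rule pair_measure_distr) (simp_all add: lb lborel.sigma_finite_measure_axioms)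
 then have e: "distr (?S xx lborel) (?S xx lborel) ?R = ?S xx lborel" unfolding lb distr_id2[OF refl] ..
 have "AE p in distr (?S xx lborel) (?S xx lborel) ?R. P (fst p) (snd p)" unfolding e by (rule assms)
 then have "AE p in ?S xx lborel. P (fst (?R p)) (snd (?R p))" by (rule AE_distrD[rotated]) measurable
 then show ?thesis by (simp add: case_prod_unfold)
qed

lemma one_plus_norm_le: "1 + norm x <= 2 * norm (x, 1::real)" using norm_fst_le[of x "1::real"] norm_snd_le[of "1::real" x] by simp

text \<open>Under central projection to height 1 the section by \<open>{z}^o\<close> becomes the
  hyperplane \<open>mu_tilde_inv X z\<close>, so the Funk transform of \<open>q\<close> is the Radon
  transform of g up to the factor in \<open>A_inv\<close>. The condition \<open>fin\<close> puts
  \<open>q\<close> into L1 of the sphere.\<close>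

lemma radon_inverseI:
 fixes X :: "'a::euclidean_space set" and g f :: "'a => 'b::euclidean_space"
 assumes X: "subspace X" and d: "2 <= dim X" and g[measurable]: "g : bmeas borel"
  and fin: "(II x. enn (norm (g x) / (1 + norm x)) dd leb X) < \<infinity>"
  and h: "AE p in sph X xx lborel. h ((+) (snd p *R fst p) ` (X Int {fst p}^o))
    = (LINT w|leb (X Int {fst p}^o). g (snd p *R fst p + w))"
  and f: "AE x in leb X. f x = g x"
 shows "is_radon_inverse X h f"
proof -
 let ?V = "X \<times> (UNIV :: real set)" and ?e = "(0::'a, 1::real)"
 \<comment> \<open>Even and homogeneous of degree -d. Over the point x of the chart its value is
   |(x, 1)|^d g(x), from which \<open>B_inv\<close> returns g(x).\<close>
 define q where "q z = (1 / \<bar>snd z\<bar> ^ dim X) *R g ((1 / snd z) *R fst z)" for z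
 have [measurable]: "q : bmeas borel" unfolding q_def by measurable
 have qs: "q (sgn (x, 1)) = norm (x, 1::real) ^ dim X *R g x" for x
 proof -
  have "0 < norm (x, 1::real)" by (simp add: zero_prod_def)
  then show ?thesis by (simp add: q_def sgn_div_norm power_one_over divide_inverse power_inverse)
 qed
 have qe: "q (- z) = q z" for z by (simp add: q_def)
 have V: "subspace ?V" "dim ?V = Suc (dim X)" using X by (auto simp: subspace_product dim_product)
 have d0: "0 < dim X" using d by simp
 define K where "K = 2 / (real (Suc (dim X)) * unit_ball_vol (real (Suc (dim X))))"
 have K: "0 < K" by (simp add: K_def)
 have "(II z. enn (norm (q z)) dd sph ?V)
  = (II w. enn (norm (q (sgn (w + 1 *R ?e)))) * enn (K * (1 / norm (w + 1 *R ?e) ^ Suc (dim X))) dd leb (?V Int {?e}^o))" unfolding K_def by (rule nni_sphere_gnomonic[OF V(1) _ _ V(2)]) (use subspace_0[OF X] in \<open>auto simp: qe\<close>)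
 also have "... = (II x. enn (norm (q (sgn (x, 1)))) * enn (K * (1 / norm (x, 1::real) ^ Suc (dim X))) dd leb X)"
 proof -
  have "(II w. enn (norm (q (sgn (w + 1 *R ?e)))) * enn (K * (1 / norm (w + 1 *R ?e) ^ Suc (dim X))) dd leb (?V Int {?e}^o))
   = (II x. enn (norm (q (sgn ((x, 0) + 1 *R ?e)))) * enn (K * (1 / norm ((x, 0) + 1 *R ?e) ^ Suc (dim X))) dd leb X)" unfolding product_Int_comp by (rule nni_product_0[OF X]) measurable
  then show ?thesis by simp
 qed
 also have "... <= (II x. enn (2 * K) * enn (norm (g x) / (1 + norm x)) dd leb X)"
 proof (rule nn_integral_mono)
  fix x :: 'a
  let ?n = "norm (x, 1::real)"
  have n: "0 < ?n" by (simp add: zero_prod_def)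
  have "norm (g x) / ?n <= norm (g x) / ((1 + norm x) / 2)" using one_plus_norm_le[of x] n by (intro divide_left_mono mult_pos_pos) (auto simp: add_pos_nonneg)
  then have *: "K * (norm (g x) / ?n) <= K * (norm (g x) / ((1 + norm x) / 2))" using K by (intro mult_left_mono) auto
  have "enn (norm (q (sgn (x, 1)))) * enn (K * (1 / ?n ^ Suc (dim X))) = enn (K * (norm (g x) / ?n))" using n K by (simp add: qs ennreal_mult[symmetric])
  also have "... <= enn (2 * K * (norm (g x) / (1 + norm x)))" using * by (intro ennreal_leI) (simp add: mult_ac)
  also have "... = enn (2 * K) * enn (norm (g x) / (1 + norm x))" using K by (intro ennreal_mult) auto
  finally show "enn (norm (q (sgn (x, 1)))) * enn (K * (1 / ?n ^ Suc (dim X))) <= enn (2 * K) * enn (norm (g x) / (1 + norm x))" .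
 qed
 also have "... = enn (2 * K) * (II x. enn (norm (g x) / (1 + norm x)) dd leb X)" by (rule nn_integral_cmult) measurable
 also have "... < \<infinity>" using fin by (simp add: ennreal_mult_less_top)
 finally have "integrable (sph ?V) q" by (intro integrableI_bounded) auto
 then have qL: "q : even_L1 ?V" using qe by (simp add: even_L1_def sphere_measure_eq integrable_completion)
 have AE2: "AE z in sph ?V. z : ?V Int sphere 0 1" using V by (intro AE_sph) auto
 have "AE z in sph ?V. A_inv X h z = funk ?V q z" using AE_sphere_productI[OF X d0 AE_sphere_pair_reflect[OF h]] AE2
 proof eventually_elim
  fix z :: "'a \<times> real"
  let ?n = "norm (fst z)" and ?p = "(1 / norm (fst z)) *R z"
  assume *: "h ((+) (- snd ?p *R fst ?p) ` (X Int {fst ?p}^o)) = (LINT w|leb (X Int {fst ?p}^o). g (- snd ?p *R fst ?p + w)) & fst z ~= 0"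
   and z: "z : ?V Int sphere 0 1"
  define a where "a = fst ?p"
  define t where "t = snd ?p"
  have n: "0 < ?n" using * by simp
  have a: "a : X" "norm a = 1" using z X n by (auto simp: a_def intro: subspace_scale)
  have zz: "fst z = ?n *R a" "snd z = ?n * t" using n by (auto simp: a_def t_def)
  have n1: "?n^2 * (1 + t^2) = 1" using z zz(2) by (simp add: norm_prod_def power_mult_distrib distrib_left)
  let ?W = "X Int {a}^o" and ?u = "- t *R a"
  have W: "subspace ?W" using X by (rule subspace_Int_comp)
  have "mu_tilde_inv X z = {x : X. x *. a = - t}"
  proof -
   have "(x, 1) *. z = ?n * (x *. a + t)" for x unfolding inner_prod_def fst_conv snd_conv by (subst zz(1), subst zz(2)) (simp add: distrib_left)
   then show ?thesis using n unfolding mu_tilde_inv_def by (auto simp: eq_neg_iff_add_eq_0)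
  qed
  then have hz: "h (mu_tilde_inv X z) = (LINT w|leb ?W. g (?u + w))" using * unfolding plane_eq_hyperplane[OF X a, symmetric] a_def[symmetric] t_def[symmetric] by simp
  \<comment> \<open>The highest point of the section, at height |z'|. The chart of the section at
    distance 1 / |z'| along it is therefore the part of its span at height 1.\<close>
  let ?e' = "(- (?n * t) *R a, ?n)" and ?Z = "?V Int {z}^o"
  have "a *. a = 1" using a(2) by (simp add: dot_square_norm)
  have Z: "subspace ?Z" "dim ?Z = dim X" using dim_Int_comp_unit[OF V(1), of z] V z by (auto intro: subspace_Int_comp)
  have iz: "(x, r) *. z = ?n * (x *. a + r * t)" for x r unfolding inner_prod_def fst_conv snd_conv by (subst zz(1), subst zz(2)) (simp add: distrib_left)
  have e': "?e' : ?Z" "norm ?e' = 1"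
  proof -
   show "?e' : ?Z" using a(1) X \<open>a *. a = 1\<close> by (auto simp: mem_comp_singleton iz intro!: subspace_neg subspace_scale)
   have "(norm ?e')^2 = ?n^2 * (1 + t^2)" using a(2) by (simp add: norm_prod_def power_mult_distrib distrib_left)
   then have "(norm ?e')^2 = 1^2" unfolding n1 by simp
   then show "norm ?e' = 1" by (rule power2_eq_imp_eq) auto
  qed
  have ZW: "?Z Int {?e'}^o = (%x. (x, 0)) ` ?W"
  proof -
   have E: "(x, r) : {z}^o & (x, r) : {?e'}^o <-> r = 0 & x *. a = 0" for x r
   proof -
    have "(x, r) : {z}^o & (x, r) : {?e'}^o <-> x *. a = - r * t & r = t * (x *. a)" using n by (auto simp: mem_comp_singleton iz inner_Pair)
    also have "... <-> x *. a = - r * t & r * (1 + t^2) = 0"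
    proof (rule conj_cong[OF refl])
     assume "x *. a = - r * t"
     then show "r = t * (x *. a) <-> r * (1 + t^2) = 0" by (simp only: power2_eq_square) (simp add: algebra_simps eq_neg_iff_add_eq_0)
    qed
    also have "... <-> r = 0 & x *. a = 0" using n1 by auto
    finally show ?thesis .
   qed
   show ?thesis
   proof (rule set_eqI)
    fix w show "w : ?Z Int {?e'}^o <-> w : (%x. (x, 0)) ` ?W" using E[of "fst w" "snd w"] by (cases w) (auto simp: mem_comp_singleton[of _ a])
   qed
  qed
  obtain m where m: "dim X = Suc m" using d0 by (cases "dim X") auto
  \<comment> \<open>The constant of \<open>A_inv\<close>: 2 over the area comes from the gnomonic
    formula, 1 / |z'| from the height of its chart.\<close>
  define k where "k = 2 / (real (dim X) * unit_ball_vol (real (dim X))) * (1 / ?n)"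
  have k: "0 <= k" by (simp add: k_def)
  have gu: "(%x. g (?u + x)) : bmeas borel" by measurable
  have "(LINT y|sph ?Z. q y) = (LINT x|leb ?W. k *R g (?u + x))"
  proof (rule int_eqI_nn(2))
   fix f :: "'b => real" assume [measurable]: "f : bmeas borel" and f: "!!c x. 0 <= c ==> f (c *R x) = c * f x"
   have he: "(x, 0) + (1 / ?n) *R ?e' = (?u + x, 1)" for x using n by simp
   have "(II y. enn (f (q y)) dd sph ?Z)
    = (II w. enn (f (q (sgn (w + (1 / ?n) *R ?e')))) * enn (2 / (real (Suc m) * unit_ball_vol (real (Suc m))) * ((1 / ?n) / norm (w + (1 / ?n) *R ?e') ^ Suc m)) dd leb (?Z Int {?e'}^o))" by (rule nni_sphere_gnomonic[OF Z(1) e']) (use Z(2) m n in \<open>simp_all add: qe\<close>)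
   also have "... = (II x. enn (f (q (sgn ((x, 0) + (1 / ?n) *R ?e')))) * enn (2 / (real (Suc m) * unit_ball_vol (real (Suc m))) * ((1 / ?n) / norm ((x, 0) + (1 / ?n) *R ?e') ^ Suc m)) dd leb ?W)" unfolding ZW by (rule nni_product_0[OF W]) measurable
   also have "... = (II x. enn (f (k *R g (?u + x))) dd leb ?W)"
   proof (rule nn_integral_cong)
    fix x
    let ?N = "norm (?u + x, 1::real)"
    have N: "0 < ?N" by (simp add: zero_prod_def)
    have "2 / (real (Suc m) * unit_ball_vol (real (Suc m))) * ((1 / ?n) / ?N ^ Suc m) = k / ?N ^ dim X" by (simp add: k_def m)
    moreover have "f (q (sgn (?u + x, 1))) = ?N ^ dim X * f (g (?u + x))" unfolding qs by (rule f) simp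
    ultimately show "enn (f (q (sgn ((x, 0) + (1 / ?n) *R ?e')))) * enn (2 / (real (Suc m) * unit_ball_vol (real (Suc m))) * ((1 / ?n) / norm ((x, 0) + (1 / ?n) *R ?e') ^ Suc m)) = enn (f (k *R g (?u + x)))" unfolding he f[OF k] using N k by (subst ennreal_mult''[symmetric]) (simp_all add: mult.commute)
   qed
   finally show "(II y. enn (f (q y)) dd sph ?Z) = (II x. enn (f (k *R g (?u + x))) dd leb ?W)" .
  qed measurable
  also have "... = k *R h (mu_tilde_inv X z)" unfolding hz by (rule integral_scaleR_right)
  finally have "funk ?V q z = k *R h (mu_tilde_inv X z)" unfolding funk_def sphere_measure_eq by (subst integral_completion) auto
  then show "A_inv X h z = funk ?V q z" using n unfolding A_inv_def k_def sphere_area_eq[OF d0] by simp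
 qed
 then have "AE z in sphere_measure ?V. A_inv X h z = funk ?V q z" unfolding sphere_measure_eq by (rule AE_completion)
 then have "is_funk_inverse ?V (A_inv X h) q" using V d by (intro funk_inversion[OF V(1) _ qL]) auto
 moreover have "AE x in subspace_lebesgue X. f x = B_inv X q x"
 proof -
  have "B_inv X q x = g x" for x
  proof -
   have n: "norm (x, 1::real) = sqrt (1 + (norm x)^2)" by (simp add: norm_Pair add.commute)
   have p: "0 < 1 + (norm x)^2" by (simp add: add_pos_nonneg)
   have "mu x = sgn (x, 1)" by (simp add: mu_def sgn_div_norm inverse_eq_divide)
   then show ?thesis unfolding B_inv_def powr_minus_half[OF p] using p by (simp add: qs n)
  qed
  then show ?thesis using f unfolding subspace_lebesgue_def by (intro AE_completion) simp
 qed
 ultimately show ?thesis unfolding is_radon_inverse_def by blast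
qed

text \<open>On the half line, partial fractions give the antiderivative (C / r) ln ((1 + (1 + r) s)
  / (1 + s)), which vanishes at 0; the form chosen in \<open>?F\<close> makes the limit at infinity
  visible. The factor 2 comes from symmetry in s.\<close>

lemma nni_log_kernel:
 assumes r: "0 < r" and C: "0 <= C"
 shows "(II s. enn (C / ((1 + \<bar>s\<bar>) * (1 + (1 + r) * \<bar>s\<bar>))) dd lborel) <= enn (2 * C * (ln (1 + r) / r))"
proof -
 let ?k = "%s. C / ((1 + \<bar>s\<bar>) * (1 + (1 + r) * \<bar>s\<bar>))" and ?f = "%s. C / ((1 + s) * (1 + (1 + r) * s))"
 let ?F = "%s. C / r * ln ((1 + r) - r / (1 + s))"
 have pos: "0 < (1 + r) - r / (1 + s)" "(1 + r) - r / (1 + s) = (1 + (1 + r) * s) / (1 + s)" if "0 <= s" for s using that r by (simp_all add: field_simps add_pos_nonneg)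
 have der: "DERIV ?F s :> ?f s" if s: "0 <= s" for s
 proof -
  have "DERIV ?F s :> C / r * ((r / (1 + s)^2) / ((1 + r) - r / (1 + s)))" using s pos(1)[OF s] by (auto intro!: derivative_eq_intros simp: power2_eq_square)
  also have "C / r * ((r / (1 + s)^2) / ((1 + r) - r / (1 + s))) = ?f s" unfolding pos(2)[OF s] using s r by (simp add: power2_eq_square)
  finally show ?thesis .
 qed
 have "((%s::real. r / (1 + s)) \<longlongrightarrow> 0) at_top" by (intro tendsto_divide_0[OF tendsto_const] filterlim_at_top_imp_at_infinity filterlim_tendsto_add_at_top[OF tendsto_const filterlim_ident])
 then have "(?F \<longlongrightarrow> C / r * ln ((1 + r) - 0)) at_top" using r by (intro tendsto_intros) auto
 then have "(II s. enn (?f s) * ind {0..} s dd lborel) = enn (C / r * ln (1 + r))" using nn_integral_FTC_atLeast[of ?f 0 ?F, OF _ der] C r by simp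
 moreover have "enn (1 / 2) * (II s. enn (?k s) dd lborel) <= (II s. enn (?f s) * ind {0..} s dd lborel)"
 proof -
  have "enn (1 / 2) * (II s. enn (?k s) dd lborel) = (II s. enn (?k s) * enn ((1 + sgn s) / 2) dd lborel)" by (rule nni_even_half[symmetric]) (auto simp: sgn_real_def)
  also have "... <= (II s. enn (?f s) * ind {0..} s dd lborel)" using C r by (intro nn_integral_mono) (auto simp: sgn_real_def indicator_def simp flip: ennreal_mult'' intro!: ennreal_leI mult_left_le)
  finally show ?thesis .
 qed
 ultimately have "ennreal 2 * (enn (1 / 2) * (II s. enn (?k s) dd lborel)) <= ennreal 2 * enn (C / r * ln (1 + r))" by (intro mult_left_mono) auto
 also have "ennreal 2 * (enn (1 / 2) * (II s. enn (?k s) dd lborel)) = (II s. enn (?k s) dd lborel)"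
 proof -
  have "ennreal 2 * enn (1 / 2) = 1" by (subst ennreal_mult[symmetric]) auto
  then show ?thesis unfolding mult.assoc[symmetric] by simp
 qed
 also have "ennreal 2 * enn (C / r * ln (1 + r)) = enn (2 * (C / r * ln (1 + r)))" using C r by (intro ennreal_mult[symmetric] mult_nonneg_nonneg) auto
 finally show ?thesis by (simp add: mult.assoc)
qed

text \<open>Slicing along x / |x| reduces the mean to one variable, with x . w = |x| s / sqrt (1 +
  s^2). One constant has to serve all V of the given dimension and all x, as the bound will be
  integrated over \<xi>.\<close>

lemma nni_sphere_log_bound:
 obtains K where "0 <= K" and "!!V x. subspace V ==> dim V = Suc (Suc m) ==> x : V ==>
  (II w. enn (1 / (1 + \<bar>x *. w\<bar>)) dd sph V) <= enn (K * (ln (2 + norm x) / (1 + norm (x::'a::euclidean_space))))"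
proof -
 define C where "C = real (Suc m) * unit_ball_vol (real (Suc m)) / (real (Suc (Suc m)) * unit_ball_vol (real (Suc (Suc m))))"
 have C: "0 < C" unfolding C_def by (intro divide_pos_pos mult_pos_pos) auto
 \<comment> \<open>2 / ln 2 serves |x| < 1, where the mean is at most 1. For |x| >= 1 the kernel
   lemma gives 8 C, doubled in passing from ln (1 + r) / r to ln (2 + r) / (1 + r).\<close>
 define K where "K = 2 / ln 2 + 16 * C"
 have K: "0 < K" using C by (auto simp: K_def intro: add_pos_pos)
 show ?thesis
 proof (rule that[of K])
  fix V and x :: 'a assume V: "subspace V" "dim V = Suc (Suc m)" and x: "x : V"
  let ?r = "norm x"
  interpret S: prob_space "sph V" using V(1) by (rule prob_sph)
  show "(II w. enn (1 / (1 + \<bar>x *. w\<bar>)) dd sph V) <= enn (K * (ln (2 + ?r) / (1 + ?r)))"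
  proof (cases "?r < 1")
   case True
   have "(II w. enn (1 / (1 + \<bar>x *. w\<bar>)) dd sph V) <= (II w. 1 dd sph V)" by (intro nn_integral_mono) (simp add: ennreal_le_1)
   also have "... = ennreal 1" using S.emeasure_space_1 by simp
   also have "... <= enn (K * (ln (2 + ?r) / (1 + ?r)))"
   proof (rule ennreal_leI)
    have "ln 2 <= ln (2 + ?r)" by (subst ln_le_cancel_iff) (auto intro: add_pos_nonneg)
    then have "ln 2 / 2 <= ln (2 + ?r) / (1 + ?r)" using True by (intro frac_le) (auto intro: add_pos_nonneg)
    then have "2 / ln 2 * (ln 2 / 2) <= K * (ln (2 + ?r) / (1 + ?r))" using C by (intro mult_mono) (auto simp: K_def)
    then show "1 <= K * (ln (2 + ?r) / (1 + ?r))" by simp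
   qed
   finally show ?thesis .
  next
   case False
   then have r: "1 <= ?r" "0 < ?r" by auto
   define e where "e = (1 / ?r) *R x"
   have e: "e : V" "norm e = 1" "x = ?r *R e" using V(1) x r by (auto simp: e_def intro: subspace_scale)
   let ?W = "V Int {e}^o"
   have W: "subspace ?W" "0 < dim ?W" using dim_Int_comp_unit[OF V(1) e(1,2)] V by (auto intro: subspace_Int_comp)
   interpret W: prob_space "sph ?W" using W(1) by (rule prob_sph)
   have "(II w. enn (1 / (1 + \<bar>x *. w\<bar>)) dd sph V)
    = (II s. II p. enn (1 / (1 + \<bar>x *. ((1 / sqrt (1 + s^2)) *R (p + s *R e))\<bar>)) * enn (C / sqrt (1 + s^2) ^ Suc (Suc m)) dd sph ?W dd lborel)" unfolding C_def by (rule nni_sphere_slice[OF V(1) e(1,2) V(2)]) measurable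
   also have "... <= (II s. enn (4 * C / ((1 + \<bar>s\<bar>) * (1 + (1 + ?r) * \<bar>s\<bar>))) dd lborel)"
   proof (rule nn_integral_mono)
    fix s :: real
    let ?q = "sqrt (1 + s^2)" and ?B = "4 * C / ((1 + \<bar>s\<bar>) * (1 + (1 + ?r) * \<bar>s\<bar>))"
    have "1 <= ?q" "\<bar>s\<bar> <= ?q" using real_sqrt_le_mono[of "s^2" "1 + s^2"] by auto
    from less_le_trans[OF zero_less_one this(1)] this(1) divide_right_mono[OF add_mono[OF this], of 2]
    have q: "0 < ?q" "1 <= ?q" "(1 + \<bar>s\<bar>) / 2 <= ?q" by simp_all
    have "(II p. enn (1 / (1 + \<bar>x *. ((1 / ?q) *R (p + s *R e))\<bar>)) * enn (C / ?q ^ Suc (Suc m)) dd sph ?W) <= (II p. enn ?B dd sph ?W)"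
    proof (rule nn_integral_mono_AE, use AE_sph[OF W] in eventually_elim)
     fix p assume "p : ?W Int sphere 0 1"
     then have "e *. p = 0" by (auto simp: mem_comp_singleton inner_commute[of e])
     moreover have "e *. e = 1" using e(2) by (simp add: dot_square_norm)
     ultimately have ip: "\<bar>x *. ((1 / ?q) *R (p + s *R e))\<bar> = ?r * \<bar>s\<bar> / ?q" using q(1) by (subst e(3)) (simp add: inner_add_right abs_mult)
     \<comment> \<open>Two powers give enough decay: one clears the denominator 1 + r |s| / q, the
       other stays, and both are then bounded below through q >= (1 + |s|) / 2.\<close>
     have "C / ?q ^ Suc (Suc m) <= C / ?q ^ 2" using q C by (intro divide_left_mono power_increasing) auto
     then have "1 / (1 + ?r * \<bar>s\<bar> / ?q) * (C / ?q ^ Suc (Suc m)) <= 1 / (1 + ?r * \<bar>s\<bar> / ?q) * (C / ?q ^ 2)" using q(1) by (intro mult_left_mono) auto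
     also have "... = C / (?q * (?q + ?r * \<bar>s\<bar>))" using q(1) by (simp add: power2_eq_square field_simps del: real_sqrt_mult_self)
     also have "... <= C / ((1 + \<bar>s\<bar>) / 2 * ((1 + (1 + ?r) * \<bar>s\<bar>) / 2))"
     proof (intro divide_left_mono mult_mono mult_pos_pos)
      have "0 <= ?r * \<bar>s\<bar>" by simp
      moreover have "(1 + (1 + ?r) * \<bar>s\<bar>) / 2 = (1 + \<bar>s\<bar>) / 2 + ?r * \<bar>s\<bar> / 2" by (simp add: field_simps)
      ultimately show "(1 + (1 + ?r) * \<bar>s\<bar>) / 2 <= ?q + ?r * \<bar>s\<bar>" using q(3) by linarith
     qed (use q C in \<open>auto intro: add_pos_nonneg\<close>)
     also have "... = ?B" by simp
     finally have "1 / (1 + ?r * \<bar>s\<bar> / ?q) * (C / ?q ^ Suc (Suc m)) <= ?B" .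
     then show "enn (1 / (1 + \<bar>x *. ((1 / ?q) *R (p + s *R e))\<bar>)) * enn (C / ?q ^ Suc (Suc m)) <= enn ?B" unfolding ip using q C by (subst ennreal_mult[symmetric]) (auto intro: ennreal_leI)
    qed
    also have "... = enn ?B" using W.emeasure_space_1 by simp
    finally show "(II p. enn (1 / (1 + \<bar>x *. ((1 / ?q) *R (p + s *R e))\<bar>)) * enn (C / ?q ^ Suc (Suc m)) dd sph ?W) <= enn ?B" .
   qed
   also have "... <= enn (2 * (4 * C) * (ln (1 + ?r) / ?r))" using C r by (intro nni_log_kernel) auto
   also have "... <= enn (K * (ln (2 + ?r) / (1 + ?r)))"
   proof (rule ennreal_leI)
    have "ln (1 + ?r) / ?r <= ln (2 + ?r) / ((1 + ?r) / 2)" using r by (intro frac_le) auto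
    also have "... = 2 * (ln (2 + ?r) / (1 + ?r))" by simp
    finally have "8 * C * (ln (1 + ?r) / ?r) <= 8 * C * (2 * (ln (2 + ?r) / (1 + ?r)))" using C by (intro mult_left_mono) auto
    also have "... = 16 * C * (ln (2 + ?r) / (1 + ?r))" by simp
    also have "... <= K * (ln (2 + ?r) / (1 + ?r))" using r by (intro mult_right_mono divide_nonneg_nonneg) (auto simp: K_def)
    finally show "2 * (4 * C) * (ln (1 + ?r) / ?r) <= K * (ln (2 + ?r) / (1 + ?r))" by simp
   qed
   finally show ?thesis .
  qed
 qed (use K in simp)
qed

section \<open>Integrals over planes and their measurable dependence on the planes\<close>

lemma complement_weight_ennreal:
 "complement_weight m z = enn (ind (cball 0 1) z / unit_ball_vol (real m))" by (simp add: complement_weight_def divide_ennreal[symmetric] ennreal_indicator)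

text \<open>The inner integral of \<open>radon_jk\<close>, taken over the uncompleted measure so
  that for Borel f it is jointly measurable in all arguments. With a Borel version of f it will be
  the witness for \<open>is_tilde\<close>.\<close>

definition plane_int :: "('a::euclidean_space set => 'b::euclidean_space) => 'a set => 'a set => 'a => 'b" where
 "plane_int f x y v = (LINT u|leb y. f ((+) (u + v) ` x))"

lemma meas_plane_kernel:
 fixes N :: "'n measure" and a b :: "'n => 'a::euclidean_space set" and f :: "'a set => 'c::topological_space"
 assumes a: "a : measurable N (plb (Gr UNIV j))" and b: "b : measurable N (plb (Gr UNIV k))"
  and v: "v : bmeas N" and f: "f : bmeas (plb (aGr UNIV j))"
 shows "(%p. f ((+) (proj (b (fst p)) (snd p) + v (fst p)) ` a (fst p))) : bmeas (N xx lborel)"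
  and "(%p. snd p - proj (b (fst p)) (snd p)) : bmeas (N xx lborel)"
proof -
 have [measurable]: "(%p. proj (b (fst p)) (snd p)) : bmeas (N xx lborel)" by (rule meas_proj_subspace[OF measurable_compose[OF measurable_fst b]]) (auto simp: grassmannian_def)
 note [measurable] = measurable_compose[OF measurable_fst v]
 show "(%p. f ((+) (proj (b (fst p)) (snd p) + v (fst p)) ` a (fst p))) : bmeas (N xx lborel)" by (rule measurable_compose[OF meas_plane[OF measurable_compose[OF measurable_fst a]] f]) auto
 show "(%p. snd p - proj (b (fst p)) (snd p)) : bmeas (N xx lborel)" by measurable
qed

text \<open>Integration over the varying subspace \<open>b n\<close> becomes weighted integration
  over \<open>lborel\<close>, where measurability in the parameter is part of Tonelli's
  theorem.\<close>

lemma meas_plane_nni: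
 fixes N :: "'n measure" and a b :: "'n => 'a::euclidean_space set"
 assumes a: "a : measurable N (plb (Gr UNIV j))" and b: "b : measurable N (plb (Gr UNIV k))"
  and v: "v : bmeas N" and f: "f : bmeas (plb (aGr UNIV j))"
 shows "(%n. II u. f ((+) (u + v n) ` a n) dd leb (b n)) : bmeas N"
proof -
 note [measurable] = meas_plane_kernel[OF assms]
 have "(%n. II x. f ((+) (proj (b n) x + v n) ` a n) * complement_weight (DIM('a) - k) (x - proj (b n) x) dd lborel) : bmeas N" using lborel.borel_measurable_nn_integral_fst[of "%p. f ((+) (proj (b (fst p)) (snd p) + v (fst p)) ` a (fst p)) * complement_weight (DIM('a) - k) (snd p - proj (b (fst p)) (snd p))" N] by simp
 moreover have "(II u. f ((+) (u + v n) ` a n) dd leb (b n))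
  = (II x. f ((+) (proj (b n) x + v n) ` a n) * complement_weight (DIM('a) - k) (x - proj (b n) x) dd lborel)" if n: "n : space N" for n
 proof -
  have B: "subspace (b n)" "dim (b n) = k" using measurable_space[OF b n] by (auto simp: grassmannian_def)
  have "(%u. f ((+) (u + v n) ` a n)) : bmeas borel" by (rule measurable_compose[OF meas_plane[of "%_. a n"] f]) (use measurable_space[OF a n] in auto)
  from nni_leb_eq[OF subspace_UNIV B(1) subset_UNIV this] B(2) show ?thesis by (simp add: leb_UNIV)
 qed
 ultimately show ?thesis by (simp cong: measurable_cong)
qed

text \<open>The same device with a real weight; homogeneity in \<open>int_eqI_nn\<close> allows the
  weight to be moved next to the value of f.\<close>

lemma meas_plane_int:
 fixes N :: "'n measure" and a b :: "'n => 'a::euclidean_space set" and f :: "'a set => 'b::euclidean_space"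
 assumes a: "a : measurable N (plb (Gr UNIV j))" and b: "b : measurable N (plb (Gr UNIV k))"
  and v: "v : bmeas N" and f: "f : bmeas (plb (aGr UNIV j))"
 shows "(%n. plane_int f (a n) (b n) (v n)) : bmeas N"
proof -
 let ?w = "%z. ind (cball 0 1) z / unit_ball_vol (real (DIM('a) - k)) :: real"
 have w[measurable]: "?w : bmeas (borel :: 'a measure)" and w0: "0 <= ?w z" for z :: 'a by (auto intro: borel_measurable_divide)
 note [measurable] = meas_plane_kernel[OF assms]
 have "(%n. LINT x|lborel. ?w (x - proj (b n) x) *R f ((+) (proj (b n) x + v n) ` a n)) : bmeas N" using lborel.borel_measurable_lebesgue_integral[of "%n x. ?w (x - proj (b n) x) *R f ((+) (proj (b n) x + v n) ` a n)" N] by (simp add: case_prod_unfold)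
 moreover have "plane_int f (a n) (b n) (v n) = (LINT x|lborel. ?w (x - proj (b n) x) *R f ((+) (proj (b n) x + v n) ` a n))" if n: "n : space N" for n unfolding plane_int_def
 proof (rule int_eqI_nn(2))
  have B: "subspace (b n)" "dim (b n) = k" using measurable_space[OF b n] by (auto simp: grassmannian_def)
  note [measurable] = bm_proj[OF B(1)]
  have m[measurable]: "(%u. f ((+) (u + v n) ` a n)) : bmeas borel" by (rule measurable_compose[OF meas_plane[of "%_. a n"] f]) (use measurable_space[OF a n] in auto)
  have [measurable]: "(%x. f ((+) (proj (b n) x + v n) ` a n)) : bmeas borel" by (rule measurable_compose[OF bm_proj[OF B(1)] m])
  show "(%u. f ((+) (u + v n) ` a n)) : bmeas (leb (b n))" by simp
  show "(%x. ?w (x - proj (b n) x) *R f ((+) (proj (b n) x + v n) ` a n)) : bmeas lborel" by measurable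
  fix h :: "'b => real" assume [measurable]: "h : bmeas borel" and h: "!!c x. 0 <= c ==> h (c *R x) = c * h x"
  have "(II u. enn (h (f ((+) (u + v n) ` a n))) dd leb (b n))
   = (II x. enn (h (f ((+) (proj (b n) x + v n) ` a n))) * complement_weight (dim (UNIV :: 'a set) - dim (b n)) (x - proj (b n) x) dd lborel)" by (subst nni_leb_eq[OF subspace_UNIV B(1) subset_UNIV]) (simp_all add: leb_UNIV)
  also have "... = (II x. enn (h (?w (x - proj (b n) x) *R f ((+) (proj (b n) x + v n) ` a n))) dd lborel)" unfolding complement_weight_ennreal h[OF w0] B(2) dim_UNIV ennreal_mult''[symmetric, OF w0] by (simp only: mult.commute)
  finally show "(II u. enn (h (f ((+) (u + v n) ` a n))) dd leb (b n))
   = (II x. enn (h (?w (x - proj (b n) x) *R f ((+) (proj (b n) x + v n) ` a n))) dd lborel)" .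
 qed
 ultimately show ?thesis by (simp cong: measurable_cong)
qed

lemma meas_flags_inner:
 fixes g :: "'a::euclidean_space set \<times> 'a set \<times> 'a => ennreal"
 assumes n: "Suc (j + k) = DIM('a)"
  and g: "g : bmeas (plb (Gr UNIV j) xx (plb (Gr UNIV k) xx borel))"
 shows "(%y. II w. g (y, y^o Int {w}^o, w) dd sph (y^o)) : bmeas (plb (Gr UNIV j))"
proof -
 let ?PB = "plb (Gr (UNIV :: 'a set) j)" and ?U = "sph (UNIV :: 'a set)"
 let ?pd = "%V (x::'a). sgn (proj V x)"
 interpret U: prob_space ?U by (rule prob_sph) simp
 have dk: "DIM('a) - j = Suc k" using n by auto
 have "k <= dim (UNIV :: 'a set)" using n by simp
 then obtain b0 :: "'a set" where b0: "b0 : Gr UNIV k" by (rule gr_nonempty[OF subspace_UNIV])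
 have c: "(%y. y^o) : measurable ?PB (plb (Gr UNIV (Suc k)))" using meas_comp_plane[of "%x. x" ?PB j] by (simp add: dk)
 let ?G = "%p. g (fst p, cut_plane b0 ((fst p)^o) (?pd ((fst p)^o) (snd p)), ?pd ((fst p)^o) (snd p))"
 have "?G : bmeas (?PB xx ?U)" by (rule measurable_compose[OF _ g]) (intro measurable_Pair measurable_fst meas_cut_plane[OF measurable_compose[OF measurable_fst c] _ b0] meas_sgn_pair[OF c])
 then have "(%y. II x. ?G (y, x) dd ?U) : bmeas ?PB" by (rule U.borel_measurable_nn_integral_fst)
 moreover have "(II w. g (y, y^o Int {w}^o, w) dd sph (y^o)) = (II x. ?G (y, x) dd ?U)" if "y : space ?PB" for y
 proof -
  have y: "y : Gr UNIV j" using that by simp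
  have W: "subspace (y^o)" "0 < dim (y^o)" "y^o : Gr UNIV (Suc k)" using comp_in_gr[OF y] by (auto simp: grassmannian_def dk)
  have gm: "(%w. g (y, cut_plane b0 (y^o) w, w)) : bmeas borel" by (rule measurable_compose[OF _ g]) (use W(3) y in \<open>auto intro!: measurable_Pair meas_cut_plane[OF _ _ b0]\<close>)
  have "(II w. g (y, y^o Int {w}^o, w) dd sph (y^o)) = (II w. g (y, cut_plane b0 (y^o) w, w) dd sph (y^o))" by (rule nn_integral_cong_AE, use AE_sph[OF W(1,2)] in eventually_elim) (auto simp: cut_plane_eq)
  also have "... = (II x. ?G (y, x) dd ?U)" using nni_sph_UNIV[OF W(1,2) gm] by simp
  finally show ?thesis .
 qed
 ultimately show ?thesis by (subst measurable_cong)
qed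

text \<open>On the side of \<xi> the integrals over \<eta> and over t recombine to Lebesgue measure
  on \<xi>^o, with t = x . \<omega>. The weight 1 / (1 + |t|) will give integrability for almost
  every \<eta>, and the weight 1 will transport null sets of planes.\<close>

lemma nni_flags_plane:
 fixes h :: "'a::euclidean_space set => ennreal" and w :: "real => ennreal"
 assumes n: "Suc (j + k) = DIM('a)" and h: "h : bmeas (plb (aGr UNIV j))" and w: "w : bmeas borel"
 defines "F \<equiv> %b. II z. II t. (II u. h ((+) (u + t *R z) ` (b^o Int {z}^o)) dd leb b) * w t dd lborel dd sph (b^o)"
 shows "(II b. F b dd grass_borel UNIV k) = (II c. II z. II x. h ((+) x ` c) * w (x *. z) dd leb (c^o) dd sph (c^o) dd grass_borel UNIV j)"
  and "F : bmeas (plb (Gr UNIV k))"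
proof -
 let ?PB = "%m. plb (Gr (UNIV :: 'a set) m)" and ?B = "borel :: 'a measure"
 define g where "g p = (II t. (II u. h ((+) (u + t *R snd (snd p)) ` fst p) dd leb (fst (snd p))) * w t dd lborel)" for p
 have gm: "g : bmeas (?PB j xx (?PB k xx ?B))"
 proof -
  let ?N = "(?PB j xx (?PB k xx ?B)) xx (lborel :: real measure)"
  have "(%q. II u. h ((+) (u + snd q *R snd (snd (fst q))) ` fst (fst q)) dd leb (fst (snd (fst q)))) : bmeas ?N" by (rule meas_plane_nni[OF _ _ _ h]) measurable
  moreover have "(%q. w (snd q)) : bmeas ?N" using measurable_compose[OF measurable_snd, of w lborel borel "?PB j xx (?PB k xx ?B)"] w by simp
  ultimately show ?thesis unfolding g_def[abs_def] using lborel.borel_measurable_nn_integral_fst[OF borel_measurable_times_ennreal] by fastforce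
 qed
 have gm': "(%p. g (fst (snd p), fst p, snd (snd p))) : bmeas (?PB k xx (?PB j xx ?B))" by (rule measurable_compose[OF _ gm]) measurable
 have F: "F = (%b. II z. g (b^o Int {z}^o, b, z) dd sph (b^o))" by (simp add: F_def g_def)
 show "F : bmeas (?PB k)" unfolding F using meas_flags_inner[OF _ gm'] n by simp
 have pr: "space (grass_borel (UNIV :: 'a set) j) = Gr UNIV j" using n by (intro grass_borel_props(2)) auto
 show "(II b. F b dd grass_borel UNIV k) = (II c. II z. II x. h ((+) x ` c) * w (x *. z) dd leb (c^o) dd sph (c^o) dd grass_borel UNIV j)" unfolding F nni_flags[OF n gm]
 proof (rule nn_integral_cong)
  fix c assume "c : space (grass_borel (UNIV :: 'a set) j)"
  then have c: "c : Gr UNIV j" using pr by simp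
  have W: "subspace (c^o)" "0 < dim (c^o)" using comp_in_gr[OF c] n by (auto simp: grassmannian_def)
  have hx: "(%x. h ((+) x ` c)) : bmeas borel" by (rule measurable_compose[OF meas_plane[of "%_. c"] h]) (use c in auto)
  have Gm: "(%x. h ((+) x ` c) * w (x *. z)) : bmeas borel" for z by (intro borel_measurable_times_ennreal hx measurable_compose[OF _ w]) measurable
  show "(II z. g (c, c^o Int {z}^o, z) dd sph (c^o)) = (II z. II x. h ((+) x ` c) * w (x *. z) dd leb (c^o) dd sph (c^o))"
  proof (rule nn_integral_cong_AE, use AE_sph[OF W] in eventually_elim)
   fix z assume "z : c^o Int sphere 0 1"
   then have z: "z : c^o" "norm z = 1" "z *. z = 1" by (auto simp: dot_square_norm)
   let ?Y = "c^o Int {z}^o"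
   have Y: "subspace ?Y" using W(1) by (rule subspace_Int_comp)
   have "(II x. h ((+) x ` c) * w (x *. z) dd leb (c^o)) = (II t. II y. h ((+) (t *R z + y) ` c) * w ((t *R z + y) *. z) dd leb ?Y dd lborel)" by (rule nni_leb_slice[OF W(1) z(1,2) Gm])
   also have "... = (II t. (II u. h ((+) (u + t *R z) ` c) dd leb ?Y) * w t dd lborel)"
   proof (rule nn_integral_cong)
    fix t :: real
    have "(II y. h ((+) (t *R z + y) ` c) * w ((t *R z + y) *. z) dd leb ?Y) = (II u. h ((+) (u + t *R z) ` c) * w t dd leb ?Y)" by (rule nn_integral_cong_AE, use AE_leb[OF Y] in eventually_elim) (simp add: mem_comp_singleton inner_add_left z(3) add.commute)
    also have "... = (II u. h ((+) (u + t *R z) ` c) dd leb ?Y) * w t" by (rule nn_integral_multc) (use measurable_compose[OF _ hx, of "%u. u + t *R z" borel] in simp)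
    finally show "(II y. h ((+) (t *R z + y) ` c) * w ((t *R z + y) *. z) dd leb ?Y) = (II u. h ((+) (u + t *R z) ` c) dd leb ?Y) * w t" .
   qed
   finally show "g (c, ?Y, z) = (II x. h ((+) x ` c) * w (x *. z) dd leb (c^o))" by (simp add: g_def)
  qed
 qed
qed

lemma aff_hyperplane_cases:
 fixes X :: "'a::euclidean_space set"
 assumes X: "subspace X" and d: "dim X = Suc j" and T: "T : aGr X j"
 obtains w t where "w : X" "norm w = 1" "T = (+) (t *R w) ` (X Int {w}^o)"
proof -
 have A: "affine T" "T \<subseteq> X" "aff_dim T = int j" using T by (auto simp: affine_grassmannian_def)
 then obtain a where a: "a : T" by force
 let ?x = "(+) (- a) ` T"
 have aX: "a : X" using a A by blast
 have e: "T = (+) a ` ?x" by (simp add: image_image)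
 have x: "subspace ?x" using affine_diffs_subspace[OF A(1) a] .
 have \<xi>X: "?x \<subseteq> X" using A(2) subspace_diff[OF X _ aX] by (auto simp: uminus_add_conv_diff)
 have "int (dim ?x) = int j" using aff_dim_subspace[OF x] aff_dim_translation_eq[of "- a" T] A(3) by simp
 then have dj: "dim ?x = j" by simp
 then have "dim (X Int ?x^o) = 1" using dim_Int_comp[OF X x \<xi>X] d by simp
 then have "~ X Int ?x^o \<subseteq> {0}" using dim_eq_0[of "X Int ?x^o"] by simp
 then obtain b where b: "b : X" "b : ?x^o" "b ~= 0" by blast
 define w where "w = sgn b"
 have w: "w : X" "w : ?x^o" "norm w = 1" using b X by (auto simp: w_def norm_sgn sgn_div_norm intro!: subspace_scale subspace_orthogonal_comp)
 have W: "subspace (X Int {w}^o)" using X by (rule subspace_Int_comp)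
 have "?x = X Int {w}^o"
 proof (rule subspace_dim_equal[OF x W])
  show "?x \<subseteq> X Int {w}^o" using \<xi>X w(2) by (auto simp: mem_comp_singleton comp_iff inner_commute)
  show "dim (X Int {w}^o) <= dim ?x" using dim_Int_comp_unit[OF X w(1,3)] d dj by simp
 qed
 then have "T = (+) (a - proj (X Int {w}^o) a) ` (X Int {w}^o)" using e plane_at_foot[OF W, of a] by simp
 also have "a - proj (X Int {w}^o) a = (a *. w) *R w" using aX by (simp add: proj_Int_comp_unit[OF X w(1,3)] closest_point_self)
 finally show ?thesis using that w by blast
qed

text \<open>By \<open>nni_aff_hyperplanes\<close> a null set of hyperplanes is null in the
  coordinates (\<omega>, t); \<open>cut_plane\<close> and \<open>proj X\<close> make the coordinate
  map total and measurable.\<close>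

lemma AE_aff_hyperplanesD:
 fixes X :: "'a::euclidean_space set"
 assumes X: "subspace X" and d: "dim X = Suc j" and P: "AE T in affine_grass_measure X j. P T"
 shows "AE p in sph X xx lborel. P ((+) (snd p *R fst p) ` (X Int {fst p}^o))"
proof -
 let ?A = "aff_grass_borel X j"
 have j: "j <= dim X" "0 < dim X" using d by auto
 obtain x0 where 0: "x0 : Gr X j" using gr_nonempty[OF X j(1)] .
 have "AE T in ?A. P T" using P unfolding aff_grass_measure_eq[OF X j(1)] AE_completion_iff .
 then obtain N where N: "!!T. T : space ?A - N ==> P T" "N : null_sets ?A" by (rule AE_E3) (rule that)
 have Nm: "ind N : bmeas (plb (aGr X j))" using null_setsD2[OF N(2)] by (intro borel_measurable_indicator) simp
 let ?q = "%p. (+) (proj X (snd p *R fst p)) ` cut_plane x0 X (fst p)"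
 note [measurable] = bm_proj[OF X]
 have "?q : measurable (sph X xx (lborel :: real measure)) (plb (aGr X j))"
 proof (rule meas_plane[OF meas_cut_plane[OF measurable_const _ 0] _ X])
  show "X : space (plb (Gr X (Suc j)))" using X d by (simp add: grassmannian_def)
  show "proj X (snd p *R fst p) : X" for p :: "'a \<times> real" by (rule proj_subspace(1)[OF X])
 qed measurable
 then have qm: "(%p. ind N (?q p) :: ennreal) : bmeas (sph X xx (lborel :: real measure))" by (rule measurable_compose[OF _ Nm])
 have eq: "?q p = (+) (snd p *R fst p) ` (X Int {fst p}^o)" if "fst p : X & norm (fst p) = 1" for p :: "'a \<times> real" using that X by (simp add: cut_plane_eq closest_point_self subspace_scale)
 have "(II p. ind N (?q p) dd (sph X xx lborel)) = (II w. II t. ind N (?q (w, t)) dd lborel dd sph X)" by (rule lborel.nn_integral_fst[OF qm, symmetric])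
 also have "... = (II w. II t. ind N ((+) (t *R w) ` (X Int {w}^o)) dd lborel dd sph X)"
 proof (rule nn_integral_cong_AE, use AE_sph[OF X j(2)] in eventually_elim)
  fix w assume "w : X Int sphere 0 1"
  then have "?q (w, t) = (+) (t *R w) ` (X Int {w}^o)" for t using eq[of "(w, t)"] by simp
  then show "(II t. ind N (?q (w, t)) dd lborel) = (II t. ind N ((+) (t *R w) ` (X Int {w}^o)) dd lborel)" by (simp only:)
 qed
 also have "... = 0" using nni_aff_hyperplanes[OF X d Nm] N(2) by (simp add: null_sets_def)
 finally have "AE p in sph X xx lborel. ind N (?q p) = (0::ennreal)" using qm by (subst nn_integral_0_iff_AE[symmetric]) simp_all
 then show ?thesis using AE_sphere_pair[OF X j(2)]
 proof eventually_elim
  fix p :: "'a \<times> real" assume p: "ind N (?q p) = (0::ennreal)" "fst p : X & norm (fst p) = 1"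
  have "X Int {fst p}^o : Gr X j" using dim_Int_comp_unit[OF X] p(2) d X by (auto simp: grassmannian_def subspace_Int_comp)
  then have "(+) (snd p *R fst p) ` (X Int {fst p}^o) : space ?A" using p(2) X by (auto intro!: plane_in_aff_gr subspace_scale)
  moreover have "(+) (snd p *R fst p) ` (X Int {fst p}^o) ~: N" using p(1) unfolding eq[OF p(2)] by (simp add: indicator_eq_0_iff)
  ultimately show "P ((+) (snd p *R fst p) ` (X Int {fst p}^o))" using N(1) by blast
 qed
qed

lemma plane_shift:
 fixes x :: "'a::euclidean_space set"
 assumes "subspace x" "c : x" shows "(+) (a + c) ` x = (+) a ` x"
proof -
 have "proj x (a + c) = proj x a + c" using assms by (simp add: linear_add[OF linear_proj] closest_point_self)
 then show ?thesis using plane_at_foot[OF assms(1), of "a + c"] plane_at_foot[OF assms(1), of a] by simp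
qed

lemma cut_plane_uminus:
 fixes V :: "'a::euclidean_space set"
 assumes "subspace V" shows "cut_plane x0 V (- w) = cut_plane x0 V w" using subspace_neg[OF assms, of w] subspace_neg[OF assms, of "- w"] by (auto simp: cut_plane_def mem_comp_singleton)

text \<open>The work for a single good \<eta>: \<open>fin\<close> is the L1 condition of
  \<open>dual_radon_funk\<close>, and \<open>null\<close> allows f to be replaced by its Borel
  version inside \<open>radon_jk\<close>.\<close>

lemma dual_radon_slice:
 fixes f f0 :: "'a::euclidean_space set => 'b::euclidean_space"
 assumes n: "Suc (j + k) = DIM('a)" and j: "0 < j" and e: "e : Gr UNIV k" and z0: "z0 : Gr (e^o) j"
  and f0: "f0 : bmeas (plb (aGr UNIV j))"
  and N: "N : sets (plb (aGr UNIV j))" and eq: "!!T. T : aGr UNIV j ==> T ~: N ==> f T = f0 T"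
  and fin: "(II w. II t. (II u. enn (norm (f0 ((+) (u + t *R w) ` (e^o Int {w}^o)))) dd leb e) * enn (1 / (1 + \<bar>t\<bar>)) dd lborel dd sph (e^o)) < \<infinity>"
  and null: "(II w. II t. (II u. ind N ((+) (u + t *R w) ` (e^o Int {w}^o)) dd leb e) * 1 dd lborel dd sph (e^o)) = 0"
 defines "H \<equiv> %p. plane_int f0 (cut_plane z0 (e^o) (fst p)) e (snd p *R fst p)"
 shows "is_funk_inverse ((e^o) \<times> UNIV) (A_star_inv (radon_jk j f e)) (dual_density (dim (e^o)) H)"
proof -
 let ?X = "e^o" and ?PB = "%X. plb (Gr (X :: 'a set) j)" and ?c = "cut_plane z0 (e^o)"
 have X: "subspace ?X" "dim ?X = Suc j" using comp_in_gr[OF e] n by (auto simp: grassmannian_def)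
 have d: "2 <= dim ?X" "0 < dim ?X" using X j by auto
 interpret S: prob_space "sph ?X" using X(1) by (rule prob_sph)
 have sX: "sfin (leb ?X)" using X(1) by (rule sf_leb)
 have XG: "?X : Gr ?X (Suc j)" using X by (simp add: grassmannian_def)
 have cX: "?c : measurable M (?PB ?X)" if "(%x. x) : bmeas M" for M :: "'a measure" by (rule meas_cut_plane[OF measurable_const that z0]) (use XG in simp)
 have inc: "(%z. z) : measurable (?PB ?X) (?PB UNIV)" by (rule meas_plane_borelI) (auto simp: grassmannian_def meas_proj_plane)
 have cU: "(%p :: 'a \<times> real. ?c (fst p)) : measurable borel (?PB UNIV)"
 proof -
  have "?c : measurable borel (?PB ?X)" by (rule cX) simp
  from measurable_compose[OF measurable_compose[OF bm_fst_snd(1) this] inc] show ?thesis .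
 qed
 have ce: "?c w = ?X Int {w}^o" if "w : ?X Int sphere 0 1" for w using that by (simp add: cut_plane_eq)
 have \<eta>c: "(%_. e) : measurable M (plb (Gr UNIV k))" for M :: "'n measure" using e by simp
 have Hm[measurable]: "H : bmeas borel" unfolding H_def by (rule meas_plane_int[OF cU \<eta>c _ f0]) measurable
 have He: "H (- p) = H p" for p by (simp add: H_def cut_plane_uminus[OF X(1)])
 have AES: "AE w in sph ?X. w : ?X Int sphere 0 1" by (rule AE_sph[OF X(1) d(2)])
 have Hfin: "(II p. enn (norm (H p) / (1 + \<bar>snd p\<bar>)) dd (sph ?X xx lborel)) < \<infinity>"
 proof -
  have m: "(%p. enn (norm (H p) / (1 + \<bar>snd p\<bar>))) : bmeas (sph ?X xx lborel)" by (rule bm_sphere_pair) measurable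
  have "(II p. enn (norm (H p) / (1 + \<bar>snd p\<bar>)) dd (sph ?X xx lborel)) = (II w. II t. enn (norm (H (w, t)) / (1 + \<bar>t\<bar>)) dd lborel dd sph ?X)" using lborel.nn_integral_fst[OF m] by simp
  also have "... <= (II w. II t. (II u. enn (norm (f0 ((+) (u + t *R w) ` (?X Int {w}^o)))) dd leb e) * enn (1 / (1 + \<bar>t\<bar>)) dd lborel dd sph ?X)"
  proof (rule nn_integral_mono_AE, use AES in eventually_elim)
   fix w assume w: "w : ?X Int sphere 0 1"
   show "(II t. enn (norm (H (w, t)) / (1 + \<bar>t\<bar>)) dd lborel) <= (II t. (II u. enn (norm (f0 ((+) (u + t *R w) ` (?X Int {w}^o)))) dd leb e) * enn (1 / (1 + \<bar>t\<bar>)) dd lborel)"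
   proof (rule nn_integral_mono)
    fix t :: real
    have "enn (norm (H (w, t)) / (1 + \<bar>t\<bar>)) = enn (norm (H (w, t))) * enn (1 / (1 + \<bar>t\<bar>))" by (simp flip: ennreal_mult)
    also have "... <= (II u. enn (norm (f0 ((+) (u + t *R w) ` (?X Int {w}^o)))) dd leb e) * enn (1 / (1 + \<bar>t\<bar>))" unfolding H_def plane_int_def fst_conv snd_conv ce[OF w] by (rule mult_right_mono[OF norm_int_le_nn]) simp
    finally show "enn (norm (H (w, t)) / (1 + \<bar>t\<bar>)) <= (II u. enn (norm (f0 ((+) (u + t *R w) ` (?X Int {w}^o)))) dd leb e) * enn (1 / (1 + \<bar>t\<bar>))" .
   qed
  qed
  finally show ?thesis using fin by (rule le_less_trans)
 qed
 let ?I = "ind N :: 'a set => ennreal"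
 have Im: "?I : bmeas (plb (aGr UNIV j))" using N by (rule borel_measurable_indicator)
 \<comment> \<open>The measure of those translations u in \<eta> for which the plane lands in the
   exceptional set.\<close>
 define B where "B p = (II u. ?I ((+) (u + snd p *R fst p) ` ?c (fst p)) dd leb e)" for p
 have Bm[measurable]: "B : bmeas borel" unfolding B_def by (rule meas_plane_nni[OF cU \<eta>c _ Im]) measurable
 have "(II w. II t. B (w, t) dd lborel dd sph ?X) = 0" unfolding null[symmetric] by (rule nn_integral_cong_AE, use AES in eventually_elim) (simp add: B_def ce)
 then have B0: "AE w in sph ?X. (II t. B (w, t) dd lborel) = 0" by (subst (asm) nn_integral_0_iff_AE) measurable
 have "(II y. II w. B (w, y *. w) dd sph ?X dd leb ?X) = (II w. II y. B (w, y *. w) dd leb ?X dd sph ?X)" by (rule nni_swap[OF sX S.sigma_finite_measure_axioms]) measurable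
 also have "... = (II w. 0 dd sph ?X)"
 proof (rule nn_integral_cong_AE, use AES B0 in eventually_elim)
  fix w assume "w : ?X Int sphere 0 1" and B0: "(II t. B (w, t) dd lborel) = 0"
  then have w: "w : ?X" "norm w = 1" "w *. w = 1" by (auto simp: dot_square_norm)
  let ?W = "?X Int {w}^o"
  have W: "subspace ?W" using X(1) by (rule subspace_Int_comp)
  have "(II y. B (w, y *. w) dd leb ?X) = (II t. II y. B (w, (t *R w + y) *. w) dd leb ?W dd lborel)" by (rule nni_leb_slice[OF X(1) w(1,2)]) measurable
  \<comment> \<open>The points y with y . w = t fill a whole hyperplane, possibly of infinite
    measure; as the integral of \<open>B\<close> over t is 0, the product is 0 nevertheless.\<close>
  also have "... = (II t. B (w, t) * em (leb ?W) (space (leb ?W)) dd lborel)"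
  proof (rule nn_integral_cong)
   fix t :: real
   have "(II y. B (w, (t *R w + y) *. w) dd leb ?W) = (II y. B (w, t) dd leb ?W)" by (rule nn_integral_cong_AE, use AE_leb[OF W] in eventually_elim) (simp add: mem_comp_singleton inner_add_left w(3))
   then show "(II y. B (w, (t *R w + y) *. w) dd leb ?W) = B (w, t) * em (leb ?W) (space (leb ?W))" by (simp only: nn_integral_const)
  qed
  also have "... = 0" by (subst nn_integral_multc) (measurable, simp only: B0 mult_zero_left)
  finally show "(II y. B (w, y *. w) dd leb ?X) = 0" .
 qed
 finally have "(II y. II w. B (w, y *. w) dd sph ?X dd leb ?X) = 0" by simp
 then have "AE y in leb ?X. (II w. B (w, y *. w) dd sph ?X) = 0" by (subst (asm) nn_integral_0_iff_AE) measurable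
 then have "AE y in leb ?X. radon_jk j f e y = (LINT w|sph ?X. H (w, y *. w))" using AE_leb[OF X(1)]
 proof eventually_elim
  fix y assume "(II w. B (w, y *. w) dd sph ?X) = 0" and y: "y : ?X"
  then have By: "AE w in sph ?X. B (w, y *. w) = 0" by (subst (asm) nn_integral_0_iff_AE) measurable
  \<comment> \<open>A hyperplane through y with normal w depends on y only through y . w; this
    matches the planes through y in \<open>radon_jk\<close> with the coordinates of
    \<open>H\<close>.\<close>
  have sh: "(+) (u + y) ` (?X Int {w}^o) = (+) (u + (y *. w) *R w) ` (?X Int {w}^o)" if w: "w : ?X Int sphere 0 1" for u w
  proof -
   have "w *. w = 1" using w by (simp add: dot_square_norm)
   then have "y - (y *. w) *R w : ?X Int {w}^o" using y w X(1) by (auto simp: mem_comp_singleton inner_diff_left intro!: subspace_diff subspace_scale)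
   from plane_shift[OF subspace_Int_comp[OF X(1)] this, of "u + (y *. w) *R w"] show ?thesis by simp
  qed
  let ?g = "grass_borel ?X j" and ?b = "%z. II u. ?I ((+) (u + y) ` z) dd leb e"
  have cS: "?c : measurable (sph ?X) (?PB ?X)" by (rule cX) simp
  have g: "?g = distr (sph ?X) (?PB ?X) ?c" by (rule grass_borel_hyperplanes[OF X z0])
  have sg: "sets ?g = sets (?PB ?X)" "space ?g = Gr ?X j" by (simp_all add: g)
  have bm: "?b : bmeas (?PB ?X)" by (rule meas_plane_nni[OF inc \<eta>c measurable_const Im]) simp
  have pm: "(%z. plane_int f0 z e y) : bmeas (?PB ?X)" by (rule meas_plane_int[OF inc \<eta>c measurable_const f0]) simp
  have "{z : space (?PB ?X). ?b z = 0} : sets (?PB ?X)" using bm by measurable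
  moreover have "AE w in sph ?X. ?b (?c w) = 0" using By AES by eventually_elim (simp add: B_def ce sh)
  ultimately have b0: "AE z in ?g. ?b z = 0" unfolding g by (subst AE_distr_iff[OF cS]) auto
  have "AE z in ?g. (LINT u|subspace_lebesgue e. f ((+) (u + y) ` z)) = plane_int f0 z e y" using b0 AE_space
  proof eventually_elim
   fix z assume b: "?b z = 0" and "z : space ?g"
   then have z: "z : Gr UNIV j" using sg by (auto simp: grassmannian_def)
   have pl: "(%u. (+) (u + y) ` z) : measurable borel (plb (aGr UNIV j))" by (rule meas_plane) (use z in auto)
   have "AE u in leb e. ?I ((+) (u + y) ` z) = 0" using b measurable_compose[OF pl Im] by (subst (asm) nn_integral_0_iff_AE) auto
   then have "AE u in leb e. f ((+) (u + y) ` z) = f0 ((+) (u + y) ` z)"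
   proof eventually_elim
    fix u assume "?I ((+) (u + y) ` z) = 0"
    then show "f ((+) (u + y) ` z) = f0 ((+) (u + y) ` z)" by (intro eq plane_in_aff_gr[OF z]) (auto simp: indicator_eq_0_iff)
   qed
   then show "(LINT u|subspace_lebesgue e. f ((+) (u + y) ` z)) = plane_int f0 z e y" unfolding plane_int_def subspace_lebesgue_def by (rule integral_completion_AE) (use measurable_compose[OF pl f0] in simp)
  qed
  then have "radon_jk j f e y = (LINT z|?g. plane_int f0 z e y)" unfolding radon_jk_def grass_measure_eq by (rule integral_completion_AE) (use pm measurable_cong_sets[OF sg(1) refl] in blast)
  also have "... = (LINT w|sph ?X. plane_int f0 (?c w) e y)" unfolding g by (rule integral_distr[OF cS pm])
  also have "... = (LINT w|sph ?X. H (w, y *. w))"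
  proof (rule integral_cong_AE)
   show "AE w in sph ?X. plane_int f0 (?c w) e y = H (w, y *. w)" using AES by eventually_elim (simp add: H_def plane_int_def ce sh)
   show "(%w. plane_int f0 (?c w) e y) : bmeas (sph ?X)" by (rule measurable_compose[OF cS pm])
  qed measurable
  finally show "radon_jk j f e y = (LINT w|sph ?X. H (w, y *. w))" .
 qed
 then show ?thesis by (rule dual_radon_funk[OF X(1) d(1) Hm He Hfin])
qed

section \<open>Reconstruction\<close>

text \<open>All conditions are equations between projections: y lies in \<open>e^o\<close> iff proj
  e after proj y vanishes, and by linearity finitely many basis vectors decide that.\<close>

lemma flags_meas:
 "flags j k : sets (plb (Gr (UNIV :: 'a::euclidean_space set) j) xx (plb (Gr UNIV k) xx borel))"
proof -
 let ?M = "plb (Gr (UNIV :: 'a set) j) xx (plb (Gr (UNIV :: 'a set) k) xx borel)"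
 have m: "fst : measurable ?M (plb (Gr UNIV j))" "(%p. fst (snd p)) : measurable ?M (plb (Gr UNIV k))" by measurable
 have cj: "(%p. proj (fst p) (g p)) : bmeas ?M" if "g : bmeas ?M" for g by (rule meas_proj_subspace[OF m(1) _ that]) (auto simp: grassmannian_def)
 have ck: "(%p. proj (fst (snd p)) (g p)) : bmeas ?M" if "g : bmeas ?M" for g by (rule meas_proj_subspace[OF m(2) _ that]) (auto simp: grassmannian_def)
 have [measurable]: "(%p. proj (fst (snd p)) (proj (fst p) b)) : bmeas ?M" for b by (rule ck, rule cj) simp
 have [measurable]: "(%p. proj (fst p) (snd (snd p))) : bmeas ?M" "(%p. proj (fst (snd p)) (snd (snd p))) : bmeas ?M" by (rule cj ck, measurable)+
 have comp: "x : V^o <-> proj V x = 0" if "subspace V" for V :: "'a set" and x using proj_subspace(2)[OF that, of x] proj_subspace_eq_0[OF that, of x] by auto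
 have sub: "y \<subseteq> e^o <-> (ALL b:Basis. proj e (proj y b) = 0)" if s: "subspace y" "subspace e" for y e :: "'a set"
 proof
  assume "y \<subseteq> e^o"
  then show "ALL b:Basis. proj e (proj y b) = 0" using proj_subspace(1)[OF s(1)] comp[OF s(2)] by blast
 next
  assume b: "ALL b:Basis. proj e (proj y b) = 0"
  have l: "linear (proj e \<circ> proj y)" by (intro linear_compose linear_proj s)
  have "(proj e \<circ> proj y) x = (%_. 0) x" for x by (rule linear_eq_stdbasis[OF l, THEN fun_cong]) (use b in \<open>auto intro: linearI\<close>)
  note z = this
  show "y \<subseteq> e^o"
  proof
   fix x assume "x : y"
   then show "x : e^o" using z[of x] unfolding comp[OF s(2)] by (simp add: closest_point_self)
  qed
 qed
 have "flags j k = {p : space ?M. (ALL b:Basis. proj (fst (snd p)) (proj (fst p) b) = 0)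
  & proj (fst p) (snd (snd p)) = 0 & proj (fst (snd p)) (snd (snd p)) = 0}"
 proof (rule set_eqI)
  fix p :: "'a set \<times> 'a set \<times> 'a"
  obtain y e v where [simp]: "p = (y, e, v)" by (cases p)
  show "p : flags j k <-> p : {p : space ?M. (ALL b:Basis. proj (fst (snd p)) (proj (fst p) b) = 0)
   & proj (fst p) (snd (snd p)) = 0 & proj (fst (snd p)) (snd (snd p)) = 0}"
  proof (cases "subspace y & subspace e")
   case True
   then have "subspace y" "subspace e" by auto
   note s = sub[OF this, symmetric] comp[OF this(1), of v, symmetric] comp[OF this(2), of v, symmetric]
   show ?thesis using True by (simp add: s flags_def grassmannian_def space_pair_measure conj_ac)
  qed (auto simp: flags_def grassmannian_def space_pair_measure)
 qed
 also have "... : sets ?M" by measurable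
 finally show ?thesis .
qed

theorem theorem7p3:
  fixes f :: "'a::euclidean_space set \<Rightarrow> 'b::{real_normed_field, euclidean_space}"
    and \<phi> :: "'a set \<Rightarrow> 'a \<Rightarrow> 'b"
    and j k :: nat
  assumes "0 < j" and "0 < k" and "j + k = DIM('a) - 1"
    and "f \<in> L_log j"
    and "\<phi> = radon_jk j f"
  shows "(\<exists>F. is_tilde j k \<phi> F) \<and>
    (\<forall>F. is_tilde j k \<phi> F \<longrightarrow>
      (AE \<xi> in grass_measure UNIV j.
         is_radon_inverse (\<xi>\<^sup>\<bottom>) (\<lambda>\<zeta>. F \<xi> (direction \<zeta>) (foot \<zeta>)) (\<lambda>u. f ((+) u ` \<xi>))))"
proof -
 let ?A = "aff_grass_borel (UNIV :: 'a set) j" and ?PA = "plb (aGr (UNIV :: 'a set) j)"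
 let ?PB = "%m. plb (Gr (UNIV :: 'a set) m)" and ?gb = "grass_borel (UNIV :: 'a set)" and ?B = "borel :: 'a measure"
 have n: "Suc (j + k) = DIM('a)" using assms(1,3) by simp
 have le: "j <= dim (UNIV :: 'a set)" "k <= dim (UNIV :: 'a set)" using n by auto
 note pj = grass_borel_props[OF subspace_UNIV le(1)] and pk = grass_borel_props[OF subspace_UNIV le(2)]
 have mj: "g : bmeas (?gb j)" if "g : bmeas (?PB j)" for g :: "'a set => ennreal" using that measurable_cong_sets[OF pj(3) refl] by blast
 have mk: "g : bmeas (?gb k)" if "g : bmeas (?PB k)" for g :: "'a set => ennreal" using that measurable_cong_sets[OF pk(3) refl] by blast
 have Am: "affine_grass_measure UNIV j = completion ?A" by (rule aff_grass_measure_eq[OF subspace_UNIV le(1)])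
 have fm: "f : bmeas (completion ?A)"
  and fin: "(II T. enn (norm (f T) / (1 + plane_norm T) * ln (2 + plane_norm T)) dd ?A) < \<infinity>" using assms(4) unfolding L_log_def Am nn_integral_completion by auto
 \<comment> \<open>f is measurable for the completed measure only, and the slices to come are null
   sets of planes. Hence a Borel version f0 and a null set \<open>N\<close> outside of which f and
   f0 agree pointwise.\<close>
 obtain f0 where f0': "f0 : bmeas ?A" and AEf: "AE T in ?A. f T = f0 T" using completion_ex_bm_euclidean[OF fm] .
 have f0: "f0 : bmeas ?PA" using f0' measurable_cong_sets[OF aff_grass_borel_props(2) refl] by blast
 obtain N where N: "!!T. T : space ?A - N ==> f T = f0 T" "N : null_sets ?A" using AEf by (rule AE_E3) (rule that)
 have Ns: "N : sets ?PA" using null_setsD2[OF N(2)] by simp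
 have feq: "f T = f0 T" if "T : aGr UNIV j" "T ~: N" for T using N(1) that by simp
 let ?I = "ind N :: 'a set => ennreal" and ?n0 = "%T. enn (norm (f0 T))"
 let ?h = "%T. enn (norm (f0 T) / (1 + plane_norm T) * ln (2 + plane_norm T))"
 have pn[measurable]: "plane_norm : bmeas ?PA" unfolding plane_norm_def[abs_def] foot_def using meas_proj_plane by measurable
 have meas: "?I : bmeas ?PA" "?n0 : bmeas ?PA" "?h : bmeas ?PA" using Ns f0 by measurable
 have int: "(II L. II u. g ((+) u ` L) dd leb (L^o) dd ?gb j) = (II T. g T dd ?A)"
  "(%L. II u. g ((+) u ` L) dd leb (L^o)) : bmeas (?gb j)"
  if g: "g : bmeas ?PA" for g using nni_aff_grass_borel[OF subspace_UNIV le(1) g]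
   mj[OF meas_plane_nni[OF _ meas_comp_plane _ g, of "%x. x" "?PB j" "%x. x" j "%_. 0"]] by simp_all
 have "(II T. enn (norm (f T) / (1 + plane_norm T) * ln (2 + plane_norm T)) dd ?A) = (II T. ?h T dd ?A)" by (rule nn_integral_cong_AE, use AEf in eventually_elim) simp
 with fin have "(II T. ?h T dd ?A) < \<infinity>" by simp
 then have hfin: "(II L. II u. ?h ((+) u ` L) dd leb (L^o) dd ?gb j) < \<infinity>" unfolding int(1)[OF meas(3)] .
 have "(II L. II u. ?I ((+) u ` L) dd leb (L^o) dd ?gb j) = 0" unfolding int(1)[OF meas(1)] using N(2) by (simp add: null_sets_def)
 then have AEN: "AE L in ?gb j. (II u. ?I ((+) u ` L) dd leb (L^o)) = 0" using int(2)[OF meas(1)] by (subst (asm) nn_integral_0_iff_AE)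
 have AEh: "AE L in ?gb j. (II u. ?h ((+) u ` L) dd leb (L^o)) ~= \<infinity>" by (rule nn_integral_PInf_AE[OF int(2)[OF meas(3)]]) (use hfin in simp)
 have slice: "subspace (L^o)" "dim (L^o) = Suc k" "(%x. (+) x ` L) : measurable borel ?PA"
  "AE u in leb (L^o). plane_norm ((+) u ` L) = norm u" if L: "L : Gr UNIV j" for L
 proof -
  show W: "subspace (L^o)" "dim (L^o) = Suc k" using comp_in_gr[OF L] n by (auto simp: grassmannian_def)
  show "(%x. (+) x ` L) : measurable borel ?PA" by (rule meas_plane[of "%_. L"]) (use L in auto)
  have s: "subspace L" using L by (simp add: grassmannian_def)
  show "AE u in leb (L^o). plane_norm ((+) u ` L) = norm u" using AE_leb[OF W(1)] by eventually_elim (simp add: plane_norm_def foot_plane[OF s] proj_subspace_eq_0[OF s])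
 qed
 define w where "w t = enn (1 / (1 + \<bar>t\<bar>))" for t :: real
 have wm[measurable]: "w : bmeas borel" unfolding w_def by measurable
 note fl1 = nni_flags_plane[OF n meas(2) wm] and fl0 = nni_flags_plane[OF n meas(1) borel_measurable_const[of 1]]
 \<comment> \<open>The sphere in question is that of \<xi>^o, of dimension k + 1 = (k - 1) + 2, so
   the bound is taken with k - 1; positivity of k enters here.\<close>
 obtain K where K: "0 <= K" "!!V x. subspace V ==> dim V = Suc (Suc (k - 1)) ==> x : V ==>
  (II \<omega>. enn (1 / (1 + \<bar>x *. \<omega>\<bar>)) dd sph V) <= enn (K * (ln (2 + norm x) / (1 + norm (x::'a))))" using nni_sphere_log_bound[of "k - 1"] by blast
 \<comment> \<open>For fixed \<xi> the mean over \<omega> can be taken first. The weight on |f|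
   becomes ln (2 + |x|) / (1 + |x|) up to a constant, which is the weight of
   \<open>L_log\<close>.\<close>
 have "(II L. II \<omega>. II x. ?n0 ((+) x ` L) * w (x *. \<omega>) dd leb (L^o) dd sph (L^o) dd ?gb j)
  <= (II L. enn K * (II u. ?h ((+) u ` L) dd leb (L^o)) dd ?gb j)"
 proof (rule nn_integral_mono)
  fix L assume "L : space (?gb j)"
  then have L: "L : Gr UNIV j" using pj(2) by simp
  note sl = slice[OF L]
  have [measurable]: "(%x. ?n0 ((+) x ` L)) : bmeas borel" "(%x. ?h ((+) x ` L)) : bmeas borel" by (rule measurable_compose[OF sl(3) meas(2)], rule measurable_compose[OF sl(3) meas(3)])
  have "(II \<omega>. II x. ?n0 ((+) x ` L) * w (x *. \<omega>) dd leb (L^o) dd sph (L^o))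
   = (II x. II \<omega>. ?n0 ((+) x ` L) * w (x *. \<omega>) dd sph (L^o) dd leb (L^o))" by (rule nni_swap[OF sf_sph[OF sl(1)] sf_leb[OF sl(1)]]) measurable
  also have "... <= (II x. enn K * ?h ((+) x ` L) dd leb (L^o))"
  proof (rule nn_integral_mono_AE, use AE_leb[OF sl(1)] sl(4) in eventually_elim)
   fix x assume x: "x : L^o" and pn: "plane_norm ((+) x ` L) = norm x"
   have "(II \<omega>. ?n0 ((+) x ` L) * w (x *. \<omega>) dd sph (L^o)) = ?n0 ((+) x ` L) * (II \<omega>. w (x *. \<omega>) dd sph (L^o))" by (rule nn_integral_cmult) measurable
   also have "... <= ?n0 ((+) x ` L) * enn (K * (ln (2 + norm x) / (1 + norm x)))" unfolding w_def using K(2)[OF sl(1) _ x] sl(2) assms(2) by (intro mult_left_mono) auto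
   also have "... = enn K * ?h ((+) x ` L)" unfolding pn using K(1) by (subst (1 2) ennreal_mult[symmetric]) (auto intro!: mult_nonneg_nonneg divide_nonneg_nonneg add_nonneg_nonneg ln_ge_zero simp: mult_ac)
   finally show "(II \<omega>. ?n0 ((+) x ` L) * w (x *. \<omega>) dd sph (L^o)) <= enn K * ?h ((+) x ` L)" .
  qed
  also have "... = enn K * (II u. ?h ((+) u ` L) dd leb (L^o))" by (rule nn_integral_cmult) measurable
  finally show "(II \<omega>. II x. ?n0 ((+) x ` L) * w (x *. \<omega>) dd leb (L^o) dd sph (L^o))
   <= enn K * (II u. ?h ((+) u ` L) dd leb (L^o))" .
 qed
 also have "... = enn K * (II L. II u. ?h ((+) u ` L) dd leb (L^o) dd ?gb j)" by (rule nn_integral_cmult[OF int(2)[OF meas(3)]])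
 also have "... < \<infinity>" using hfin by (simp add: ennreal_mult_less_top)
 finally have AE1: "AE b in ?gb k. (II \<omega>. II t. (II u. ?n0 ((+) (u + t *R \<omega>) ` (b^o Int {\<omega>}^o)) dd leb b) * w t dd lborel dd sph (b^o)) ~= \<infinity>" unfolding fl1(1)[symmetric] by (intro nn_integral_PInf_AE[OF mk[OF fl1(2)]]) simp
 \<comment> \<open>The same exchange with weight 1: for almost every \<eta> the exceptional set is
   met in null sets only.\<close>
 have "(II L. II \<omega>. II x. ?I ((+) x ` L) * 1 dd leb (L^o) dd sph (L^o) dd ?gb j) = (II L. 0 dd ?gb j)" by (rule nn_integral_cong_AE, use AEN in eventually_elim) simp
 then have "(II b. II \<omega>. II t. (II u. ?I ((+) (u + t *R \<omega>) ` (b^o Int {\<omega>}^o)) dd leb b) * 1 dd lborel dd sph (b^o) dd ?gb k) = 0" unfolding fl0(1)[symmetric] by simp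
 then have AE0: "AE b in ?gb k. (II \<omega>. II t. (II u. ?I ((+) (u + t *R \<omega>) ` (b^o Int {\<omega>}^o)) dd leb b) * 1 dd lborel dd sph (b^o)) = 0" by (subst (asm) nn_integral_0_iff_AE[OF mk[OF fl0(2)]])
 \<comment> \<open>The default \<open>L0\<close> must lie in \<eta>^o and so depends on \<eta>; it
   is chosen separately for each.\<close>
 define H where "H L0 b p = plane_int f0 (cut_plane L0 (b^o) (fst p)) b (snd p *R fst p)" for L0 b and p :: "'a \<times> real"
 have dual: "AE b in ?gb k. subspace (b^o) & dim (b^o) = Suc j & b : Gr UNIV k &
   (EX L0. is_funk_inverse ((b^o) \<times> UNIV) (A_star_inv (\<phi> b)) (dual_density (dim (b^o)) (H L0 b)))" using AE1 AE0 AE_space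
 proof eventually_elim
  fix b assume a1: "(II \<omega>. II t. (II u. ?n0 ((+) (u + t *R \<omega>) ` (b^o Int {\<omega>}^o)) dd leb b) * w t dd lborel dd sph (b^o)) ~= \<infinity>"
   and a0: "(II \<omega>. II t. (II u. ?I ((+) (u + t *R \<omega>) ` (b^o Int {\<omega>}^o)) dd leb b) * 1 dd lborel dd sph (b^o)) = 0"
   and "b : space (?gb k)"
  then have b: "b : Gr UNIV k" using pk(2) by simp
  have X: "subspace (b^o)" "dim (b^o) = Suc j" using comp_in_gr[OF b] n by (auto simp: grassmannian_def)
  then have "j <= dim (b^o)" by simp
  then obtain L0 where 0: "L0 : Gr (b^o) j" by (rule gr_nonempty[OF X(1)])
  have "is_funk_inverse ((b^o) \<times> UNIV) (A_star_inv (\<phi> b)) (dual_density (dim (b^o)) (H L0 b))" unfolding assms(5) H_def[abs_def] by (rule dual_radon_slice[OF n assms(1) b 0 f0 Ns feq]) (use a1 a0 in \<open>simp_all add: w_def less_top\<close>)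
  then show "subspace (b^o) & dim (b^o) = Suc j & b : Gr UNIV k &
   (EX L0. is_funk_inverse ((b^o) \<times> UNIV) (A_star_inv (\<phi> b)) (dual_density (dim (b^o)) (H L0 b)))" using X b by blast
 qed
 let ?M = "?PB j xx (?PB k xx ?B)"
 let ?Q = "%(L, b, v). plane_int f0 L b v"
 have F0m: "?Q : bmeas ?M" unfolding case_prod_unfold by (rule meas_plane_int[OF _ _ _ f0]) measurable
 \<comment> \<open>Existence: \<open>B_star_inv\<close> turns the density of
   \<open>dual_radon_slice\<close> back into \<open>plane_int f0\<close> on every hyperplane of
   \<eta>^o, and the defaults are not met there.\<close>
 have "is_tilde j k \<phi> (plane_int f0)" unfolding is_tilde_def grass_measure_eq
 proof (intro conjI AE_completion)
  show "?Q : bmeas (restrict_space ?M (flags j k))" by (rule measurable_restrict_space1[OF F0m])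
  show "AE b in ?gb k. is_dual_radon_inverse (b^o) (\<phi> b) (%T. plane_int f0 (direction T) b (foot T))" using dual
  proof eventually_elim
   fix b assume "subspace (b^o) & dim (b^o) = Suc j & b : Gr UNIV k &
    (EX L0. is_funk_inverse ((b^o) \<times> UNIV) (A_star_inv (\<phi> b)) (dual_density (dim (b^o)) (H L0 b)))"
   then obtain L0 where X: "subspace (b^o)" "dim (b^o) = Suc j"
    and fi: "is_funk_inverse ((b^o) \<times> UNIV) (A_star_inv (\<phi> b)) (dual_density (dim (b^o)) (H L0 b))" by blast
   let ?X = "b^o" and ?p = "dual_density (dim (b^o)) (H L0 b)"
   have pe: "?p : even_L1 (?X \<times> UNIV)" using fi by (simp add: is_funk_inverse_def)
   have "plane_int f0 (direction T) b (foot T) = B_star_inv ?X ?p T" if T0: "T : aGr ?X j" for T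
   proof -
    obtain \<omega> t where \<omega>: "\<omega> : ?X" "norm \<omega> = 1" and T: "T = (+) (t *R \<omega>) ` (?X Int {\<omega>}^o)" using aff_hyperplane_cases[OF X T0] .
    have c: "0 < 1 / sqrt (1 + t^2)" by (simp add: add_pos_nonneg)
    have "B_star_inv ?X ?p T = (1 / sqrt (1 + t^2) ^ dim ?X) *R ((1 / (1 / sqrt (1 + t^2)) ^ dim ?X) *R H L0 b (\<omega>, t))" unfolding T B_star_inv_plane[OF X(1) \<omega> pe] using \<omega>(2) c by (subst dual_density_scale) simp_all
    also have "... = H L0 b (\<omega>, t)" using c by (simp add: power_one_over)
    finally show ?thesis unfolding T plane_norm_plane[OF X(1) \<omega>(2)] by (simp add: H_def cut_plane_eq \<omega>)
   qed
   then have "AE T in affine_grass_measure ?X (dim ?X - 1). plane_int f0 (direction T) b (foot T) = B_star_inv ?X ?p T" using aff_grass_measure_eq[OF X(1), of j] X(2) by (intro AE_I2) simp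
   then show "is_dual_radon_inverse ?X (\<phi> b) (%T. plane_int f0 (direction T) b (foot T))" using fi unfolding is_dual_radon_inverse_def by blast
  qed
 qed
 moreover have "AE L in grass_measure UNIV j. is_radon_inverse (L^o) (%e. F L (direction e) (foot e)) (%u. f ((+) u ` L))"
  if tilde: "is_tilde j k \<phi> F" for F
 proof -
  let ?F = "%(L, b, v). F L b v" and ?R = "restrict_space ?M (flags j k)"
  have Fm: "?F : bmeas ?R" and AEF: "AE b in ?gb k. is_dual_radon_inverse (b^o) (\<phi> b) (%T. F (direction T) b (foot T))" using tilde unfolding is_tilde_def grass_measure_eq AE_completion_iff by auto
  \<comment> \<open>The flags on which the given version disagrees with \<open>plane_int f0\<close>.
    Joint measurability of F makes this set measurable, as the exchange of \<xi> and \<eta>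
    requires.\<close>
  define D where "D = {p : space ?R. ?F p ~= ?Q p}"
  have "D : sets ?R" unfolding D_def using Fm measurable_restrict_space1[OF F0m] by measurable
  then have D: "D : sets ?M" using flags_meas[of j k, where 'a='a] sets.sets_into_space[OF flags_meas[of j k, where 'a='a]] by (subst (asm) sets_restrict_space_iff) (auto simp: Int_absorb2)
  have Dflags: "F L b v = plane_int f0 L b v" if "(L, b, v) : flags j k" "(L, b, v) ~: D" for L b v
  proof -
   have "(L, b, v) : space ?R" using that(1) subsetD[OF sets.sets_into_space[OF flags_meas[of j k, where 'a='a]] that(1)] by (simp add: space_restrict_space)
   then have "?F (L, b, v) = ?Q (L, b, v)" using that(2) unfolding D_def mem_Collect_eq by blast
   then show ?thesis unfolding prod.case .
  qed
  \<comment> \<open>In \<open>nni_flags\<close> the vector v occurs as a unit vector \<omega> only;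
    integrating over t covers the vectors t \<omega> on its line.\<close>
  define g where "g p = (II t. ind D (fst p, fst (snd p), t *R snd (snd p)) dd lborel)" for p
  have gm: "g : bmeas ?M"
  proof -
   have "(%q. (fst (fst q), fst (snd (fst q)), snd q *R snd (snd (fst q)))) : measurable (?M xx (lborel :: real measure)) ?M" by measurable
   from lborel.borel_measurable_nn_integral_fst[OF measurable_compose[OF this borel_measurable_indicator[OF D]]]
   show ?thesis by (simp add: g_def[abs_def])
  qed
  have "(II b. II \<omega>. g (b^o Int {\<omega>}^o, b, \<omega>) dd sph (b^o) dd ?gb k) = (II b. 0 dd ?gb k)"
  proof (rule nn_integral_cong_AE, use dual AEF in eventually_elim)
   fix b assume a: "subspace (b^o) & dim (b^o) = Suc j & b : Gr UNIV k &
    (EX L0. is_funk_inverse ((b^o) \<times> UNIV) (A_star_inv (\<phi> b)) (dual_density (dim (b^o)) (H L0 b)))"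
    and Fd: "is_dual_radon_inverse (b^o) (\<phi> b) (%T. F (direction T) b (foot T))"
   let ?X = "b^o"
   from a obtain L0 where X: "subspace ?X" "dim ?X = Suc j"
    and fi: "is_funk_inverse (?X \<times> UNIV) (A_star_inv (\<phi> b)) (dual_density (dim ?X) (H L0 b))" by blast
   have d: "0 < dim ?X" "dim ?X - 1 = j" using X(2) by auto
   obtain p where p: "is_funk_inverse (?X \<times> UNIV) (A_star_inv (\<phi> b)) p"
    and pA: "AE T in affine_grass_measure ?X j. F (direction T) b (foot T) = B_star_inv ?X p T" using Fd unfolding is_dual_radon_inverse_def d(2) by blast
   have pe: "p : even_L1 (?X \<times> UNIV)" using p by (simp add: is_funk_inverse_def)
   \<comment> \<open>Both densities invert the same Funk transform and so agree almost everywhere on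
     the sphere; in the coordinates (\<omega>, t) this becomes agreement on almost all hyperplanes
     of \<eta>^o.\<close>
   have "AE z in sph (?X \<times> UNIV). p z = dual_density (dim ?X) (H L0 b) z" using is_funk_inverse_unique[OF p fi] unfolding sphere_measure_eq AE_completion_iff .
   from AE_sphere_productD[OF X(1) d(1) this] AE_aff_hyperplanesD[OF X pA] AE_sphere_pair[OF X(1) d(1)]
   have "AE q in sph ?X xx lborel. (?X Int {fst q}^o, b, snd q *R fst q) ~: D"
   proof eventually_elim
    fix q :: "'a \<times> real"
    let ?c = "1 / sqrt (1 + (snd q)^2)" and ?T = "(+) (snd q *R fst q) ` (?X Int {fst q}^o)"
    assume pq: "p (?c *R q) = dual_density (dim ?X) (H L0 b) (?c *R q)" and F: "F (direction ?T) b (foot ?T) = B_star_inv ?X p ?T"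
     and "fst q : ?X & norm (fst q) = 1"
    then have \<omega>: "fst q : ?X" "norm (fst q) = 1" by auto
    have c: "0 < ?c" by (simp add: add_pos_nonneg)
    have "F (?X Int {fst q}^o) b (snd q *R fst q) = (1 / sqrt (1 + (snd q)^2) ^ dim ?X) *R p (?c *R q)" using F unfolding B_star_inv_plane[OF X(1) \<omega> pe] plane_norm_plane[OF X(1) \<omega>(2)] by simp
    also have "... = H L0 b q" unfolding pq dual_density_scale[OF \<omega>(2) c] using c by (simp add: power_one_over)
    also have "... = plane_int f0 (?X Int {fst q}^o) b (snd q *R fst q)" by (simp add: H_def cut_plane_eq \<omega>)
    finally show "(?X Int {fst q}^o, b, snd q *R fst q) ~: D" by (simp add: D_def)
   qed
   interpret pair_sigma_finite "sph ?X" "lborel :: real measure" by (intro pair_sigma_finite.intro sf_sph X lborel.sigma_finite_measure_axioms)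
   from AE_pair[OF \<open>AE q in sph ?X xx lborel. (?X Int {fst q}^o, b, snd q *R fst q) ~: D\<close>]
   have "(II \<omega>. g (?X Int {\<omega>}^o, b, \<omega>) dd sph ?X) = (II \<omega>. 0 dd sph ?X)"
   proof (intro nn_integral_cong_AE, eventually_elim)
    fix \<omega> assume "AE t in lborel. (?X Int {fst (\<omega>, t)}^o, b, snd (\<omega>, t) *R fst (\<omega>, t)) ~: D"
    then have "(II t. ind D (?X Int {\<omega>}^o, b, t *R \<omega>) dd lborel) = (II (t::real). (0::ennreal) dd lborel)" by (intro nn_integral_cong_AE, eventually_elim) simp
    then show "g (?X Int {\<omega>}^o, b, \<omega>) = 0" by (simp add: g_def)
   qed
   then show "(II \<omega>. g (?X Int {\<omega>}^o, b, \<omega>) dd sph ?X) = 0" by simp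
  qed
  \<comment> \<open>Here the fixed variable changes: a set null over almost every \<eta> is null
    over almost every \<xi>.\<close>
  then have "(II L. II \<omega>. g (L, L^o Int {\<omega>}^o, \<omega>) dd sph (L^o) dd ?gb j) = 0" unfolding nni_flags[OF n gm] by simp
  then have "AE L in ?gb j. (II \<omega>. g (L, L^o Int {\<omega>}^o, \<omega>) dd sph (L^o)) = 0" by (subst (asm) nn_integral_0_iff_AE[OF mj[OF meas_flags_inner[OF n gm]]])
  then have "AE L in ?gb j. is_radon_inverse (L^o) (%e. F L (direction e) (foot e)) (%u. f ((+) u ` L))" using AEN AEh AE_space
  proof eventually_elim
   fix L assume g0: "(II \<omega>. g (L, L^o Int {\<omega>}^o, \<omega>) dd sph (L^o)) = 0"
    and N0: "(II u. ?I ((+) u ` L) dd leb (L^o)) = 0" and hi: "(II u. ?h ((+) u ` L) dd leb (L^o)) ~= \<infinity>"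
    and "L : space (?gb j)"
   then have L: "L : Gr UNIV j" using pj(2) by simp
   note sl = slice[OF L]
   let ?X = "L^o"
   have d: "2 <= dim ?X" "0 < dim ?X" using sl(2) assms(2) by auto
   have s: "subspace L" "dim L = j" using L by (auto simp: grassmannian_def)
   show "is_radon_inverse ?X (%e. F L (direction e) (foot e)) (%u. f ((+) u ` L))"
   proof (rule radon_inverseI[where g="%x. f0 ((+) x ` L)", OF sl(1) d(1)])
    show fx: "(%x. f0 ((+) x ` L)) : bmeas borel" by (rule measurable_compose[OF sl(3) f0])
    have hx: "(%x. ?h ((+) x ` L)) : bmeas borel" by (rule measurable_compose[OF sl(3) meas(3)])
    \<comment> \<open>Since ln (2 + |x|) >= ln 2, the logarithmic condition contains the one for the
      hyperplane transform in \<xi>^o.\<close>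
    have "(II x. enn (norm (f0 ((+) x ` L)) / (1 + norm x)) dd leb ?X) <= (II x. enn (1 / ln 2) * ?h ((+) x ` L) dd leb ?X)"
    proof (rule nn_integral_mono_AE, use sl(4) in eventually_elim)
     fix x assume pn: "plane_norm ((+) x ` L) = norm x"
     let ?a = "norm (f0 ((+) x ` L)) / (1 + norm x)"
     have "ln 2 <= ln (2 + norm x)" by (subst ln_le_cancel_iff) (auto intro: add_pos_nonneg)
     then have aln: "?a * ln 2 <= ?a * ln (2 + norm x)" by (intro mult_left_mono) auto
     have "y <= 1 / ln 2 * z" if "y * ln 2 <= z" for y z :: real using that by (simp add: pos_le_divide_eq)
     from this[OF aln] have "?a <= 1 / ln 2 * (?a * ln (2 + norm x))" .
     then show "enn ?a <= enn (1 / ln 2) * ?h ((+) x ` L)" unfolding pn by (subst ennreal_mult'[symmetric]) (auto intro: ennreal_leI)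
    qed
    also have "... = enn (1 / ln 2) * (II x. ?h ((+) x ` L) dd leb ?X)" by (rule nn_integral_cmult) (use hx in simp)
    also have "... < \<infinity>" using hi by (simp add: ennreal_mult_less_top less_top)
    finally show "(II x. enn (norm (f0 ((+) x ` L)) / (1 + norm x)) dd leb ?X) < \<infinity>" .
    have "AE u in leb ?X. ?I ((+) u ` L) = 0" using N0 measurable_compose[OF sl(3) meas(1)] by (subst (asm) nn_integral_0_iff_AE) auto
    then show "AE u in leb ?X. f ((+) u ` L) = f0 ((+) u ` L)"
    proof eventually_elim
     fix u assume "?I ((+) u ` L) = 0"
     then show "f ((+) u ` L) = f0 ((+) u ` L)" by (intro feq plane_in_aff_gr[OF L]) (auto simp: indicator_eq_0_iff)
    qed
    obtain b0 :: "'a set" where 0: "b0 : Gr UNIV k" using gr_nonempty[OF subspace_UNIV le(2)] .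
    \<comment> \<open>The flags over the fixed L, with \<eta> = L^o Int \<omega>^o and v = t
      \<omega>. Outside \<open>D\<close>, F is there the integral of f0 over a hyperplane of L^o,
      that is, its Radon transform.\<close>
    let ?q = "%p. (L, cut_plane b0 ?X (fst p), snd p *R fst p)"
    have "?X : Gr UNIV (Suc k)" using sl by (simp add: grassmannian_def)
    then have "?q : measurable (sph ?X xx (lborel :: real measure)) ?M" using L by (intro measurable_Pair meas_cut_plane[OF measurable_const _ 0] measurable_const) (simp_all add: measurable)
    from measurable_compose[OF this borel_measurable_indicator[OF D]]
    have qm: "(%p. ind D (?q p) :: ennreal) : bmeas (sph ?X xx (lborel :: real measure))" .
    have "(II p. ind D (?q p) dd (sph ?X xx lborel)) = (II \<omega>. II t. ind D (?q (\<omega>, t)) dd lborel dd sph ?X)" by (rule lborel.nn_integral_fst[OF qm, symmetric])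
    also have "... = 0" unfolding g0[symmetric] by (rule nn_integral_cong_AE, use AE_sph[OF sl(1) d(2)] in eventually_elim) (simp add: g_def cut_plane_eq)
    finally have "AE p in sph ?X xx lborel. ind D (?q p) = (0::ennreal)" using qm by (subst nn_integral_0_iff_AE[symmetric]) simp_all
    then show "AE p in sph ?X xx lborel. F L (direction ((+) (snd p *R fst p) ` (?X Int {fst p}^o))) (foot ((+) (snd p *R fst p) ` (?X Int {fst p}^o)))
     = (LINT w|leb (?X Int {fst p}^o). f0 ((+) (snd p *R fst p + w) ` L))" using AE_sphere_pair[OF sl(1) d(2)]
    proof eventually_elim
     fix p :: "'a \<times> real" assume q: "ind D (?q p) = (0::ennreal)" and "fst p : ?X & norm (fst p) = 1"
     then have \<omega>: "fst p : ?X" "norm (fst p) = 1" by auto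
     let ?W = "?X Int {fst p}^o"
     have W: "subspace ?W" "dim ?W = k" using dim_Int_comp_unit[OF sl(1) \<omega>] sl by (auto intro: subspace_Int_comp)
     have "(L, ?W, snd p *R fst p) ~: D" using q by (simp add: cut_plane_eq \<omega> indicator_eq_0_iff)
     moreover have "(L, ?W, snd p *R fst p) : flags j k"
     proof -
      have "x *. y = 0" if "x : L" "y : ?W" for x y using that inner_commute[of x y] by (simp add: comp_iff)
      then have "L \<subseteq> ?W^o" unfolding subset_eq comp_iff by (intro ballI)
      moreover have "snd p *R fst p : L^o" by (rule subspace_scale[OF sl(1) \<omega>(1)])
      moreover have "snd p *R fst p *. y = 0" if "y : ?W" for y using that inner_commute[of "fst p" y] by (simp add: comp_iff)
      then have "snd p *R fst p : ?W^o" unfolding comp_iff by (intro ballI)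
      ultimately show ?thesis using W s by (simp add: flags_def grassmannian_def)
     qed
     ultimately have "F L ?W (snd p *R fst p) = plane_int f0 L ?W (snd p *R fst p)" by (intro Dflags)
     then show "F L (direction ((+) (snd p *R fst p) ` ?W)) (foot ((+) (snd p *R fst p) ` ?W)) = (LINT w|leb ?W. f0 ((+) (snd p *R fst p + w) ` L))" unfolding plane_norm_plane[OF sl(1) \<omega>(2)] by (simp only: plane_int_def add.commute)
    qed
   qed
  qed
  then show ?thesis unfolding grass_measure_eq by (rule AE_completion)
 qed
 ultimately show ?thesis by blast
qed

end
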